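(* Let $p$ be a prime, $\xi\in k$ a primitive $p$th root of unity, $\mathcal{B}=(\mathrm{Vec}_{\mathbb{Z}/p},\xi)$ and $H=k[x]/x^p$ the Hopf algebra in $\mathcal{B}$ with $x$ of degree $1$, $\Delta(x)=x\otimes1+1\otimes x$, $S(x)=-x$, $\epsilon(x)=0$. Let $\mathcal{B}_0$ be the stable braided $\mathcal{B}$-module given by the anti-twist $\varsigma_0(v)=\xi^{-i^2}v$, $v\in V_i$. Then $$HC_{\mathcal{B}_0}(H_{\mathcal{B}}\text{-mod})\simeq\mathrm{Vec}.$$
   Context: $k$ is an algebraically closed field of characteristic $0$; $\mathrm{Vec}$ is finite dimensional $k$-vector spaces. $\mathcal{B}$ is $\mathbb{Z}/p$-graded finite dimensional vector spaces with braiding $\tau(v\otimes w)=\xi^{ij}w\otimes v$, $v\in V_i,w\in W_j$; $\tau^{-1}_{X,Y}:=(\tau_{Y,X})^{-1}$. $\mathcal{M}=\mathcal{B}_0$ is $\mathcal{B}$ as a left module category over itself, with stable structure $\varsigma=\varsigma_0\in Aut(Id_{\mathcal{B}})$ and braided structure $E_{X,M}=\varsigma_{X\otimes M}(Id_X\otimes\varsigma_M)^{-1}$. $HC_{\mathcal{M}}(H_{\mathcal{B}}\text{-mod})$ is identified with the category $saYD^H_{\mathcal{M}}$ defined as follows. ${}^*H$ is the dual ($ev:H\otimes{}^*H\to1$, $coev:1\to{}^*H\otimes H$), an algebra with unit ${}^*\epsilon$ and multiplication the map whose adjoint $H\otimes{}^*H\otimes{}^*H\to1$ is $ev(Id_H\otimes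 ev\otimes Id_{{}^*H})(\tau^{-1}_{H,H}\Delta\otimes Id)$. For an $H$-module $M$ let $r_0,r_1:H\otimes{}^*H\otimes M\to{}^*H\otimes M$ be the maps whose adjoints $H\otimes H\otimes{}^*H\otimes M\to M$ are: for $r_1$, $ev\circ(m_H\otimes Id)$; for $r_0$, $\rho_{H,M}(Id_H\otimes ev)(Id_H\otimes m_H\otimes Id)(Id_H\otimes S\otimes Id_H\otimes Id)(\Delta\otimes Id_H\otimes Id)(\tau_{H,H}\otimes Id)$. Put $act_M=r_1\circ E_{H,{}^*H\otimes M}\circ(Id_H\otimes r_0)\circ(\Delta\otimes Id)$. $aYD^H_{\mathcal{M}}$ has objects $M\in\mathcal{M}$ which are both $H$- and ${}^*H$-modules with $\rho_{H,M}(Id_H\otimes\rho_{{}^*H,M})=\rho_{{}^*H,M}\circ act_M$, and morphisms respecting both actions. $\varsigma^H_M=\rho_{{}^*H,M}(Id_{{}^*H}\otimes\rho_{H,M})(coev\otimes Id_M)\varsigma_M$, and $saYD^H_{\mathcal{M}}$ is the full subcategory of $M\in aYD^H_{\mathcal{M}}$ with $\varsigma^H_M=Id_M$. *)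

theory Defs
  imports
    "Jordan_Normal_Form.Missing_VectorSpace"
    "HOL-Algebra.Algebraic_Closure_Type"
    "HOL-Computational_Algebra.Polynomial"
    "HOL-Library.FuncSet"
begin

section \<open>Vector spaces, linear categories and their equivalences\<close>

abbreviation scalars :: "'k::field ring" where
  "scalars \<equiv> ring_of_type_algebra"

definition fd_space :: "('k::field, 'a, 'm) module_scheme \<Rightarrow> bool" where
  "fd_space V \<longleftrightarrow> vectorspace scalars V \<and> vectorspace.fin_dim scalars V"

text \<open>Arrows carry their source and target.  The underlying function is extensional on the
  carrier of the source, so that equality of arrows is equality of linear maps.\<close>

record ('v, 'w, 'a, 'b) arr =
  Dom :: 'v
  Cod :: 'w
  Fun :: "'a \<Rightarrow> 'b"

definition lin_hom ::
  "('k::field, 'a, 'm) module_scheme \<Rightarrow> ('k, 'b, 'n) module_scheme \<Rightarrow>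
   (('k, 'a, 'm) module_scheme, ('k, 'b, 'n) module_scheme, 'a, 'b) arr set" where
  "lin_hom V W = {f. Dom f = V \<and> Cod f = W \<and> linear_map scalars V W (Fun f) \<and>
     Fun f \<in> extensional (carrier V)}"

definition id_arr ::
  "('k, 'a, 'm) module_scheme \<Rightarrow>
   (('k, 'a, 'm) module_scheme, ('k, 'a, 'm) module_scheme, 'a, 'a) arr" where
  "id_arr V = \<lparr>Dom = V, Cod = V, Fun = restrict (\<lambda>v. v) (carrier V)\<rparr>"

definition comp_arr ::
  "('v, 'w, 'b, 'c) arr \<Rightarrow> (('k, 'a, 'm) module_scheme, 'v, 'a, 'b) arr \<Rightarrow>
   (('k, 'a, 'm) module_scheme, 'w, 'a, 'c) arr"  (infixr "\<circ>\<^sub>a" 60) where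
  "g \<circ>\<^sub>a f = \<lparr>Dom = Dom f, Cod = Cod g, Fun = compose (carrier (Dom f)) (Fun g) (Fun f)\<rparr>"

text \<open>The space of arrows from \<open>V\<close> to \<open>W\<close> that lie in the set \<open>S\<close>, with pointwise operations.  The
  multiplicative fields of the record type are irrelevant for a module and are left unspecified.\<close>

definition hom_module ::
  "(('k::field, 'a, 'm) module_scheme, ('k, 'b, 'n) module_scheme, 'a, 'b) arr set \<Rightarrow>
   ('k, 'a, 'm) module_scheme \<Rightarrow> ('k, 'b, 'n) module_scheme \<Rightarrow>
   ('k, (('k, 'a, 'm) module_scheme, ('k, 'b, 'n) module_scheme, 'a, 'b) arr) module" where
  "hom_module S V W = \<lparr>carrier = S, monoid.mult = undefined, one = undefined,
     ring.zero = \<lparr>Dom = V, Cod = W, Fun = restrict (\<lambda>v. \<zero>\<^bsub>W\<^esub>) (carrier V)\<rparr>,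
     add = (\<lambda>f g. \<lparr>Dom = V, Cod = W, Fun = restrict (\<lambda>v. Fun f v \<oplus>\<^bsub>W\<^esub> Fun g v) (carrier V)\<rparr>),
     module.smult = (\<lambda>c f. \<lparr>Dom = V, Cod = W, Fun = restrict (\<lambda>v. c \<odot>\<^bsub>W\<^esub> Fun f v) (carrier V)\<rparr>)\<rparr>"

record ('k, 'o, 'm) lincat =
  Obj :: "'o set"
  Hom :: "'o \<Rightarrow> 'o \<Rightarrow> ('k, 'm) module"
  Ident :: "'o \<Rightarrow> 'm"
  Comp :: "'m \<Rightarrow> 'm \<Rightarrow> 'm"

definition linear_category :: "('k::field, 'o, 'm) lincat \<Rightarrow> bool" where
  "linear_category C \<longleftrightarrow>
     (\<forall>a\<in>Obj C. \<forall>b\<in>Obj C. vectorspace scalars (Hom C a b)) \<and>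
     (\<forall>a\<in>Obj C. Ident C a \<in> carrier (Hom C a a)) \<and>
     (\<forall>a\<in>Obj C. \<forall>b\<in>Obj C. \<forall>c\<in>Obj C.
        (\<forall>g\<in>carrier (Hom C b c). linear_map scalars (Hom C a b) (Hom C a c) (\<lambda>f. Comp C g f)) \<and>
        (\<forall>f\<in>carrier (Hom C a b). linear_map scalars (Hom C b c) (Hom C a c) (\<lambda>g. Comp C g f))) \<and>
     (\<forall>a\<in>Obj C. \<forall>b\<in>Obj C. \<forall>f\<in>carrier (Hom C a b).
        Comp C f (Ident C a) = f \<and> Comp C (Ident C b) f = f) \<and>
     (\<forall>a\<in>Obj C. \<forall>b\<in>Obj C. \<forall>c\<in>Obj C. \<forall>d\<in>Obj C.
        \<forall>f\<in>carrier (Hom C a b). \<forall>g\<in>carrier (Hom C b c). \<forall>h\<in>carrier (Hom C c d).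
        Comp C h (Comp C g f) = Comp C (Comp C h g) f)"

definition linear_functor ::
  "('k::field, 'o, 'm) lincat \<Rightarrow> ('k, 'q, 'n) lincat \<Rightarrow>
   ('o \<Rightarrow> 'q) \<Rightarrow> ('o \<Rightarrow> 'o \<Rightarrow> 'm \<Rightarrow> 'n) \<Rightarrow> bool" where
  "linear_functor C D Fo Fm \<longleftrightarrow>
     (\<forall>a\<in>Obj C. Fo a \<in> Obj D) \<and>
     (\<forall>a\<in>Obj C. \<forall>b\<in>Obj C. linear_map scalars (Hom C a b) (Hom D (Fo a) (Fo b)) (Fm a b)) \<and>
     (\<forall>a\<in>Obj C. Fm a a (Ident C a) = Ident D (Fo a)) \<and>
     (\<forall>a\<in>Obj C. \<forall>b\<in>Obj C. \<forall>c\<in>Obj C. \<forall>f\<in>carrier (Hom C a b). \<forall>g\<in>carrier (Hom C b c).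
        Fm a c (Comp C g f) = Comp D (Fm b c g) (Fm a b f))"

definition natural_iso ::
  "('k::field, 'o, 'm) lincat \<Rightarrow> ('k, 'q, 'n) lincat \<Rightarrow>
   ('o \<Rightarrow> 'q) \<Rightarrow> ('o \<Rightarrow> 'o \<Rightarrow> 'm \<Rightarrow> 'n) \<Rightarrow>
   ('o \<Rightarrow> 'q) \<Rightarrow> ('o \<Rightarrow> 'o \<Rightarrow> 'm \<Rightarrow> 'n) \<Rightarrow> ('o \<Rightarrow> 'n) \<Rightarrow> bool" where
  "natural_iso C D Fo Fm Go Gm \<eta> \<longleftrightarrow>
     (\<forall>a\<in>Obj C. \<eta> a \<in> carrier (Hom D (Fo a) (Go a)) \<and>
        (\<exists>\<theta>\<in>carrier (Hom D (Go a) (Fo a)).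
           Comp D \<theta> (\<eta> a) = Ident D (Fo a) \<and> Comp D (\<eta> a) \<theta> = Ident D (Go a))) \<and>
     (\<forall>a\<in>Obj C. \<forall>b\<in>Obj C. \<forall>f\<in>carrier (Hom C a b).
        Comp D (\<eta> b) (Fm a b f) = Comp D (Gm a b f) (\<eta> a))"

definition lin_equivalent :: "('k::field, 'o, 'm) lincat \<Rightarrow> ('k, 'q, 'n) lincat \<Rightarrow> bool" where
  "lin_equivalent C D \<longleftrightarrow> linear_category C \<and> linear_category D \<and>
     (\<exists>Fo Fm Go Gm \<eta> \<epsilon>.
        linear_functor C D Fo Fm \<and> linear_functor D C Go Gm \<and>
        natural_iso C C (\<lambda>a. a) (\<lambda>a b f. f)
          (\<lambda>a. Go (Fo a)) (\<lambda>a b f. Gm (Fo a) (Fo b) (Fm a b f)) \<eta> \<and>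
        natural_iso D D (\<lambda>x. Fo (Go x)) (\<lambda>x y g. Fm (Go x) (Go y) (Gm x y g))
          (\<lambda>x. x) (\<lambda>x y g. g) \<epsilon>)"

text \<open>Finite dimensional spaces whose carrier is a subset of the type \<open>'u\<close>, which plays the role
  of the universe.  If the field is infinite, every finite dimensional space is isomorphic to one of
  these as soon as \<open>'u\<close> has at least as many elements as the field.\<close>

type_synonym ('k, 'u) space = "('k, 'u) module"

definition Vec :: "('k::field, ('k, 'u) space, (('k, 'u) space, ('k, 'u) space, 'u, 'u) arr) lincat"
  where
  "Vec = \<lparr>Obj = {V. fd_space V}, Hom = (\<lambda>V W. hom_module (lin_hom V W) V W),
     Ident = id_arr, Comp = (\<circ>\<^sub>a)\<rparr>"


section \<open>Graded spaces and their tensor products\<close>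

text \<open>Degrees are the representatives \<open>0, \<dots>, p - 1\<close>; the values of \<open>homog\<close> elsewhere are ignored.\<close>

record ('k, 'a) gspace = "('k, 'a) module" +
  homog :: "nat \<Rightarrow> 'a set"

type_synonym ('k, 'a, 'b) garr = "(('k, 'a) gspace, ('k, 'b) gspace, 'a, 'b) arr"

definition unit_space :: "('k::field, 'k) gspace"  ("\<I>") where
  "\<I> = \<lparr>carrier = UNIV, monoid.mult = (*), one = 1, ring.zero = 0, add = (+), module.smult = (*),
     homog = (\<lambda>i. if i = 0 then UNIV else {0})\<rparr>"

text \<open>The tensor product of finite dimensional spaces is realised as the dual of the space of
  bilinear forms; \<open>pure V W v w\<close> is the element usually written as the tensor of \<open>v\<close> and \<open>w\<close>.\<close>

type_synonym ('k, 'a, 'b) tensor = "('a \<Rightarrow> 'b \<Rightarrow> 'k) \<Rightarrow> 'k"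

definition bilinear_form ::
  "('k::field, 'a) gspace \<Rightarrow> ('k, 'b) gspace \<Rightarrow> ('a \<Rightarrow> 'b \<Rightarrow> 'k) \<Rightarrow> bool" where
  "bilinear_form V W \<beta> \<longleftrightarrow>
     (\<forall>w\<in>carrier W. linear_map scalars V \<I> (\<lambda>v. \<beta> v w)) \<and>
     (\<forall>v\<in>carrier V. linear_map scalars W \<I> (\<lambda>w. \<beta> v w))"

definition pure ::
  "('k::field, 'a) gspace \<Rightarrow> ('k, 'b) gspace \<Rightarrow> 'a \<Rightarrow> 'b \<Rightarrow> ('k, 'a, 'b) tensor" where
  "pure V W v w = (\<lambda>\<beta>. if bilinear_form V W \<beta> then \<beta> v w else 0)"

definition tensor_span ::
  "('k::field, 'a) gspace \<Rightarrow> ('k, 'b) gspace \<Rightarrow> ('a \<times> 'b) set \<Rightarrow> ('k, 'a, 'b) tensor set" where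
  "tensor_span V W P = {t. \<exists>(n::nat) v w. (\<forall>i<n. (v i, w i) \<in> P) \<and>
     t = (\<lambda>\<beta>. \<Sum>i<n. pure V W (v i) (w i) \<beta>)}"

locale zp_graded =
  fixes p :: nat and \<xi> :: "'k::field"
begin

definition graded_space :: "('k, 'a) gspace \<Rightarrow> bool" where
  "graded_space V \<longleftrightarrow> fd_space V \<and> (\<forall>i<p. VectorSpace.subspace scalars (homog V i) V) \<and>
     (\<forall>v\<in>carrier V. \<exists>!c. c \<in> (\<Pi>\<^sub>E i\<in>{..<p}. homog V i) \<and> finsum V c {..<p} = v)"

definition mor :: "('k, 'a) gspace \<Rightarrow> ('k, 'b) gspace \<Rightarrow> ('k, 'a, 'b) garr set" where
  "mor V W = {f \<in> lin_hom V W. \<forall>i<p. Fun f ` homog V i \<subseteq> homog W i}"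

definition inv_arr :: "('k, 'a, 'b) garr \<Rightarrow> ('k, 'b, 'a) garr" where
  "inv_arr f = (THE g. g \<in> mor (Cod f) (Dom f) \<and> g \<circ>\<^sub>a f = id_arr (Dom f) \<and> f \<circ>\<^sub>a g = id_arr (Cod f))"

definition tensor_space ::
  "('k, 'a) gspace \<Rightarrow> ('k, 'b) gspace \<Rightarrow> ('k, ('k, 'a, 'b) tensor) gspace"
  (infixr "\<boxtimes>" 70) where
  "V \<boxtimes> W = \<lparr>carrier = tensor_span V W (carrier V \<times> carrier W),
     monoid.mult = undefined, one = undefined,
     ring.zero = (\<lambda>\<beta>. 0), add = (\<lambda>s t \<beta>. s \<beta> + t \<beta>), module.smult = (\<lambda>c t \<beta>. c * t \<beta>),
     homog = (\<lambda>l. tensor_span V W (\<Union>i<p. \<Union>j\<in>{j. j < p \<and> (i + j) mod p = l}.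
                                 homog V i \<times> homog W j))\<rparr>"

text \<open>The structure arrows below are the unique morphisms with the given values on pure
  tensors.  Associativity and unit constraints are never suppressed.\<close>

definition tensor_arr ::
  "('k, 'a, 'c) garr \<Rightarrow> ('k, 'b, 'd) garr \<Rightarrow> ('k, ('k, 'a, 'b) tensor, ('k, 'c, 'd) tensor) garr"
  (infixr "\<star>" 70) where
  "f \<star> g = (THE h. h \<in> mor (Dom f \<boxtimes> Dom g) (Cod f \<boxtimes> Cod g) \<and>
     (\<forall>v\<in>carrier (Dom f). \<forall>w\<in>carrier (Dom g).
        Fun h (pure (Dom f) (Dom g) v w) = pure (Cod f) (Cod g) (Fun f v) (Fun g w)))"

definition assoc ::
  "('k, 'a) gspace \<Rightarrow> ('k, 'b) gspace \<Rightarrow> ('k, 'c) gspace \<Rightarrow>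
   ('k, ('k, ('k, 'a, 'b) tensor, 'c) tensor, ('k, 'a, ('k, 'b, 'c) tensor) tensor) garr" where
  "assoc U V W = (THE h. h \<in> mor ((U \<boxtimes> V) \<boxtimes> W) (U \<boxtimes> (V \<boxtimes> W)) \<and>
     (\<forall>u\<in>carrier U. \<forall>v\<in>carrier V. \<forall>w\<in>carrier W.
        Fun h (pure (U \<boxtimes> V) W (pure U V u v) w) = pure U (V \<boxtimes> W) u (pure V W v w)))"

definition lunit :: "('k, 'a) gspace \<Rightarrow> ('k, ('k, 'k, 'a) tensor, 'a) garr" where
  "lunit V = (THE h. h \<in> mor (\<I> \<boxtimes> V) V \<and>
     (\<forall>c. \<forall>v\<in>carrier V. Fun h (pure \<I> V c v) = c \<odot>\<^bsub>V\<^esub> v))"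

definition runit :: "('k, 'a) gspace \<Rightarrow> ('k, ('k, 'a, 'k) tensor, 'a) garr" where
  "runit V = (THE h. h \<in> mor (V \<boxtimes> \<I>) V \<and>
     (\<forall>v\<in>carrier V. \<forall>c. Fun h (pure V \<I> v c) = c \<odot>\<^bsub>V\<^esub> v))"

abbreviation assoc_inv ::
  "('k, 'a) gspace \<Rightarrow> ('k, 'b) gspace \<Rightarrow> ('k, 'c) gspace \<Rightarrow>
   ('k, ('k, 'a, ('k, 'b, 'c) tensor) tensor, ('k, ('k, 'a, 'b) tensor, 'c) tensor) garr" where
  "assoc_inv U V W \<equiv> inv_arr (assoc U V W)"

definition braid ::
  "('k, 'a) gspace \<Rightarrow> ('k, 'b) gspace \<Rightarrow> ('k, ('k, 'a, 'b) tensor, ('k, 'b, 'a) tensor) garr" where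
  "braid V W = (THE h. h \<in> mor (V \<boxtimes> W) (W \<boxtimes> V) \<and>
     (\<forall>i<p. \<forall>j<p. \<forall>v\<in>homog V i. \<forall>w\<in>homog W j.
        Fun h (pure V W v w) = (\<xi> ^ (i * j)) \<odot>\<^bsub>W \<boxtimes> V\<^esub> pure W V w v))"

text \<open>The inverse braiding from \<open>V \<boxtimes> W\<close> to \<open>W \<boxtimes> V\<close>; note the exchange of the arguments.\<close>

definition braid_inv ::
  "('k, 'a) gspace \<Rightarrow> ('k, 'b) gspace \<Rightarrow> ('k, ('k, 'a, 'b) tensor, ('k, 'b, 'a) tensor) garr" where
  "braid_inv V W = inv_arr (braid W V)"

definition antitwist :: "('k, 'a) gspace \<Rightarrow> ('k, 'a, 'a) garr" where
  "antitwist V = (THE h. h \<in> mor V V \<and>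
     (\<forall>i<p. \<forall>v\<in>homog V i. Fun h v = (\<xi> powi (- (int i ^ 2))) \<odot>\<^bsub>V\<^esub> v))"

definition braided_structure ::
  "('k, 'a) gspace \<Rightarrow> ('k, 'b) gspace \<Rightarrow> ('k, ('k, 'a, 'b) tensor, ('k, 'a, 'b) tensor) garr" where
  "braided_structure U M = antitwist (U \<boxtimes> M) \<circ>\<^sub>a inv_arr (id_arr U \<star> antitwist M)"


section \<open>Algebras, modules and Hopf algebras in the braided category\<close>

definition algebra_obj ::
  "('k, 'a) gspace \<Rightarrow> ('k, ('k, 'a, 'a) tensor, 'a) garr \<Rightarrow> ('k, 'k, 'a) garr \<Rightarrow> bool" where
  "algebra_obj A m u \<longleftrightarrow> graded_space A \<and> m \<in> mor (A \<boxtimes> A) A \<and> u \<in> mor \<I> A \<and>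
     m \<circ>\<^sub>a (m \<star> id_arr A) = m \<circ>\<^sub>a (id_arr A \<star> m) \<circ>\<^sub>a assoc A A A \<and>
     m \<circ>\<^sub>a (u \<star> id_arr A) = lunit A \<and> m \<circ>\<^sub>a (id_arr A \<star> u) = runit A"

definition coalgebra_obj ::
  "('k, 'a) gspace \<Rightarrow> ('k, 'a, ('k, 'a, 'a) tensor) garr \<Rightarrow> ('k, 'a, 'k) garr \<Rightarrow> bool" where
  "coalgebra_obj A \<Delta> e \<longleftrightarrow> graded_space A \<and> \<Delta> \<in> mor A (A \<boxtimes> A) \<and> e \<in> mor A \<I> \<and>
     assoc A A A \<circ>\<^sub>a (\<Delta> \<star> id_arr A) \<circ>\<^sub>a \<Delta> = (id_arr A \<star> \<Delta>) \<circ>\<^sub>a \<Delta> \<and>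
     lunit A \<circ>\<^sub>a (e \<star> id_arr A) \<circ>\<^sub>a \<Delta> = id_arr A \<and> runit A \<circ>\<^sub>a (id_arr A \<star> e) \<circ>\<^sub>a \<Delta> = id_arr A"

definition module_obj ::
  "('k, 'a) gspace \<Rightarrow> ('k, ('k, 'a, 'a) tensor, 'a) garr \<Rightarrow> ('k, 'k, 'a) garr \<Rightarrow>
   ('k, 'b) gspace \<Rightarrow> ('k, ('k, 'a, 'b) tensor, 'b) garr \<Rightarrow> bool" where
  "module_obj A m u M \<rho> \<longleftrightarrow> graded_space M \<and> \<rho> \<in> mor (A \<boxtimes> M) M \<and>
     \<rho> \<circ>\<^sub>a (m \<star> id_arr M) = \<rho> \<circ>\<^sub>a (id_arr A \<star> \<rho>) \<circ>\<^sub>a assoc A A M \<and>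
     \<rho> \<circ>\<^sub>a (u \<star> id_arr M) = lunit M"

text \<open>The braiding of the two middle factors of \<open>(A \<boxtimes> A) \<boxtimes> (A \<boxtimes> A)\<close>.\<close>

definition middle_braid ::
  "('k, 'a) gspace \<Rightarrow> ('k, ('k, ('k, 'a, 'a) tensor, ('k, 'a, 'a) tensor) tensor,
                       ('k, ('k, 'a, 'a) tensor, ('k, 'a, 'a) tensor) tensor) garr" where
  "middle_braid A = assoc_inv A A (A \<boxtimes> A) \<circ>\<^sub>a (id_arr A \<star> assoc A A A) \<circ>\<^sub>a
     (id_arr A \<star> (braid A A \<star> id_arr A)) \<circ>\<^sub>a (id_arr A \<star> assoc_inv A A A) \<circ>\<^sub>a assoc A A (A \<boxtimes> A)"

end

record ('k, 'h) hopf =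
  Space :: "('k, 'h) gspace"
  Mul :: "('k, ('k, 'h, 'h) tensor, 'h) garr"
  Unit :: "('k, 'k, 'h) garr"
  Comul :: "('k, 'h, ('k, 'h, 'h) tensor) garr"
  Counit :: "('k, 'h, 'k) garr"
  Antipode :: "('k, 'h, 'h) garr"

context zp_graded
begin

definition hopf_algebra :: "('k, 'h) hopf \<Rightarrow> bool" where
  "hopf_algebra H \<longleftrightarrow>
     algebra_obj (Space H) (Mul H) (Unit H) \<and> coalgebra_obj (Space H) (Comul H) (Counit H) \<and>
     Comul H \<circ>\<^sub>a Mul H = (Mul H \<star> Mul H) \<circ>\<^sub>a middle_braid (Space H) \<circ>\<^sub>a (Comul H \<star> Comul H) \<and>
     Comul H \<circ>\<^sub>a Unit H \<circ>\<^sub>a lunit \<I> = Unit H \<star> Unit H \<and>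
     Counit H \<circ>\<^sub>a Mul H = lunit \<I> \<circ>\<^sub>a (Counit H \<star> Counit H) \<and>
     Counit H \<circ>\<^sub>a Unit H = id_arr \<I> \<and>
     Antipode H \<in> mor (Space H) (Space H) \<and>
     Mul H \<circ>\<^sub>a (Antipode H \<star> id_arr (Space H)) \<circ>\<^sub>a Comul H = Unit H \<circ>\<^sub>a Counit H \<and>
     Mul H \<circ>\<^sub>a (id_arr (Space H) \<star> Antipode H) \<circ>\<^sub>a Comul H = Unit H \<circ>\<^sub>a Counit H"


section \<open>The dual algebra\<close>

definition dual :: "('k, 'a) gspace \<Rightarrow> ('k, 'a \<Rightarrow> 'k) gspace" where
  "dual V = \<lparr>carrier = {\<phi> \<in> extensional (carrier V). linear_map scalars V \<I> \<phi>},
     monoid.mult = undefined, one = undefined,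
     ring.zero = restrict (\<lambda>v. 0) (carrier V),
     add = (\<lambda>\<phi> \<psi>. restrict (\<lambda>v. \<phi> v + \<psi> v) (carrier V)),
     module.smult = (\<lambda>c \<phi>. restrict (\<lambda>v. c * \<phi> v) (carrier V)),
     homog = (\<lambda>i. {\<phi> \<in> extensional (carrier V). linear_map scalars V \<I> \<phi> \<and>
                    (\<forall>j<p. (i + j) mod p \<noteq> 0 \<longrightarrow> (\<forall>v\<in>homog V j. \<phi> v = 0))})\<rparr>"

definition ev :: "('k, 'a) gspace \<Rightarrow> ('k, ('k, 'a, 'a \<Rightarrow> 'k) tensor, 'k) garr" where
  "ev V = (THE h. h \<in> mor (V \<boxtimes> dual V) \<I> \<and>
     (\<forall>v\<in>carrier V. \<forall>\<phi>\<in>carrier (dual V). Fun h (pure V (dual V) v \<phi>) = \<phi> v))"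

text \<open>The arrow written \<open>ev \<otimes> Id\<close> in formulas that suppress the associativity and unit
  constraints.\<close>

definition ev_id ::
  "('k, 'a) gspace \<Rightarrow> ('k, 'b) gspace \<Rightarrow>
   ('k, ('k, 'a, ('k, 'a \<Rightarrow> 'k, 'b) tensor) tensor, 'b) garr" where
  "ev_id V U = lunit U \<circ>\<^sub>a (ev V \<star> id_arr U) \<circ>\<^sub>a assoc_inv V (dual V) U"

text \<open>The coevaluation is determined by the two zigzag identities.\<close>

definition coev :: "('k, 'a) gspace \<Rightarrow> ('k, 'k, ('k, 'a \<Rightarrow> 'k, 'a) tensor) garr" where
  "coev V = (THE c. c \<in> mor \<I> (dual V \<boxtimes> V) \<and>
     ev_id V V \<circ>\<^sub>a (id_arr V \<star> c) = runit V \<and>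
     runit (dual V) \<circ>\<^sub>a (id_arr (dual V) \<star> ev V) \<circ>\<^sub>a assoc (dual V) V (dual V) \<circ>\<^sub>a
       (c \<star> id_arr (dual V)) = lunit (dual V))"

text \<open>The map \<open>U \<rightarrow> dual V \<boxtimes> Y\<close> whose adjoint is the given map \<open>V \<boxtimes> U \<rightarrow> Y\<close>, and the variant
  without \<open>Y\<close>.\<close>

definition of_adjoint ::
  "('k, 'a) gspace \<Rightarrow> ('k, 'b) gspace \<Rightarrow> ('k, 'c) gspace \<Rightarrow> ('k, ('k, 'a, 'b) tensor, 'c) garr \<Rightarrow>
   ('k, 'b, ('k, 'a \<Rightarrow> 'k, 'c) tensor) garr" where
  "of_adjoint V U Y g =
     (THE f. f \<in> mor U (dual V \<boxtimes> Y) \<and> ev_id V Y \<circ>\<^sub>a (id_arr V \<star> f) = g)"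

definition of_adjoint_unit ::
  "('k, 'a) gspace \<Rightarrow> ('k, 'b) gspace \<Rightarrow> ('k, ('k, 'a, 'b) tensor, 'k) garr \<Rightarrow>
   ('k, 'b, 'a \<Rightarrow> 'k) garr" where
  "of_adjoint_unit V U g = (THE f. f \<in> mor U (dual V) \<and> ev V \<circ>\<^sub>a (id_arr V \<star> f) = g)"

definition dual_mul ::
  "('k, 'h) hopf \<Rightarrow> ('k, ('k, 'h \<Rightarrow> 'k, 'h \<Rightarrow> 'k) tensor, 'h \<Rightarrow> 'k) garr" where
  "dual_mul H = (let A = Space H; D = dual A in
     of_adjoint_unit A (D \<boxtimes> D)
       (ev A \<circ>\<^sub>a (id_arr A \<star> ev_id A D) \<circ>\<^sub>a assoc A A (D \<boxtimes> D) \<circ>\<^sub>a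
        ((braid_inv A A \<circ>\<^sub>a Comul H) \<star> id_arr (D \<boxtimes> D))))"

definition dual_unit :: "('k, 'h) hopf \<Rightarrow> ('k, 'k, 'h \<Rightarrow> 'k) garr" where
  "dual_unit H = of_adjoint_unit (Space H) \<I> (Counit H \<circ>\<^sub>a runit (Space H))"


section \<open>Stable anti-Yetter-Drinfeld modules\<close>

definition r_one ::
  "('k, 'h) hopf \<Rightarrow> ('k, 'b) gspace \<Rightarrow>
   ('k, ('k, 'h, ('k, 'h \<Rightarrow> 'k, 'b) tensor) tensor, ('k, 'h \<Rightarrow> 'k, 'b) tensor) garr" where
  "r_one H M = (let A = Space H; Y = dual A \<boxtimes> M in
     of_adjoint A (A \<boxtimes> Y) M
       (ev_id A M \<circ>\<^sub>a (Mul H \<star> id_arr Y) \<circ>\<^sub>a assoc_inv A A Y))"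

definition r_zero ::
  "('k, 'h) hopf \<Rightarrow> ('k, 'b) gspace \<Rightarrow> ('k, ('k, 'h, 'b) tensor, 'b) garr \<Rightarrow>
   ('k, ('k, 'h, ('k, 'h \<Rightarrow> 'k, 'b) tensor) tensor, ('k, 'h \<Rightarrow> 'k, 'b) tensor) garr" where
  "r_zero H M \<rho> = (let A = Space H; Y = dual A \<boxtimes> M in
     of_adjoint A (A \<boxtimes> Y) M
       (\<rho> \<circ>\<^sub>a (id_arr A \<star> ev_id A M) \<circ>\<^sub>a
        (id_arr A \<star> ((Mul H \<star> id_arr Y) \<circ>\<^sub>a assoc_inv A A Y)) \<circ>\<^sub>a
        (id_arr A \<star> (Antipode H \<star> id_arr (A \<boxtimes> Y))) \<circ>\<^sub>a
        (assoc A A (A \<boxtimes> Y) \<circ>\<^sub>a (Comul H \<star> id_arr (A \<boxtimes> Y))) \<circ>\<^sub>a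
        (assoc A A Y \<circ>\<^sub>a (braid A A \<star> id_arr Y) \<circ>\<^sub>a assoc_inv A A Y)))"

definition act ::
  "('k, 'h) hopf \<Rightarrow> ('k, 'b) gspace \<Rightarrow> ('k, ('k, 'h, 'b) tensor, 'b) garr \<Rightarrow>
   ('k, ('k, 'h, ('k, 'h \<Rightarrow> 'k, 'b) tensor) tensor, ('k, 'h \<Rightarrow> 'k, 'b) tensor) garr" where
  "act H M \<rho> = (let A = Space H; Y = dual A \<boxtimes> M in
     r_one H M \<circ>\<^sub>a braided_structure A Y \<circ>\<^sub>a (id_arr A \<star> r_zero H M \<rho>) \<circ>\<^sub>a
     (assoc A A Y \<circ>\<^sub>a (Comul H \<star> id_arr Y)))"

end

record ('k, 'h, 'u) ayd =
  Und :: "('k, 'u) gspace"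
  Act :: "('k, ('k, 'h, 'u) tensor, 'u) garr"
  Dact :: "('k, ('k, 'h \<Rightarrow> 'k, 'u) tensor, 'u) garr"

context zp_graded
begin

definition aYD_obj :: "('k, 'h) hopf \<Rightarrow> ('k, 'h, 'u) ayd \<Rightarrow> bool" where
  "aYD_obj H M \<longleftrightarrow>
     module_obj (Space H) (Mul H) (Unit H) (Und M) (Act M) \<and>
     module_obj (dual (Space H)) (dual_mul H) (dual_unit H) (Und M) (Dact M) \<and>
     Act M \<circ>\<^sub>a (id_arr (Space H) \<star> Dact M) = Dact M \<circ>\<^sub>a act H (Und M) (Act M)"

definition aYD_hom ::
  "('k, 'h) hopf \<Rightarrow> ('k, 'h, 'u) ayd \<Rightarrow> ('k, 'h, 'u) ayd \<Rightarrow> ('k, 'u, 'u) garr set" where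
  "aYD_hom H M N = {f \<in> mor (Und M) (Und N).
     f \<circ>\<^sub>a Act M = Act N \<circ>\<^sub>a (id_arr (Space H) \<star> f) \<and>
     f \<circ>\<^sub>a Dact M = Dact N \<circ>\<^sub>a (id_arr (dual (Space H)) \<star> f)}"

definition stab :: "('k, 'h) hopf \<Rightarrow> ('k, 'h, 'u) ayd \<Rightarrow> ('k, 'u, 'u) garr" where
  "stab H M = (let A = Space H; V = Und M in
     Dact M \<circ>\<^sub>a (id_arr (dual A) \<star> Act M) \<circ>\<^sub>a assoc (dual A) A V \<circ>\<^sub>a (coev A \<star> id_arr V) \<circ>\<^sub>a
     inv_arr (lunit V) \<circ>\<^sub>a antitwist V)"

definition saYD :: "('k, 'h) hopf \<Rightarrow> ('k, ('k, 'h, 'u) ayd, ('k, 'u, 'u) garr) lincat" where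
  "saYD H = \<lparr>Obj = {M. aYD_obj H M \<and> stab H M = id_arr (Und M)},
     Hom = (\<lambda>M N. hom_module (aYD_hom H M N) (Und M) (Und N)),
     Ident = (\<lambda>M. id_arr (Und M)), Comp = (\<circ>\<^sub>a)\<rparr>"

end


section \<open>Truncated polynomials\<close>

text \<open>The algebra \<open>k[x]/x\<^sup>p\<close>, graded by the degree in \<open>x\<close>; classes are represented by the
  polynomials of degree less than \<open>p\<close>.\<close>

definition trunc_poly :: "nat \<Rightarrow> ('k::field, 'k poly) gspace" where
  "trunc_poly p = \<lparr>carrier = {f. degree f < p},
     monoid.mult = (\<lambda>f g. (f * g) mod monom 1 p), one = 1,
     ring.zero = 0, add = (+), module.smult = Polynomial.smult,
     homog = (\<lambda>i. range (\<lambda>c. monom c i))\<rparr>"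

text \<open>Hopf algebra structures in the braided category whose underlying algebra is \<open>k[x]/x\<^sup>p\<close> and in
  which \<open>x\<close> is primitive.\<close>

definition is_trunc_poly_hopf :: "nat \<Rightarrow> 'k::field \<Rightarrow> ('k, 'k poly) hopf \<Rightarrow> bool" where
  "is_trunc_poly_hopf p \<xi> H \<longleftrightarrow> (let A = trunc_poly p; x = monom 1 1 in
     zp_graded.hopf_algebra p \<xi> H \<and> Space H = A \<and>
     (\<forall>f\<in>carrier A. \<forall>g\<in>carrier A. Fun (Mul H) (pure A A f g) = f \<otimes>\<^bsub>A\<^esub> g) \<and>
     Fun (Unit H) 1 = \<one>\<^bsub>A\<^esub> \<and>
     Fun (Comul H) x = pure A A x 1 \<oplus>\<^bsub>zp_graded.tensor_space p A A\<^esub> pure A A 1 x \<and>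
     Fun (Antipode H) x = - x \<and> Fun (Counit H) x = 0)"

end

theory Submission
  imports Defs
begin

text \<open>A stable anti-Yetter-Drinfeld module over \<open>H = k[x]/x\<^sup>p\<close> is a graded space \<open>M\<close> with an
  operator \<open>X\<close> of degree \<open>1\<close>, by which \<open>x\<close> acts, and operators \<open>D\<^sub>n\<close> of degree \<open>- n\<close> for \<open>n < p\<close>,
  by which the basis \<open>\<delta> n\<close> dual to the powers of \<open>x\<close> acts.  The theorems \<open>stable_ops_of_saYD\<close> and
  \<open>saYD_of_stable_ops\<close> express the axioms in these terms.  The module axioms read \<open>X\<^sup>p = 0\<close>,
  \<open>D\<^sub>0 = Id\<close> and \<open>D\<^sub>i D\<^sub>j = \<kappa> i j D\<^sub>i\<^sub>+\<^sub>j\<close>, or \<open>0\<close> if \<open>i + j \<ge> p\<close>; as \<open>\<kappa> i j\<close> is nonzero otherwise, every \<open>D\<^sub>n\<close>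
  is a nonzero multiple of a power of \<open>D = D\<^sub>1\<close>.  The anti-Yetter-Drinfeld condition becomes a commutation
  relation, which for \<open>n = 1\<close> and on degree \<open>d\<close> is \<open>X D = \<xi> D X + (\<xi>\<^sup>1\<^sup>-\<^sup>2\<^sup>d - 1)\<close>.  Stability says that
  \<open>m\<close> is the sum of the \<open>D\<^sub>n X\<^sup>n m\<close>, multiplied by \<open>\<xi>\<close> to the power \<open>- d\<^sup>2\<close>, for \<open>m\<close> of degree \<open>d\<close>.

  Stability decides the structure.  On a vector of degree \<open>d\<close> killed by \<open>X\<close> only the term \<open>n = 0\<close>
  survives, and since \<open>p\<close> is prime, the scalar is \<open>1\<close> only for \<open>d = 0\<close>: thus \<open>X\<close> is injective in
  all degrees but \<open>0\<close> (\<open>ra_kernel\<close>).  Because \<open>X\<close> is nilpotent, it must kill degree \<open>0\<close>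
  (\<open>ra_homog_0\<close>).  The commutation relation then gives \<open>X D\<^sup>n v = c\<^sub>n D\<^sup>n\<^sup>-\<^sup>1 v\<close> for \<open>v\<close> of degree \<open>0\<close>, with
  \<open>c\<^sub>n = (\<xi>\<^sup>n - 1)\<^sup>2 / (\<xi> - 1)\<close>, which is nonzero for \<open>0 < n < p\<close> (\<open>ra_lo_pow\<close>).  Hence \<open>X\<^sup>n\<close> identifies
  degree \<open>- n\<close> with degree \<open>0\<close>, with inverse a multiple of \<open>D\<^sup>n\<close> (\<open>recover\<close>), and the whole module is
  determined by its degree \<open>0\<close> part: the functor that takes this part is fully faithful
  (\<open>fully_faithful_deg0\<close>).

  Conversely, these formulas define operators on a sum of \<open>p\<close> copies of any space \<open>V\<close>, the copy \<open>j\<close>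
  being placed in degree \<open>- j\<close>.  The commutation relation is a polynomial identity in \<open>\<xi>\<close>, and
  stability amounts to the \<open>q\<close>-analogue of the binomial theorem that expands \<open>x\<^sup>j\<close> in the products
  \<open>(x - 1) (x - q) \<dots> (x - q\<^sup>n\<^sup>-\<^sup>1)\<close>, evaluated at \<open>x = \<xi>\<^sup>j\<close> (\<open>qbin_newton\<close>, \<open>cst_dpow\<close>).  So the functor is
  essentially surjective (\<open>essentially_surjective_deg0\<close>) and an equivalence (\<open>lin_equivalentI\<close>).
  The \<open>p\<close> copies of \<open>V\<close> must fit into the type that contains \<open>V\<close>; they do because \<open>V\<close> is zero or
  infinite (\<open>tuples_in_universe\<close>).

  The longest part is the translation into operators.  Every structure arrow is a definite
  description and is evaluated on pure tensors of basis elements.  In the arrow \<open>act\<close> both \<open>r\<^sub>0\<close> and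
  the full composite turn out to be powers of a sum of two operators that commute up to \<open>\<xi>\<close>, by the
  \<open>q\<close>-binomial theorem, whose coefficients are those of the comultiplication.  Therefore \<open>x\<^sup>i\<close> acts
  through \<open>act\<close> as the \<open>i\<close>-th power of \<open>x\<close> (\<open>Fun_act_pow'\<close>), and the condition has to be compared
  on \<open>x\<close> alone (\<open>ayd_condition_iff\<close>).\<close>

section \<open>Linear maps and generating sets\<close>

abbreviation vecsp :: "('k::field, 'a, 'm) module_scheme \<Rightarrow> bool" where
  "vecsp V \<equiv> vectorspace scalars V"

abbreviation lin ::
  "('k::field, 'a, 'm) module_scheme \<Rightarrow> ('k, 'b, 'n) module_scheme \<Rightarrow> ('a \<Rightarrow> 'b) \<Rightarrow> bool" where
  "lin V W f \<equiv> linear_map scalars V W f"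

lemma scalars_simps [simp]:
  "carrier (scalars :: 'k::field ring) = UNIV"
  "x \<otimes>\<^bsub>scalars\<^esub> y = x * y" "\<one>\<^bsub>scalars\<^esub> = (1::'k)" "\<zero>\<^bsub>scalars\<^esub> = (0::'k)"
  "x \<oplus>\<^bsub>scalars\<^esub> y = x + (y::'k)"
  by (simp_all add: ring_of_type_algebra_def)

lemma vecsp_module: "vecsp V \<Longrightarrow> Module.module scalars V"
  by (simp add: vectorspace_def)

lemma vecsp_group: "vecsp V \<Longrightarrow> abelian_group V"
  by (simp add: vectorspace_def Module.module_def)

lemma vecsp_monoid: "vecsp V \<Longrightarrow> abelian_monoid V"
  by (simp add: abelian_group.axioms vecsp_group)

lemma vecsp_closed [simp, intro]:
  assumes "vecsp V"
  shows "\<zero>\<^bsub>V\<^esub> \<in> carrier V"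
    and "v \<in> carrier V \<Longrightarrow> w \<in> carrier V \<Longrightarrow> v \<oplus>\<^bsub>V\<^esub> w \<in> carrier V"
    and "v \<in> carrier V \<Longrightarrow> c \<odot>\<^bsub>V\<^esub> v \<in> carrier V"
proof -
  interpret Module.module scalars V using assms by (rule vecsp_module)
  show "\<zero>\<^bsub>V\<^esub> \<in> carrier V" by simp
  show "v \<in> carrier V \<Longrightarrow> w \<in> carrier V \<Longrightarrow> v \<oplus>\<^bsub>V\<^esub> w \<in> carrier V" by simp
  show "v \<in> carrier V \<Longrightarrow> c \<odot>\<^bsub>V\<^esub> v \<in> carrier V" by simp
qed

lemma vecsp_add_ac:
  assumes "vecsp V" "u \<in> carrier V" "v \<in> carrier V" "w \<in> carrier V"
  shows "(u \<oplus>\<^bsub>V\<^esub> v) \<oplus>\<^bsub>V\<^esub> w = u \<oplus>\<^bsub>V\<^esub> (v \<oplus>\<^bsub>V\<^esub> w)"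
    and "u \<oplus>\<^bsub>V\<^esub> v = v \<oplus>\<^bsub>V\<^esub> u"
    and "u \<oplus>\<^bsub>V\<^esub> (v \<oplus>\<^bsub>V\<^esub> w) = v \<oplus>\<^bsub>V\<^esub> (u \<oplus>\<^bsub>V\<^esub> w)"
proof -
  interpret abelian_group V using assms(1) by (rule vecsp_group)
  show "(u \<oplus>\<^bsub>V\<^esub> v) \<oplus>\<^bsub>V\<^esub> w = u \<oplus>\<^bsub>V\<^esub> (v \<oplus>\<^bsub>V\<^esub> w)" "u \<oplus>\<^bsub>V\<^esub> v = v \<oplus>\<^bsub>V\<^esub> u"
    "u \<oplus>\<^bsub>V\<^esub> (v \<oplus>\<^bsub>V\<^esub> w) = v \<oplus>\<^bsub>V\<^esub> (u \<oplus>\<^bsub>V\<^esub> w)"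
    using assms by (simp_all add: a_ac)
qed

lemma vecsp_zero [simp]:
  assumes "vecsp V" "v \<in> carrier V"
  shows "\<zero>\<^bsub>V\<^esub> \<oplus>\<^bsub>V\<^esub> v = v" and "v \<oplus>\<^bsub>V\<^esub> \<zero>\<^bsub>V\<^esub> = v" and "0 \<odot>\<^bsub>V\<^esub> v = \<zero>\<^bsub>V\<^esub>" and "1 \<odot>\<^bsub>V\<^esub> v = v"
proof -
  interpret Module.module scalars V using assms(1) by (rule vecsp_module)
  show "\<zero>\<^bsub>V\<^esub> \<oplus>\<^bsub>V\<^esub> v = v" "v \<oplus>\<^bsub>V\<^esub> \<zero>\<^bsub>V\<^esub> = v" using assms by simp_all
  show "0 \<odot>\<^bsub>V\<^esub> v = \<zero>\<^bsub>V\<^esub>" "1 \<odot>\<^bsub>V\<^esub> v = v"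
    using lmult_0[of v] smult_one[of v] assms by simp_all
qed

lemma vecsp_smult_zero [simp]: "vecsp V \<Longrightarrow> c \<odot>\<^bsub>V\<^esub> \<zero>\<^bsub>V\<^esub> = \<zero>\<^bsub>V\<^esub>"
  using Module.module.smult_assoc1[OF vecsp_module, of V c 0 "\<zero>\<^bsub>V\<^esub>"] by simp

lemma vecsp_smult:
  assumes "vecsp V" "v \<in> carrier V"
  shows "(a * b) \<odot>\<^bsub>V\<^esub> v = a \<odot>\<^bsub>V\<^esub> (b \<odot>\<^bsub>V\<^esub> v)"
    and "(a + b) \<odot>\<^bsub>V\<^esub> v = a \<odot>\<^bsub>V\<^esub> v \<oplus>\<^bsub>V\<^esub> b \<odot>\<^bsub>V\<^esub> v"
    and "w \<in> carrier V \<Longrightarrow> a \<odot>\<^bsub>V\<^esub> (v \<oplus>\<^bsub>V\<^esub> w) = a \<odot>\<^bsub>V\<^esub> v \<oplus>\<^bsub>V\<^esub> a \<odot>\<^bsub>V\<^esub> w"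
proof -
  interpret Module.module scalars V using assms(1) by (rule vecsp_module)
  show "(a * b) \<odot>\<^bsub>V\<^esub> v = a \<odot>\<^bsub>V\<^esub> (b \<odot>\<^bsub>V\<^esub> v)" "(a + b) \<odot>\<^bsub>V\<^esub> v = a \<odot>\<^bsub>V\<^esub> v \<oplus>\<^bsub>V\<^esub> b \<odot>\<^bsub>V\<^esub> v"
    using smult_assoc1[of a b v] smult_l_distr[of a b v] assms by simp_all
  show "w \<in> carrier V \<Longrightarrow> a \<odot>\<^bsub>V\<^esub> (v \<oplus>\<^bsub>V\<^esub> w) = a \<odot>\<^bsub>V\<^esub> v \<oplus>\<^bsub>V\<^esub> a \<odot>\<^bsub>V\<^esub> w"
    using smult_r_distr[of a v w] assms by simp
qed

lemma vecsp_add_cancel: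
  assumes "vecsp V" "u \<in> carrier V" "v \<in> carrier V" "w \<in> carrier V" "u \<oplus>\<^bsub>V\<^esub> v = u \<oplus>\<^bsub>V\<^esub> w"
  shows "v = w"
proof -
  interpret abelian_group V using assms(1) by (rule vecsp_group)
  show ?thesis using assms add.l_cancel[of u v w] by simp
qed

lemma vecspI:
  assumes "\<zero>\<^bsub>V\<^esub> \<in> carrier V"
    and "\<And>v w. v \<in> carrier V \<Longrightarrow> w \<in> carrier V \<Longrightarrow> v \<oplus>\<^bsub>V\<^esub> w \<in> carrier V"
    and "\<And>c v. v \<in> carrier V \<Longrightarrow> (c::'k::field) \<odot>\<^bsub>V\<^esub> v \<in> carrier V"
    and "\<And>u v w. u \<in> carrier V \<Longrightarrow> v \<in> carrier V \<Longrightarrow> w \<in> carrier V \<Longrightarrow>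
           (u \<oplus>\<^bsub>V\<^esub> v) \<oplus>\<^bsub>V\<^esub> w = u \<oplus>\<^bsub>V\<^esub> (v \<oplus>\<^bsub>V\<^esub> w)"
    and "\<And>v w. v \<in> carrier V \<Longrightarrow> w \<in> carrier V \<Longrightarrow> v \<oplus>\<^bsub>V\<^esub> w = w \<oplus>\<^bsub>V\<^esub> v"
    and "\<And>v. v \<in> carrier V \<Longrightarrow> v \<oplus>\<^bsub>V\<^esub> \<zero>\<^bsub>V\<^esub> = v"
    and "\<And>v. v \<in> carrier V \<Longrightarrow> 0 \<odot>\<^bsub>V\<^esub> v = \<zero>\<^bsub>V\<^esub>" and "\<And>v. v \<in> carrier V \<Longrightarrow> 1 \<odot>\<^bsub>V\<^esub> v = v"
    and "\<And>a b v. v \<in> carrier V \<Longrightarrow> (a * b) \<odot>\<^bsub>V\<^esub> v = a \<odot>\<^bsub>V\<^esub> (b \<odot>\<^bsub>V\<^esub> v)"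
    and "\<And>a b v. v \<in> carrier V \<Longrightarrow> (a + b) \<odot>\<^bsub>V\<^esub> v = a \<odot>\<^bsub>V\<^esub> v \<oplus>\<^bsub>V\<^esub> b \<odot>\<^bsub>V\<^esub> v"
    and "\<And>a v w. v \<in> carrier V \<Longrightarrow> w \<in> carrier V \<Longrightarrow>
           a \<odot>\<^bsub>V\<^esub> (v \<oplus>\<^bsub>V\<^esub> w) = a \<odot>\<^bsub>V\<^esub> v \<oplus>\<^bsub>V\<^esub> a \<odot>\<^bsub>V\<^esub> w"
  shows "vecsp V"
proof (rule vs_criteria)
  have "v \<oplus>\<^bsub>V\<^esub> ((-1) \<odot>\<^bsub>V\<^esub> v) = \<zero>\<^bsub>V\<^esub>" if "v \<in> carrier V" for v
    using assms(10)[OF that, of 1 "-1"] assms(7,8)[OF that] by simp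
  then show "\<forall>v\<in>carrier V. \<exists>w\<in>carrier V. v \<oplus>\<^bsub>V\<^esub> w = \<zero>\<^bsub>V\<^esub>"
    using assms(3) by blast
qed (use assms field_from_type_algebra in \<open>simp_all\<close>)

lemma linI:
  assumes "vecsp V" "vecsp W" "\<And>v. v \<in> carrier V \<Longrightarrow> f v \<in> carrier W"
    and "\<And>v w. v \<in> carrier V \<Longrightarrow> w \<in> carrier V \<Longrightarrow> f (v \<oplus>\<^bsub>V\<^esub> w) = f v \<oplus>\<^bsub>W\<^esub> f w"
    and "\<And>c v. v \<in> carrier V \<Longrightarrow> f (c \<odot>\<^bsub>V\<^esub> v) = c \<odot>\<^bsub>W\<^esub> f v"
  shows "lin V W f"
  using assms
  by (simp add: linear_map_def mod_hom_def mod_hom_axioms_def LinearCombinations.module_hom_def vectorspace_def)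

lemma lin_vecsp: "lin V W f \<Longrightarrow> vecsp V" "lin V W f \<Longrightarrow> vecsp W"
  by (simp_all add: linear_map_def)

lemma lin_mod_hom: "lin V W f \<Longrightarrow> mod_hom scalars V W f"
  by (simp add: linear_map_def)

lemma lin_closed: "lin V W f \<Longrightarrow> v \<in> carrier V \<Longrightarrow> f v \<in> carrier W"
  by (rule mod_hom.f_im[OF lin_mod_hom])

lemma lin_add:
  "lin V W f \<Longrightarrow> v \<in> carrier V \<Longrightarrow> w \<in> carrier V \<Longrightarrow> f (v \<oplus>\<^bsub>V\<^esub> w) = f v \<oplus>\<^bsub>W\<^esub> f w"
  using mod_hom.f_hom[OF lin_mod_hom, of V W f] by (simp add: LinearCombinations.module_hom_def)

lemma lin_smult: "lin V W f \<Longrightarrow> v \<in> carrier V \<Longrightarrow> f (c \<odot>\<^bsub>V\<^esub> v) = c \<odot>\<^bsub>W\<^esub> f v"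
  using mod_hom.f_hom[OF lin_mod_hom, of V W f] by (simp add: LinearCombinations.module_hom_def)

lemma lin_zero: "lin V W f \<Longrightarrow> f \<zero>\<^bsub>V\<^esub> = \<zero>\<^bsub>W\<^esub>"
  by (rule mod_hom.f0_is_0[OF lin_mod_hom])

lemma lin_cong:
  assumes "lin V W f" "\<And>v. v \<in> carrier V \<Longrightarrow> f v = g v"
  shows "lin V W g"
  by (rule linI)
    (use lin_vecsp[OF assms(1)] lin_closed[OF assms(1)] lin_add[OF assms(1)] lin_smult[OF assms(1)]
      in \<open>simp_all flip: assms(2)\<close>)

lemma vecsp_finsum_closed:
  "vecsp V \<Longrightarrow> (\<And>i. i \<in> I \<Longrightarrow> f i \<in> carrier V) \<Longrightarrow> finsum V f I \<in> carrier V"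
  by (rule abelian_monoid.finsum_closed[OF vecsp_monoid]) auto

lemma vecsp_finsum_cong:
  "vecsp V \<Longrightarrow> (\<And>i. i \<in> I \<Longrightarrow> g i \<in> carrier V) \<Longrightarrow> (\<And>i. i \<in> I \<Longrightarrow> f i = g i) \<Longrightarrow>
   finsum V f I = finsum V g I"
  by (rule abelian_monoid.finsum_cong'[OF vecsp_monoid]) auto

lemma lin_finsum:
  assumes "lin V W h" "\<And>i. i \<in> I \<Longrightarrow> f i \<in> carrier V"
  shows "h (finsum V f I) = finsum W (\<lambda>i. h (f i)) I"
proof (cases "finite I")
  case True
  interpret V: abelian_monoid V using lin_vecsp(1)[OF assms(1)] by (rule vecsp_monoid)
  interpret W: abelian_monoid W using lin_vecsp(2)[OF assms(1)] by (rule vecsp_monoid)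
  show ?thesis using True assms(2)
  proof (induction I)
    case (insert x F)
    have "finsum V f F \<in> carrier V" using insert by (auto intro!: V.finsum_closed)
    moreover have "(\<lambda>i. h (f i)) \<in> F \<rightarrow> carrier W"
      using insert by (auto intro!: lin_closed[OF assms(1)])
    ultimately show ?case
      using insert lin_closed[OF assms(1)] by (simp add: Pi_def lin_add[OF assms(1)])
  qed (simp add: lin_zero[OF assms(1)])
next
  case False
  interpret V: abelian_monoid V using lin_vecsp(1)[OF assms(1)] by (rule vecsp_monoid)
  interpret W: abelian_monoid W using lin_vecsp(2)[OF assms(1)] by (rule vecsp_monoid)
  show ?thesis using False by (simp add: lin_zero[OF assms(1)])
qed

lemma finsum_single:
  assumes "vecsp V" "finite I" "v \<in> carrier V"
  shows "finsum V (\<lambda>i. if i = j then v else \<zero>\<^bsub>V\<^esub>) I = (if j \<in> I then v else \<zero>\<^bsub>V\<^esub>)"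
proof -
  interpret V: abelian_monoid V using assms(1) by (rule vecsp_monoid)
  show ?thesis
  proof (cases "j \<in> I")
    case True
    then show ?thesis using V.finsum_singleton[OF True assms(2), of "\<lambda>_. v"] assms
      by (simp add: Pi_def eq_commute)
  next
    case False
    then have "finsum V (\<lambda>i. if i = j then v else \<zero>\<^bsub>V\<^esub>) I = finsum V (\<lambda>i. \<zero>\<^bsub>V\<^esub>) I"
      using assms by (intro vecsp_finsum_cong) auto
    then show ?thesis using False by simp
  qed
qed

lemma lin_comp: "lin U V f \<Longrightarrow> lin V W g \<Longrightarrow> lin U W (\<lambda>u. g (f u))"
  by (rule linI) (simp_all add: lin_vecsp lin_closed lin_add lin_smult)

lemma lin_id: "vecsp V \<Longrightarrow> lin V V (\<lambda>v. v)"
  by (rule linI) simp_all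

lemma lin_zero_map: "vecsp V \<Longrightarrow> vecsp W \<Longrightarrow> lin V W (\<lambda>v. \<zero>\<^bsub>W\<^esub>)"
  by (rule linI) simp_all

lemma lin_add_map: "lin V W f \<Longrightarrow> lin V W g \<Longrightarrow> lin V W (\<lambda>v. f v \<oplus>\<^bsub>W\<^esub> g v)"
  by (rule linI) (simp_all add: lin_vecsp lin_closed lin_add lin_smult vecsp_smult vecsp_add_ac)

lemma lin_smult_map: "lin V W f \<Longrightarrow> lin V W (\<lambda>v. c \<odot>\<^bsub>W\<^esub> f v)"
  by (rule linI)
    (simp_all add: lin_vecsp lin_closed lin_add lin_smult vecsp_smult mult.commute flip: vecsp_smult(1))

lemma lin_finsum_map:
  assumes "finite I" "vecsp V" "vecsp W" "\<And>i. i \<in> I \<Longrightarrow> lin V W (f i)"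
  shows "lin V W (\<lambda>v. finsum W (\<lambda>i. f i v) I)"
  using assms(1,4)
proof (induction I)
  case empty
  interpret W: abelian_monoid W using assms(3) by (rule vecsp_monoid)
  show ?case using assms by (simp add: lin_zero_map)
next
  case (insert x F)
  interpret W: abelian_monoid W using assms(3) by (rule vecsp_monoid)
  have lx: "lin V W (f x)" and lF: "lin V W (\<lambda>v. finsum W (\<lambda>i. f i v) F)"
    using insert by auto
  have *: "finsum W (\<lambda>i. f i v) (insert x F) = f x v \<oplus>\<^bsub>W\<^esub> finsum W (\<lambda>i. f i v) F"
    if "v \<in> carrier V" for v
    using insert that by (intro W.finsum_insert) (auto intro: lin_closed)
  show ?case by (rule lin_cong[OF lin_add_map[OF lx lF]]) (simp add: *)
qed

lemma lin_restrict: "lin V W f \<Longrightarrow> lin V W (restrict f (carrier V))"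
  by (rule linI) (simp_all add: lin_vecsp lin_closed lin_add lin_smult)

lemma submoduleI:
  assumes "vecsp V" "U \<subseteq> carrier V" "\<zero>\<^bsub>V\<^esub> \<in> U"
    and "\<And>v w. v \<in> U \<Longrightarrow> w \<in> U \<Longrightarrow> v \<oplus>\<^bsub>V\<^esub> w \<in> U" "\<And>c v. v \<in> U \<Longrightarrow> c \<odot>\<^bsub>V\<^esub> v \<in> U"
  shows "VectorSpace.subspace scalars U V"
  using assms by (simp add: VectorSpace.subspace_def submodule_def vecsp_module)

lemma subspace_closed:
  assumes "VectorSpace.subspace scalars U V"
  shows "U \<subseteq> carrier V" "\<zero>\<^bsub>V\<^esub> \<in> U" "v \<in> U \<Longrightarrow> w \<in> U \<Longrightarrow> v \<oplus>\<^bsub>V\<^esub> w \<in> U"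
    "v \<in> U \<Longrightarrow> c \<odot>\<^bsub>V\<^esub> v \<in> U"
proof -
  have "LinearCombinations.submodule scalars U V" using assms by (simp add: VectorSpace.subspace_def)
  note U = this[unfolded LinearCombinations.submodule_def]
  show "U \<subseteq> carrier V" "\<zero>\<^bsub>V\<^esub> \<in> U" "v \<in> U \<Longrightarrow> w \<in> U \<Longrightarrow> v \<oplus>\<^bsub>V\<^esub> w \<in> U"
    "v \<in> U \<Longrightarrow> c \<odot>\<^bsub>V\<^esub> v \<in> U"
    using U by auto
qed

lemma subspace_finsum:
  assumes "VectorSpace.subspace scalars U V" "\<And>i. i \<in> I \<Longrightarrow> f i \<in> U"
  shows "finsum V f I \<in> U"
proof -
  interpret V: abelian_monoid V using assms(1) by (simp add: VectorSpace.subspace_def vecsp_monoid)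
  show ?thesis
  proof (cases "finite I")
    case True
    then show ?thesis using assms(2)
    proof (induction I)
      case (insert x F)
      then show ?case
        using subspace_closed[OF assms(1)] by (subst V.finsum_insert) auto
    qed (simp add: subspace_closed(2)[OF assms(1)])
  next
    case False
    then show ?thesis by (simp add: subspace_closed(2)[OF assms(1)])
  qed
qed

text \<open>Generation is phrased by subspaces instead of linear combinations, because this is the form in
  which a property is propagated from \<open>S\<close> to the whole space.\<close>

definition generates :: "('k::field, 'a, 'm) module_scheme \<Rightarrow> 'a set \<Rightarrow> bool" where
  "generates V S \<longleftrightarrow> vecsp V \<and> S \<subseteq> carrier V \<and>
     (\<forall>U. VectorSpace.subspace scalars U V \<longrightarrow> S \<subseteq> U \<longrightarrow> carrier V \<subseteq> U)"

lemma generates_lin_eq: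
  assumes "generates V S" "lin V W f" "lin V W g" "\<And>s. s \<in> S \<Longrightarrow> f s = g s" "v \<in> carrier V"
  shows "f v = g v"
proof -
  have "VectorSpace.subspace scalars {u \<in> carrier V. f u = g u} V"
    using assms by (intro submoduleI) (auto simp: lin_vecsp lin_zero lin_add lin_smult)
  moreover have "S \<subseteq> {u \<in> carrier V. f u = g u}" using assms by (auto simp: generates_def)
  ultimately show ?thesis using assms(1,5) unfolding generates_def by blast
qed

lemma generates_lin_image:
  assumes "generates V S" "lin V W f" "VectorSpace.subspace scalars U W"
    "\<And>s. s \<in> S \<Longrightarrow> f s \<in> U" "v \<in> carrier V"
  shows "f v \<in> U"
proof -
  note U = subspace_closed[OF assms(3)]
  have "VectorSpace.subspace scalars {u \<in> carrier V. f u \<in> U} V"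
    using assms U by (intro submoduleI) (auto simp: lin_vecsp lin_zero lin_add lin_smult)
  moreover have "S \<subseteq> {u \<in> carrier V. f u \<in> U}" using assms by (auto simp: generates_def)
  ultimately show ?thesis using assms(1,5) unfolding generates_def by blast
qed

lemma generates_surj:
  assumes "generates V S" "lin V W f" "f ` carrier V = carrier W"
  shows "generates W (f ` S)"
  unfolding generates_def
proof (intro conjI allI impI)
  show "vecsp W" by (rule lin_vecsp(2)[OF assms(2)])
  show "f ` S \<subseteq> carrier W" using assms(1,3) by (auto simp: generates_def)
  fix U assume "VectorSpace.subspace scalars U W" "f ` S \<subseteq> U"
  then show "carrier W \<subseteq> U"
    using generates_lin_image[OF assms(1,2)] assms(3) by (metis image_subset_iff subsetI)
qed

lemma fd_space_iff_generates: "fd_space V \<longleftrightarrow> (\<exists>S. finite S \<and> generates V S)"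
proof
  assume fd: "fd_space V"
  then interpret V: vectorspace scalars V by (simp add: fd_space_def)
  obtain S where S: "finite S" "S \<subseteq> carrier V" "V.span S = carrier V"
    using fd by (auto simp: fd_space_def V.fin_dim_def)
  have "generates V S"
    unfolding generates_def
  proof (intro conjI allI impI)
    fix U assume U: "VectorSpace.subspace scalars U V" "S \<subseteq> U"
    show "carrier V \<subseteq> U"
      using S V.span_is_subset[OF U(2)] U(1) by (simp add: V.is_module)
  qed (use S V.vectorspace_axioms in auto)
  then show "\<exists>S. finite S \<and> generates V S" using S by blast
next
  assume "\<exists>S. finite S \<and> generates V S"
  then obtain S where S: "finite S" "generates V S" by blast
  then interpret V: vectorspace scalars V by (simp add: generates_def)
  have sub: "S \<subseteq> carrier V" using S by (simp add: generates_def)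
  have "carrier V \<subseteq> V.span S"
    using S(2) V.span_is_subspace[OF sub] V.in_own_span[OF sub] by (simp add: generates_def)
  then have "V.span S = carrier V" using V.span_is_subset2[OF sub] by blast
  then show "fd_space V"
    using S sub V.vectorspace_axioms by (auto simp: fd_space_def V.fin_dim_def)
qed

lemma fd_space_vecsp: "fd_space V \<Longrightarrow> vecsp V"
  by (simp add: fd_space_def)

lemma fd_space_surj:
  assumes "fd_space V" "lin V W f" "f ` carrier V = carrier W"
  shows "fd_space W"
  using assms generates_surj[OF _ assms(2,3)] unfolding fd_space_iff_generates by blast

lemma unit_space_simps [simp]:
  "carrier \<I> = UNIV" "\<zero>\<^bsub>\<I>\<^esub> = (0::'k::field)" "x \<oplus>\<^bsub>\<I>\<^esub> y = x + (y::'k)" "c \<odot>\<^bsub>\<I>\<^esub> x = c * x"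
  "homog \<I> i = (if i = 0 then UNIV else {0})"
  by (simp_all add: unit_space_def)

lemma vecsp_unit [simp]: "vecsp \<I>"
  by (rule vecspI) (simp_all add: algebra_simps)

lemma finsum_unit: "finite I \<Longrightarrow> finsum (\<I> :: ('k::field, 'k) gspace) f I = (\<Sum>i\<in>I. f i)"
proof (induction I rule: finite_induct)
  case empty
  interpret abelian_monoid "\<I> :: ('k, 'k) gspace" by (rule vecsp_monoid) simp
  show ?case by simp
next
  case (insert x F)
  interpret abelian_monoid "\<I> :: ('k, 'k) gspace" by (rule vecsp_monoid) simp
  show ?case using insert by (subst finsum_insert) auto
qed

text \<open>The coordinates with respect to a basis are linear forms, so linear forms separate points.\<close>

lemma functional_separates:
  fixes V :: "('k::field, 'a, 'm) module_scheme"
  assumes "fd_space V" "v \<in> carrier V" "\<And>\<phi>. lin V \<I> \<phi> \<Longrightarrow> \<phi> v = 0"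
  shows "v = \<zero>\<^bsub>V\<^esub>"
proof -
  interpret V: vectorspace scalars V using assms(1) by (rule fd_space_vecsp)
  have fd: "V.fin_dim" using assms(1) by (simp add: fd_space_def)
  obtain B where B: "finite B" "V.basis B" using V.finite_basis_exists[OF fd] by blast
  have BV: "B \<subseteq> carrier V" using B(2) by (simp add: V.basis_def)
  have ex1: "\<exists>!a. a \<in> B \<rightarrow>\<^sub>E UNIV \<and> V.lincomb a B = w" if "w \<in> carrier V" for w
    using V.basis_criterion[OF B(1) BV] B(2) that by simp
  define co where "co w = (THE a. a \<in> B \<rightarrow>\<^sub>E UNIV \<and> V.lincomb a B = w)" for w
  have co: "co w \<in> B \<rightarrow>\<^sub>E UNIV \<and> V.lincomb (co w) B = w" if "w \<in> carrier V" for w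
    using theI'[OF ex1[OF that]] by (simp add: co_def)
  have co_eq: "co w b = a b" if "w \<in> carrier V" "V.lincomb a B = w" "b \<in> B" for w a b
  proof -
    have "V.lincomb (restrict a B) B = V.lincomb a B"
      using BV by (intro V.lincomb_cong) auto
    then have "restrict a B = co w"
      using ex1[OF that(1)] co[OF that(1)] that(2) by (metis restrict_PiE_iff UNIV_I)
    then show ?thesis using that(3) by (metis restrict_apply')
  qed
  have linb: "lin V \<I> (\<lambda>w. co w b)" if "b \<in> B" for b
  proof (rule linI)
    fix u w assume uw: "u \<in> carrier V" "w \<in> carrier V"
    have "V.lincomb (\<lambda>b. co u b + co w b) B = u \<oplus>\<^bsub>V\<^esub> w"
      using V.lincomb_sum[OF B(1) BV, of "co u" "co w"] co[OF uw(1)] co[OF uw(2)] by simp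
    then show "co (u \<oplus>\<^bsub>V\<^esub> w) b = co u b \<oplus>\<^bsub>\<I>\<^esub> co w b"
      using co_eq[of "u \<oplus>\<^bsub>V\<^esub> w" _ b] uw that by simp
  next
    fix c u assume u: "u \<in> carrier V"
    have "V.lincomb (\<lambda>b. c * co u b) B = c \<odot>\<^bsub>V\<^esub> u"
      using V.lincomb_smult[OF BV, of "co u" c] co[OF u] by simp
    then show "co (c \<odot>\<^bsub>V\<^esub> u) b = c \<odot>\<^bsub>\<I>\<^esub> co u b"
      using co_eq[of "c \<odot>\<^bsub>V\<^esub> u" _ b] u that by simp
  qed (simp_all add: V.vectorspace_axioms)
  have "V.lincomb (co v) B = V.lincomb (\<lambda>_. 0) B"
    using BV assms(3)[OF linb] by (intro V.lincomb_cong) auto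
  also have "\<dots> = \<zero>\<^bsub>V\<^esub>"
    unfolding V.lincomb_def using BV V.vectorspace_axioms
    by (subst vecsp_finsum_cong[of _ _ "\<lambda>_. \<zero>\<^bsub>V\<^esub>"]) auto
  finally show ?thesis using co[OF assms(2)] by simp
qed

lemma vecsp_diff_zero:
  assumes "vecsp V" "v \<in> carrier V" "w \<in> carrier V" "v \<oplus>\<^bsub>V\<^esub> (-1) \<odot>\<^bsub>V\<^esub> w = \<zero>\<^bsub>V\<^esub>"
  shows "v = w"
proof -
  have "w \<oplus>\<^bsub>V\<^esub> (-1) \<odot>\<^bsub>V\<^esub> w = (1 + -1) \<odot>\<^bsub>V\<^esub> w"
    using assms(1,3) by (subst vecsp_smult(2)) simp_all
  then have "w \<oplus>\<^bsub>V\<^esub> (-1) \<odot>\<^bsub>V\<^esub> w = \<zero>\<^bsub>V\<^esub>" using assms(1,3) by simp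
  then have "(-1) \<odot>\<^bsub>V\<^esub> w \<oplus>\<^bsub>V\<^esub> v = (-1) \<odot>\<^bsub>V\<^esub> w \<oplus>\<^bsub>V\<^esub> w"
    using assms vecsp_add_ac(2)[OF assms(1)] by (metis vecsp_closed(3))
  then show ?thesis using assms vecsp_add_cancel by (metis vecsp_closed(3))
qed

lemma functional_eqI:
  assumes "fd_space V" "v \<in> carrier V" "w \<in> carrier V" "\<And>\<phi>. lin V \<I> \<phi> \<Longrightarrow> \<phi> v = \<phi> w"
  shows "v = w"
proof (rule vecsp_diff_zero)
  show V: "vecsp V" using assms(1) by (rule fd_space_vecsp)
  show "v \<oplus>\<^bsub>V\<^esub> (-1) \<odot>\<^bsub>V\<^esub> w = \<zero>\<^bsub>V\<^esub>"
    using assms V by (intro functional_separates) (auto simp: lin_add lin_smult)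
qed (use assms in auto)

lemma arr_ext:
  assumes "f \<in> lin_hom V W" "g \<in> lin_hom V W" "\<And>v. v \<in> carrier V \<Longrightarrow> Fun f v = Fun g v"
  shows "f = g"
proof -
  have "Fun f = Fun g" using assms by (auto simp: lin_hom_def intro: extensionalityI)
  then show ?thesis using assms(1,2) by (simp add: lin_hom_def)
qed

section \<open>Equivalences from fully faithful functors\<close>

text \<open>A quasi-inverse is chosen on objects by \<open>es\<close>; a morphism is conjugated with the chosen
  isomorphisms and pulled back along the bijections of \<open>ff\<close>.  All equations in \<open>C\<close> are verified
  after applying the faithful functor, which turns them into associativity in \<open>D\<close>.\<close>

lemma lin_equivalentI:
  assumes C: "linear_category C" and D: "linear_category D"
    and F: "linear_functor C D Fo Fm"
    and ff: "\<And>a b. a \<in> Obj C \<Longrightarrow> b \<in> Obj C \<Longrightarrow>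
               bij_betw (Fm a b) (carrier (Hom C a b)) (carrier (Hom D (Fo a) (Fo b)))"
    and es: "\<And>x. x \<in> Obj D \<Longrightarrow> \<exists>a\<in>Obj C. \<exists>u\<in>carrier (Hom D (Fo a) x). \<exists>w\<in>carrier (Hom D x (Fo a)).
               Comp D w u = Ident D (Fo a) \<and> Comp D u w = Ident D x"
  shows "lin_equivalent C D"
proof -
  obtain Go where Go: "\<And>x. x \<in> Obj D \<Longrightarrow> Go x \<in> Obj C \<and> (\<exists>u\<in>carrier (Hom D (Fo (Go x)) x).
      \<exists>w\<in>carrier (Hom D x (Fo (Go x))). Comp D w u = Ident D (Fo (Go x)) \<and> Comp D u w = Ident D x)"
    using bchoice[of "Obj D" "\<lambda>x a. a \<in> Obj C \<and> (\<exists>u\<in>carrier (Hom D (Fo a) x).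
      \<exists>w\<in>carrier (Hom D x (Fo a)). Comp D w u = Ident D (Fo a) \<and> Comp D u w = Ident D x)"] es
    by blast
  obtain e where e: "\<And>x. x \<in> Obj D \<Longrightarrow> e x \<in> carrier (Hom D (Fo (Go x)) x) \<and>
      (\<exists>w\<in>carrier (Hom D x (Fo (Go x))). Comp D w (e x) = Ident D (Fo (Go x)) \<and> Comp D (e x) w = Ident D x)"
    using bchoice[of "Obj D" "\<lambda>x u. u \<in> carrier (Hom D (Fo (Go x)) x) \<and>
      (\<exists>w\<in>carrier (Hom D x (Fo (Go x))). Comp D w u = Ident D (Fo (Go x)) \<and> Comp D u w = Ident D x)"] Go
    by blast
  obtain e' where e': "\<And>x. x \<in> Obj D \<Longrightarrow> e' x \<in> carrier (Hom D x (Fo (Go x))) \<and>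
      Comp D (e' x) (e x) = Ident D (Fo (Go x)) \<and> Comp D (e x) (e' x) = Ident D x"
    using bchoice[of "Obj D" "\<lambda>x w. w \<in> carrier (Hom D x (Fo (Go x))) \<and>
      Comp D w (e x) = Ident D (Fo (Go x)) \<and> Comp D (e x) w = Ident D x"] e
    by blast
  have GoC [simp]: "Go x \<in> Obj C" if "x \<in> Obj D" for x using Go[OF that] by blast
  have eD [simp]: "e x \<in> carrier (Hom D (Fo (Go x)) x)" if "x \<in> Obj D" for x using e[OF that] by blast
  have e'D [simp]: "e' x \<in> carrier (Hom D x (Fo (Go x)))" if "x \<in> Obj D" for x using e'[OF that] by blast
  have ee' [simp]: "Comp D (e' x) (e x) = Ident D (Fo (Go x))" "Comp D (e x) (e' x) = Ident D x"
    if "x \<in> Obj D" for x using e'[OF that] by auto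
  have FoD [simp]: "Fo a \<in> Obj D" if "a \<in> Obj C" for a
    using F that by (simp add: linear_functor_def)
  have Fl: "lin (Hom C a b) (Hom D (Fo a) (Fo b)) (Fm a b)" if "a \<in> Obj C" "b \<in> Obj C" for a b
    using F that by (simp add: linear_functor_def)
  have Fid: "Fm a a (Ident C a) = Ident D (Fo a)" if "a \<in> Obj C" for a
    using F that by (simp add: linear_functor_def)
  have Fcomp: "Fm a c (Comp C g f) = Comp D (Fm b c g) (Fm a b f)"
    if "a \<in> Obj C" "b \<in> Obj C" "c \<in> Obj C" "f \<in> carrier (Hom C a b)" "g \<in> carrier (Hom C b c)"
    for a b c f g using F that by (simp add: linear_functor_def)
  have Fcl [simp]: "Fm a b f \<in> carrier (Hom D (Fo a) (Fo b))"
    if "a \<in> Obj C" "b \<in> Obj C" "f \<in> carrier (Hom C a b)" for a b f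
    using that by (intro lin_closed[OF Fl])
  have Did [simp]: "Ident D x \<in> carrier (Hom D x x)" if "x \<in> Obj D" for x
    using D that by (simp add: linear_category_def)
  have Cid [simp]: "Ident C x \<in> carrier (Hom C x x)" if "x \<in> Obj C" for x
    using C that by (simp add: linear_category_def)
  have Dl: "lin (Hom D a b) (Hom D a c) (\<lambda>f. Comp D g f)"
    if "a \<in> Obj D" "b \<in> Obj D" "c \<in> Obj D" "g \<in> carrier (Hom D b c)" for a b c g
    using D that by (simp_all add: linear_category_def)
  have Dr: "lin (Hom D b c) (Hom D a c) (\<lambda>g. Comp D g f)"
    if "a \<in> Obj D" "b \<in> Obj D" "c \<in> Obj D" "f \<in> carrier (Hom D a b)" for a b c f
    using D that by (simp_all add: linear_category_def)
  have Cl: "lin (Hom C a b) (Hom C a c) (\<lambda>f. Comp C g f)"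
    if "a \<in> Obj C" "b \<in> Obj C" "c \<in> Obj C" "g \<in> carrier (Hom C b c)" for a b c g
    using C that by (simp_all add: linear_category_def)
  have Dc [simp]: "Comp D g f \<in> carrier (Hom D a c)"
    if "a \<in> Obj D" "b \<in> Obj D" "c \<in> Obj D" "f \<in> carrier (Hom D a b)" "g \<in> carrier (Hom D b c)" for a b c f g
    using that by (intro lin_closed[OF Dl])
  have Cc [simp]: "Comp C g f \<in> carrier (Hom C a c)"
    if "a \<in> Obj C" "b \<in> Obj C" "c \<in> Obj C" "f \<in> carrier (Hom C a b)" "g \<in> carrier (Hom C b c)" for a b c f g
    using that by (intro lin_closed[OF Cl])
  have Dunit [simp]: "Comp D f (Ident D a) = f" "Comp D (Ident D b) f = f"
    if "a \<in> Obj D" "b \<in> Obj D" "f \<in> carrier (Hom D a b)" for a b f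
    using D that by (simp_all add: linear_category_def)
  have Dassoc: "Comp D (Comp D h g) f = Comp D h (Comp D g f)"
    if "a \<in> Obj D" "b \<in> Obj D" "c \<in> Obj D" "d \<in> Obj D"
      "f \<in> carrier (Hom D a b)" "g \<in> carrier (Hom D b c)" "h \<in> carrier (Hom D c d)" for a b c d f g h
    using D that unfolding linear_category_def by metis
  define iF where "iF a b = the_inv_into (carrier (Hom C a b)) (Fm a b)" for a b
  have iF [simp]: "iF a b g \<in> carrier (Hom C a b)" "Fm a b (iF a b g) = g"
    if "a \<in> Obj C" "b \<in> Obj C" "g \<in> carrier (Hom D (Fo a) (Fo b))" for a b g
    using ff[OF that(1,2)] that(3) unfolding iF_def
    by (auto simp: bij_betw_def f_the_inv_into_f intro!: the_inv_into_into)
  have inj: "f = g" if "a \<in> Obj C" "b \<in> Obj C" "f \<in> carrier (Hom C a b)" "g \<in> carrier (Hom C a b)"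
      "Fm a b f = Fm a b g" for a b f g
    using ff[OF that(1,2)] that by (auto simp: bij_betw_def inj_on_def)
  define Gm where "Gm x y g = iF (Go x) (Go y) (Comp D (e' y) (Comp D g (e x)))" for x y g
  define \<eta> where "\<eta> a = iF a (Go (Fo a)) (e' (Fo a))" for a
  define \<theta> where "\<theta> a = iF (Go (Fo a)) a (e (Fo a))" for a
  have mid [simp]: "Comp D (e' y) (Comp D g (e x)) \<in> carrier (Hom D (Fo (Go x)) (Fo (Go y)))"
    if "x \<in> Obj D" "y \<in> Obj D" "g \<in> carrier (Hom D x y)" for x y g
  proof -
    have "Comp D g (e x) \<in> carrier (Hom D (Fo (Go x)) y)"
      by (rule Dc[of _ x]) (use that in auto)
    then show ?thesis by (intro Dc[of "Fo (Go x)" y "Fo (Go y)"]) (use that in auto)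
  qed
  have GmC [simp]: "Gm x y g \<in> carrier (Hom C (Go x) (Go y))"
    and FGm [simp]: "Fm (Go x) (Go y) (Gm x y g) = Comp D (e' y) (Comp D g (e x))"
    if "x \<in> Obj D" "y \<in> Obj D" "g \<in> carrier (Hom D x y)" for x y g
    using that by (simp_all add: Gm_def)
  have G: "linear_functor D C Go Gm"
    unfolding linear_functor_def
  proof (intro conjI ballI)
    fix x y assume xy: "x \<in> Obj D" "y \<in> Obj D"
    have vD: "vecsp (Hom D x y)" and vC: "vecsp (Hom C (Go x) (Go y))"
      using C D xy by (simp_all add: linear_category_def)
    have l: "lin (Hom D x y) (Hom D (Fo (Go x)) (Fo (Go y))) (\<lambda>g. Comp D (e' y) (Comp D g (e x)))"
      by (rule lin_comp[OF Dr[of "Fo (Go x)" x y "e x"] Dl[of "Fo (Go x)" y "Fo (Go y)"]]) (use xy in auto)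
    show "lin (Hom D x y) (Hom C (Go x) (Go y)) (Gm x y)"
    proof (rule linI[OF vD vC])
      fix g h assume gh: "g \<in> carrier (Hom D x y)" "h \<in> carrier (Hom D x y)"
      show "Gm x y (g \<oplus>\<^bsub>Hom D x y\<^esub> h) = Gm x y g \<oplus>\<^bsub>Hom C (Go x) (Go y)\<^esub> Gm x y h"
        by (rule inj[of "Go x" "Go y"])
          (use xy gh vD vC in \<open>simp_all add: lin_add[OF Fl] lin_add[OF l]\<close>)
    next
      fix c g assume g: "g \<in> carrier (Hom D x y)"
      show "Gm x y (c \<odot>\<^bsub>Hom D x y\<^esub> g) = c \<odot>\<^bsub>Hom C (Go x) (Go y)\<^esub> Gm x y g"
        by (rule inj[of "Go x" "Go y"])
          (use xy g vD vC in \<open>simp_all add: lin_smult[OF Fl] lin_smult[OF l]\<close>)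
    qed (use xy in simp)
  next
    fix x assume x: "x \<in> Obj D"
    show "Gm x x (Ident D x) = Ident C (Go x)"
      by (rule inj[of "Go x" "Go x"]) (use x in \<open>simp_all add: Fid Dunit(2)[of "Fo (Go x)" x]\<close>)
  next
    fix x y z f g assume xyz: "x \<in> Obj D" "y \<in> Obj D" "z \<in> Obj D"
      and f: "f \<in> carrier (Hom D x y)" and g: "g \<in> carrier (Hom D y z)"
    have fe: "Comp D f (e x) \<in> carrier (Hom D (Fo (Go x)) y)"
      by (rule Dc[of _ x]) (use xyz f in auto)
    have "Comp D (Comp D (e' z) (Comp D g (e y))) (Comp D (e' y) (Comp D f (e x)))
        = Comp D (e' z) (Comp D (Comp D g (e y)) (Comp D (e' y) (Comp D f (e x))))"
      by (rule Dassoc[of "Fo (Go x)" "Fo (Go y)" z "Fo (Go z)"]) (use xyz f g in \<open>auto intro: Dc[of _ y]\<close>)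
    also have "Comp D (Comp D g (e y)) (Comp D (e' y) (Comp D f (e x)))
        = Comp D g (Comp D (e y) (Comp D (e' y) (Comp D f (e x))))"
      by (rule Dassoc[of "Fo (Go x)" "Fo (Go y)" y z]) (use xyz f g in auto)
    also have "Comp D (e y) (Comp D (e' y) (Comp D f (e x))) = Comp D (Comp D (e y) (e' y)) (Comp D f (e x))"
      by (rule Dassoc[symmetric, of "Fo (Go x)" y "Fo (Go y)" y]) (use xyz f g fe in auto)
    also have "\<dots> = Comp D f (e x)"
      using xyz fe by (simp add: Dunit(2)[of "Fo (Go x)" y])
    also have "Comp D g (Comp D f (e x)) = Comp D (Comp D g f) (e x)"
      by (rule Dassoc[symmetric, of "Fo (Go x)" x y z]) (use xyz f g in auto)
    finally have eq: "Comp D (Comp D (e' z) (Comp D g (e y))) (Comp D (e' y) (Comp D f (e x)))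
      = Comp D (e' z) (Comp D (Comp D g f) (e x))" .
    have gf: "Comp D g f \<in> carrier (Hom D x z)" using xyz f g by (intro Dc[of x y z]) auto
    have "Comp C (Gm y z g) (Gm x y f) \<in> carrier (Hom C (Go x) (Go z))"
      using xyz f g by (intro Cc[of "Go x" "Go y" "Go z"]) auto
    then show "Gm x z (Comp D g f) = Comp C (Gm y z g) (Gm x y f)"
      by (intro inj[of "Go x" "Go z"])
        (use xyz f g gf eq in \<open>simp_all add: Fcomp[of "Go x" "Go y" "Go z"]\<close>)
  qed simp
  have "natural_iso C C (\<lambda>a. a) (\<lambda>a b f. f)
          (\<lambda>a. Go (Fo a)) (\<lambda>a b f. Gm (Fo a) (Fo b) (Fm a b f)) \<eta>"
    unfolding natural_iso_def
  proof (intro conjI ballI)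
    fix a assume a: "a \<in> Obj C"
    have \<eta>a: "\<eta> a \<in> carrier (Hom C a (Go (Fo a)))" and \<theta>a: "\<theta> a \<in> carrier (Hom C (Go (Fo a)) a)"
      and F\<eta>: "Fm a (Go (Fo a)) (\<eta> a) = e' (Fo a)" and F\<theta>: "Fm (Go (Fo a)) a (\<theta> a) = e (Fo a)"
      using a by (simp_all add: \<eta>_def \<theta>_def)
    show "\<eta> a \<in> carrier (Hom C a (Go (Fo a)))" by (fact \<eta>a)
    have "Comp C (\<theta> a) (\<eta> a) = Ident C a"
      by (rule inj[of a a])
        (use a \<eta>a \<theta>a in \<open>auto simp: Fid F\<eta> F\<theta> Fcomp[of a "Go (Fo a)" a] intro: Cc[of a "Go (Fo a)" a]\<close>)
    moreover have "Comp C (\<eta> a) (\<theta> a) = Ident C (Go (Fo a))"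
      by (rule inj[of "Go (Fo a)" "Go (Fo a)"])
        (use a \<eta>a \<theta>a in \<open>auto simp: Fid F\<eta> F\<theta> Fcomp[of "Go (Fo a)" a "Go (Fo a)"]
          intro: Cc[of "Go (Fo a)" a "Go (Fo a)"]\<close>)
    ultimately show "\<exists>\<theta>\<in>carrier (Hom C (Go (Fo a)) a). Comp C \<theta> (\<eta> a) = Ident C a \<and> Comp C (\<eta> a) \<theta> = Ident C (Go (Fo a))"
      using \<theta>a by blast
  next
    fix a b f assume a: "a \<in> Obj C" and b: "b \<in> Obj C" and f: "f \<in> carrier (Hom C a b)"
    have \<eta>a: "\<eta> a \<in> carrier (Hom C a (Go (Fo a)))" and \<eta>b: "\<eta> b \<in> carrier (Hom C b (Go (Fo b)))"
      and F\<eta>: "Fm a (Go (Fo a)) (\<eta> a) = e' (Fo a)" "Fm b (Go (Fo b)) (\<eta> b) = e' (Fo b)"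
      using a b by (simp_all add: \<eta>_def)
    let ?f = "Fm a b f"
    have "Comp D (Comp D (e' (Fo b)) (Comp D ?f (e (Fo a)))) (e' (Fo a))
        = Comp D (e' (Fo b)) (Comp D (Comp D ?f (e (Fo a))) (e' (Fo a)))"
      by (rule Dassoc[of "Fo a" "Fo (Go (Fo a))" "Fo b" "Fo (Go (Fo b))"])
        (use a b f in \<open>auto intro: Dc[of _ "Fo a"]\<close>)
    also have "Comp D (Comp D ?f (e (Fo a))) (e' (Fo a)) = Comp D ?f (Comp D (e (Fo a)) (e' (Fo a)))"
      by (rule Dassoc[of "Fo a" "Fo (Go (Fo a))" "Fo a" "Fo b"]) (use a b f in auto)
    finally have eq: "Comp D (Comp D (e' (Fo b)) (Comp D ?f (e (Fo a)))) (e' (Fo a)) = Comp D (e' (Fo b)) ?f"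
      using a b f by (simp add: Dunit(1)[of "Fo a" "Fo b"])
    show "Comp C (\<eta> b) f = Comp C (Gm (Fo a) (Fo b) ?f) (\<eta> a)"
      by (rule inj[of a "Go (Fo b)"])
        (use a b f \<eta>a \<eta>b eq in \<open>auto simp: F\<eta> Fcomp[of a b "Go (Fo b)"] Fcomp[of a "Go (Fo a)" "Go (Fo b)"]
           intro: Cc[of a b "Go (Fo b)"] Cc[of a "Go (Fo a)" "Go (Fo b)"]\<close>)
  qed
  moreover have "natural_iso D D (\<lambda>x. Fo (Go x)) (\<lambda>x y g. Fm (Go x) (Go y) (Gm x y g))
          (\<lambda>x. x) (\<lambda>x y g. g) e"
    unfolding natural_iso_def
  proof (intro conjI ballI)
    fix x assume x: "x \<in> Obj D"
    then show "e x \<in> carrier (Hom D (Fo (Go x)) x)" by simp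
    show "\<exists>\<theta>\<in>carrier (Hom D x (Fo (Go x))). Comp D \<theta> (e x) = Ident D (Fo (Go x)) \<and> Comp D (e x) \<theta> = Ident D x"
      using x by (intro bexI[of _ "e' x"]) auto
  next
    fix x y g assume x: "x \<in> Obj D" and y: "y \<in> Obj D" and g: "g \<in> carrier (Hom D x y)"
    have ge: "Comp D g (e x) \<in> carrier (Hom D (Fo (Go x)) y)" by (rule Dc[of _ x]) (use x y g in auto)
    have "Comp D (e y) (Comp D (e' y) (Comp D g (e x))) = Comp D (Comp D (e y) (e' y)) (Comp D g (e x))"
      by (rule Dassoc[symmetric, of "Fo (Go x)" y "Fo (Go y)" y]) (use x y ge in auto)
    then show "Comp D (e y) (Fm (Go x) (Go y) (Gm x y g)) = Comp D g (e x)"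
      using x y g ge by (simp add: Dunit(2)[of "Fo (Go x)" y])
  qed
  ultimately show ?thesis
    unfolding lin_equivalent_def using C D F G by blast
qed

section \<open>Bilinear maps\<close>

definition bilin ::
  "('k::field, 'a) gspace \<Rightarrow> ('k, 'b) gspace \<Rightarrow> ('k, 'c) gspace \<Rightarrow> ('a \<Rightarrow> 'b \<Rightarrow> 'c) \<Rightarrow> bool" where
  "bilin V W Z b \<longleftrightarrow> (\<forall>w\<in>carrier W. lin V Z (\<lambda>v. b v w)) \<and> (\<forall>v\<in>carrier V. lin W Z (b v))"

lemma bilinear_form_iff: "bilinear_form V W \<beta> \<longleftrightarrow> bilin V W \<I> \<beta>"
  by (simp add: bilinear_form_def bilin_def eta_contract_eq)

lemma bilin_simps:
  assumes "bilin V W Z b" "v \<in> carrier V" "w \<in> carrier W"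
  shows "b v w \<in> carrier Z"
    "v' \<in> carrier V \<Longrightarrow> b (v \<oplus>\<^bsub>V\<^esub> v') w = b v w \<oplus>\<^bsub>Z\<^esub> b v' w"
    "w' \<in> carrier W \<Longrightarrow> b v (w \<oplus>\<^bsub>W\<^esub> w') = b v w \<oplus>\<^bsub>Z\<^esub> b v w'"
    "b (c \<odot>\<^bsub>V\<^esub> v) w = c \<odot>\<^bsub>Z\<^esub> b v w" "b v (c \<odot>\<^bsub>W\<^esub> w) = c \<odot>\<^bsub>Z\<^esub> b v w"
proof -
  have 1: "lin V Z (\<lambda>v. b v w)" and 2: "lin W Z (b v)" using assms by (simp_all add: bilin_def)
  show "b v w \<in> carrier Z" by (rule lin_closed[OF 2 assms(3)])
  show "v' \<in> carrier V \<Longrightarrow> b (v \<oplus>\<^bsub>V\<^esub> v') w = b v w \<oplus>\<^bsub>Z\<^esub> b v' w"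
    "b (c \<odot>\<^bsub>V\<^esub> v) w = c \<odot>\<^bsub>Z\<^esub> b v w"
    using lin_add[OF 1 assms(2)] lin_smult[OF 1 assms(2)] by simp_all
  show "w' \<in> carrier W \<Longrightarrow> b v (w \<oplus>\<^bsub>W\<^esub> w') = b v w \<oplus>\<^bsub>Z\<^esub> b v w'"
    "b v (c \<odot>\<^bsub>W\<^esub> w) = c \<odot>\<^bsub>Z\<^esub> b v w"
    using lin_add[OF 2 assms(3)] lin_smult[OF 2 assms(3)] by simp_all
qed

lemma bilinear_form_simps:
  assumes "bilinear_form V W \<beta>" "v \<in> carrier V" "w \<in> carrier W"
  shows "v' \<in> carrier V \<Longrightarrow> \<beta> (v \<oplus>\<^bsub>V\<^esub> v') w = \<beta> v w + \<beta> v' w"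
    "w' \<in> carrier W \<Longrightarrow> \<beta> v (w \<oplus>\<^bsub>W\<^esub> w') = \<beta> v w + \<beta> v w'"
    "\<beta> (c \<odot>\<^bsub>V\<^esub> v) w = c * \<beta> v w" "\<beta> v (c \<odot>\<^bsub>W\<^esub> w) = c * \<beta> v w"
  using bilin_simps[OF assms(1)[unfolded bilinear_form_iff] assms(2,3)] by simp_all

section \<open>Graded spaces\<close>

locale zp_root = zp_graded p \<xi> for p :: nat and \<xi> :: "'k::field" +
  assumes prime_p: "prime p" and root: "\<xi> ^ p = 1"
    and primitive: "\<And>m. 0 < m \<Longrightarrow> m < p \<Longrightarrow> \<xi> ^ m \<noteq> 1"
begin

lemma p_gt_1: "1 < p" and p_pos [simp]: "0 < p"
  using prime_gt_1_nat[OF prime_p] by simp_all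

lemma root_nonzero [simp]: "\<xi> \<noteq> 0"
  using root p_pos by (metis power_0_left not_gr_zero zero_neq_one)

text \<open>Exponents of \<open>\<xi>\<close> are computed from degrees, which are only determined modulo \<open>p\<close>.\<close>

lemma powi_root_cong:
  assumes "a mod int p = b mod int p"
  shows "\<xi> powi a = \<xi> powi b"
proof -
  have "a = b + int p * (a div int p - b div int p)"
    using assms mult_div_mod_eq[of "int p" a] mult_div_mod_eq[of "int p" b]
    by (metis add.assoc add.commute add_diff_cancel_left' diff_add_cancel right_diff_distrib)
  then obtain k where "a = b + int p * k" by blast
  then show ?thesis by (simp add: power_int_add power_int_mult root)
qed

definition component :: "('k, 'a) gspace \<Rightarrow> nat \<Rightarrow> 'a \<Rightarrow> 'a" where
  "component V i v = (THE c. c \<in> (\<Pi>\<^sub>E i\<in>{..<p}. homog V i) \<and> finsum V c {..<p} = v) i"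

lemma graded_fd: "graded_space V \<Longrightarrow> fd_space V"
  by (simp add: graded_space_def)

lemma graded_vecsp: "graded_space V \<Longrightarrow> vecsp V"
  by (simp add: graded_fd fd_space_vecsp)

lemma graded_homog: "graded_space V \<Longrightarrow> i < p \<Longrightarrow> VectorSpace.subspace scalars (homog V i) V"
  by (simp add: graded_space_def)

lemma homog_carrier: "graded_space V \<Longrightarrow> i < p \<Longrightarrow> v \<in> homog V i \<Longrightarrow> v \<in> carrier V"
  using subspace_closed(1)[OF graded_homog, of V i] by blast

lemma homog_zero: "graded_space V \<Longrightarrow> i < p \<Longrightarrow> \<zero>\<^bsub>V\<^esub> \<in> homog V i"
  by (rule subspace_closed(2)[OF graded_homog])

lemma homog_add:
  "graded_space V \<Longrightarrow> i < p \<Longrightarrow> v \<in> homog V i \<Longrightarrow> w \<in> homog V i \<Longrightarrow> v \<oplus>\<^bsub>V\<^esub> w \<in> homog V i"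
  by (rule subspace_closed(3)[OF graded_homog])

lemma homog_smult: "graded_space V \<Longrightarrow> i < p \<Longrightarrow> v \<in> homog V i \<Longrightarrow> c \<odot>\<^bsub>V\<^esub> v \<in> homog V i"
  by (rule subspace_closed(4)[OF graded_homog])

context
  fixes V :: "('k, 'a) gspace"
  assumes V: "graded_space V"
begin

lemma the_component:
  assumes "v \<in> carrier V"
  shows "(THE c. c \<in> (\<Pi>\<^sub>E i\<in>{..<p}. homog V i) \<and> finsum V c {..<p} = v) \<in> (\<Pi>\<^sub>E i\<in>{..<p}. homog V i) \<and>
    finsum V (THE c. c \<in> (\<Pi>\<^sub>E i\<in>{..<p}. homog V i) \<and> finsum V c {..<p} = v) {..<p} = v"
proof -
  have "\<exists>!c. c \<in> (\<Pi>\<^sub>E i\<in>{..<p}. homog V i) \<and> finsum V c {..<p} = v"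
    using V assms by (simp add: graded_space_def)
  then show ?thesis by (rule theI')
qed

lemma component_homog: "v \<in> carrier V \<Longrightarrow> i < p \<Longrightarrow> component V i v \<in> homog V i"
  using the_component[of v] by (auto simp: component_def)

lemma component_sum: "v \<in> carrier V \<Longrightarrow> finsum V (\<lambda>i. component V i v) {..<p} = v"
  using the_component[of v] by (simp add: component_def)

lemma component_unique:
  assumes "\<And>i. i < p \<Longrightarrow> c i \<in> homog V i" "i < p"
  shows "component V i (finsum V c {..<p}) = c i"
proof -
  have car: "c i \<in> carrier V" if "i < p" for i using homog_carrier[OF V that assms(1)[OF that]] .
  have "(THE d. d \<in> (\<Pi>\<^sub>E i\<in>{..<p}. homog V i) \<and> finsum V d {..<p} = finsum V c {..<p}) = restrict c {..<p}"
  proof (rule the1_equality)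
    show "\<exists>!d. d \<in> (\<Pi>\<^sub>E i\<in>{..<p}. homog V i) \<and> finsum V d {..<p} = finsum V c {..<p}"
      using V vecsp_finsum_closed[OF graded_vecsp[OF V], of "{..<p}" c] car
      by (simp add: graded_space_def)
    show "restrict c {..<p} \<in> (\<Pi>\<^sub>E i\<in>{..<p}. homog V i) \<and>
        finsum V (restrict c {..<p}) {..<p} = finsum V c {..<p}"
      using assms(1) car by (auto intro!: vecsp_finsum_cong graded_vecsp[OF V])
  qed
  then show ?thesis using assms(2) by (simp add: component_def)
qed

lemma component_homog_eq:
  assumes "v \<in> homog V j" "j < p" "i < p"
  shows "component V i v = (if i = j then v else \<zero>\<^bsub>V\<^esub>)"
proof -
  have "finsum V (\<lambda>i. if i = j then v else \<zero>\<^bsub>V\<^esub>) {..<p} = v"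
    using assms homog_carrier[OF V] by (simp add: finsum_single graded_vecsp[OF V])
  then show ?thesis
    using component_unique[of "\<lambda>i. if i = j then v else \<zero>\<^bsub>V\<^esub>" i] assms homog_zero[OF V] by simp
qed

lemma component_carrier: "v \<in> carrier V \<Longrightarrow> i < p \<Longrightarrow> component V i v \<in> carrier V"
  using component_homog homog_carrier[OF V] by blast

lemma component_lin:
  assumes "i < p"
  shows "lin V V (component V i)"
proof (rule linI)
  note vs = graded_vecsp[OF V]
  show "vecsp V" "vecsp V" by (rule vs)+
  show "component V i v \<in> carrier V" if "v \<in> carrier V" for v using that assms by (rule component_carrier)
  fix v assume v: "v \<in> carrier V"
  interpret abelian_monoid V using vs by (rule vecsp_monoid)
  show "component V i (v \<oplus>\<^bsub>V\<^esub> w) = component V i v \<oplus>\<^bsub>V\<^esub> component V i w" if w: "w \<in> carrier V" for w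
  proof -
    have "v \<oplus>\<^bsub>V\<^esub> w = finsum V (\<lambda>i. component V i v \<oplus>\<^bsub>V\<^esub> component V i w) {..<p}"
      using v w component_sum component_carrier by (subst finsum_addf) auto
    then show ?thesis
      using component_unique[of "\<lambda>i. component V i v \<oplus>\<^bsub>V\<^esub> component V i w"] v w assms
      by (simp add: component_homog homog_add[OF V])
  qed
  show "component V i (c \<odot>\<^bsub>V\<^esub> v) = c \<odot>\<^bsub>V\<^esub> component V i v" for c
  proof -
    have "c \<odot>\<^bsub>V\<^esub> v = finsum V (\<lambda>i. c \<odot>\<^bsub>V\<^esub> component V i v) {..<p}"
      using lin_finsum[OF lin_smult_map[OF lin_id[OF vs], of c], of "{..<p}" "\<lambda>i. component V i v"]
        v component_sum component_carrier by auto
    then show ?thesis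
      using component_unique[of "\<lambda>i. c \<odot>\<^bsub>V\<^esub> component V i v"] v assms
      by (simp add: component_homog homog_smult[OF V])
  qed
qed

lemma generates_homog: "generates V (\<Union>i<p. homog V i)"
  unfolding generates_def
proof (intro conjI allI impI)
  show "vecsp V" by (rule graded_vecsp[OF V])
  show "(\<Union>i<p. homog V i) \<subseteq> carrier V" using homog_carrier[OF V] by blast
  fix U assume U: "VectorSpace.subspace scalars U V" "(\<Union>i<p. homog V i) \<subseteq> U"
  show "carrier V \<subseteq> U"
  proof
    fix v assume v: "v \<in> carrier V"
    have "finsum V (\<lambda>i. component V i v) {..<p} \<in> U"
      by (rule subspace_finsum[OF U(1)]) (use U(2) component_homog[OF v] in auto)
    then show "v \<in> U" using component_sum[OF v] by simp
  qed
qed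

end

text \<open>A grading is most easily exhibited by its projections.\<close>

lemma graded_spaceI:
  assumes fd: "fd_space V" and sub: "\<And>i. i < p \<Longrightarrow> VectorSpace.subspace scalars (homog V i) V"
    and pr: "\<And>i. i < p \<Longrightarrow> lin V V (pr i)"
      "\<And>i v. i < p \<Longrightarrow> v \<in> carrier V \<Longrightarrow> pr i v \<in> homog V i"
      "\<And>v. v \<in> carrier V \<Longrightarrow> finsum V (\<lambda>i. pr i v) {..<p} = v"
      "\<And>i j v. i < p \<Longrightarrow> j < p \<Longrightarrow> v \<in> homog V j \<Longrightarrow> pr i v = (if i = j then v else \<zero>\<^bsub>V\<^esub>)"
  shows "graded_space V"
  unfolding graded_space_def
proof (intro conjI allI impI ballI fd sub)
  have vs: "vecsp V" using fd by (rule fd_space_vecsp)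
  have car: "v \<in> carrier V" if "i < p" "v \<in> homog V i" for i v
    using subspace_closed(1)[OF sub] that by blast
  fix v assume v: "v \<in> carrier V"
  show "\<exists>!c. c \<in> (\<Pi>\<^sub>E i\<in>{..<p}. homog V i) \<and> finsum V c {..<p} = v"
  proof (rule ex1I[of _ "restrict (\<lambda>i. pr i v) {..<p}"])
    have "finsum V (restrict (\<lambda>i. pr i v) {..<p}) {..<p} = finsum V (\<lambda>i. pr i v) {..<p}"
      using v pr(2) car by (intro vecsp_finsum_cong[OF vs]) auto
    then show "restrict (\<lambda>i. pr i v) {..<p} \<in> (\<Pi>\<^sub>E i\<in>{..<p}. homog V i) \<and>
        finsum V (restrict (\<lambda>i. pr i v) {..<p}) {..<p} = v"
      using v pr(2,3) by auto
  next
    fix c assume c: "c \<in> (\<Pi>\<^sub>E i\<in>{..<p}. homog V i) \<and> finsum V c {..<p} = v"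
    then have ch: "c i \<in> homog V i" if "i < p" for i using that by (simp add: PiE_iff)
    have cext: "c \<in> extensional {..<p}" using c by (simp add: PiE_iff)
    show "c = restrict (\<lambda>i. pr i v) {..<p}"
    proof (rule extensionalityI[where A = "{..<p}"])
      fix i assume i: "i \<in> {..<p}"
      have "pr i v = finsum V (\<lambda>j. pr i (c j)) {..<p}"
        using lin_finsum[OF pr(1), of i "{..<p}" c] c ch car i by auto
      also have "\<dots> = finsum V (\<lambda>j. if j = i then c i else \<zero>\<^bsub>V\<^esub>) {..<p}"
        using ch car i pr(4) vs by (intro vecsp_finsum_cong[OF vs]) auto
      also have "\<dots> = c i" using i ch car by (subst finsum_single[OF vs]) auto
      finally show "c i = restrict (\<lambda>i. pr i v) {..<p} i" using i by simp
    qed (use cext in simp_all)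
  qed
qed

section \<open>Arrows\<close>

definition arrow :: "('k, 'a, 'b) garr \<Rightarrow> ('k, 'a) gspace \<Rightarrow> ('k, 'b) gspace \<Rightarrow> bool" where
  "arrow f V W \<longleftrightarrow> graded_space V \<and> graded_space W \<and> f \<in> mor V W"

definition mk_arr :: "('k, 'a) gspace \<Rightarrow> ('k, 'b) gspace \<Rightarrow> ('a \<Rightarrow> 'b) \<Rightarrow> ('k, 'a, 'b) garr" where
  "mk_arr V W f = \<lparr>Dom = V, Cod = W, Fun = restrict f (carrier V)\<rparr>"

lemma mk_arr_simps [simp]: "v \<in> carrier V \<Longrightarrow> Fun (mk_arr V W f) v = f v"
  by (simp add: mk_arr_def)

lemma arrow_graded: "arrow f V W \<Longrightarrow> graded_space V" "arrow f V W \<Longrightarrow> graded_space W"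
  by (simp_all add: arrow_def)

lemma arrow_dom: "arrow f V W \<Longrightarrow> Dom f = V" "arrow f V W \<Longrightarrow> Cod f = W"
  by (simp_all add: arrow_def mor_def lin_hom_def)

lemma arrow_lin: "arrow f V W \<Longrightarrow> lin V W (Fun f)"
  by (simp add: arrow_def mor_def lin_hom_def)

lemma arrow_closed: "arrow f V W \<Longrightarrow> v \<in> carrier V \<Longrightarrow> Fun f v \<in> carrier W"
  using lin_closed[OF arrow_lin, of f V W v] by simp

lemma arrow_homog: "arrow f V W \<Longrightarrow> i < p \<Longrightarrow> v \<in> homog V i \<Longrightarrow> Fun f v \<in> homog W i"
  by (auto simp: arrow_def mor_def)

lemma arrow_mor: "arrow f V W \<Longrightarrow> f \<in> mor V W"
  by (simp add: arrow_def)

lemma arrow_mk: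
  assumes "graded_space V" "graded_space W" "lin V W f"
    and "\<And>i v. i < p \<Longrightarrow> v \<in> homog V i \<Longrightarrow> f v \<in> homog W i"
  shows "arrow (mk_arr V W f) V W"
  using assms homog_carrier[OF assms(1)]
  by (auto simp: arrow_def mor_def lin_hom_def mk_arr_def lin_restrict)

lemma arrow_eqI:
  assumes "arrow f V W" "arrow g V W" "generates V S" "\<And>v. v \<in> S \<Longrightarrow> Fun f v = Fun g v"
  shows "f = g"
proof (rule arr_ext)
  show "f \<in> lin_hom V W" "g \<in> lin_hom V W" using assms(1,2) by (auto simp: arrow_def mor_def)
  show "Fun f v = Fun g v" if "v \<in> carrier V" for v
    by (rule generates_lin_eq[OF assms(3) arrow_lin[OF assms(1)] arrow_lin[OF assms(2)] assms(4) that])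
qed

lemma Fun_comp: "u \<in> carrier (Dom f) \<Longrightarrow> Fun (g \<circ>\<^sub>a f) u = Fun g (Fun f u)"
  by (simp add: comp_arr_def compose_def)

lemma arrow_comp:
  assumes "arrow f U V" "arrow g V W"
  shows "arrow (g \<circ>\<^sub>a f) U W"
proof -
  have "g \<circ>\<^sub>a f = mk_arr U W (\<lambda>u. Fun g (Fun f u))"
    using arrow_dom[OF assms(1)] arrow_dom[OF assms(2)] by (simp add: comp_arr_def compose_def mk_arr_def)
  then show ?thesis
    using assms arrow_graded[OF assms(1)] arrow_graded[OF assms(2)]
    by (auto intro!: arrow_mk lin_comp[OF arrow_lin arrow_lin] arrow_homog)
qed

lemma Fun_comp_arrow: "arrow f U V \<Longrightarrow> u \<in> carrier U \<Longrightarrow> Fun (g \<circ>\<^sub>a f) u = Fun g (Fun f u)"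
  by (simp add: Fun_comp arrow_dom(1))

lemma arrow_id: "graded_space V \<Longrightarrow> arrow (id_arr V) V V"
  using arrow_mk[of V V "\<lambda>v. v"] by (simp add: id_arr_def mk_arr_def lin_id graded_vecsp)

lemma Fun_id [simp]: "v \<in> carrier V \<Longrightarrow> Fun (id_arr V) v = v"
  by (simp add: id_arr_def)

text \<open>A structure arrow is a definite description; it is found by constructing an arrow with the
  required property and comparing any other such arrow with it on generators.\<close>

lemma the_arrow:
  assumes "arrow h V W" "P h" "\<And>h'. arrow h' V W \<Longrightarrow> P h' \<Longrightarrow> h' = h"
  shows "(THE h. h \<in> mor V W \<and> P h) = h"
  using assms by (intro the_equality) (auto simp: arrow_def)

lemma arrow_comp_id:
  assumes "arrow f V W"
  shows "f \<circ>\<^sub>a id_arr V = f" "id_arr W \<circ>\<^sub>a f = f"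
proof -
  note g = arrow_graded[OF assms]
  show "f \<circ>\<^sub>a id_arr V = f"
    by (rule arrow_eqI[OF arrow_comp[OF arrow_id assms] assms generates_homog])
      (use g in \<open>auto simp: Fun_comp id_arr_def homog_carrier\<close>)
  show "id_arr W \<circ>\<^sub>a f = f"
    by (rule arrow_eqI[OF arrow_comp[OF assms arrow_id] assms generates_homog])
      (use g assms in \<open>auto simp: Fun_comp_arrow homog_carrier arrow_closed\<close>)
qed

lemma arrow_comp_assoc:
  assumes "arrow f U V" "arrow g V W" "arrow h W Z"
  shows "h \<circ>\<^sub>a (g \<circ>\<^sub>a f) = (h \<circ>\<^sub>a g) \<circ>\<^sub>a f"
  using arrow_dom[OF assms(1)] arrow_dom[OF assms(2)] arrow_closed[OF assms(1)]
  by (auto simp: comp_arr_def compose_def fun_eq_iff restrict_def)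

lemma inv_arr_eq:
  assumes "arrow f V W" "arrow g W V" "g \<circ>\<^sub>a f = id_arr V" "f \<circ>\<^sub>a g = id_arr W"
  shows "inv_arr f = g"
proof -
  have "(THE g. g \<in> mor W V \<and> (g \<circ>\<^sub>a f = id_arr V \<and> f \<circ>\<^sub>a g = id_arr W)) = g"
  proof (rule the_arrow[OF assms(2)])
    fix h assume h: "arrow h W V" "h \<circ>\<^sub>a f = id_arr V \<and> f \<circ>\<^sub>a h = id_arr W"
    have "h = h \<circ>\<^sub>a (f \<circ>\<^sub>a g)" using assms(4) arrow_comp_id[OF h(1)] by simp
    also have "\<dots> = (h \<circ>\<^sub>a f) \<circ>\<^sub>a g" by (rule arrow_comp_assoc[OF assms(2,1) h(1)])
    also have "\<dots> = g" using h(2) arrow_comp_id[OF assms(2)] by simp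
    finally show "h = g" .
  qed (use assms in simp)
  then show ?thesis using arrow_dom[OF assms(1)] by (simp add: inv_arr_def)
qed

text \<open>The antitwist and its inverse both act by a scalar on each degree.\<close>

definition scaling :: "(nat \<Rightarrow> 'k) \<Rightarrow> ('k, 'a) gspace \<Rightarrow> ('k, 'a, 'a) garr" where
  "scaling c V = mk_arr V V (\<lambda>v. finsum V (\<lambda>i. c i \<odot>\<^bsub>V\<^esub> component V i v) {..<p})"

lemma Fun_scaling:
  assumes "graded_space V" "i < p" "v \<in> homog V i"
  shows "Fun (scaling c V) v = c i \<odot>\<^bsub>V\<^esub> v"
proof -
  note vs = graded_vecsp[OF assms(1)] and v = homog_carrier[OF assms]
  have "Fun (scaling c V) v = finsum V (\<lambda>j. if j = i then c i \<odot>\<^bsub>V\<^esub> v else \<zero>\<^bsub>V\<^esub>) {..<p}"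
    using assms v vs by (auto simp: scaling_def component_homog_eq intro!: vecsp_finsum_cong)
  also have "\<dots> = c i \<odot>\<^bsub>V\<^esub> v" using assms v vs by (simp add: finsum_single)
  finally show ?thesis .
qed

lemma arrow_scaling:
  assumes "graded_space V"
  shows "arrow (scaling c V) V V"
  unfolding scaling_def
proof (rule arrow_mk[OF assms assms])
  note vs = graded_vecsp[OF assms]
  show "lin V V (\<lambda>v. finsum V (\<lambda>i. c i \<odot>\<^bsub>V\<^esub> component V i v) {..<p})"
    using vs assms by (intro lin_finsum_map lin_smult_map component_lin) auto
  fix i v assume "i < p" "v \<in> homog V i"
  then show "finsum V (\<lambda>i. c i \<odot>\<^bsub>V\<^esub> component V i v) {..<p} \<in> homog V i"
    using Fun_scaling[OF assms, of i v c] homog_carrier[OF assms] homog_smult[OF assms]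
    by (simp add: scaling_def)
qed

lemma scaling_inverse:
  assumes "graded_space V" "\<And>i. i < p \<Longrightarrow> d i * c i = 1"
  shows "scaling d V \<circ>\<^sub>a scaling c V = id_arr V"
proof (rule arrow_eqI[OF arrow_comp[OF arrow_scaling arrow_scaling] arrow_id generates_homog])
  fix v assume "v \<in> (\<Union>i<p. homog V i)"
  then obtain i where i: "i < p" "v \<in> homog V i" by blast
  then show "Fun (scaling d V \<circ>\<^sub>a scaling c V) v = Fun (id_arr V) v"
    using assms homog_carrier[OF assms(1) i] graded_vecsp[OF assms(1)]
    by (simp add: Fun_comp_arrow[OF arrow_scaling] Fun_scaling[of V i] homog_smult flip: vecsp_smult(1))
qed (use assms in auto)

lemma antitwist_eq:
  assumes "graded_space V"
  shows "antitwist V = scaling (\<lambda>i. \<xi> powi (- (int i ^ 2))) V"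
  unfolding antitwist_def
proof (rule the_arrow[OF arrow_scaling[OF assms]])
  fix h assume h: "arrow h V V" "\<forall>i<p. \<forall>v\<in>homog V i. Fun h v = (\<xi> powi (- (int i ^ 2))) \<odot>\<^bsub>V\<^esub> v"
  show "h = scaling (\<lambda>i. \<xi> powi (- (int i ^ 2))) V"
    by (rule arrow_eqI[OF h(1) arrow_scaling generates_homog])
      (use assms h in \<open>auto simp: Fun_scaling\<close>)
qed (use assms in \<open>auto simp: Fun_scaling\<close>)

section \<open>Tensor products\<close>

lemma tensor_simps [simp]:
  "carrier (V \<boxtimes> W) = tensor_span V W (carrier V \<times> carrier W)"
  "\<zero>\<^bsub>V \<boxtimes> W\<^esub> = (\<lambda>\<beta>. 0)" "s \<oplus>\<^bsub>V \<boxtimes> W\<^esub> t = (\<lambda>\<beta>. s \<beta> + t \<beta>)" "c \<odot>\<^bsub>V \<boxtimes> W\<^esub> t = (\<lambda>\<beta>. c * t \<beta>)"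
  "homog (V \<boxtimes> W) l = tensor_span V W (\<Union>i<p. \<Union>j\<in>{j. j < p \<and> (i + j) mod p = l}. homog V i \<times> homog W j)"
  by (simp_all add: tensor_space_def)

lemma tensor_span_zero: "(\<lambda>\<beta>. 0) \<in> tensor_span V W P"
  unfolding tensor_span_def by (auto intro!: exI[of _ "0::nat"])

lemma tensor_span_induct [consumes 1, case_names zero add]:
  assumes "t \<in> tensor_span V W P" "Q (\<lambda>\<beta>. 0)"
    and "\<And>v w t. (v, w) \<in> P \<Longrightarrow> t \<in> tensor_span V W P \<Longrightarrow> Q t \<Longrightarrow> Q (\<lambda>\<beta>. pure V W v w \<beta> + t \<beta>)"
  shows "Q t"
proof -
  have "Q (\<lambda>\<beta>. \<Sum>i<n. pure V W (v i) (w i) \<beta>)" if "\<forall>i<n. (v i, w i) \<in> P" for n :: nat and v w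
    using that
  proof (induction n)
    case (Suc n)
    have "(\<lambda>\<beta>. \<Sum>i<n. pure V W (v i) (w i) \<beta>) \<in> tensor_span V W P"
      unfolding tensor_span_def mem_Collect_eq
      using Suc.prems by (intro exI[of _ n] exI[of _ v] exI[of _ w]) auto
    then have "Q (\<lambda>\<beta>. pure V W (v n) (w n) \<beta> + (\<Sum>i<n. pure V W (v i) (w i) \<beta>))"
      using Suc by (intro assms(3)) auto
    then show ?case by (simp add: add.commute)
  qed (simp add: assms(2))
  then show ?thesis using assms(1) by (auto simp: tensor_span_def)
qed

lemma tensor_span_pure_add:
  assumes "(v, w) \<in> P" "t \<in> tensor_span V W P"
  shows "(\<lambda>\<beta>. pure V W v w \<beta> + t \<beta>) \<in> tensor_span V W P"
proof -
  obtain n :: nat and a b where ab: "\<forall>i<n. (a i, b i) \<in> P" "t = (\<lambda>\<beta>. \<Sum>i<n. pure V W (a i) (b i) \<beta>)"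
    using assms(2) by (auto simp: tensor_span_def)
  have "\<forall>i<Suc n. ((a(n := v)) i, (b(n := w)) i) \<in> P" using ab(1) assms(1) by auto
  moreover have "(\<lambda>\<beta>. pure V W v w \<beta> + t \<beta>) = (\<lambda>\<beta>. \<Sum>i<Suc n. pure V W ((a(n := v)) i) ((b(n := w)) i) \<beta>)"
    by (auto simp: ab(2) fun_eq_iff add.commute intro!: sum.cong)
  ultimately show ?thesis unfolding tensor_span_def by blast
qed

lemma tensor_span_pure: "(v, w) \<in> P \<Longrightarrow> pure V W v w \<in> tensor_span V W P"
  using tensor_span_pure_add[OF _ tensor_span_zero] by fastforce

lemma tensor_span_add:
  assumes "s \<in> tensor_span V W P" "t \<in> tensor_span V W P"
  shows "(\<lambda>\<beta>. s \<beta> + t \<beta>) \<in> tensor_span V W P"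
  using assms(1)
  by (induction rule: tensor_span_induct) (auto simp: assms(2) add.assoc intro: tensor_span_pure_add)

lemma tensor_span_mono: "P \<subseteq> Q \<Longrightarrow> tensor_span V W P \<subseteq> tensor_span V W Q"
  unfolding tensor_span_def by blast

lemma pure_add:
  assumes "v \<in> carrier V" "w \<in> carrier W"
  shows "v' \<in> carrier V \<Longrightarrow> pure V W (v \<oplus>\<^bsub>V\<^esub> v') w = (\<lambda>\<beta>. pure V W v w \<beta> + pure V W v' w \<beta>)"
    "w' \<in> carrier W \<Longrightarrow> pure V W v (w \<oplus>\<^bsub>W\<^esub> w') = (\<lambda>\<beta>. pure V W v w \<beta> + pure V W v w' \<beta>)"
    "pure V W (c \<odot>\<^bsub>V\<^esub> v) w = (\<lambda>\<beta>. c * pure V W v w \<beta>)"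
    "pure V W v (c \<odot>\<^bsub>W\<^esub> w) = (\<lambda>\<beta>. c * pure V W v w \<beta>)"
  using assms
  by (auto simp: pure_def fun_eq_iff bilinear_form_simps)

lemma tensor_span_smult:
  assumes "t \<in> tensor_span V W P" "P \<subseteq> carrier V \<times> carrier W"
    and "\<And>v w. (v, w) \<in> P \<Longrightarrow> (c \<odot>\<^bsub>V\<^esub> v, w) \<in> P"
  shows "(\<lambda>\<beta>. c * t \<beta>) \<in> tensor_span V W P"
  using assms(1)
proof (induction rule: tensor_span_induct)
  case (add v w t)
  have "(\<lambda>\<beta>. c * (pure V W v w \<beta> + t \<beta>)) = (\<lambda>\<beta>. pure V W (c \<odot>\<^bsub>V\<^esub> v) w \<beta> + c * t \<beta>)"
    using pure_add(3)[of v V w W c] add(1) assms(2) by (auto simp: distrib_left)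
  then show ?case using tensor_span_pure_add[OF assms(3)[OF add(1)] add(3)] by simp
qed (simp add: tensor_span_zero)

lemma pure_carrier: "v \<in> carrier V \<Longrightarrow> w \<in> carrier W \<Longrightarrow> pure V W v w \<in> carrier (V \<boxtimes> W)"
  by (simp add: tensor_span_pure)

lemma vecsp_tensor: "vecsp V \<Longrightarrow> vecsp (V \<boxtimes> W)"
  by (rule vecspI)
    (auto simp: tensor_span_zero tensor_span_add algebra_simps intro!: tensor_span_smult)

lemma bilin_pure: "vecsp V \<Longrightarrow> vecsp W \<Longrightarrow> bilin V W (V \<boxtimes> W) (pure V W)"
  unfolding bilin_def
  by (auto intro!: linI vecsp_tensor tensor_span_pure simp: pure_add)

lemma pure_lin:
  assumes "vecsp V" "vecsp W"
  shows "w \<in> carrier W \<Longrightarrow> lin V (V \<boxtimes> W) (\<lambda>v. pure V W v w)"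
    "v \<in> carrier V \<Longrightarrow> lin W (V \<boxtimes> W) (pure V W v)"
  using bilin_pure[OF assms] by (simp_all add: bilin_def)

lemma generates_tensor:
  assumes "generates V S" "generates W T"
  shows "generates (V \<boxtimes> W) {pure V W v w | v w. v \<in> S \<and> w \<in> T}"
  unfolding generates_def
proof (intro conjI allI impI)
  have vs: "vecsp V" "vecsp W" and sub: "S \<subseteq> carrier V" "T \<subseteq> carrier W"
    using assms by (auto simp: generates_def)
  show "vecsp (V \<boxtimes> W)" by (rule vecsp_tensor[OF vs(1)])
  show "{pure V W v w | v w. v \<in> S \<and> w \<in> T} \<subseteq> carrier (V \<boxtimes> W)"
    using sub by (auto intro!: tensor_span_pure)
  fix U assume U: "VectorSpace.subspace scalars U (V \<boxtimes> W)" "{pure V W v w | v w. v \<in> S \<and> w \<in> T} \<subseteq> U"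
  have 1: "pure V W v w \<in> U" if "v \<in> carrier V" "w \<in> T" for v w
    by (rule generates_lin_image[OF assms(1) pure_lin(1)[OF vs] U(1) _ that(1)]) (use U(2) that sub in auto)
  have 2: "pure V W v w \<in> U" if "v \<in> carrier V" "w \<in> carrier W" for v w
    by (rule generates_lin_image[OF assms(2) pure_lin(2)[OF vs] U(1) _ that(2)]) (use 1 that in auto)
  show "carrier (V \<boxtimes> W) \<subseteq> U"
  proof
    fix t assume "t \<in> carrier (V \<boxtimes> W)"
    then have "t \<in> tensor_span V W (carrier V \<times> carrier W)" by simp
    then show "t \<in> U"
    proof (induction rule: tensor_span_induct)
      case zero
      show ?case using subspace_closed(2)[OF U(1)] by simp
    next
      case (add v w t)
      then show ?case using subspace_closed(3)[OF U(1) 2] by auto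
    qed
  qed
qed

lemma fd_space_tensor: "fd_space V \<Longrightarrow> fd_space W \<Longrightarrow> fd_space (V \<boxtimes> W)"
proof -
  assume "fd_space V" "fd_space W"
  then obtain S T where ST: "finite S" "generates V S" "finite T" "generates W T"
    unfolding fd_space_iff_generates by blast
  have "{pure V W v w | v w. v \<in> S \<and> w \<in> T} = (\<lambda>(v, w). pure V W v w) ` (S \<times> T)" by auto
  then have "finite {pure V W v w | v w. v \<in> S \<and> w \<in> T}" using ST by simp
  then show ?thesis using generates_tensor[OF ST(2,4)] unfolding fd_space_iff_generates by blast
qed

text \<open>The projection to degree \<open>l\<close> is dual to replacing a bilinear form by its degree \<open>l\<close> part.\<close>

definition tensor_proj ::
  "('k, 'a) gspace \<Rightarrow> ('k, 'b) gspace \<Rightarrow> nat \<Rightarrow> ('k, 'a, 'b) tensor \<Rightarrow> ('k, 'a, 'b) tensor" where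
  "tensor_proj V W l t = (\<lambda>\<beta>. if bilinear_form V W \<beta>
     then t (\<lambda>v w. \<Sum>i<p. \<Sum>j | j < p \<and> (i + j) mod p = l. \<beta> (component V i v) (component W j w)) else 0)"

lemma bilin_sum:
  assumes "finite I" "vecsp V" "vecsp W" "\<And>i. i \<in> I \<Longrightarrow> bilin V W \<I> (b i)"
  shows "bilin V W \<I> (\<lambda>v w. \<Sum>i\<in>I. b i v w)"
  unfolding bilin_def
  by (auto intro!: linI assms(2,3) simp: bilin_simps[OF assms(4)] sum.distrib sum_distrib_left)

lemma graded_tensor:
  assumes V: "graded_space V" and W: "graded_space W"
  shows "graded_space (V \<boxtimes> W)"
proof (rule graded_spaceI[where pr = "tensor_proj V W"])
  note vs = graded_vecsp[OF V] graded_vecsp[OF W]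
  note vT = vecsp_tensor[OF vs(1), of W]
  show "fd_space (V \<boxtimes> W)" using V W by (simp add: fd_space_tensor graded_fd)
  have form: "bilinear_form V W (\<lambda>v w. \<Sum>i<p. \<Sum>j | j < p \<and> (i + j) mod p = l. \<beta> (component V i v) (component W j w))"
    if "bilinear_form V W \<beta>" for \<beta> l
    unfolding bilinear_form_iff
  proof (intro bilin_sum vs)
    fix i j assume ij: "i \<in> {..<p}" "j \<in> {j. j < p \<and> (i + j) mod p = l}"
    show "bilin V W \<I> (\<lambda>v w. \<beta> (component V i v) (component W j w))"
      using that ij V W unfolding bilinear_form_def bilin_def
      by (auto intro: lin_comp[OF component_lin, of V i \<I>] lin_comp[OF component_lin, of W j \<I>] component_carrier)
  qed auto
  have sub: "(\<Union>i<p. \<Union>j\<in>{j. j < p \<and> (i + j) mod p = l}. homog V i \<times> homog W j) \<subseteq> carrier V \<times> carrier W" for l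
    using homog_carrier[OF V] homog_carrier[OF W] by blast
  show subsp: "VectorSpace.subspace scalars (homog (V \<boxtimes> W) l) (V \<boxtimes> W)" if "l < p" for l
  proof (rule submoduleI[OF vT])
    show "homog (V \<boxtimes> W) l \<subseteq> carrier (V \<boxtimes> W)" by (simp only: tensor_simps tensor_span_mono[OF sub])
  next
    fix c v assume v: "v \<in> homog (V \<boxtimes> W) l"
    then show "c \<odot>\<^bsub>V \<boxtimes> W\<^esub> v \<in> homog (V \<boxtimes> W) l"
      unfolding tensor_simps by (rule tensor_span_smult[OF _ sub]) (use homog_smult[OF V] in auto)
  qed (auto simp: tensor_span_zero tensor_span_add)
  have pure: "tensor_proj V W l (pure V W v w) = (if (i + j) mod p = l then pure V W v w else (\<lambda>\<beta>. 0))"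
    if v: "i < p" "v \<in> homog V i" and w: "j < p" "w \<in> homog W j" for i j v w l
  proof
    fix \<beta>
    show "tensor_proj V W l (pure V W v w) \<beta> = (if (i + j) mod p = l then pure V W v w else (\<lambda>\<beta>. 0)) \<beta>"
    proof (cases "bilinear_form V W \<beta>")
      case True
      have z: "\<beta> \<zero>\<^bsub>V\<^esub> w = 0" "\<beta> v \<zero>\<^bsub>W\<^esub> = 0" "\<beta> \<zero>\<^bsub>V\<^esub> \<zero>\<^bsub>W\<^esub> = 0"
        using True vs homog_carrier[OF V v] homog_carrier[OF W w] unfolding bilinear_form_def
        by (metis lin_zero unit_space_simps(2) vecsp_closed(1))+
      have "(\<Sum>i'<p. \<Sum>j' | j' < p \<and> (i' + j') mod p = l. \<beta> (component V i' v) (component W j' w))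
          = (\<Sum>i'<p. \<Sum>j' | j' < p \<and> (i' + j') mod p = l. if i' = i \<and> j' = j then \<beta> v w else 0)"
        using v w z by (intro sum.cong refl) (auto simp: component_homog_eq[OF V] component_homog_eq[OF W])
      also have "\<dots> = (\<Sum>i'<p. if i' = i then if (i + j) mod p = l then \<beta> v w else 0 else 0)"
        using w by (intro sum.cong refl) (auto simp: sum.delta)
      also have "\<dots> = (if (i + j) mod p = l then \<beta> v w else 0)"
        using v by (simp add: sum.delta)
      finally show ?thesis using True form[OF True] by (simp add: tensor_proj_def pure_def)
    qed (simp add: tensor_proj_def pure_def)
  qed
  have gen: "generates (V \<boxtimes> W) {pure V W v w | v w. v \<in> (\<Union>i<p. homog V i) \<and> w \<in> (\<Union>i<p. homog W i)}"
    by (rule generates_tensor[OF generates_homog[OF V] generates_homog[OF W]])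
  have proj_add: "tensor_proj V W l (\<lambda>\<beta>. s \<beta> + t \<beta>) = (\<lambda>\<beta>. tensor_proj V W l s \<beta> + tensor_proj V W l t \<beta>)"
    "tensor_proj V W l (\<lambda>\<beta>. c * t \<beta>) = (\<lambda>\<beta>. c * tensor_proj V W l t \<beta>)"
    "tensor_proj V W l (\<lambda>\<beta>. 0) = (\<lambda>\<beta>. 0)" for s t c l
    by (auto simp: tensor_proj_def fun_eq_iff)
  have mem: "tensor_proj V W l t \<in> homog (V \<boxtimes> W) l" if l: "l < p" and t: "t \<in> carrier (V \<boxtimes> W)" for l t
  proof -
    have "VectorSpace.subspace scalars {t \<in> carrier (V \<boxtimes> W). tensor_proj V W l t \<in> homog (V \<boxtimes> W) l} (V \<boxtimes> W)"
    proof (rule submoduleI[OF vT])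
      show "\<zero>\<^bsub>V \<boxtimes> W\<^esub> \<in> {t \<in> carrier (V \<boxtimes> W). tensor_proj V W l t \<in> homog (V \<boxtimes> W) l}"
        by (simp add: proj_add tensor_span_zero)
    next
      fix s t assume "s \<in> {t \<in> carrier (V \<boxtimes> W). tensor_proj V W l t \<in> homog (V \<boxtimes> W) l}"
        "t \<in> {t \<in> carrier (V \<boxtimes> W). tensor_proj V W l t \<in> homog (V \<boxtimes> W) l}"
      then show "s \<oplus>\<^bsub>V \<boxtimes> W\<^esub> t \<in> {t \<in> carrier (V \<boxtimes> W). tensor_proj V W l t \<in> homog (V \<boxtimes> W) l}"
        using tensor_span_add by (auto simp: proj_add)
    next
      fix c t assume t: "t \<in> {t \<in> carrier (V \<boxtimes> W). tensor_proj V W l t \<in> homog (V \<boxtimes> W) l}"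
      then have "c \<odot>\<^bsub>V \<boxtimes> W\<^esub> tensor_proj V W l t \<in> homog (V \<boxtimes> W) l" "c \<odot>\<^bsub>V \<boxtimes> W\<^esub> t \<in> carrier (V \<boxtimes> W)"
        using subspace_closed(4)[OF subsp[OF l]] vecsp_closed(3)[OF vT] by blast+
      then show "c \<odot>\<^bsub>V \<boxtimes> W\<^esub> t \<in> {t \<in> carrier (V \<boxtimes> W). tensor_proj V W l t \<in> homog (V \<boxtimes> W) l}"
        by (simp add: proj_add)
    qed auto
    moreover have "{pure V W v w | v w. v \<in> (\<Union>i<p. homog V i) \<and> w \<in> (\<Union>i<p. homog W i)}
      \<subseteq> {t \<in> carrier (V \<boxtimes> W). tensor_proj V W l t \<in> homog (V \<boxtimes> W) l}"
    proof clarify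
      fix v w i j assume vw: "v \<in> homog V i" "i < p" "w \<in> homog W j" "j < p"
      have "pure V W v w \<in> carrier (V \<boxtimes> W)"
        using homog_carrier[OF V vw(2,1)] homog_carrier[OF W vw(4,3)] by (rule pure_carrier)
      moreover have "pure V W v w \<in> homog (V \<boxtimes> W) l" if "(i + j) mod p = l"
        using vw that by (auto intro!: tensor_span_pure)
      ultimately show "pure V W v w \<in> carrier (V \<boxtimes> W) \<and> tensor_proj V W l (pure V W v w) \<in> homog (V \<boxtimes> W) l"
        using pure[OF vw(2,1,4,3), of l] by (simp add: tensor_span_zero)
    qed
    ultimately show ?thesis using gen t unfolding generates_def by blast
  qed
  then show "tensor_proj V W l t \<in> homog (V \<boxtimes> W) l" if "l < p" "t \<in> carrier (V \<boxtimes> W)" for l t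
    using that by blast
  show lin: "lin (V \<boxtimes> W) (V \<boxtimes> W) (tensor_proj V W l)" if "l < p" for l
    using subspace_closed(1)[OF subsp[OF that]] mem[OF that]
    by (intro linI vT) (auto simp: proj_add)
  show "finsum (V \<boxtimes> W) (\<lambda>l. tensor_proj V W l t) {..<p} = t" if t: "t \<in> carrier (V \<boxtimes> W)" for t
  proof (rule generates_lin_eq[OF gen _ _ _ t])
    show "lin (V \<boxtimes> W) (V \<boxtimes> W) (\<lambda>t. finsum (V \<boxtimes> W) (\<lambda>l. tensor_proj V W l t) {..<p})"
      using lin vT by (intro lin_finsum_map) auto
    show "lin (V \<boxtimes> W) (V \<boxtimes> W) (\<lambda>t. t)" by (rule lin_id[OF vT])
    fix s assume "s \<in> {pure V W v w | v w. v \<in> (\<Union>i<p. homog V i) \<and> w \<in> (\<Union>i<p. homog W i)}"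
    then obtain v w i j where vw: "s = pure V W v w" "v \<in> homog V i" "i < p" "w \<in> homog W j" "j < p" by blast
    have s: "s \<in> carrier (V \<boxtimes> W)"
      using homog_carrier[OF V vw(3,2)] homog_carrier[OF W vw(5,4)] unfolding vw(1) by (rule pure_carrier)
    have "finsum (V \<boxtimes> W) (\<lambda>l. tensor_proj V W l s) {..<p}
        = finsum (V \<boxtimes> W) (\<lambda>l. if l = (i + j) mod p then s else \<zero>\<^bsub>V \<boxtimes> W\<^esub>) {..<p}"
      using vT s vecsp_closed(1)[OF vT] pure[OF vw(3,2,5,4)] vw(1) by (intro vecsp_finsum_cong[OF vT]) auto
    also have "\<dots> = s" using s by (subst finsum_single[OF vT]) auto
    finally show "finsum (V \<boxtimes> W) (\<lambda>l. tensor_proj V W l s) {..<p} = s" .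
  qed
  show "tensor_proj V W l t = (if l = m then t else \<zero>\<^bsub>V \<boxtimes> W\<^esub>)"
    if "l < p" "m < p" "t \<in> homog (V \<boxtimes> W) m" for l m t
    using that(3) unfolding tensor_simps
  proof (induction rule: tensor_span_induct)
    case (add v w t)
    then obtain i j where "v \<in> homog V i" "i < p" "w \<in> homog W j" "j < p" "(i + j) mod p = m" by blast
    then show ?case using add pure[of i v j w l] by (auto simp: proj_add)
  qed (auto simp: proj_add)
qed

text \<open>The universal property.  A functional on the space of bilinear forms that is a sum of
  evaluations determines a vector of \<open>Z\<close> because linear forms separate the points of \<open>Z\<close>.\<close>

definition lift :: "('k, 'c) gspace \<Rightarrow> ('a \<Rightarrow> 'b \<Rightarrow> 'c) \<Rightarrow> ('k, 'a, 'b) tensor \<Rightarrow> 'c" where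
  "lift Z b t = (THE z. z \<in> carrier Z \<and> (\<forall>\<phi>. lin Z \<I> \<phi> \<longrightarrow> \<phi> z = t (\<lambda>v w. \<phi> (b v w))))"

lemma bilin_form: "bilin V W Z b \<Longrightarrow> lin Z \<I> \<phi> \<Longrightarrow> bilinear_form V W (\<lambda>v w. \<phi> (b v w))"
  unfolding bilinear_form_def bilin_def using lin_comp[of V Z _ \<I> \<phi>] lin_comp[of W Z _ \<I> \<phi>] by blast

lemma lift_spec:
  assumes "fd_space Z" "bilin V W Z b" "t \<in> carrier (V \<boxtimes> W)"
  shows "lift Z b t \<in> carrier Z" "lin Z \<I> \<phi> \<Longrightarrow> \<phi> (lift Z b t) = t (\<lambda>v w. \<phi> (b v w))"
proof -
  have vZ: "vecsp Z" using assms(1) by (rule fd_space_vecsp)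
  have cl: "b v w \<in> carrier Z" if "v \<in> carrier V" "w \<in> carrier W" for v w
    using assms(2) that lin_closed[of W Z "b v"] by (simp add: bilin_def)
  have "t \<in> tensor_span V W (carrier V \<times> carrier W)" using assms(3) by simp
  then have "\<exists>z. z \<in> carrier Z \<and> (\<forall>\<phi>. lin Z \<I> \<phi> \<longrightarrow> \<phi> z = t (\<lambda>v w. \<phi> (b v w)))"
  proof (induction rule: tensor_span_induct)
    case zero
    show ?case using vZ by (intro exI[of _ "\<zero>\<^bsub>Z\<^esub>"]) (auto simp: lin_zero[where W = \<I>])
  next
    case (add v w t)
    then obtain z where "z \<in> carrier Z" "\<forall>\<phi>. lin Z \<I> \<phi> \<longrightarrow> \<phi> z = t (\<lambda>v w. \<phi> (b v w))" by blast
    then show ?case using add(1) vZ cl bilin_form[OF assms(2)]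
      by (intro exI[of _ "b v w \<oplus>\<^bsub>Z\<^esub> z"]) (auto simp: lin_add[where W = \<I>] pure_def)
  qed
  then obtain z where z: "z \<in> carrier Z \<and> (\<forall>\<phi>. lin Z \<I> \<phi> \<longrightarrow> \<phi> z = t (\<lambda>v w. \<phi> (b v w)))" by blast
  then have "lift Z b t = z"
    unfolding lift_def by (rule the_equality) (use z functional_eqI[OF assms(1)] in auto)
  then show "lift Z b t \<in> carrier Z" "lin Z \<I> \<phi> \<Longrightarrow> \<phi> (lift Z b t) = t (\<lambda>v w. \<phi> (b v w))"
    using z by auto
qed

lemma lift_lin:
  assumes "fd_space Z" "vecsp V" "bilin V W Z b"
  shows "lin (V \<boxtimes> W) Z (lift Z b)"
proof (rule linI)
  show vT: "vecsp (V \<boxtimes> W)" by (rule vecsp_tensor[OF assms(2)])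
  show vZ: "vecsp Z" using assms(1) by (rule fd_space_vecsp)
  note l = lift_spec[OF assms(1,3)]
  show "lift Z b t \<in> carrier Z" if "t \<in> carrier (V \<boxtimes> W)" for t using l(1)[OF that] .
  fix s assume s: "s \<in> carrier (V \<boxtimes> W)"
  show "lift Z b (s \<oplus>\<^bsub>V \<boxtimes> W\<^esub> t) = lift Z b s \<oplus>\<^bsub>Z\<^esub> lift Z b t" if t: "t \<in> carrier (V \<boxtimes> W)" for t
  proof (rule functional_eqI[OF assms(1)])
    have st: "s \<oplus>\<^bsub>V \<boxtimes> W\<^esub> t \<in> carrier (V \<boxtimes> W)" using vT s t by (rule vecsp_closed(2))
    show "lift Z b (s \<oplus>\<^bsub>V \<boxtimes> W\<^esub> t) \<in> carrier Z" "lift Z b s \<oplus>\<^bsub>Z\<^esub> lift Z b t \<in> carrier Z"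
      using l(1)[OF st] l(1)[OF s] l(1)[OF t] vZ by auto
    show "\<phi> (lift Z b (s \<oplus>\<^bsub>V \<boxtimes> W\<^esub> t)) = \<phi> (lift Z b s \<oplus>\<^bsub>Z\<^esub> lift Z b t)" if "lin Z \<I> \<phi>" for \<phi>
      using l(2)[OF st that] l(2)[OF s that] l(2)[OF t that] lin_add[OF that l(1)[OF s] l(1)[OF t]] by simp
  qed
  show "lift Z b (c \<odot>\<^bsub>V \<boxtimes> W\<^esub> s) = c \<odot>\<^bsub>Z\<^esub> lift Z b s" for c
  proof (rule functional_eqI[OF assms(1)])
    have st: "c \<odot>\<^bsub>V \<boxtimes> W\<^esub> s \<in> carrier (V \<boxtimes> W)" using vT s by (rule vecsp_closed(3))
    show "lift Z b (c \<odot>\<^bsub>V \<boxtimes> W\<^esub> s) \<in> carrier Z" "c \<odot>\<^bsub>Z\<^esub> lift Z b s \<in> carrier Z"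
      using l(1)[OF st] l(1)[OF s] vZ by auto
    show "\<phi> (lift Z b (c \<odot>\<^bsub>V \<boxtimes> W\<^esub> s)) = \<phi> (c \<odot>\<^bsub>Z\<^esub> lift Z b s)" if "lin Z \<I> \<phi>" for \<phi>
      using l(2)[OF st that] l(2)[OF s that] lin_smult[OF that l(1)[OF s]] by simp
  qed
qed

lemma lift_pure:
  assumes "fd_space Z" "bilin V W Z b" "v \<in> carrier V" "w \<in> carrier W"
  shows "lift Z b (pure V W v w) = b v w"
proof (rule functional_eqI[OF assms(1)])
  note l = lift_spec[OF assms(1,2) pure_carrier[OF assms(3,4)]]
  show "lift Z b (pure V W v w) \<in> carrier Z" by (rule l(1))
  show "b v w \<in> carrier Z" using assms(2-4) lin_closed[of W Z "b v"] by (simp add: bilin_def)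
  show "\<phi> (lift Z b (pure V W v w)) = \<phi> (b v w)" if "lin Z \<I> \<phi>" for \<phi>
    using l(2)[OF that] bilin_form[OF assms(2) that] by (simp add: pure_def)
qed

lemma generates_pure:
  "vecsp V \<Longrightarrow> vecsp W \<Longrightarrow> generates (V \<boxtimes> W) {pure V W v w | v w. v \<in> carrier V \<and> w \<in> carrier W}"
  by (rule generates_tensor) (simp_all add: generates_def)

text \<open>Trilinear maps extend in stages: the extension of a bilinear map depends linearly on a
  parameter on which the map depends linearly.\<close>

lemma lift_param:
  fixes V :: "('k, 'a) gspace" and W :: "('k, 'b) gspace" and Z :: "('k, 'c) gspace"
    and Y :: "('k, 'd, 'm) module_scheme"
  assumes Z: "fd_space Z" and V: "vecsp V" and W: "vecsp W"
    and b: "\<And>x. x \<in> carrier Y \<Longrightarrow> bilin V W Z (b x)"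
    and Y: "vecsp Y" "\<And>v w. v \<in> carrier V \<Longrightarrow> w \<in> carrier W \<Longrightarrow> lin Y Z (\<lambda>x. b x v w)"
  shows "t \<in> carrier (V \<boxtimes> W) \<Longrightarrow> lin Y Z (\<lambda>x. lift Z (b x) t)"
proof (rule linI)
  note vZ = fd_space_vecsp[OF Z]
  note gen = generates_pure[OF V W]
  show "vecsp Y" "vecsp Z" by fact+
  assume t: "t \<in> carrier (V \<boxtimes> W)"
  show "lift Z (b x) t \<in> carrier Z" if "x \<in> carrier Y" for x using lift_spec(1)[OF Z b[OF that] t] .
  show "lift Z (b (x \<oplus>\<^bsub>Y\<^esub> y)) t = lift Z (b x) t \<oplus>\<^bsub>Z\<^esub> lift Z (b y) t"
    if x: "x \<in> carrier Y" and y: "y \<in> carrier Y" for x y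
  proof (rule generates_lin_eq[OF gen _ _ _ t])
    have xy: "x \<oplus>\<^bsub>Y\<^esub> y \<in> carrier Y" using Y x y by simp
    show "lin (V \<boxtimes> W) Z (lift Z (b (x \<oplus>\<^bsub>Y\<^esub> y)))" by (rule lift_lin[OF Z V b[OF xy]])
    show "lin (V \<boxtimes> W) Z (\<lambda>t. lift Z (b x) t \<oplus>\<^bsub>Z\<^esub> lift Z (b y) t)"
      by (rule lin_add_map[OF lift_lin[OF Z V b[OF x]] lift_lin[OF Z V b[OF y]]])
    fix s assume "s \<in> {pure V W v w | v w. v \<in> carrier V \<and> w \<in> carrier W}"
    then show "lift Z (b (x \<oplus>\<^bsub>Y\<^esub> y)) s = lift Z (b x) s \<oplus>\<^bsub>Z\<^esub> lift Z (b y) s"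
      using lin_add[OF Y(2) x y] by (auto simp: lift_pure[OF Z b] xy x y)
  qed
  show "lift Z (b (c \<odot>\<^bsub>Y\<^esub> x)) t = c \<odot>\<^bsub>Z\<^esub> lift Z (b x) t"
    if x: "x \<in> carrier Y" for c x
  proof (rule generates_lin_eq[OF gen _ _ _ t])
    have xy: "c \<odot>\<^bsub>Y\<^esub> x \<in> carrier Y" using Y x by simp
    show "lin (V \<boxtimes> W) Z (lift Z (b (c \<odot>\<^bsub>Y\<^esub> x)))" by (rule lift_lin[OF Z V b[OF xy]])
    show "lin (V \<boxtimes> W) Z (\<lambda>t. c \<odot>\<^bsub>Z\<^esub> lift Z (b x) t)"
      by (rule lin_smult_map[OF lift_lin[OF Z V b[OF x]]])
    fix s assume "s \<in> {pure V W v w | v w. v \<in> carrier V \<and> w \<in> carrier W}"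
    then show "lift Z (b (c \<odot>\<^bsub>Y\<^esub> x)) s = c \<odot>\<^bsub>Z\<^esub> lift Z (b x) s"
      using lin_smult[OF Y(2) x] by (auto simp: lift_pure[OF Z b] xy x)
  qed
qed

definition bilin_arr ::
  "('k, 'a) gspace \<Rightarrow> ('k, 'b) gspace \<Rightarrow> ('k, 'c) gspace \<Rightarrow> ('a \<Rightarrow> 'b \<Rightarrow> 'c) \<Rightarrow>
   ('k, ('k, 'a, 'b) tensor, 'c) garr" where
  "bilin_arr V W Z b = mk_arr (V \<boxtimes> W) Z (lift Z b)"

text \<open>With the homogeneous parts of \<open>Z\<close> for \<open>U\<close>, this shows that extensions of graded maps are graded.\<close>

lemma lift_subspace:
  assumes V: "graded_space V" and W: "graded_space W" and Z: "fd_space Z" and b: "bilin V W Z b"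
    and U: "VectorSpace.subspace scalars U Z" and t: "t \<in> homog (V \<boxtimes> W) l"
    and h: "\<And>i j v w. i < p \<Longrightarrow> j < p \<Longrightarrow> (i + j) mod p = l \<Longrightarrow> v \<in> homog V i \<Longrightarrow> w \<in> homog W j \<Longrightarrow> b v w \<in> U"
  shows "lift Z b t \<in> U"
proof -
  note lin = lift_lin[OF Z graded_vecsp[OF V] b]
  have sub: "(\<Union>i<p. \<Union>j\<in>{j. j < p \<and> (i + j) mod p = l}. homog V i \<times> homog W j) \<subseteq> carrier V \<times> carrier W"
    using homog_carrier[OF V] homog_carrier[OF W] by blast
  show ?thesis using t unfolding tensor_simps(5)
  proof (induction rule: tensor_span_induct)
    case zero
    then show ?case using lin_zero[OF lin] subspace_closed(2)[OF U] by simp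
  next
    case (add v w t)
    then obtain i j where ij: "v \<in> homog V i" "i < p" "w \<in> homog W j" "j < p" "(i + j) mod p = l" by blast
    have vw: "v \<in> carrier V" "w \<in> carrier W" using homog_carrier[OF V] homog_carrier[OF W] ij by auto
    have t: "t \<in> carrier (V \<boxtimes> W)" using add(2) tensor_span_mono[OF sub] by auto
    have "lift Z b (\<lambda>\<beta>. pure V W v w \<beta> + t \<beta>) = b v w \<oplus>\<^bsub>Z\<^esub> lift Z b t"
      using lin_add[OF lin pure_carrier[OF vw] t] lift_pure[OF Z b vw] by simp
    then show ?case using add(3) h[OF ij(2,4,5,1,3)] subspace_closed(3)[OF U] by simp
  qed
qed

lemma arrow_bilin:
  assumes V: "graded_space V" and W: "graded_space W" and Z: "graded_space Z" and b: "bilin V W Z b"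
    and h: "\<And>i j v w. i < p \<Longrightarrow> j < p \<Longrightarrow> v \<in> homog V i \<Longrightarrow> w \<in> homog W j \<Longrightarrow> b v w \<in> homog Z ((i + j) mod p)"
  shows "arrow (bilin_arr V W Z b) (V \<boxtimes> W) Z"
  unfolding bilin_arr_def
proof (rule arrow_mk[OF graded_tensor[OF V W] Z lift_lin[OF graded_fd[OF Z] graded_vecsp[OF V] b]])
  fix l t assume l: "l < p" and t: "t \<in> homog (V \<boxtimes> W) l"
  show "lift Z b t \<in> homog Z l"
    by (rule lift_subspace[OF V W graded_fd[OF Z] b graded_homog[OF Z l] t]) (use h in auto)
qed

lemma Fun_bilin:
  assumes "graded_space Z" "bilin V W Z b" "v \<in> carrier V" "w \<in> carrier W"
  shows "Fun (bilin_arr V W Z b) (pure V W v w) = b v w"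
  using lift_pure[OF graded_fd[OF assms(1)] assms(2-4)] pure_carrier[OF assms(3,4)]
  by (simp add: bilin_arr_def)

lemma arrow_tensor_eqI:
  assumes "arrow f (V \<boxtimes> W) Z" "arrow g (V \<boxtimes> W) Z" "generates V S" "generates W T"
    and "\<And>v w. v \<in> S \<Longrightarrow> w \<in> T \<Longrightarrow> Fun f (pure V W v w) = Fun g (pure V W v w)"
  shows "f = g"
  by (rule arrow_eqI[OF assms(1,2) generates_tensor[OF assms(3,4)]]) (use assms(5) in auto)

lemma generates_carrier: "graded_space V \<Longrightarrow> generates V (carrier V)"
  by (simp add: generates_def graded_vecsp)

lemma homog_pure:
  assumes "i < p" "j < p" "v \<in> homog V i" "w \<in> homog W j"
  shows "pure V W v w \<in> homog (V \<boxtimes> W) ((i + j) mod p)"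
  using assms by (auto intro!: tensor_span_pure)

end

context zp_root
begin

section \<open>The structure arrows on pure tensors\<close>

lemma arrow_tensor_unique:
  assumes "arrow h (V \<boxtimes> W) Z" "\<And>v w. v \<in> carrier V \<Longrightarrow> w \<in> carrier W \<Longrightarrow> Fun h (pure V W v w) = b v w"
    "graded_space V" "graded_space W"
  shows "(THE h. h \<in> mor (V \<boxtimes> W) Z \<and> (\<forall>v\<in>carrier V. \<forall>w\<in>carrier W. Fun h (pure V W v w) = b v w)) = h"
proof (rule the_arrow[OF assms(1)])
  fix h' assume h': "arrow h' (V \<boxtimes> W) Z" "\<forall>v\<in>carrier V. \<forall>w\<in>carrier W. Fun h' (pure V W v w) = b v w"
  show "h' = h"
    by (rule arrow_tensor_eqI[OF h'(1) assms(1) generates_carrier generates_carrier])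
      (use assms h' in auto)
qed (use assms in auto)

lemma bilin_comp_pure:
  "arrow f V V' \<Longrightarrow> arrow g W W' \<Longrightarrow> bilin V W (V' \<boxtimes> W') (\<lambda>v w. pure V' W' (Fun f v) (Fun g w))"
  unfolding bilin_def
  using lin_comp[OF arrow_lin pure_lin(1), of f V V' W'] lin_comp[OF arrow_lin pure_lin(2), of g W W' V']
  by (simp add: arrow_closed graded_vecsp arrow_graded)

lemma tensor_arr:
  assumes f: "arrow f V V'" and g: "arrow g W W'"
  shows arrow_tensor: "arrow (f \<star> g) (V \<boxtimes> W) (V' \<boxtimes> W')"
    and Fun_tensor: "v \<in> carrier V \<Longrightarrow> w \<in> carrier W \<Longrightarrow>
      Fun (f \<star> g) (pure V W v w) = pure V' W' (Fun f v) (Fun g w)"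
proof -
  note gr = arrow_graded[OF f] arrow_graded[OF g]
  define h where "h = bilin_arr V W (V' \<boxtimes> W') (\<lambda>v w. pure V' W' (Fun f v) (Fun g w))"
  have h: "arrow h (V \<boxtimes> W) (V' \<boxtimes> W')"
    unfolding h_def
    by (rule arrow_bilin[OF gr(1,3) graded_tensor[OF gr(2,4)] bilin_comp_pure[OF f g]],
        rule homog_pure, assumption+, rule arrow_homog[OF f], assumption+, rule arrow_homog[OF g])
  have hp: "Fun h (pure V W v w) = pure V' W' (Fun f v) (Fun g w)" if "v \<in> carrier V" "w \<in> carrier W" for v w
    unfolding h_def by (rule Fun_bilin[OF graded_tensor[OF gr(2,4)] bilin_comp_pure[OF f g] that])
  have "f \<star> g = h"
    unfolding tensor_arr_def arrow_dom[OF f] arrow_dom[OF g]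
    by (rule arrow_tensor_unique[OF h hp gr(1,3)])
  then show "arrow (f \<star> g) (V \<boxtimes> W) (V' \<boxtimes> W')"
    "v \<in> carrier V \<Longrightarrow> w \<in> carrier W \<Longrightarrow> Fun (f \<star> g) (pure V W v w) = pure V' W' (Fun f v) (Fun g w)"
    using h hp by simp_all
qed

definition trilin ::
  "('k, 'a) gspace \<Rightarrow> ('k, 'b) gspace \<Rightarrow> ('k, 'c) gspace \<Rightarrow> ('k, 'd) gspace \<Rightarrow> ('a \<Rightarrow> 'b \<Rightarrow> 'c \<Rightarrow> 'd) \<Rightarrow> bool"
  where "trilin U V W Z b \<longleftrightarrow> (\<forall>w\<in>carrier W. bilin U V Z (\<lambda>u v. b u v w)) \<and> (\<forall>u\<in>carrier U. bilin V W Z (b u))"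

lemma trilin_left:
  assumes U: "graded_space U" and V: "graded_space V" and W: "graded_space W" and Z: "graded_space Z"
    and b: "trilin U V W Z b"
    and h: "\<And>i j k u v w. i < p \<Longrightarrow> j < p \<Longrightarrow> k < p \<Longrightarrow> u \<in> homog U i \<Longrightarrow> v \<in> homog V j \<Longrightarrow> w \<in> homog W k \<Longrightarrow>
      b u v w \<in> homog Z ((i + j + k) mod p)"
  obtains f where "arrow f ((U \<boxtimes> V) \<boxtimes> W) Z"
    "\<And>u v w. u \<in> carrier U \<Longrightarrow> v \<in> carrier V \<Longrightarrow> w \<in> carrier W \<Longrightarrow>
      Fun f (pure (U \<boxtimes> V) W (pure U V u v) w) = b u v w"
proof -
  define B where "B = (\<lambda>t w. lift Z (\<lambda>u v. b u v w) t)"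
  have b1: "bilin U V Z (\<lambda>u v. b u v w)" if "w \<in> carrier W" for w using b that by (simp add: trilin_def)
  have b2: "lin W Z (\<lambda>w. b u v w)" if "u \<in> carrier U" "v \<in> carrier V" for u v
    using b that by (simp add: trilin_def bilin_def)
  have B: "bilin (U \<boxtimes> V) W Z B"
    unfolding bilin_def B_def
    using lift_lin[OF graded_fd[OF Z] graded_vecsp[OF U] b1]
      lift_param[OF graded_fd[OF Z] graded_vecsp[OF U] graded_vecsp[OF V] b1 graded_vecsp[OF W] b2]
    by blast
  have hom: "B t w \<in> homog Z ((l + k) mod p)"
    if l: "l < p" "k < p" "t \<in> homog (U \<boxtimes> V) l" "w \<in> homog W k" for l k t w
  proof -
    have "lift Z (\<lambda>u v. b u v w) t \<in> homog Z ((l + k) mod p)"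
    proof (rule lift_subspace[OF U V graded_fd[OF Z] b1[OF homog_carrier[OF W l(2,4)]] graded_homog[OF Z] l(3)])
      fix i j u v assume ij: "i < p" "j < p" "(i + j) mod p = l" "u \<in> homog U i" "v \<in> homog V j"
      have "(i + j + k) mod p = (l + k) mod p" using ij(3) by (metis mod_add_left_eq)
      then show "b u v w \<in> homog Z ((l + k) mod p)" using h[OF ij(1,2) l(2) ij(4,5) l(4)] by simp
    qed simp
    then show ?thesis by (simp add: B_def)
  qed
  show ?thesis
  proof (rule that)
    show "arrow (bilin_arr (U \<boxtimes> V) W Z B) ((U \<boxtimes> V) \<boxtimes> W) Z"
      by (rule arrow_bilin[OF graded_tensor[OF U V] W Z B hom])
    fix u v w assume uvw: "u \<in> carrier U" "v \<in> carrier V" "w \<in> carrier W"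
    show "Fun (bilin_arr (U \<boxtimes> V) W Z B) (pure (U \<boxtimes> V) W (pure U V u v) w) = b u v w"
      using Fun_bilin[OF Z B pure_carrier[OF uvw(1,2)] uvw(3)] lift_pure[OF graded_fd[OF Z] b1[OF uvw(3)] uvw(1,2)]
      by (simp add: B_def)
  qed
qed

lemma trilin_right:
  assumes U: "graded_space U" and V: "graded_space V" and W: "graded_space W" and Z: "graded_space Z"
    and b: "trilin U V W Z b"
    and h: "\<And>i j k u v w. i < p \<Longrightarrow> j < p \<Longrightarrow> k < p \<Longrightarrow> u \<in> homog U i \<Longrightarrow> v \<in> homog V j \<Longrightarrow> w \<in> homog W k \<Longrightarrow>
      b u v w \<in> homog Z ((i + j + k) mod p)"
  obtains f where "arrow f (U \<boxtimes> (V \<boxtimes> W)) Z"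
    "\<And>u v w. u \<in> carrier U \<Longrightarrow> v \<in> carrier V \<Longrightarrow> w \<in> carrier W \<Longrightarrow>
      Fun f (pure U (V \<boxtimes> W) u (pure V W v w)) = b u v w"
proof -
  define B where "B = (\<lambda>u t. lift Z (b u) t)"
  have b1: "bilin V W Z (b u)" if "u \<in> carrier U" for u using b that by (simp add: trilin_def)
  have b2: "lin U Z (\<lambda>u. b u v w)" if "v \<in> carrier V" "w \<in> carrier W" for v w
    using b that by (simp add: trilin_def bilin_def)
  have B: "bilin U (V \<boxtimes> W) Z B"
    unfolding bilin_def B_def
    using lift_lin[OF graded_fd[OF Z] graded_vecsp[OF V] b1]
      lift_param[OF graded_fd[OF Z] graded_vecsp[OF V] graded_vecsp[OF W] b1 graded_vecsp[OF U] b2]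
    by (auto simp: eta_contract_eq)
  have hom: "B u t \<in> homog Z ((i + l) mod p)"
    if l: "i < p" "l < p" "u \<in> homog U i" "t \<in> homog (V \<boxtimes> W) l" for i l u t
  proof -
    have "lift Z (b u) t \<in> homog Z ((i + l) mod p)"
    proof (rule lift_subspace[OF V W graded_fd[OF Z] b1[OF homog_carrier[OF U l(1,3)]] graded_homog[OF Z] l(4)])
      fix j k v w assume jk: "j < p" "k < p" "(j + k) mod p = l" "v \<in> homog V j" "w \<in> homog W k"
      have "(i + j + k) mod p = (i + l) mod p" using jk(3) by (metis add.assoc mod_add_right_eq)
      then show "b u v w \<in> homog Z ((i + l) mod p)" using h[OF l(1) jk(1,2) l(3) jk(4,5)] by simp
    qed simp
    then show ?thesis by (simp add: B_def)
  qed
  show ?thesis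
  proof (rule that)
    show "arrow (bilin_arr U (V \<boxtimes> W) Z B) (U \<boxtimes> (V \<boxtimes> W)) Z"
      by (rule arrow_bilin[OF U graded_tensor[OF V W] Z B hom])
    fix u v w assume uvw: "u \<in> carrier U" "v \<in> carrier V" "w \<in> carrier W"
    show "Fun (bilin_arr U (V \<boxtimes> W) Z B) (pure U (V \<boxtimes> W) u (pure V W v w)) = b u v w"
      using Fun_bilin[OF Z B uvw(1) pure_carrier[OF uvw(2,3)]] lift_pure[OF graded_fd[OF Z] b1[OF uvw(1)] uvw(2,3)]
      by (simp add: B_def)
  qed
qed

lemma trilin_pure:
  assumes U: "graded_space U" and V: "graded_space V" and W: "graded_space W"
  shows "trilin U V W (U \<boxtimes> (V \<boxtimes> W)) (\<lambda>u v w. pure U (V \<boxtimes> W) u (pure V W v w))"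
    and "trilin U V W ((U \<boxtimes> V) \<boxtimes> W) (\<lambda>u v w. pure (U \<boxtimes> V) W (pure U V u v) w)"
proof -
  note vs = graded_vecsp[OF U] graded_vecsp[OF V] graded_vecsp[OF W]
  note l1 = pure_lin[OF vs(1) vecsp_tensor[OF vs(2), of W]] and l2 = pure_lin[OF vs(2,3)]
    and l3 = pure_lin[OF vecsp_tensor[OF vs(1), of V] vs(3)] and l4 = pure_lin[OF vs(1,2)]
  show "trilin U V W (U \<boxtimes> (V \<boxtimes> W)) (\<lambda>u v w. pure U (V \<boxtimes> W) u (pure V W v w))"
    unfolding trilin_def bilin_def
    by (intro conjI ballI lin_comp[OF l2(1) l1(2)] lin_comp[OF l2(2) l1(2)] l1(1) pure_carrier)
  show "trilin U V W ((U \<boxtimes> V) \<boxtimes> W) (\<lambda>u v w. pure (U \<boxtimes> V) W (pure U V u v) w)"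
    unfolding trilin_def bilin_def
    by (intro conjI ballI lin_comp[OF l4(1) l3(1)] lin_comp[OF l4(2) l3(1)] l3(2) pure_carrier)
qed

lemma generates_left:
  assumes "graded_space U" "graded_space V" "graded_space W"
  shows "generates ((U \<boxtimes> V) \<boxtimes> W)
    {pure (U \<boxtimes> V) W t w | t w. t \<in> {pure U V u v | u v. u \<in> carrier U \<and> v \<in> carrier V} \<and> w \<in> carrier W}"
  using assms by (intro generates_tensor generates_carrier graded_vecsp)

lemma generates_right:
  assumes "graded_space U" "graded_space V" "graded_space W"
  shows "generates (U \<boxtimes> (V \<boxtimes> W))
    {pure U (V \<boxtimes> W) u t | u t. u \<in> carrier U \<and> t \<in> {pure V W v w | v w. v \<in> carrier V \<and> w \<in> carrier W}}"
  using assms by (intro generates_tensor generates_carrier graded_vecsp)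

text \<open>Both bracketings have the universal property for trilinear maps, so an arrow is obtained in
  either direction, and the two are mutually inverse since they are so on pure tensors.\<close>

lemma assoc_arr:
  assumes U: "graded_space U" and V: "graded_space V" and W: "graded_space W"
  shows arrow_assoc: "arrow (assoc U V W) ((U \<boxtimes> V) \<boxtimes> W) (U \<boxtimes> (V \<boxtimes> W))"
    and Fun_assoc: "u \<in> carrier U \<Longrightarrow> v \<in> carrier V \<Longrightarrow> w \<in> carrier W \<Longrightarrow>
      Fun (assoc U V W) (pure (U \<boxtimes> V) W (pure U V u v) w) = pure U (V \<boxtimes> W) u (pure V W v w)"
    and arrow_assoc_inv: "arrow (assoc_inv U V W) (U \<boxtimes> (V \<boxtimes> W)) ((U \<boxtimes> V) \<boxtimes> W)"
    and Fun_assoc_inv: "u \<in> carrier U \<Longrightarrow> v \<in> carrier V \<Longrightarrow> w \<in> carrier W \<Longrightarrow>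
      Fun (assoc_inv U V W) (pure U (V \<boxtimes> W) u (pure V W v w)) = pure (U \<boxtimes> V) W (pure U V u v) w"
proof -
  note T1 = graded_tensor[OF graded_tensor[OF U V] W] and T2 = graded_tensor[OF U graded_tensor[OF V W]]
  have m: "((i + j) mod p + k) mod p = (i + j + k) mod p" "(i + (j + k) mod p) mod p = (i + j + k) mod p" for i j k
    by (simp_all add: mod_add_left_eq mod_add_right_eq add.assoc)
  obtain f where f: "arrow f ((U \<boxtimes> V) \<boxtimes> W) (U \<boxtimes> (V \<boxtimes> W))"
    "\<And>u v w. u \<in> carrier U \<Longrightarrow> v \<in> carrier V \<Longrightarrow> w \<in> carrier W \<Longrightarrow>
      Fun f (pure (U \<boxtimes> V) W (pure U V u v) w) = pure U (V \<boxtimes> W) u (pure V W v w)"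
  proof (rule trilin_left[OF U V W T2 trilin_pure(1)[OF U V W]])
    fix i j k u v w assume "i < p" "j < p" "k < p" "u \<in> homog U i" "v \<in> homog V j" "w \<in> homog W k"
    then show "pure U (V \<boxtimes> W) u (pure V W v w) \<in> homog (U \<boxtimes> (V \<boxtimes> W)) ((i + j + k) mod p)"
      using homog_pure[of i "(j + k) mod p" u U "pure V W v w" "V \<boxtimes> W"] homog_pure[of j k v V w W]
      by (simp only: m p_pos mod_less_divisor)
  qed blast
  obtain g where g: "arrow g (U \<boxtimes> (V \<boxtimes> W)) ((U \<boxtimes> V) \<boxtimes> W)"
    "\<And>u v w. u \<in> carrier U \<Longrightarrow> v \<in> carrier V \<Longrightarrow> w \<in> carrier W \<Longrightarrow>
      Fun g (pure U (V \<boxtimes> W) u (pure V W v w)) = pure (U \<boxtimes> V) W (pure U V u v) w"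
  proof (rule trilin_right[OF U V W T1 trilin_pure(2)[OF U V W]])
    fix i j k u v w assume "i < p" "j < p" "k < p" "u \<in> homog U i" "v \<in> homog V j" "w \<in> homog W k"
    then show "pure (U \<boxtimes> V) W (pure U V u v) w \<in> homog ((U \<boxtimes> V) \<boxtimes> W) ((i + j + k) mod p)"
      using homog_pure[of "(i + j) mod p" k "pure U V u v" "U \<boxtimes> V" w W] homog_pure[of i j u U v V]
      by (simp only: m p_pos mod_less_divisor)
  qed blast
  have fa: "assoc U V W = f"
    unfolding assoc_def
  proof (rule the_arrow[OF f(1)])
    fix h assume h: "arrow h ((U \<boxtimes> V) \<boxtimes> W) (U \<boxtimes> (V \<boxtimes> W))"
      "\<forall>u\<in>carrier U. \<forall>v\<in>carrier V. \<forall>w\<in>carrier W.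
        Fun h (pure (U \<boxtimes> V) W (pure U V u v) w) = pure U (V \<boxtimes> W) u (pure V W v w)"
    show "h = f" by (rule arrow_eqI[OF h(1) f(1) generates_left[OF U V W]]) (use h f in auto)
  qed (use f in auto)
  have gf: "g \<circ>\<^sub>a f = id_arr ((U \<boxtimes> V) \<boxtimes> W)"
    by (rule arrow_eqI[OF arrow_comp[OF f(1) g(1)] arrow_id[OF T1] generates_left[OF U V W]])
      (auto simp: Fun_comp_arrow[OF f(1)] f g pure_carrier simp del: tensor_simps)
  have fg: "f \<circ>\<^sub>a g = id_arr (U \<boxtimes> (V \<boxtimes> W))"
    by (rule arrow_eqI[OF arrow_comp[OF g(1) f(1)] arrow_id[OF T2] generates_right[OF U V W]])
      (auto simp: Fun_comp_arrow[OF g(1)] f g pure_carrier simp del: tensor_simps)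
  have ga: "assoc_inv U V W = g" unfolding fa by (rule inv_arr_eq[OF f(1) g(1) gf fg])
  show "arrow (assoc U V W) ((U \<boxtimes> V) \<boxtimes> W) (U \<boxtimes> (V \<boxtimes> W))"
    "arrow (assoc_inv U V W) (U \<boxtimes> (V \<boxtimes> W)) ((U \<boxtimes> V) \<boxtimes> W)"
    unfolding ga unfolding fa by (rule f g)+
  show "u \<in> carrier U \<Longrightarrow> v \<in> carrier V \<Longrightarrow> w \<in> carrier W \<Longrightarrow>
      Fun (assoc U V W) (pure (U \<boxtimes> V) W (pure U V u v) w) = pure U (V \<boxtimes> W) u (pure V W v w)"
    "u \<in> carrier U \<Longrightarrow> v \<in> carrier V \<Longrightarrow> w \<in> carrier W \<Longrightarrow>
      Fun (assoc_inv U V W) (pure U (V \<boxtimes> W) u (pure V W v w)) = pure (U \<boxtimes> V) W (pure U V u v) w"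
    unfolding ga unfolding fa by (rule f(2) g(2); assumption)+
qed

lemma generates_unit: "generates (\<I> :: ('k, 'k) gspace) {1}"
  unfolding generates_def
proof (intro conjI allI impI)
  fix U assume U: "VectorSpace.subspace scalars U (\<I> :: ('k, 'k) gspace)" "{1::'k} \<subseteq> U"
  show "carrier \<I> \<subseteq> U" using subspace_closed(4)[OF U(1), of 1] U(2) by (simp add: subset_iff)
qed auto

lemma graded_unit: "graded_space \<I>"
proof (rule graded_spaceI[where pr = "\<lambda>i v. if i = 0 then v else 0"])
  show "fd_space (\<I> :: ('k, 'k) gspace)" unfolding fd_space_iff_generates using generates_unit by (intro exI[of _ "{1}"]) simp
  show "VectorSpace.subspace scalars (homog \<I> i) (\<I> :: ('k, 'k) gspace)" for i
    by (rule submoduleI) auto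
  show "lin \<I> \<I> (\<lambda>v. if i = 0 then v else 0 :: 'k)" for i :: nat by (rule linI) auto
  show "finsum \<I> (\<lambda>i. if i = 0 then v else 0) {..<p} = (v::'k)" for v
    using finsum_single[of \<I> "{..<p}" v 0] by (simp cong: if_cong)
qed auto

lemma bilin_smult:
  assumes "vecsp V"
  shows "bilin \<I> V V (\<lambda>c v. c \<odot>\<^bsub>V\<^esub> v)" "bilin V \<I> V (\<lambda>v c. c \<odot>\<^bsub>V\<^esub> v)"
  using assms lin_smult_map[OF lin_id[OF assms]]
  by (auto simp: bilin_def vecsp_smult intro!: linI)

lemma lunit_arr:
  assumes V: "graded_space V"
  shows arrow_lunit: "arrow (lunit V) (\<I> \<boxtimes> V) V"
    and Fun_lunit: "v \<in> carrier V \<Longrightarrow> Fun (lunit V) (pure \<I> V c v) = c \<odot>\<^bsub>V\<^esub> v"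
    and arrow_runit: "arrow (runit V) (V \<boxtimes> \<I>) V"
    and Fun_runit: "v \<in> carrier V \<Longrightarrow> Fun (runit V) (pure V \<I> v c) = c \<odot>\<^bsub>V\<^esub> v"
    and arrow_lunit_inv: "arrow (inv_arr (lunit V)) V (\<I> \<boxtimes> V)"
    and Fun_lunit_inv: "v \<in> carrier V \<Longrightarrow> Fun (inv_arr (lunit V)) v = pure \<I> V 1 v"
proof -
  note vs = graded_vecsp[OF V] and b = bilin_smult[OF graded_vecsp[OF V]]
  let ?l = "bilin_arr \<I> V V (\<lambda>c v. c \<odot>\<^bsub>V\<^esub> v)" and ?r = "bilin_arr V \<I> V (\<lambda>v c. c \<odot>\<^bsub>V\<^esub> v)"
  have l: "arrow ?l (\<I> \<boxtimes> V) V"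
    by (rule arrow_bilin[OF graded_unit V V b(1)])
      (use homog_smult[OF V] homog_zero[OF V] homog_carrier[OF V] vs in \<open>auto split: if_splits\<close>)
  have r: "arrow ?r (V \<boxtimes> \<I>) V"
    by (rule arrow_bilin[OF V graded_unit V b(2)])
      (use homog_smult[OF V] homog_zero[OF V] homog_carrier[OF V] vs in \<open>auto split: if_splits\<close>)
  have lp: "Fun ?l (pure \<I> V c v) = c \<odot>\<^bsub>V\<^esub> v" and rp: "Fun ?r (pure V \<I> v c) = c \<odot>\<^bsub>V\<^esub> v"
    if "v \<in> carrier V" for c v
    using Fun_bilin[OF V b(1), of c v] Fun_bilin[OF V b(2), of v c] that by simp_all
  have le: "lunit V = ?l"
    using arrow_tensor_unique[OF l, of "\<lambda>c v. c \<odot>\<^bsub>V\<^esub> v"] lp graded_unit V by (simp add: lunit_def)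
  have re: "runit V = ?r"
    using arrow_tensor_unique[OF r, of "\<lambda>v c. c \<odot>\<^bsub>V\<^esub> v"] rp graded_unit V by (simp add: runit_def)
  show "arrow (lunit V) (\<I> \<boxtimes> V) V" "arrow (runit V) (V \<boxtimes> \<I>) V"
    "v \<in> carrier V \<Longrightarrow> Fun (lunit V) (pure \<I> V c v) = c \<odot>\<^bsub>V\<^esub> v"
    "v \<in> carrier V \<Longrightarrow> Fun (runit V) (pure V \<I> v c) = c \<odot>\<^bsub>V\<^esub> v"
    using l r lp rp by (simp_all add: le re)
  let ?i = "mk_arr V (\<I> \<boxtimes> V) (\<lambda>v. pure \<I> V 1 v)"
  have i: "arrow ?i V (\<I> \<boxtimes> V)"
  proof (rule arrow_mk[OF V graded_tensor[OF graded_unit V]])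
    show "lin V (\<I> \<boxtimes> V) (\<lambda>v. pure \<I> V 1 v)" using pure_lin(2)[OF vecsp_unit vs, of 1] by simp
    show "pure \<I> V 1 v \<in> homog (\<I> \<boxtimes> V) i" if "i < p" "v \<in> homog V i" for i v
      using homog_pure[of 0 i 1 \<I> v V] that by simp
  qed
  have il: "?i \<circ>\<^sub>a ?l = id_arr (\<I> \<boxtimes> V)"
  proof (rule arrow_tensor_eqI[OF arrow_comp[OF l i] arrow_id[OF graded_tensor[OF graded_unit V]]
        generates_carrier[OF graded_unit] generates_carrier[OF V]])
    fix c v assume v: "v \<in> carrier V"
    have "pure \<I> V c v \<in> carrier (\<I> \<boxtimes> V)" using v by (intro pure_carrier) simp_all
    moreover have "pure \<I> V 1 (c \<odot>\<^bsub>V\<^esub> v) = pure \<I> V c v"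
      using v pure_add(3)[of 1 \<I> v V c] pure_add(4)[of 1 \<I> v V c] by simp
    ultimately show "Fun (?i \<circ>\<^sub>a ?l) (pure \<I> V c v) = Fun (id_arr (\<I> \<boxtimes> V)) (pure \<I> V c v)"
      using v vs by (simp add: Fun_comp_arrow[OF l] lp del: tensor_simps)
  qed
  have li: "?l \<circ>\<^sub>a ?i = id_arr V"
    by (rule arrow_eqI[OF arrow_comp[OF i l] arrow_id[OF V] generates_carrier[OF V]])
      (use lp vs in \<open>simp add: Fun_comp_arrow[OF i]\<close>)
  have "inv_arr (lunit V) = ?i" unfolding le by (rule inv_arr_eq[OF l i il li])
  then show "arrow (inv_arr (lunit V)) V (\<I> \<boxtimes> V)"
    "v \<in> carrier V \<Longrightarrow> Fun (inv_arr (lunit V)) v = pure \<I> V 1 v" using i by simp_all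
qed

text \<open>The braiding with an arbitrary parameter, so that the inverse braiding is another instance.\<close>

definition braid_with :: "'k \<Rightarrow> ('k, 'a) gspace \<Rightarrow> ('k, 'b) gspace \<Rightarrow>
    ('k, ('k, 'a, 'b) tensor, ('k, 'b, 'a) tensor) garr" where
  "braid_with q V W = bilin_arr V W (W \<boxtimes> V) (\<lambda>v w. finsum (W \<boxtimes> V)
     (\<lambda>(i, j). (q ^ (i * j)) \<odot>\<^bsub>W \<boxtimes> V\<^esub> pure W V (component W j w) (component V i v)) ({..<p} \<times> {..<p}))"

lemma braid_with:
  assumes V: "graded_space V" and W: "graded_space W"
  shows arrow_braid_with: "arrow (braid_with q V W) (V \<boxtimes> W) (W \<boxtimes> V)"
    and Fun_braid_with: "i < p \<Longrightarrow> j < p \<Longrightarrow> v \<in> homog V i \<Longrightarrow> w \<in> homog W j \<Longrightarrow>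
      Fun (braid_with q V W) (pure V W v w) = (q ^ (i * j)) \<odot>\<^bsub>W \<boxtimes> V\<^esub> pure W V w v"
proof -
  note vs = graded_vecsp[OF V] graded_vecsp[OF W]
  note T = graded_tensor[OF W V] and vT = vecsp_tensor[OF vs(2), of V]
  define b where "b v w = finsum (W \<boxtimes> V)
     (\<lambda>(i, j). (q ^ (i * j)) \<odot>\<^bsub>W \<boxtimes> V\<^esub> pure W V (component W j w) (component V i v)) ({..<p} \<times> {..<p})" for v w
  have bl: "bilin V W (W \<boxtimes> V) b"
    unfolding bilin_def b_def case_prod_beta
  proof (intro conjI ballI lin_finsum_map lin_smult_map vs vT)
    fix w x assume "w \<in> carrier W" "x \<in> {..<p} \<times> {..<p}"
    then show "lin V (W \<boxtimes> V) (\<lambda>v. pure W V (component W (snd x) w) (component V (fst x) v))"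
      using lin_comp[OF component_lin[OF V] pure_lin(2)[OF vs(2,1)]] component_carrier[OF W] by auto
  next
    fix v x assume "v \<in> carrier V" "x \<in> {..<p} \<times> {..<p}"
    then show "lin W (W \<boxtimes> V) (\<lambda>w. pure W V (component W (snd x) w) (component V (fst x) v))"
      using lin_comp[OF component_lin[OF W] pure_lin(1)[OF vs(2,1)]] component_carrier[OF V] by auto
  qed auto
  have bh: "b v w = (q ^ (i * j)) \<odot>\<^bsub>W \<boxtimes> V\<^esub> pure W V w v"
    if ij: "i < p" "j < p" "v \<in> homog V i" "w \<in> homog W j" for i j v w
  proof -
    have car: "v \<in> carrier V" "w \<in> carrier W" using ij homog_carrier[OF V] homog_carrier[OF W] by auto
    have c: "(q ^ (i * j)) \<odot>\<^bsub>W \<boxtimes> V\<^esub> pure W V w v \<in> carrier (W \<boxtimes> V)"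
      by (intro vecsp_closed(3)[OF vT] pure_carrier car)
    have z: "pure W V \<zero>\<^bsub>W\<^esub> v = \<zero>\<^bsub>W \<boxtimes> V\<^esub>" "pure W V w \<zero>\<^bsub>V\<^esub> = \<zero>\<^bsub>W \<boxtimes> V\<^esub>"
      "pure W V \<zero>\<^bsub>W\<^esub> \<zero>\<^bsub>V\<^esub> = \<zero>\<^bsub>W \<boxtimes> V\<^esub>"
      using lin_zero[OF pure_lin(1)[OF vs(2,1) car(1)]] lin_zero[OF pure_lin(2)[OF vs(2,1) car(2)]]
        lin_zero[OF pure_lin(1)[OF vs(2,1) vecsp_closed(1)[OF vs(1)]]] by simp_all
    have "b v w = finsum (W \<boxtimes> V) (\<lambda>x. if x = (i, j) then (q ^ (i * j)) \<odot>\<^bsub>W \<boxtimes> V\<^esub> pure W V w v else \<zero>\<^bsub>W \<boxtimes> V\<^esub>)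
        ({..<p} \<times> {..<p})"
      unfolding b_def
      using ij c vecsp_closed(1)[OF vT] z
      by (intro vecsp_finsum_cong[OF vT]) (auto simp: component_homog_eq[OF V] component_homog_eq[OF W])
    also have "\<dots> = (q ^ (i * j)) \<odot>\<^bsub>W \<boxtimes> V\<^esub> pure W V w v"
      using ij c by (subst finsum_single[OF vT]) auto
    finally show ?thesis .
  qed
  have eq: "braid_with q V W = bilin_arr V W (W \<boxtimes> V) b" unfolding braid_with_def b_def ..
  show "arrow (braid_with q V W) (V \<boxtimes> W) (W \<boxtimes> V)"
    unfolding eq
  proof (rule arrow_bilin[OF V W T bl])
    fix i j v w assume ij: "i < p" "j < p" "v \<in> homog V i" "w \<in> homog W j"
    show "b v w \<in> homog (W \<boxtimes> V) ((i + j) mod p)"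
      unfolding bh[OF ij] using homog_pure[OF ij(2,1,4,3)] homog_smult[OF T]
      by (simp add: add.commute del: tensor_simps)
  qed
  show "i < p \<Longrightarrow> j < p \<Longrightarrow> v \<in> homog V i \<Longrightarrow> w \<in> homog W j \<Longrightarrow>
      Fun (braid_with q V W) (pure V W v w) = (q ^ (i * j)) \<odot>\<^bsub>W \<boxtimes> V\<^esub> pure W V w v"
    using Fun_bilin[OF T bl] bh homog_carrier[OF V] homog_carrier[OF W] by (simp add: eq del: tensor_simps)
qed

lemma braid_eq:
  assumes V: "graded_space V" and W: "graded_space W"
  shows "braid V W = braid_with \<xi> V W"
  unfolding braid_def
proof (rule the_arrow[OF arrow_braid_with[OF V W]])
  fix h assume h: "arrow h (V \<boxtimes> W) (W \<boxtimes> V)"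
    "\<forall>i<p. \<forall>j<p. \<forall>v\<in>homog V i. \<forall>w\<in>homog W j.
        Fun h (pure V W v w) = (\<xi> ^ (i * j)) \<odot>\<^bsub>W \<boxtimes> V\<^esub> pure W V w v"
  show "h = braid_with \<xi> V W"
    by (rule arrow_tensor_eqI[OF h(1) arrow_braid_with[OF V W] generates_homog[OF V] generates_homog[OF W]])
      (use h(2) Fun_braid_with[OF V W] in auto)
qed (use Fun_braid_with[OF V W] in auto)

lemma braid_with_inverse:
  assumes V: "graded_space V" and W: "graded_space W" and "q * r = 1"
  shows "braid_with r W V \<circ>\<^sub>a braid_with q V W = id_arr (V \<boxtimes> W)"
proof (rule arrow_tensor_eqI[OF arrow_comp[OF arrow_braid_with[OF V W] arrow_braid_with[OF W V]]
      arrow_id[OF graded_tensor[OF V W]] generates_homog[OF V] generates_homog[OF W]])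
  fix v w assume "v \<in> (\<Union>i<p. homog V i)" "w \<in> (\<Union>i<p. homog W i)"
  then obtain i j where ij: "i < p" "j < p" "v \<in> homog V i" "w \<in> homog W j" by blast
  have car: "v \<in> carrier V" "w \<in> carrier W" using ij homog_carrier[OF V] homog_carrier[OF W] by auto
  have "q ^ (i * j) * r ^ (j * i) = 1"
    using assms(3) by (metis mult.commute power_mult_distrib power_one)
  then show "Fun (braid_with r W V \<circ>\<^sub>a braid_with q V W) (pure V W v w) = Fun (id_arr (V \<boxtimes> W)) (pure V W v w)"
    using lin_smult[OF arrow_lin[OF arrow_braid_with[OF W V]] pure_carrier[OF car(2,1)], of r "q ^ (i * j)"]
    by (simp add: Fun_comp_arrow[OF arrow_braid_with[OF V W]] pure_carrier[OF car] Fun_braid_with[OF V W ij]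
        Fun_braid_with[OF W V ij(2,1,4,3)] mult.assoc[symmetric] del: tensor_simps(1,5))
qed

lemma braid_inv_eq:
  assumes V: "graded_space V" and W: "graded_space W"
  shows "braid_inv V W = braid_with (inverse \<xi>) V W"
  unfolding braid_inv_def braid_eq[OF W V]
  by (rule inv_arr_eq[OF arrow_braid_with[OF W V] arrow_braid_with[OF V W]
        braid_with_inverse[OF W V] braid_with_inverse[OF V W]]) simp_all

lemma tensor_arr_comp:
  assumes "arrow f V V'" "arrow f' V' V''" "arrow g W W'" "arrow g' W' W''"
  shows "(f' \<star> g') \<circ>\<^sub>a (f \<star> g) = (f' \<circ>\<^sub>a f) \<star> (g' \<circ>\<^sub>a g)"
proof (rule arrow_tensor_eqI[OF arrow_comp[OF arrow_tensor arrow_tensor] arrow_tensor[OF arrow_comp arrow_comp]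
      generates_carrier generates_carrier])
  fix v w assume v: "v \<in> carrier V" and w: "w \<in> carrier W"
  show "Fun ((f' \<star> g') \<circ>\<^sub>a (f \<star> g)) (pure V W v w) = Fun ((f' \<circ>\<^sub>a f) \<star> (g' \<circ>\<^sub>a g)) (pure V W v w)"
    by (simp add: Fun_comp_arrow[OF arrow_tensor[OF assms(1,3)] pure_carrier[OF v w]]
        Fun_tensor[OF assms(1,3) v w] Fun_tensor[OF assms(2,4)] arrow_closed[OF assms(1) v] arrow_closed[OF assms(3) w]
        Fun_tensor[OF arrow_comp[OF assms(1,2)] arrow_comp[OF assms(3,4)] v w]
        Fun_comp_arrow[OF assms(1) v] Fun_comp_arrow[OF assms(3) w])
qed (use assms arrow_graded in auto)

lemma tensor_arr_id:
  assumes V: "graded_space V" and W: "graded_space W"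
  shows "id_arr V \<star> id_arr W = id_arr (V \<boxtimes> W)"
  by (rule arrow_tensor_eqI[OF arrow_tensor[OF arrow_id[OF V] arrow_id[OF W]] arrow_id[OF graded_tensor[OF V W]]
        generates_carrier[OF V] generates_carrier[OF W]])
    (simp add: Fun_tensor[OF arrow_id[OF V] arrow_id[OF W]] pure_carrier del: tensor_simps)

text \<open>The two antitwists contribute the exponents \<open>- (i + j)\<^sup>2\<close> and \<open>j\<^sup>2\<close>; the sum \<open>i + j\<close> is
  reduced modulo \<open>p\<close>, which does not affect the scalar.\<close>

lemma braided_structure:
  assumes U: "graded_space U" and M: "graded_space M"
  shows arrow_braided_structure: "arrow (braided_structure U M) (U \<boxtimes> M) (U \<boxtimes> M)"
    and Fun_braided_structure: "i < p \<Longrightarrow> j < p \<Longrightarrow> u \<in> homog U i \<Longrightarrow> v \<in> homog M j \<Longrightarrow>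
      Fun (braided_structure U M) (pure U M u v)
        = (\<xi> powi (- (int i ^ 2) - 2 * int i * int j)) \<odot>\<^bsub>U \<boxtimes> M\<^esub> pure U M u v"
proof -
  note T = graded_tensor[OF U M]
  let ?s = "scaling (\<lambda>i. \<xi> powi (- (int i ^ 2)))" and ?t = "scaling (\<lambda>i. \<xi> powi (int i ^ 2))"
  note s = arrow_scaling[OF M] and I = arrow_id[OF U]
  have inv: "\<xi> powi a * \<xi> powi (- a) = 1" "\<xi> powi (- a) * \<xi> powi a = 1" for a
    by (simp_all add: power_int_add[symmetric])
  have "inv_arr (id_arr U \<star> antitwist M) = id_arr U \<star> ?t M"
    unfolding antitwist_eq[OF M]
    by (rule inv_arr_eq[OF arrow_tensor[OF I s] arrow_tensor[OF I s]])
      (simp_all add: tensor_arr_comp[OF I I s s] arrow_comp_id[OF I] scaling_inverse[OF M] inv tensor_arr_id[OF U M])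
  then have eq: "braided_structure U M = ?s (U \<boxtimes> M) \<circ>\<^sub>a (id_arr U \<star> ?t M)"
    by (simp add: braided_structure_def antitwist_eq[OF T])
  show "arrow (braided_structure U M) (U \<boxtimes> M) (U \<boxtimes> M)"
    unfolding eq by (rule arrow_comp[OF arrow_tensor[OF I s] arrow_scaling[OF T]])
  assume ij: "i < p" "j < p" "u \<in> homog U i" "v \<in> homog M j"
  have car: "u \<in> carrier U" "v \<in> carrier M" using ij homog_carrier[OF U] homog_carrier[OF M] by auto
  have h: "pure U M u v \<in> homog (U \<boxtimes> M) ((i + j) mod p)" by (rule homog_pure[OF ij])
  have p: "pure U M u v \<in> carrier (U \<boxtimes> M)" by (rule pure_carrier[OF car])
  have "Fun (id_arr U \<star> ?t M) (pure U M u v) = (\<xi> powi (int j ^ 2)) \<odot>\<^bsub>U \<boxtimes> M\<^esub> pure U M u v"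
    using pure_add(4)[OF car] by (simp add: Fun_tensor[OF I s car] car Fun_scaling[OF M ij(2,4)])
  then have "Fun (braided_structure U M) (pure U M u v)
    = (\<xi> powi (int j ^ 2) * \<xi> powi (- (int ((i + j) mod p) ^ 2))) \<odot>\<^bsub>U \<boxtimes> M\<^esub> pure U M u v"
    using lin_smult[OF arrow_lin[OF arrow_scaling[OF T]] p] Fun_scaling[OF T _ h] p
    by (simp add: eq Fun_comp_arrow[OF arrow_tensor[OF I s]] mult.assoc del: tensor_simps(1,5))
  also have "\<xi> powi (int j ^ 2) * \<xi> powi (- (int ((i + j) mod p) ^ 2)) = \<xi> powi (int j ^ 2 - int ((i + j) mod p) ^ 2)"
    by (simp add: power_int_diff power_int_minus field_simps)
  also have "\<dots> = \<xi> powi (- (int i ^ 2) - 2 * int i * int j)"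
  proof (rule powi_root_cong)
    have "(int j ^ 2 - int ((i + j) mod p) ^ 2) mod int p = (int j ^ 2 - (int (i + j) mod int p) ^ 2) mod int p"
      by (simp add: zmod_int)
    also have "\<dots> = (int j ^ 2 - int (i + j) ^ 2) mod int p"
      by (metis mod_diff_right_eq power_mod)
    also have "int j ^ 2 - int (i + j) ^ 2 = - (int i ^ 2) - 2 * int i * int j"
      by (simp add: power2_eq_square algebra_simps)
    finally show "(int j ^ 2 - int ((i + j) mod p) ^ 2) mod int p = (- (int i ^ 2) - 2 * int i * int j) mod int p" .
  qed
  finally show "Fun (braided_structure U M) (pure U M u v)
        = (\<xi> powi (- (int i ^ 2) - 2 * int i * int j)) \<odot>\<^bsub>U \<boxtimes> M\<^esub> pure U M u v" .
qed

end

section \<open>Gaussian binomial coefficients\<close>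

fun qbin :: "'k::field \<Rightarrow> nat \<Rightarrow> nat \<Rightarrow> 'k" where
  "qbin q n 0 = 1"
| "qbin q 0 (Suc k) = 0"
| "qbin q (Suc n) (Suc k) = qbin q n k + q ^ Suc k * qbin q n (Suc k)"

lemma qbin_eq_0: "n < k \<Longrightarrow> qbin q n k = 0"
  by (induction q n k rule: qbin.induct) auto

text \<open>The Pascal rule, summed against an arbitrary sequence of vectors: it reduces a sum over one row
  of Gaussian binomials to a sum over the row above.\<close>

lemma qbin_sum_Suc:
  assumes V: "vecsp V" and a: "\<And>k. a k \<in> carrier V"
  shows "finsum V (\<lambda>k. qbin q n k \<odot>\<^bsub>V\<^esub> a (Suc k)) {..n} \<oplus>\<^bsub>V\<^esub> finsum V (\<lambda>k. (qbin q n k * q ^ k) \<odot>\<^bsub>V\<^esub> a k) {..n}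
       = finsum V (\<lambda>k. qbin q (Suc n) k \<odot>\<^bsub>V\<^esub> a k) {..Suc n}"
proof -
  interpret abelian_monoid V using V by (rule vecsp_monoid)
  let ?b = "\<lambda>k. (qbin q n k * q ^ k) \<odot>\<^bsub>V\<^esub> a k"
  have cl: "c \<odot>\<^bsub>V\<^esub> a k \<in> carrier V" for c k using V a by simp
  have scl: "finsum V (\<lambda>k. f k \<odot>\<^bsub>V\<^esub> a (g k)) K \<in> carrier V" for f g and K :: "nat set"
    using cl by (intro finsum_closed) auto
  have "finsum V ?b {..n} = finsum V ?b {..Suc n}"
    using V a scl by (subst finsum_Suc) (auto simp: qbin_eq_0)
  also have "\<dots> = finsum V (\<lambda>k. ?b (Suc k)) {..n} \<oplus>\<^bsub>V\<^esub> a 0"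
    using V a by (subst finsum_Suc2) auto
  finally have "finsum V (\<lambda>k. qbin q n k \<odot>\<^bsub>V\<^esub> a (Suc k)) {..n} \<oplus>\<^bsub>V\<^esub> finsum V ?b {..n}
      = (finsum V (\<lambda>k. qbin q n k \<odot>\<^bsub>V\<^esub> a (Suc k)) {..n} \<oplus>\<^bsub>V\<^esub> finsum V (\<lambda>k. ?b (Suc k)) {..n}) \<oplus>\<^bsub>V\<^esub> a 0"
    using V a scl by (simp add: vecsp_add_ac(1))
  also have "finsum V (\<lambda>k. qbin q n k \<odot>\<^bsub>V\<^esub> a (Suc k)) {..n} \<oplus>\<^bsub>V\<^esub> finsum V (\<lambda>k. ?b (Suc k)) {..n}
      = finsum V (\<lambda>k. qbin q (Suc n) (Suc k) \<odot>\<^bsub>V\<^esub> a (Suc k)) {..n}"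
    using V a by (subst finsum_addf[symmetric]) (auto intro!: finsum_cong' simp: vecsp_smult(2)[symmetric] mult.commute)
  also have "\<dots> \<oplus>\<^bsub>V\<^esub> a 0 = finsum V (\<lambda>k. qbin q (Suc n) k \<odot>\<^bsub>V\<^esub> a k) {..Suc n}"
    using V a by (subst finsum_Suc2) (auto simp del: qbin.simps(3))
  finally show ?thesis .
qed

lemma qbin_sum_Suc_field:
  "(\<Sum>k\<le>Suc n. qbin q (Suc n) k * a k) = (\<Sum>k\<le>n. qbin q n k * (a (Suc k) + q ^ k * a k))"
  for a :: "nat \<Rightarrow> 'k::field"
  using qbin_sum_Suc[of "\<I> :: ('k, 'k) gspace" a q n]
  by (simp add: finsum_unit sum.distrib distrib_left mult.assoc)

text \<open>The antipode axiom for a power of \<open>x\<close> is this identity.\<close>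

lemma qbin_alternating:
  "(\<Sum>k\<le>Suc n. qbin q (Suc n) k * ((-1) ^ k * q ^ (k * (k - 1) div 2))) = 0"
proof -
  have "(-1) ^ Suc k * q ^ (Suc k * (Suc k - 1) div 2) + q ^ k * ((-1) ^ k * q ^ (k * (k - 1) div 2)) = 0" for k
  proof -
    have "Suc k * (Suc k - 1) div 2 = k + k * (k - 1) div 2"
      by (cases k) (auto simp: algebra_simps)
    then show ?thesis by (simp add: power_add mult.commute)
  qed
  then show ?thesis by (simp only: qbin_sum_Suc_field mult_zero_right sum.neutral_const)
qed

definition qfact :: "'k::field \<Rightarrow> nat \<Rightarrow> 'k" where
  "qfact q n = (\<Prod>m<n. \<Sum>i\<le>m. q ^ i)"

lemma qfact_Suc: "qfact q (Suc n) = qfact q n * (\<Sum>i\<le>n. q ^ i)"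
  by (simp add: qfact_def)

text \<open>The product form of a quotient of \<open>q\<close>-factorials, valid also where these vanish.\<close>

lemma qbin_qfact: "qbin q (i + j) i * qfact q i * qfact q j = qfact q (i + j)"
proof (induction "i + j" arbitrary: i j)
  case 0
  then show ?case by (simp add: qfact_def)
next
  case (Suc n)
  have sp: "(\<Sum>l\<le>i + j. q ^ l) = (\<Sum>l<i. q ^ l) + q ^ i * (\<Sum>l\<le>j. q ^ l)" for i j
  proof (induction j)
    case 0
    show ?case by (simp add: lessThan_Suc_atMost[symmetric])
  next
    case (Suc j)
    then show ?case by (simp add: algebra_simps power_add)
  qed
  show ?case
  proof (cases i)
    case 0
    then show ?thesis by (simp add: qfact_def)
  next
    case i: (Suc i')
    show ?thesis
    proof (cases j)
      case 0
      have "qbin q n n = 1" for n by (induction n) (simp_all add: qbin_eq_0)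
      then show ?thesis using 0 by (simp add: qfact_def)
    next
      case j: (Suc j')
      have h1: "qbin q n i' * qfact q i' * qfact q j = qfact q n" using Suc(1)[of i' j] Suc(2) i by simp
      have h2: "qbin q n i * qfact q i * qfact q j' = qfact q n" using Suc(1)[of i j'] Suc(2) j by simp
      have ij: "i + j = Suc n" using Suc(2) by simp
      have "qbin q (i + j) i = qbin q n i' + q ^ i * qbin q n i" unfolding ij by (simp add: i)
      then have "qbin q (i + j) i * qfact q i * qfact q j
          = qbin q n i' * qfact q i * qfact q j + q ^ i * (qbin q n i * qfact q i * qfact q j)"
        by (simp add: algebra_simps)
      also have "qbin q n i' * qfact q i * qfact q j = (qbin q n i' * qfact q i' * qfact q j) * (\<Sum>l\<le>i'. q ^ l)"
        by (simp add: i qfact_Suc mult_ac)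
      also have "qbin q n i * qfact q i * qfact q j = (qbin q n i * qfact q i * qfact q j') * (\<Sum>l\<le>j'. q ^ l)"
        by (simp add: j qfact_Suc mult_ac)
      finally have "qbin q (i + j) i * qfact q i * qfact q j
          = qfact q n * (\<Sum>l\<le>i'. q ^ l) + q ^ i * (qfact q n * (\<Sum>l\<le>j'. q ^ l))"
        by (simp only: h1 h2)
      also have "\<dots> = qfact q n * ((\<Sum>l<i. q ^ l) + q ^ i * (\<Sum>l\<le>j'. q ^ l))"
        by (simp add: i lessThan_Suc_atMost algebra_simps)
      also have "\<dots> = qfact q n * (\<Sum>l\<le>n. q ^ l)"
        using sp[of i j'] Suc(2) j by simp
      finally show ?thesis using ij by (simp add: qfact_Suc)
    qed
  qed
qed

context zp_root
begin

section \<open>The truncated polynomial algebra and its dual\<close>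

abbreviation A :: "('k, 'k poly) gspace" ("\<A>") where "\<A> \<equiv> trunc_poly p"
abbreviation D :: "('k, 'k poly \<Rightarrow> 'k) gspace" ("\<D>") where "\<D> \<equiv> dual \<A>"
abbreviation xpow :: "nat \<Rightarrow> 'k poly" ("\<x>") where "\<x> i \<equiv> monom 1 i"

definition \<delta> :: "nat \<Rightarrow> 'k poly \<Rightarrow> 'k" where
  "\<delta> n = restrict (\<lambda>f. coeff f n) (carrier \<A>)"

lemma trunc_simps [simp]:
  "carrier \<A> = {f. degree f < p}" "\<zero>\<^bsub>\<A>\<^esub> = 0" "f \<oplus>\<^bsub>\<A>\<^esub> g = f + g" "c \<odot>\<^bsub>\<A>\<^esub> f = Polynomial.smult c f"
  "homog \<A> i = range (\<lambda>c. monom c i)" "\<one>\<^bsub>\<A>\<^esub> = 1" "f \<otimes>\<^bsub>\<A>\<^esub> g = (f * g) mod monom 1 p"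
  by (simp_all add: trunc_poly_def)

lemma degree_xpow [simp]: "degree (\<x> i) = i"
  by (simp add: degree_monom_eq)

lemma xpow_carrier [simp]: "i < p \<Longrightarrow> \<x> i \<in> carrier \<A>"
  by (simp add: degree_monom_eq)

lemma vecsp_trunc: "vecsp \<A>"
  by (rule vecspI) (auto simp: degree_add_less smult_add_left smult_add_right algebra_simps intro: le_less_trans[OF degree_smult_le])

lemma finsum_trunc:
  "finite I \<Longrightarrow> (\<And>i. i \<in> I \<Longrightarrow> f i \<in> carrier \<A>) \<Longrightarrow> finsum \<A> f I = (\<Sum>i\<in>I. f i)"
proof (induction I rule: finite_induct)
  case empty
  interpret abelian_monoid \<A> by (rule vecsp_monoid[OF vecsp_trunc])
  show ?case by simp
next
  case (insert x F)
  interpret abelian_monoid \<A> by (rule vecsp_monoid[OF vecsp_trunc])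
  show ?case using insert by (subst finsum_insert) auto
qed

lemma monom_carrier: "i < p \<Longrightarrow> monom c i \<in> carrier \<A>"
  by (auto intro: le_less_trans[OF degree_monom_le])

lemma trunc_expand:
  assumes "f \<in> carrier \<A>"
  shows "finsum \<A> (\<lambda>i. monom (coeff f i) i) {..<p} = f"
proof -
  have "finsum \<A> (\<lambda>i. monom (coeff f i) i) {..<p} = (\<Sum>i<p. monom (coeff f i) i)"
    using monom_carrier by (intro finsum_trunc) auto
  also have "\<dots> = (\<Sum>i\<le>p - 1. monom (coeff f i) i)"
    using p_gt_1 by (intro sum.cong) auto
  also have "\<dots> = f"
    using assms by (intro poly_as_sum_of_monoms') auto
  finally show ?thesis .
qed

lemma generates_trunc: "generates \<A> (\<x> ` {..<p})"
  unfolding generates_def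
proof (intro conjI allI impI vecsp_trunc)
  show "\<x> ` {..<p} \<subseteq> carrier \<A>" using xpow_carrier by blast
  fix U assume U: "VectorSpace.subspace scalars U \<A>" "\<x> ` {..<p} \<subseteq> U"
  show "carrier \<A> \<subseteq> U"
  proof
    fix f assume f: "f \<in> carrier \<A>"
    have "finsum \<A> (\<lambda>i. monom (coeff f i) i) {..<p} \<in> U"
    proof (rule subspace_finsum[OF U(1)])
      fix i assume "i \<in> {..<p}"
      then show "monom (coeff f i) i \<in> U"
        using subspace_closed(4)[OF U(1), of "\<x> i" "coeff f i"] U(2) by (auto simp: smult_monom)
    qed
    then show "f \<in> U" using trunc_expand[OF f] by simp
  qed
qed

lemma graded_trunc: "graded_space \<A>"
proof (rule graded_spaceI[where pr = "\<lambda>i f. monom (coeff f i) i"])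
  show "fd_space \<A>" unfolding fd_space_iff_generates using generates_trunc by (intro exI[of _ "\<x> ` {..<p}"]) simp
  fix i assume i: "i < p"
  show "VectorSpace.subspace scalars (homog \<A> i) \<A>"
  proof (rule submoduleI[OF vecsp_trunc])
    show "homog \<A> i \<subseteq> carrier \<A>" using monom_carrier[OF i] by auto
    show "\<zero>\<^bsub>\<A>\<^esub> \<in> homog \<A> i" using monom_eq_0[of i, symmetric] by (simp del: monom_eq_0)
  qed (auto simp: add_monom smult_monom)
  show "lin \<A> \<A> (\<lambda>f. monom (coeff f i) i)"
    using monom_carrier[OF i] by (intro linI vecsp_trunc) (auto simp: add_monom smult_monom)
  show "monom (coeff v i) i = (if i = j then v else \<zero>\<^bsub>\<A>\<^esub>)" if "v \<in> homog \<A> j" for j v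
    using that by auto
qed (use trunc_expand in auto)

lemma dual_simps [simp]:
  "\<zero>\<^bsub>dual V\<^esub> = restrict (\<lambda>v. 0) (carrier V)"
  "\<phi> \<oplus>\<^bsub>dual V\<^esub> \<psi> = restrict (\<lambda>v. \<phi> v + \<psi> v) (carrier V)"
  "c \<odot>\<^bsub>dual V\<^esub> \<phi> = restrict (\<lambda>v. c * \<phi> v) (carrier V)"
  by (simp_all add: dual_def)

lemma dual_carrier: "\<phi> \<in> carrier (dual V) \<longleftrightarrow> \<phi> \<in> extensional (carrier V) \<and> lin V \<I> \<phi>"
  by (auto simp: dual_def)

lemma dual_homog: "\<phi> \<in> homog (dual V) i \<longleftrightarrow> \<phi> \<in> carrier (dual V) \<and>
    (\<forall>j<p. (i + j) mod p \<noteq> 0 \<longrightarrow> (\<forall>v\<in>homog V j. \<phi> v = 0))"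
  by (auto simp: dual_def)

lemma vecsp_dual:
  assumes "vecsp V"
  shows "vecsp (dual V)"
proof (rule vecspI)
  have r: "restrict f (carrier V) \<in> carrier (dual V)" if "lin V \<I> f" for f
    using lin_restrict[OF that] by (simp add: dual_carrier)
  show "\<zero>\<^bsub>dual V\<^esub> \<in> carrier (dual V)"
    using lin_zero_map[OF assms, of \<I>] by (simp add: r)
  show "\<phi> \<oplus>\<^bsub>dual V\<^esub> \<psi> \<in> carrier (dual V)" if "\<phi> \<in> carrier (dual V)" "\<psi> \<in> carrier (dual V)" for \<phi> \<psi>
    using that lin_add_map[of V \<I> \<phi> \<psi>] by (simp add: r dual_carrier[of \<phi>] dual_carrier[of \<psi>])
  show "c \<odot>\<^bsub>dual V\<^esub> \<phi> \<in> carrier (dual V)" if "\<phi> \<in> carrier (dual V)" for \<phi> c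
    using that lin_smult_map[of V \<I> \<phi> c] by (simp add: r dual_carrier[of \<phi>])
qed (auto simp: dual_carrier fun_eq_iff restrict_def extensional_def algebra_simps assms)

lemma dual_eqI:
  assumes "\<phi> \<in> carrier \<D>" "\<psi> \<in> carrier \<D>" "\<And>i. i < p \<Longrightarrow> \<phi> (\<x> i) = \<psi> (\<x> i)"
  shows "\<phi> = \<psi>"
proof (rule extensionalityI)
  show "\<phi> \<in> extensional (carrier \<A>)" "\<psi> \<in> extensional (carrier \<A>)"
    using assms(1,2) unfolding dual_carrier by blast+
  show "\<phi> f = \<psi> f" if "f \<in> carrier \<A>" for f
    by (rule generates_lin_eq[OF generates_trunc, of \<I>])
      (use assms that in \<open>auto simp: dual_carrier\<close>)
qed

lemma delta_carrier [simp]: "\<delta> n \<in> carrier \<D>"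
  unfolding dual_carrier \<delta>_def
  by (intro conjI lin_restrict linI vecsp_trunc) auto

lemma delta_xpow [simp]: "i < p \<Longrightarrow> \<delta> n (\<x> i) = (if n = i then 1 else 0)"
  by (simp add: \<delta>_def degree_monom_eq)

lemma dual_simps_xpow [simp]:
  "i < p \<Longrightarrow> (\<phi> \<oplus>\<^bsub>\<D>\<^esub> \<psi>) (\<x> i) = \<phi> (\<x> i) + \<psi> (\<x> i)"
  "i < p \<Longrightarrow> (c \<odot>\<^bsub>\<D>\<^esub> \<phi>) (\<x> i) = c * \<phi> (\<x> i)" "i < p \<Longrightarrow> \<zero>\<^bsub>\<D>\<^esub> (\<x> i) = 0"
  by (simp_all add: degree_monom_eq)

lemma dual_eval_lin: "f \<in> carrier \<A> \<Longrightarrow> lin \<D> \<I> (\<lambda>\<phi>. \<phi> f)"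
  by (rule linI) (auto intro: vecsp_dual vecsp_trunc)

lemma dual_expand:
  assumes "\<phi> \<in> carrier \<D>"
  shows "finsum \<D> (\<lambda>n. \<phi> (\<x> n) \<odot>\<^bsub>\<D>\<^esub> \<delta> n) {..<p} = \<phi>"
proof (rule dual_eqI)
  have vD: "vecsp \<D>" by (rule vecsp_dual[OF vecsp_trunc])
  have cl: "\<phi> (\<x> n) \<odot>\<^bsub>\<D>\<^esub> \<delta> n \<in> carrier \<D>" for n by (rule vecsp_closed(3)[OF vD delta_carrier])
  show "finsum \<D> (\<lambda>n. \<phi> (\<x> n) \<odot>\<^bsub>\<D>\<^esub> \<delta> n) {..<p} \<in> carrier \<D>"
    using cl by (rule vecsp_finsum_closed[OF vD])
  show "\<phi> \<in> carrier \<D>" by fact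
  fix i assume i: "i < p"
  have "finsum \<D> (\<lambda>n. \<phi> (\<x> n) \<odot>\<^bsub>\<D>\<^esub> \<delta> n) {..<p} (\<x> i) = (\<Sum>n<p. (\<phi> (\<x> n) \<odot>\<^bsub>\<D>\<^esub> \<delta> n) (\<x> i))"
    using lin_finsum[OF dual_eval_lin[OF xpow_carrier[OF i]], of "{..<p}" "\<lambda>n. \<phi> (\<x> n) \<odot>\<^bsub>\<D>\<^esub> \<delta> n"] cl
    by (simp add: finsum_unit del: dual_simps)
  also have "\<dots> = (\<Sum>n<p. if n = i then \<phi> (\<x> i) else 0)"
    using i by (intro sum.cong refl) (simp del: dual_simps)
  also have "\<dots> = \<phi> (\<x> i)" using i by simp
  finally show "finsum \<D> (\<lambda>n. \<phi> (\<x> n) \<odot>\<^bsub>\<D>\<^esub> \<delta> n) {..<p} (\<x> i) = \<phi> (\<x> i)" .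
qed

lemma generates_dual: "generates \<D> (\<delta> ` {..<p})"
  unfolding generates_def
proof (intro conjI allI impI vecsp_dual vecsp_trunc)
  show "\<delta> ` {..<p} \<subseteq> carrier \<D>" using delta_carrier by blast
  fix U assume U: "VectorSpace.subspace scalars U \<D>" "\<delta> ` {..<p} \<subseteq> U"
  show "carrier \<D> \<subseteq> U"
  proof
    fix \<phi> assume \<phi>: "\<phi> \<in> carrier \<D>"
    have "finsum \<D> (\<lambda>n. \<phi> (\<x> n) \<odot>\<^bsub>\<D>\<^esub> \<delta> n) {..<p} \<in> U"
      by (rule subspace_finsum[OF U(1)], rule subspace_closed(4)[OF U(1)]) (use U(2) in blast)
    then show "\<phi> \<in> U" using dual_expand[OF \<phi>] by simp
  qed
qed

text \<open>The representative of \<open>- l\<close> modulo \<open>p\<close>, which is the degree of \<open>\<delta> l\<close>.\<close>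

definition codeg :: "nat \<Rightarrow> nat" where "codeg l = (p - l) mod p"

lemma codeg: "l < p \<Longrightarrow> j < p \<Longrightarrow> (l + j) mod p = 0 \<longleftrightarrow> j = codeg l" "codeg l < p"
  "l < p \<Longrightarrow> codeg (codeg l) = l"
proof -
  show "codeg l < p" by (simp add: codeg_def)
  show *: "(l + j) mod p = 0 \<longleftrightarrow> j = codeg l" if "l < p" "j < p" for l j
  proof (cases "l + j < p")
    case True
    then show ?thesis using that by (cases "l = 0") (auto simp: codeg_def)
  next
    case False
    then have "(l + j) mod p = l + j - p" using that by (simp add: mod_if)
    then show ?thesis using that False by (cases "l = 0") (auto simp: codeg_def)
  qed
  show "l < p \<Longrightarrow> codeg (codeg l) = l"
    using *[of "codeg l" l] *[of l "codeg l"] by (simp add: codeg_def add.commute)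
qed

lemma codeg_mod: "n \<le> p \<Longrightarrow> int (codeg n) mod int p = (- int n) mod int p"
  by (simp add: codeg_def zmod_int of_nat_diff)

lemma codeg_bij: "inj_on codeg {..<p}" "codeg ` {..<p} = {..<p}"
proof -
  show "inj_on codeg {..<p}" using codeg(3) by (metis inj_onI lessThan_iff)
  show "codeg ` {..<p} = {..<p}"
  proof (rule Set.set_eqI)
    fix i
    have "codeg (codeg i) \<in> codeg ` {..<p}" by (rule imageI) (simp add: codeg(2))
    then show "i \<in> codeg ` {..<p} \<longleftrightarrow> i \<in> {..<p}"
      using codeg(2) codeg(3)[of i] by (metis imageE lessThan_iff)
  qed
qed

lemma dual_homog_iff:
  assumes "l < p"
  shows "\<phi> \<in> homog \<D> l \<longleftrightarrow> \<phi> \<in> carrier \<D> \<and> (\<forall>j<p. j \<noteq> codeg l \<longrightarrow> \<phi> (\<x> j) = 0)"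
proof -
  have "(\<forall>v\<in>homog \<A> j. \<phi> v = 0) \<longleftrightarrow> \<phi> (\<x> j) = 0" if "\<phi> \<in> carrier \<D>" "j < p" for j
  proof
    assume 0: "\<phi> (\<x> j) = 0"
    have l: "lin \<A> \<I> \<phi>" using that(1) unfolding dual_carrier by blast
    show "\<forall>v\<in>homog \<A> j. \<phi> v = 0"
    proof
      fix v assume "v \<in> homog \<A> j"
      then obtain c where "v = c \<odot>\<^bsub>\<A>\<^esub> \<x> j" by (auto simp: smult_monom)
      then show "\<phi> v = 0" using lin_smult[OF l xpow_carrier[OF that(2)], of c] 0 by simp
    qed
  qed simp
  then show ?thesis unfolding dual_homog using codeg(1)[OF assms] by auto
qed

lemma delta_homog: "n < p \<Longrightarrow> \<delta> n \<in> homog \<D> (codeg n)"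
  by (simp add: dual_homog_iff codeg del: dual_simps)

lemma graded_dual: "graded_space \<D>"
proof (rule graded_spaceI[where pr = "\<lambda>l \<phi>. \<phi> (\<x> (codeg l)) \<odot>\<^bsub>\<D>\<^esub> \<delta> (codeg l)"])
  have vD: "vecsp \<D>" by (rule vecsp_dual[OF vecsp_trunc])
  show "fd_space \<D>" unfolding fd_space_iff_generates using generates_dual by (intro exI[of _ "\<delta> ` {..<p}"]) simp
  have cl: "\<phi> (\<x> n) \<odot>\<^bsub>\<D>\<^esub> \<delta> n \<in> carrier \<D>" for n \<phi> by (rule vecsp_closed(3)[OF vD delta_carrier])
  fix l assume l: "l < p"
  show sub: "VectorSpace.subspace scalars (homog \<D> l) \<D>"
    using vecsp_closed[OF vD] by (intro submoduleI[OF vD]) (auto simp: dual_homog_iff[OF l] simp del: dual_simps)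
  show "lin \<D> \<D> (\<lambda>\<phi>. \<phi> (\<x> (codeg l)) \<odot>\<^bsub>\<D>\<^esub> \<delta> (codeg l))"
    by (rule linI[OF vD vD cl]; rule dual_eqI) (auto simp: cl vecsp_closed[OF vD] codeg(2) algebra_simps simp del: dual_simps)
  show "\<phi> (\<x> (codeg l)) \<odot>\<^bsub>\<D>\<^esub> \<delta> (codeg l) \<in> homog \<D> l" if "\<phi> \<in> carrier \<D>" for \<phi>
    unfolding dual_homog_iff[OF l] using cl by (auto simp del: dual_simps)
  show "\<phi> (\<x> (codeg l)) \<odot>\<^bsub>\<D>\<^esub> \<delta> (codeg l) = (if l = m then \<phi> else \<zero>\<^bsub>\<D>\<^esub>)"
    if m: "m < p" and \<phi>: "\<phi> \<in> homog \<D> m" for m \<phi>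
  proof (rule dual_eqI)
    have inj: "codeg l = codeg m \<longleftrightarrow> l = m" using codeg(3)[OF l] codeg(3)[OF m] by metis
    have \<phi>D: "\<phi> \<in> carrier \<D>" using \<phi> unfolding dual_homog_iff[OF m] by blast
    show "\<phi> (\<x> (codeg l)) \<odot>\<^bsub>\<D>\<^esub> \<delta> (codeg l) \<in> carrier \<D>" by (rule cl)
    show "(if l = m then \<phi> else \<zero>\<^bsub>\<D>\<^esub>) \<in> carrier \<D>" using \<phi>D vecsp_closed(1)[OF vD] by simp
    fix i assume i: "i < p"
    show "(\<phi> (\<x> (codeg l)) \<odot>\<^bsub>\<D>\<^esub> \<delta> (codeg l)) (\<x> i) = (if l = m then \<phi> else \<zero>\<^bsub>\<D>\<^esub>) (\<x> i)"
      using \<phi> i codeg(2)[of l] inj unfolding dual_homog_iff[OF m] by (auto simp del: dual_simps)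
  qed
next
  have vD: "vecsp \<D>" by (rule vecsp_dual[OF vecsp_trunc])
  interpret abelian_monoid \<D> by (rule vecsp_monoid[OF vD])
  fix \<phi> assume \<phi>: "\<phi> \<in> carrier \<D>"
  have cl: "\<phi> (\<x> n) \<odot>\<^bsub>\<D>\<^esub> \<delta> n \<in> carrier \<D>" for n by (rule vecsp_closed(3)[OF vD delta_carrier])
  note im = codeg_bij(2)
  have "inj_on codeg {..<p}" by (rule codeg_bij(1))
  then have "finsum \<D> (\<lambda>n. \<phi> (\<x> n) \<odot>\<^bsub>\<D>\<^esub> \<delta> n) (codeg ` {..<p})
      = finsum \<D> (\<lambda>l. \<phi> (\<x> (codeg l)) \<odot>\<^bsub>\<D>\<^esub> \<delta> (codeg l)) {..<p}"
    using cl by (intro finsum_reindex) auto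
  then show "finsum \<D> (\<lambda>l. \<phi> (\<x> (codeg l)) \<odot>\<^bsub>\<D>\<^esub> \<delta> (codeg l)) {..<p} = \<phi>"
    using dual_expand[OF \<phi>] by (simp add: im del: dual_simps)
qed

section \<open>Evaluation, coevaluation and adjoints\<close>

lemma ev_arr:
  shows arrow_ev: "arrow (ev \<A>) (\<A> \<boxtimes> \<D>) \<I>"
    and Fun_ev: "f \<in> carrier \<A> \<Longrightarrow> \<phi> \<in> carrier \<D> \<Longrightarrow> Fun (ev \<A>) (pure \<A> \<D> f \<phi>) = \<phi> f"
proof -
  have b: "bilin \<A> \<D> \<I> (\<lambda>f \<phi>. \<phi> f)"
    unfolding bilin_def using dual_eval_lin by (auto simp: dual_carrier)
  let ?e = "bilin_arr \<A> \<D> \<I> (\<lambda>f \<phi>. \<phi> f)"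
  have e: "arrow ?e (\<A> \<boxtimes> \<D>) \<I>"
  proof (rule arrow_bilin[OF graded_trunc graded_dual graded_unit b])
    fix i j f \<phi> assume "i < p" "j < p" "f \<in> homog \<A> i" "\<phi> \<in> homog \<D> j"
    then show "\<phi> f \<in> homog \<I> ((i + j) mod p)"
      unfolding dual_homog by (auto simp: add.commute)
  qed
  have ep: "Fun ?e (pure \<A> \<D> f \<phi>) = \<phi> f" if "f \<in> carrier \<A>" "\<phi> \<in> carrier \<D>" for f \<phi>
    by (rule Fun_bilin[OF graded_unit b that])
  have "ev \<A> = ?e"
    unfolding ev_def by (rule arrow_tensor_unique[OF e ep graded_trunc graded_dual])
  then show "arrow (ev \<A>) (\<A> \<boxtimes> \<D>) \<I>"
    "f \<in> carrier \<A> \<Longrightarrow> \<phi> \<in> carrier \<D> \<Longrightarrow> Fun (ev \<A>) (pure \<A> \<D> f \<phi>) = \<phi> f"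
    using e ep by simp_all
qed

lemma ev_id_arr:
  assumes U: "graded_space U"
  shows arrow_ev_id: "arrow (ev_id \<A> U) (\<A> \<boxtimes> (\<D> \<boxtimes> U)) U"
    and Fun_ev_id: "f \<in> carrier \<A> \<Longrightarrow> \<phi> \<in> carrier \<D> \<Longrightarrow> u \<in> carrier U \<Longrightarrow>
      Fun (ev_id \<A> U) (pure \<A> (\<D> \<boxtimes> U) f (pure \<D> U \<phi> u)) = \<phi> f \<odot>\<^bsub>U\<^esub> u"
proof -
  note a = arrow_assoc_inv[OF graded_trunc graded_dual U] and e = arrow_tensor[OF arrow_ev arrow_id[OF U]]
  note ae = arrow_comp[OF a e]
  show "arrow (ev_id \<A> U) (\<A> \<boxtimes> (\<D> \<boxtimes> U)) U"
    unfolding ev_id_def by (rule arrow_comp[OF ae arrow_lunit[OF U]])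
  assume c: "f \<in> carrier \<A>" "\<phi> \<in> carrier \<D>" "u \<in> carrier U"
  show "Fun (ev_id \<A> U) (pure \<A> (\<D> \<boxtimes> U) f (pure \<D> U \<phi> u)) = \<phi> f \<odot>\<^bsub>U\<^esub> u"
    unfolding ev_id_def
    by (simp add: Fun_comp_arrow[OF ae] Fun_comp_arrow[OF a] pure_carrier c
        Fun_assoc_inv[OF graded_trunc graded_dual U c] Fun_tensor[OF arrow_ev arrow_id[OF U] pure_carrier[OF c(1,2)] c(3)]
        Fun_ev[OF c(1,2)] Fun_lunit[OF U c(3)] del: tensor_simps trunc_simps)
qed

text \<open>The coefficient of \<open>\<delta> i\<close>: the vectors \<open>u\<^sub>i\<close> in the unique expansion of \<open>t\<close> as a sum of the
  \<open>\<delta> i \<otimes> u\<^sub>i\<close>.\<close>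

definition coord :: "('k, 'b) gspace \<Rightarrow> nat \<Rightarrow> ('k, 'k poly \<Rightarrow> 'k, 'b) tensor \<Rightarrow> 'b" where
  "coord U i t = Fun (ev_id \<A> U) (pure \<A> (\<D> \<boxtimes> U) (\<x> i) t)"

lemma coord_lin:
  assumes "graded_space U" "i < p"
  shows "lin (\<D> \<boxtimes> U) U (coord U i)"
  unfolding coord_def
  by (rule lin_comp[OF pure_lin(2) arrow_lin[OF arrow_ev_id]])
    (use assms in \<open>simp_all add: vecsp_trunc vecsp_dual vecsp_tensor xpow_carrier del: trunc_simps\<close>)

lemma coord_pure:
  assumes "graded_space U" "i < p" "u \<in> carrier U"
  shows "coord U i (pure \<D> U (\<delta> n) u) = (if n = i then u else \<zero>\<^bsub>U\<^esub>)"
  using Fun_ev_id[OF assms(1) xpow_carrier[OF assms(2)] delta_carrier[of n] assms(3)] assms graded_vecsp[OF assms(1)]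
  by (simp add: coord_def)

lemma generates_dual_tensor:
  assumes "graded_space U"
  shows "generates (\<D> \<boxtimes> U) {pure \<D> U \<phi> u | \<phi> u. \<phi> \<in> \<delta> ` {..<p} \<and> u \<in> carrier U}"
  by (rule generates_tensor[OF generates_dual generates_carrier[OF assms]])

lemma coord_expand:
  assumes U: "graded_space U" and t: "t \<in> carrier (\<D> \<boxtimes> U)"
  shows "finsum (\<D> \<boxtimes> U) (\<lambda>i. pure \<D> U (\<delta> i) (coord U i t)) {..<p} = t"
proof (rule generates_lin_eq[OF generates_dual_tensor[OF U] _ _ _ t])
  note vD = vecsp_dual[OF vecsp_trunc] and vU = graded_vecsp[OF U]
  note vT = vecsp_tensor[OF vD, of U]
  show "lin (\<D> \<boxtimes> U) (\<D> \<boxtimes> U) (\<lambda>t. finsum (\<D> \<boxtimes> U) (\<lambda>i. pure \<D> U (\<delta> i) (coord U i t)) {..<p})"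
  proof (intro lin_finsum_map vT)
    fix i assume "i \<in> {..<p}"
    then show "lin (\<D> \<boxtimes> U) (\<D> \<boxtimes> U) (\<lambda>t. pure \<D> U (\<delta> i) (coord U i t))"
      using lin_comp[OF coord_lin[OF U] pure_lin(2)[OF vD vU delta_carrier]] by simp
  qed simp
  show "lin (\<D> \<boxtimes> U) (\<D> \<boxtimes> U) (\<lambda>t. t)" by (rule lin_id[OF vT])
  fix s assume "s \<in> {pure \<D> U \<phi> u | \<phi> u. \<phi> \<in> \<delta> ` {..<p} \<and> u \<in> carrier U}"
  then obtain n u where s: "s = pure \<D> U (\<delta> n) u" "n < p" "u \<in> carrier U" by auto
  have sc: "s \<in> carrier (\<D> \<boxtimes> U)" unfolding s(1) by (rule pure_carrier[OF delta_carrier s(3)])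
  have z: "pure \<D> U (\<delta> i) \<zero>\<^bsub>U\<^esub> = \<zero>\<^bsub>\<D> \<boxtimes> U\<^esub>" for i by (rule lin_zero[OF pure_lin(2)[OF vD vU delta_carrier]])
  have "finsum (\<D> \<boxtimes> U) (\<lambda>i. pure \<D> U (\<delta> i) (coord U i s)) {..<p}
      = finsum (\<D> \<boxtimes> U) (\<lambda>i. if i = n then s else \<zero>\<^bsub>\<D> \<boxtimes> U\<^esub>) {..<p}"
    using s sc vecsp_closed(1)[OF vT]
    by (intro vecsp_finsum_cong[OF vT]) (auto simp: coord_pure[OF U _ s(3)] z simp del: tensor_simps)
  also have "\<dots> = s" using s sc by (subst finsum_single[OF vT]) auto
  finally show "finsum (\<D> \<boxtimes> U) (\<lambda>i. pure \<D> U (\<delta> i) (coord U i s)) {..<p} = s" .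
qed

lemma coord_sum:
  assumes U: "graded_space U" and u: "\<And>i. i < p \<Longrightarrow> u i \<in> carrier U" and j: "j < p"
  shows "coord U j (finsum (\<D> \<boxtimes> U) (\<lambda>i. pure \<D> U (\<delta> i) (u i)) {..<p}) = u j"
proof -
  note vU = graded_vecsp[OF U]
  have "coord U j (finsum (\<D> \<boxtimes> U) (\<lambda>i. pure \<D> U (\<delta> i) (u i)) {..<p})
      = finsum U (\<lambda>i. coord U j (pure \<D> U (\<delta> i) (u i))) {..<p}"
    by (rule lin_finsum[OF coord_lin[OF U j]]) (rule pure_carrier[OF delta_carrier], simp add: u)
  also have "\<dots> = finsum U (\<lambda>i. if i = j then u j else \<zero>\<^bsub>U\<^esub>) {..<p}"
    using u j vU by (intro vecsp_finsum_cong[OF vU]) (auto simp: coord_pure[OF U j])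
  also have "\<dots> = u j" using j u vU by (simp add: finsum_single)
  finally show ?thesis .
qed

text \<open>The adjoint of \<open>f\<close> evaluated at \<open>\<x> i\<close> is the coordinate \<open>i\<close> of \<open>f\<close>, so \<open>f\<close> is obtained by
  prescribing all coordinates.\<close>

lemma of_adjoint:
  assumes g: "arrow g (\<A> \<boxtimes> U) Y" and U: "graded_space U"
  shows arrow_of_adjoint: "arrow (of_adjoint \<A> U Y g) U (\<D> \<boxtimes> Y)"
    and Fun_of_adjoint: "u \<in> carrier U \<Longrightarrow> Fun (of_adjoint \<A> U Y g) u
      = finsum (\<D> \<boxtimes> Y) (\<lambda>i. pure \<D> Y (\<delta> i) (Fun g (pure \<A> U (\<x> i) u))) {..<p}"
proof -
  note Y = arrow_graded(2)[OF g]
  note vD = vecsp_dual[OF vecsp_trunc] and vU = graded_vecsp[OF U] and vY = graded_vecsp[OF Y]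
  note vT = vecsp_tensor[OF vD, of Y] and T = graded_tensor[OF graded_dual Y]
  let ?F = "\<lambda>u. finsum (\<D> \<boxtimes> Y) (\<lambda>i. pure \<D> Y (\<delta> i) (Fun g (pure \<A> U (\<x> i) u))) {..<p}"
  let ?f = "mk_arr U (\<D> \<boxtimes> Y) ?F"
  have gc: "Fun g (pure \<A> U (\<x> i) u) \<in> carrier Y" if "i < p" "u \<in> carrier U" for i u
    by (rule arrow_closed[OF g pure_carrier[OF xpow_carrier[OF that(1)] that(2)]])
  have f: "arrow ?f U (\<D> \<boxtimes> Y)"
  proof (rule arrow_mk[OF U T])
    show "lin U (\<D> \<boxtimes> Y) ?F"
    proof (intro lin_finsum_map vU vT)
      fix i assume "i \<in> {..<p}"
      then show "lin U (\<D> \<boxtimes> Y) (\<lambda>u. pure \<D> Y (\<delta> i) (Fun g (pure \<A> U (\<x> i) u)))"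
        using lin_comp[OF lin_comp[OF pure_lin(2)[OF vecsp_trunc vU xpow_carrier] arrow_lin[OF g]]
            pure_lin(2)[OF vD vY delta_carrier]] by simp
    qed simp
    fix l u assume l: "l < p" "u \<in> homog U l"
    show "?F u \<in> homog (\<D> \<boxtimes> Y) l"
    proof (rule subspace_finsum[OF graded_homog[OF T l(1)]])
      fix i assume "i \<in> {..<p}"
      then have i: "i < p" by simp
      have xi: "\<x> i \<in> homog \<A> i" by simp
      have "Fun g (pure \<A> U (\<x> i) u) \<in> homog Y ((i + l) mod p)"
        by (rule arrow_homog[OF g _ homog_pure[OF i l(1) xi l(2)]]) simp
      then have "pure \<D> Y (\<delta> i) (Fun g (pure \<A> U (\<x> i) u)) \<in> homog (\<D> \<boxtimes> Y) ((codeg i + (i + l) mod p) mod p)"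
        using delta_homog[OF i] codeg(2) by (intro homog_pure) simp_all
      moreover have "(codeg i + (i + l) mod p) mod p = l"
      proof -
        have "(codeg i + (i + l) mod p) mod p = ((i + codeg i) mod p + l) mod p"
          by (simp add: mod_add_left_eq mod_add_right_eq ac_simps)
        also have "(i + codeg i) mod p = 0" using codeg(1)[OF i codeg(2)] by simp
        finally show ?thesis using l(1) by simp
      qed
      ultimately show "pure \<D> Y (\<delta> i) (Fun g (pure \<A> U (\<x> i) u)) \<in> homog (\<D> \<boxtimes> Y) l" by simp
    qed
  qed
  have ff: "Fun ?f u = ?F u" if "u \<in> carrier U" for u using that by simp
  have evf: "ev_id \<A> Y \<circ>\<^sub>a (id_arr \<A> \<star> h) = g \<longleftrightarrow>
      (\<forall>i<p. \<forall>u\<in>carrier U. coord Y i (Fun h u) = Fun g (pure \<A> U (\<x> i) u))"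
    if h: "arrow h U (\<D> \<boxtimes> Y)" for h
  proof -
    note Ih = arrow_tensor[OF arrow_id[OF graded_trunc] h]
    note a = arrow_comp[OF Ih arrow_ev_id[OF Y]]
    have v: "Fun (ev_id \<A> Y \<circ>\<^sub>a (id_arr \<A> \<star> h)) (pure \<A> U (\<x> i) u) = coord Y i (Fun h u)"
      if "i < p" "u \<in> carrier U" for i u
      using that by (simp add: Fun_comp_arrow[OF Ih] pure_carrier Fun_tensor[OF arrow_id[OF graded_trunc] h]
          coord_def xpow_carrier del: trunc_simps tensor_simps)
    show ?thesis
    proof
      assume "\<forall>i<p. \<forall>u\<in>carrier U. coord Y i (Fun h u) = Fun g (pure \<A> U (\<x> i) u)"
      then show "ev_id \<A> Y \<circ>\<^sub>a (id_arr \<A> \<star> h) = g"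
        using v by (intro arrow_tensor_eqI[OF a g generates_trunc generates_carrier[OF U]]) auto
    qed (use v in metis)
  qed
  have "of_adjoint \<A> U Y g = ?f"
    unfolding of_adjoint_def
  proof (rule the_arrow[OF f])
    show "ev_id \<A> Y \<circ>\<^sub>a (id_arr \<A> \<star> ?f) = g"
      unfolding evf[OF f] using coord_sum[OF Y gc] by (simp add: ff)
    fix h assume h: "arrow h U (\<D> \<boxtimes> Y)" "ev_id \<A> Y \<circ>\<^sub>a (id_arr \<A> \<star> h) = g"
    then have c: "coord Y i (Fun h u) = Fun g (pure \<A> U (\<x> i) u)" if "i < p" "u \<in> carrier U" for i u
      unfolding evf[OF h(1)] using that by blast
    show "h = ?f"
    proof (rule arrow_eqI[OF h(1) f generates_carrier[OF U]])
      fix u assume u: "u \<in> carrier U"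
      have "Fun h u = finsum (\<D> \<boxtimes> Y) (\<lambda>i. pure \<D> Y (\<delta> i) (coord Y i (Fun h u))) {..<p}"
        using coord_expand[OF Y arrow_closed[OF h(1) u]] by simp
      also have "\<dots> = ?F u"
        by (rule vecsp_finsum_cong[OF vT], rule pure_carrier[OF delta_carrier gc]) (use u c in auto)
      finally show "Fun h u = Fun ?f u" using ff[OF u] by simp
    qed
  qed
  then show "arrow (of_adjoint \<A> U Y g) U (\<D> \<boxtimes> Y)" "u \<in> carrier U \<Longrightarrow> Fun (of_adjoint \<A> U Y g) u = ?F u"
    using f ff by simp_all
qed

lemma of_adjoint_unit:
  assumes g: "arrow g (\<A> \<boxtimes> U) \<I>" and U: "graded_space U"
  shows arrow_of_adjoint_unit: "arrow (of_adjoint_unit \<A> U g) U \<D>"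
    and Fun_of_adjoint_unit: "u \<in> carrier U \<Longrightarrow> f \<in> carrier \<A> \<Longrightarrow>
      Fun (of_adjoint_unit \<A> U g) u f = Fun g (pure \<A> U f u)"
proof -
  note vU = graded_vecsp[OF U]
  let ?F = "\<lambda>u. restrict (\<lambda>f. Fun g (pure \<A> U f u)) (carrier \<A>)"
  let ?f = "mk_arr U \<D> ?F"
  have l1: "lin \<A> \<I> (\<lambda>f. Fun g (pure \<A> U f u))" if "u \<in> carrier U" for u
    by (rule lin_comp[OF pure_lin(1)[OF vecsp_trunc vU that] arrow_lin[OF g]])
  have l2: "lin U \<I> (\<lambda>u. Fun g (pure \<A> U f u))" if "f \<in> carrier \<A>" for f
    by (rule lin_comp[OF pure_lin(2)[OF vecsp_trunc vU that] arrow_lin[OF g]])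
  have Fc: "?F u \<in> carrier \<D>" if "u \<in> carrier U" for u
    unfolding dual_carrier using lin_restrict[OF l1[OF that]] by simp
  have f: "arrow ?f U \<D>"
  proof (rule arrow_mk[OF U graded_dual])
    show "lin U \<D> ?F"
      using Fc lin_add[OF l2] lin_smult[OF l2]
      by (intro linI vU vecsp_dual vecsp_trunc) (auto simp: restrict_def fun_eq_iff simp del: trunc_simps)
    fix l u assume l: "l < p" "u \<in> homog U l"
    show "?F u \<in> homog \<D> l"
      unfolding dual_homog
    proof (intro conjI allI impI ballI)
      show "?F u \<in> carrier \<D>" by (rule Fc[OF homog_carrier[OF U l]])
      fix j v assume j: "j < p" "(l + j) mod p \<noteq> 0" "v \<in> homog \<A> j"
      have "Fun g (pure \<A> U v u) \<in> homog \<I> ((j + l) mod p)"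
        by (rule arrow_homog[OF g _ homog_pure[OF j(1) l(1) j(3) l(2)]]) simp
      then show "?F u v = 0" using j homog_carrier[OF graded_trunc j(1,3)] by (simp add: add.commute del: trunc_simps)
    qed
  qed
  have evf: "ev \<A> \<circ>\<^sub>a (id_arr \<A> \<star> h) = g \<longleftrightarrow>
      (\<forall>f\<in>carrier \<A>. \<forall>u\<in>carrier U. Fun h u f = Fun g (pure \<A> U f u))"
    if h: "arrow h U \<D>" for h
  proof -
    note Ih = arrow_tensor[OF arrow_id[OF graded_trunc] h]
    note a = arrow_comp[OF Ih arrow_ev]
    have v: "Fun (ev \<A> \<circ>\<^sub>a (id_arr \<A> \<star> h)) (pure \<A> U f u) = Fun h u f"
      if "f \<in> carrier \<A>" "u \<in> carrier U" for f u
      using that by (simp add: Fun_comp_arrow[OF Ih] pure_carrier Fun_tensor[OF arrow_id[OF graded_trunc] h]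
          Fun_ev arrow_closed[OF h] del: trunc_simps tensor_simps)
    show ?thesis
    proof
      assume "\<forall>f\<in>carrier \<A>. \<forall>u\<in>carrier U. Fun h u f = Fun g (pure \<A> U f u)"
      then show "ev \<A> \<circ>\<^sub>a (id_arr \<A> \<star> h) = g"
        using v by (intro arrow_tensor_eqI[OF a g generates_carrier[OF graded_trunc] generates_carrier[OF U]]) auto
    qed (use v in metis)
  qed
  have ff: "Fun ?f u = ?F u" if "u \<in> carrier U" for u using that by simp
  have "of_adjoint_unit \<A> U g = ?f"
    unfolding of_adjoint_unit_def
  proof (rule the_arrow[OF f])
    show "ev \<A> \<circ>\<^sub>a (id_arr \<A> \<star> ?f) = g"
      unfolding evf[OF f] by (simp add: ff)
    fix h assume h: "arrow h U \<D>" "ev \<A> \<circ>\<^sub>a (id_arr \<A> \<star> h) = g"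
    show "h = ?f"
    proof (rule arrow_eqI[OF h(1) f generates_carrier[OF U]])
      fix u assume u: "u \<in> carrier U"
      have "Fun h u \<in> extensional (carrier \<A>)"
        using arrow_closed[OF h(1) u] unfolding dual_carrier by blast
      then have "Fun h u = ?F u"
        using h(2) u unfolding evf[OF h(1)] by (intro extensionalityI[of _ "carrier \<A>"]) auto
      then show "Fun h u = Fun ?f u" using ff[OF u] by simp
    qed
  qed
  then show "arrow (of_adjoint_unit \<A> U g) U \<D>"
    "u \<in> carrier U \<Longrightarrow> f \<in> carrier \<A> \<Longrightarrow> Fun (of_adjoint_unit \<A> U g) u f = Fun g (pure \<A> U f u)"
    using f ff by (simp_all del: trunc_simps)
qed

text \<open>The first zigzag identity alone determines the coordinates of the value at \<open>1\<close>.  That the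
  resulting arrow satisfies the second one is the expansion of a functional in the basis \<open>\<delta>\<close>.\<close>

lemma coev_arr:
  shows arrow_coev: "arrow (coev \<A>) \<I> (\<D> \<boxtimes> \<A>)"
    and Fun_coev: "Fun (coev \<A>) 1 = finsum (\<D> \<boxtimes> \<A>) (\<lambda>i. pure \<D> \<A> (\<delta> i) (\<x> i)) {..<p}"
proof -
  note vD = vecsp_dual[OF vecsp_trunc]
  note vT = vecsp_tensor[OF vD, of \<A>]
  note r = arrow_runit[OF graded_trunc]
  define c where "c = of_adjoint \<A> \<I> \<A> (runit \<A>)"
  have c: "arrow c \<I> (\<D> \<boxtimes> \<A>)" unfolding c_def by (rule arrow_of_adjoint[OF r graded_unit])
  have c1: "Fun c 1 = finsum (\<D> \<boxtimes> \<A>) (\<lambda>i. pure \<D> \<A> (\<delta> i) (\<x> i)) {..<p}"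
    unfolding c_def
    by (subst Fun_of_adjoint[OF r graded_unit])
      (auto intro!: vecsp_finsum_cong[OF vT] pure_carrier simp: Fun_runit[OF graded_trunc] xpow_carrier
        simp del: tensor_simps trunc_simps, auto)
  have pc: "pure \<D> \<A> (\<delta> i) (\<x> i) \<in> carrier (\<D> \<boxtimes> \<A>)" if "i \<in> {..<p}" for i
    using that by (intro pure_carrier delta_carrier) simp_all
  have zig1: "ev_id \<A> \<A> \<circ>\<^sub>a (id_arr \<A> \<star> h) = runit \<A> \<longleftrightarrow>
      (\<forall>i<p. coord \<A> i (Fun h 1) = \<x> i)" if h: "arrow h \<I> (\<D> \<boxtimes> \<A>)" for h
  proof -
    note Ih = arrow_tensor[OF arrow_id[OF graded_trunc] h]
    note a = arrow_comp[OF Ih arrow_ev_id[OF graded_trunc]]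
    have v: "Fun (ev_id \<A> \<A> \<circ>\<^sub>a (id_arr \<A> \<star> h)) (pure \<A> \<I> (\<x> i) 1) = coord \<A> i (Fun h 1)" if "i < p" for i
      using that by (simp add: Fun_comp_arrow[OF Ih] pure_carrier Fun_tensor[OF arrow_id[OF graded_trunc] h]
          coord_def xpow_carrier del: trunc_simps tensor_simps)
    have rv: "Fun (runit \<A>) (pure \<A> \<I> (\<x> i) 1) = \<x> i" if "i < p" for i
      using Fun_runit[OF graded_trunc xpow_carrier[OF that], of 1] by simp
    show ?thesis
    proof
      assume "\<forall>i<p. coord \<A> i (Fun h 1) = \<x> i"
      then show "ev_id \<A> \<A> \<circ>\<^sub>a (id_arr \<A> \<star> h) = runit \<A>"
        using v rv by (intro arrow_tensor_eqI[OF a r generates_trunc generates_unit]) auto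
    qed (use v rv in metis)
  qed
  have cc: "coord \<A> i (Fun c 1) = \<x> i" if "i < p" for i
    unfolding c1 by (rule coord_sum[OF graded_trunc xpow_carrier that])
  note cI = arrow_tensor[OF c arrow_id[OF graded_dual]]
    and as = arrow_assoc[OF graded_dual graded_trunc graded_dual]
    and Ie = arrow_tensor[OF arrow_id[OF graded_dual] arrow_ev]
    and rD = arrow_runit[OF graded_dual]
  have zig2: "runit \<D> \<circ>\<^sub>a (id_arr \<D> \<star> ev \<A>) \<circ>\<^sub>a assoc \<D> \<A> \<D> \<circ>\<^sub>a (c \<star> id_arr \<D>) = lunit \<D>"
  proof (rule arrow_tensor_eqI[OF _ arrow_lunit[OF graded_dual] generates_carrier[OF graded_unit] generates_carrier[OF graded_dual]])
    note h1 = arrow_comp[OF as Ie] note h2 = arrow_comp[OF h1 rD]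
    have eq: "runit \<D> \<circ>\<^sub>a (id_arr \<D> \<star> ev \<A>) \<circ>\<^sub>a assoc \<D> \<A> \<D> \<circ>\<^sub>a (c \<star> id_arr \<D>)
      = (runit \<D> \<circ>\<^sub>a (id_arr \<D> \<star> ev \<A>) \<circ>\<^sub>a assoc \<D> \<A> \<D>) \<circ>\<^sub>a (c \<star> id_arr \<D>)"
      using arrow_comp_assoc[OF cI as Ie] arrow_comp_assoc[OF cI h1 rD] by simp
    show ar: "arrow (runit \<D> \<circ>\<^sub>a (id_arr \<D> \<star> ev \<A>) \<circ>\<^sub>a assoc \<D> \<A> \<D> \<circ>\<^sub>a (c \<star> id_arr \<D>)) (\<I> \<boxtimes> \<D>) \<D>"
      unfolding eq by (rule arrow_comp[OF cI h2])
    fix k :: 'k and \<phi> assume \<phi>: "\<phi> \<in> carrier \<D>"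
    let ?G = "\<lambda>t. Fun (runit \<D> \<circ>\<^sub>a (id_arr \<D> \<star> ev \<A>) \<circ>\<^sub>a assoc \<D> \<A> \<D>) (pure (\<D> \<boxtimes> \<A>) \<D> t \<phi>)"
    have Gl: "lin (\<D> \<boxtimes> \<A>) \<D> ?G"
      by (rule lin_comp[OF pure_lin(1)[OF vT vD \<phi>] arrow_lin[OF h2]])
    have G: "?G (pure \<D> \<A> (\<delta> i) (\<x> i)) = \<phi> (\<x> i) \<odot>\<^bsub>\<D>\<^esub> \<delta> i" if "i < p" for i
      using that \<phi> xpow_carrier[OF that]
      by (simp add: Fun_comp_arrow[OF h1] Fun_comp_arrow[OF as] pure_carrier Fun_assoc[OF graded_dual graded_trunc graded_dual]
          Fun_tensor[OF arrow_id[OF graded_dual] arrow_ev] Fun_ev Fun_runit[OF graded_dual]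
          del: trunc_simps tensor_simps dual_simps)
    have "Fun c k = k \<odot>\<^bsub>\<D> \<boxtimes> \<A>\<^esub> Fun c 1" using lin_smult[OF arrow_lin[OF c], of 1 k] by simp
    then have "?G (Fun c k) = k \<odot>\<^bsub>\<D>\<^esub> ?G (Fun c 1)"
      using lin_smult[OF Gl arrow_closed[OF c], of 1 k] by (simp del: tensor_simps dual_simps)
    also have "?G (Fun c 1) = finsum \<D> (\<lambda>i. ?G (pure \<D> \<A> (\<delta> i) (\<x> i))) {..<p}"
      unfolding c1 by (rule lin_finsum[OF Gl pc])
    also have "\<dots> = finsum \<D> (\<lambda>i. \<phi> (\<x> i) \<odot>\<^bsub>\<D>\<^esub> \<delta> i) {..<p}"
      using G by (intro vecsp_finsum_cong[OF vD] vecsp_closed(3)[OF vD delta_carrier]) simp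
    also have "\<dots> = \<phi>" by (rule dual_expand[OF \<phi>])
    finally have "?G (Fun c k) = k \<odot>\<^bsub>\<D>\<^esub> \<phi>" .
    then show "Fun (runit \<D> \<circ>\<^sub>a (id_arr \<D> \<star> ev \<A>) \<circ>\<^sub>a assoc \<D> \<A> \<D> \<circ>\<^sub>a (c \<star> id_arr \<D>)) (pure \<I> \<D> k \<phi>)
        = Fun (lunit \<D>) (pure \<I> \<D> k \<phi>)"
      unfolding eq using \<phi>
      by (simp add: Fun_comp_arrow[OF cI] pure_carrier Fun_tensor[OF c arrow_id[OF graded_dual]] Fun_lunit[OF graded_dual]
          del: tensor_simps dual_simps)
  qed
  have "coev \<A> = c"
    unfolding coev_def
  proof (rule the_arrow[OF c])
    show "ev_id \<A> \<A> \<circ>\<^sub>a (id_arr \<A> \<star> c) = runit \<A> \<and>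
      runit \<D> \<circ>\<^sub>a (id_arr \<D> \<star> ev \<A>) \<circ>\<^sub>a assoc \<D> \<A> \<D> \<circ>\<^sub>a (c \<star> id_arr \<D>) = lunit \<D>"
      using zig1[OF c] cc zig2 by blast
    fix h assume h: "arrow h \<I> (\<D> \<boxtimes> \<A>)" "ev_id \<A> \<A> \<circ>\<^sub>a (id_arr \<A> \<star> h) = runit \<A> \<and>
      runit \<D> \<circ>\<^sub>a (id_arr \<D> \<star> ev \<A>) \<circ>\<^sub>a assoc \<D> \<A> \<D> \<circ>\<^sub>a (h \<star> id_arr \<D>) = lunit \<D>"
    have hc: "coord \<A> i (Fun h 1) = \<x> i" if "i < p" for i using zig1[OF h(1)] h(2) that by blast
    have h1: "Fun h 1 \<in> carrier (\<D> \<boxtimes> \<A>)" by (rule arrow_closed[OF h(1)]) simp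
    have "Fun h 1 = finsum (\<D> \<boxtimes> \<A>) (\<lambda>i. pure \<D> \<A> (\<delta> i) (coord \<A> i (Fun h 1))) {..<p}"
      using coord_expand[OF graded_trunc h1] by simp
    also have "\<dots> = Fun c 1"
      unfolding c1 using hc pc by (intro vecsp_finsum_cong[OF vT]) (simp_all del: tensor_simps)
    finally have "Fun h 1 = Fun c 1" .
    then have "Fun h k = Fun c k" for k
      using lin_smult[OF arrow_lin[OF h(1)], of 1 k] lin_smult[OF arrow_lin[OF c], of 1 k] by simp
    then show "h = c" by (intro arrow_eqI[OF h(1) c generates_carrier[OF graded_unit]])
  qed
  then show "arrow (coev \<A>) \<I> (\<D> \<boxtimes> \<A>)"
    "Fun (coev \<A>) 1 = finsum (\<D> \<boxtimes> \<A>) (\<lambda>i. pure \<D> \<A> (\<delta> i) (\<x> i)) {..<p}"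
    using c c1 by simp_all
qed

end

section \<open>Operators that commute up to a scalar\<close>

lemma lin_funpow: "lin V V f \<Longrightarrow> lin V V (f ^^ n)"
proof (induction n)
  case 0
  then show ?case using lin_id[OF lin_vecsp(1)] by (auto simp: id_def)
next
  case (Suc n)
  then show ?case using lin_comp[of V V "f ^^ n" V f] by (simp add: comp_def)
qed

text \<open>The order of \<open>P\<close> and \<open>Q\<close> in the summands is the one in which the terms of the
  comultiplication of a power of \<open>x\<close> are applied below.\<close>

theorem qbinomial:
  assumes P: "lin V V P" and Q: "lin V V Q" and v: "v \<in> carrier V"
    and PQ: "\<And>v. v \<in> carrier V \<Longrightarrow> Q (P v) = q \<odot>\<^bsub>V\<^esub> P (Q v)"
  shows "((\<lambda>v. P v \<oplus>\<^bsub>V\<^esub> Q v) ^^ n) v = finsum V (\<lambda>k. qbin q n k \<odot>\<^bsub>V\<^esub> (P ^^ k) ((Q ^^ (n - k)) v)) {..n}"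
proof (induction n)
  case 0
  interpret abelian_monoid V by (rule vecsp_monoid[OF lin_vecsp(1)[OF P]])
  show ?case using v lin_vecsp(1)[OF P] by simp
next
  case (Suc n)
  note V = lin_vecsp(1)[OF P]
  note cl = lin_closed[OF lin_funpow[OF P]] lin_closed[OF lin_funpow[OF Q]] lin_closed[OF P] lin_closed[OF Q]
  have QP: "Q ((P ^^ k) w) = q ^ k \<odot>\<^bsub>V\<^esub> (P ^^ k) (Q w)" if w: "w \<in> carrier V" for k w
  proof (induction k)
    case 0
    show ?case using w V cl by simp
  next
    case (Suc k)
    then show ?case using w V cl
      by (simp add: PQ lin_smult[OF P] vecsp_smult(1))
  qed
  have ph: "lin V V (\<lambda>v. P v \<oplus>\<^bsub>V\<^esub> Q v)" by (rule lin_add_map[OF P Q])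
  define a where "a k = (P ^^ k) ((Q ^^ (Suc n - k)) v)" for k
  have a: "a k \<in> carrier V" for k using v cl by (simp add: a_def)
  have c: "(P ^^ k) ((Q ^^ (n - k)) v) \<in> carrier V" for k using v cl by simp
  interpret abelian_monoid V by (rule vecsp_monoid[OF V])
  have "((\<lambda>v. P v \<oplus>\<^bsub>V\<^esub> Q v) ^^ Suc n) v
      = finsum V (\<lambda>k. P (qbin q n k \<odot>\<^bsub>V\<^esub> (P ^^ k) ((Q ^^ (n - k)) v)) \<oplus>\<^bsub>V\<^esub> Q (qbin q n k \<odot>\<^bsub>V\<^esub> (P ^^ k) ((Q ^^ (n - k)) v))) {..n}"
    using lin_finsum[OF ph, of "{..n}" "\<lambda>k. qbin q n k \<odot>\<^bsub>V\<^esub> (P ^^ k) ((Q ^^ (n - k)) v)"] Suc V c by simp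
  also have "\<dots> = finsum V (\<lambda>k. qbin q n k \<odot>\<^bsub>V\<^esub> a (Suc k) \<oplus>\<^bsub>V\<^esub> (qbin q n k * q ^ k) \<odot>\<^bsub>V\<^esub> a k) {..n}"
  proof (rule vecsp_finsum_cong[OF V])
    fix k assume "k \<in> {..n}"
    then have e: "Suc n - k = Suc (n - k)" by auto
    show "P (qbin q n k \<odot>\<^bsub>V\<^esub> (P ^^ k) ((Q ^^ (n - k)) v)) \<oplus>\<^bsub>V\<^esub> Q (qbin q n k \<odot>\<^bsub>V\<^esub> (P ^^ k) ((Q ^^ (n - k)) v))
      = qbin q n k \<odot>\<^bsub>V\<^esub> a (Suc k) \<oplus>\<^bsub>V\<^esub> (qbin q n k * q ^ k) \<odot>\<^bsub>V\<^esub> a k"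
      using v V c cl by (simp add: a_def e lin_smult[OF P] lin_smult[OF Q] QP vecsp_smult(1))
  qed (use V a in auto)
  also have "\<dots> = finsum V (\<lambda>k. qbin q n k \<odot>\<^bsub>V\<^esub> a (Suc k)) {..n} \<oplus>\<^bsub>V\<^esub> finsum V (\<lambda>k. (qbin q n k * q ^ k) \<odot>\<^bsub>V\<^esub> a k) {..n}"
    using V a by (intro finsum_addf) auto
  also have "\<dots> = finsum V (\<lambda>k. qbin q (Suc n) k \<odot>\<^bsub>V\<^esub> a k) {..Suc n}"
    by (rule qbin_sum_Suc[OF V a])
  finally show ?case by (simp add: a_def)
qed

section \<open>The Hopf algebra of truncated polynomials\<close>

context zp_root
begin

text \<open>Tensors, truncated polynomials and functionals are from now on treated through pure tensors and
  bases, no longer through their representation by functions.\<close>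

declare tensor_simps [simp del] trunc_simps (1,5) [simp del] dual_simps [simp del] monom_eq_1 [simp del]
declare pure_carrier [simp, intro]

lemma Dom_comp [simp]: "Dom (g \<circ>\<^sub>a f) = Dom f"
  by (simp add: comp_arr_def)

lemma pure_smult:
  assumes "v \<in> carrier V" "w \<in> carrier W"
  shows "pure V W (c \<odot>\<^bsub>V\<^esub> v) w = c \<odot>\<^bsub>V \<boxtimes> W\<^esub> pure V W v w"
    "pure V W v (c \<odot>\<^bsub>W\<^esub> w) = c \<odot>\<^bsub>V \<boxtimes> W\<^esub> pure V W v w"
  using pure_add(3,4)[OF assms] by (simp_all add: tensor_simps)

lemma pure_zero:
  assumes "vecsp V" "vecsp W"
  shows "w \<in> carrier W \<Longrightarrow> pure V W \<zero>\<^bsub>V\<^esub> w = \<zero>\<^bsub>V \<boxtimes> W\<^esub>" "v \<in> carrier V \<Longrightarrow> pure V W v \<zero>\<^bsub>W\<^esub> = \<zero>\<^bsub>V \<boxtimes> W\<^esub>"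
  using lin_zero[OF pure_lin(1)[OF assms]] lin_zero[OF pure_lin(2)[OF assms]] by simp_all

lemma xpow_homog [simp]: "\<x> i \<in> homog \<A> i"
  by (simp add: trunc_simps)

lemma xpow_mult:
  assumes "i < p" "j < p"
  shows "(\<x> i * \<x> j) mod monom 1 p = (if i + j < p then \<x> (i + j) else 0)"
proof (cases "i + j < p")
  case True
  then show ?thesis by (simp add: mult_monom mod_poly_less degree_monom_eq)
next
  case False
  then have "\<x> i * \<x> j = \<x> (i + j - p) * monom 1 p" by (simp add: mult_monom)
  then show ?thesis using False by simp
qed

lemma braid_trunc:
  shows arrow_braid_trunc: "arrow (braid \<A> \<A>) (\<A> \<boxtimes> \<A>) (\<A> \<boxtimes> \<A>)"
    and Fun_braid_trunc: "i < p \<Longrightarrow> j < p \<Longrightarrow>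
      Fun (braid \<A> \<A>) (pure \<A> \<A> (\<x> i) (\<x> j)) = (\<xi> ^ (i * j)) \<odot>\<^bsub>\<A> \<boxtimes> \<A>\<^esub> pure \<A> \<A> (\<x> j) (\<x> i)"
    and arrow_braid_inv_trunc: "arrow (braid_inv \<A> \<A>) (\<A> \<boxtimes> \<A>) (\<A> \<boxtimes> \<A>)"
    and Fun_braid_inv_trunc: "i < p \<Longrightarrow> j < p \<Longrightarrow>
      Fun (braid_inv \<A> \<A>) (pure \<A> \<A> (\<x> i) (\<x> j)) = (inverse \<xi> ^ (i * j)) \<odot>\<^bsub>\<A> \<boxtimes> \<A>\<^esub> pure \<A> \<A> (\<x> j) (\<x> i)"
  using arrow_braid_with[OF graded_trunc graded_trunc] Fun_braid_with[OF graded_trunc graded_trunc _ _ xpow_homog xpow_homog]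
  by (simp_all add: braid_eq[OF graded_trunc graded_trunc] braid_inv_eq[OF graded_trunc graded_trunc])

lemma middle_braid:
  shows arrow_middle_braid: "arrow (middle_braid \<A>) ((\<A> \<boxtimes> \<A>) \<boxtimes> (\<A> \<boxtimes> \<A>)) ((\<A> \<boxtimes> \<A>) \<boxtimes> (\<A> \<boxtimes> \<A>))"
    and Fun_middle_braid: "a \<in> carrier \<A> \<Longrightarrow> d \<in> carrier \<A> \<Longrightarrow> i < p \<Longrightarrow> j < p \<Longrightarrow>
      Fun (middle_braid \<A>) (pure (\<A> \<boxtimes> \<A>) (\<A> \<boxtimes> \<A>) (pure \<A> \<A> a (\<x> i)) (pure \<A> \<A> (\<x> j) d))
      = (\<xi> ^ (i * j)) \<odot>\<^bsub>(\<A> \<boxtimes> \<A>) \<boxtimes> (\<A> \<boxtimes> \<A>)\<^esub>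
          pure (\<A> \<boxtimes> \<A>) (\<A> \<boxtimes> \<A>) (pure \<A> \<A> a (\<x> j)) (pure \<A> \<A> (\<x> i) d)"
proof -
  note I = arrow_id[OF graded_trunc] and B = arrow_braid_trunc
  note AA = graded_tensor[OF graded_trunc graded_trunc]
  note f1 = arrow_assoc[OF graded_trunc graded_trunc AA]
    and f2 = arrow_tensor[OF I arrow_assoc_inv[OF graded_trunc graded_trunc graded_trunc]]
    and f3 = arrow_tensor[OF I arrow_tensor[OF B I]]
    and f4 = arrow_tensor[OF I arrow_assoc[OF graded_trunc graded_trunc graded_trunc]]
    and f5 = arrow_assoc_inv[OF graded_trunc graded_trunc AA]
  show ar: "arrow (middle_braid \<A>) ((\<A> \<boxtimes> \<A>) \<boxtimes> (\<A> \<boxtimes> \<A>)) ((\<A> \<boxtimes> \<A>) \<boxtimes> (\<A> \<boxtimes> \<A>))"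
    unfolding middle_braid_def by (intro arrow_comp[OF _ f5] arrow_comp[OF _ f4] arrow_comp[OF _ f3] arrow_comp[OF f1 f2])
  assume a: "a \<in> carrier \<A>" "d \<in> carrier \<A>" and ij: "i < p" "j < p"
  note [simp] = a ij
  show "Fun (middle_braid \<A>) (pure (\<A> \<boxtimes> \<A>) (\<A> \<boxtimes> \<A>) (pure \<A> \<A> a (\<x> i)) (pure \<A> \<A> (\<x> j) d))
      = (\<xi> ^ (i * j)) \<odot>\<^bsub>(\<A> \<boxtimes> \<A>) \<boxtimes> (\<A> \<boxtimes> \<A>)\<^esub>
          pure (\<A> \<boxtimes> \<A>) (\<A> \<boxtimes> \<A>) (pure \<A> \<A> a (\<x> j)) (pure \<A> \<A> (\<x> i) d)"
    unfolding middle_braid_def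
    by (simp add: Fun_comp arrow_dom(1)[OF f1] Fun_assoc[OF graded_trunc graded_trunc AA]
        Fun_tensor[OF I arrow_assoc_inv[OF graded_trunc graded_trunc graded_trunc]]
        Fun_assoc_inv[OF graded_trunc graded_trunc graded_trunc]
        Fun_tensor[OF I arrow_tensor[OF B I]] Fun_tensor[OF B I] Fun_braid_trunc
        pure_smult lin_smult[OF arrow_lin[OF f4]] lin_smult[OF arrow_lin[OF f5]]
        Fun_tensor[OF I arrow_assoc[OF graded_trunc graded_trunc graded_trunc]]
        Fun_assoc[OF graded_trunc graded_trunc graded_trunc]
        Fun_assoc_inv[OF graded_trunc graded_trunc AA])
qed

end

locale zp_hopf = zp_root p \<xi> for p :: nat and \<xi> :: "'k::field" +
  fixes H :: "('k, 'k poly) hopf"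
  assumes hopf: "is_trunc_poly_hopf p \<xi> H"
begin

lemma Space_H [simp]: "Space H = \<A>"
  using hopf by (simp add: is_trunc_poly_hopf_def Let_def)

lemma hopf_H: "hopf_algebra H"
  using hopf by (simp add: is_trunc_poly_hopf_def Let_def)

lemma arrow_H:
  shows arrow_Mul: "arrow (Mul H) (\<A> \<boxtimes> \<A>) \<A>" and arrow_Unit: "arrow (Unit H) \<I> \<A>"
    and arrow_Comul: "arrow (Comul H) \<A> (\<A> \<boxtimes> \<A>)" and arrow_Counit: "arrow (Counit H) \<A> \<I>"
    and arrow_Antipode: "arrow (Antipode H) \<A> \<A>"
  using hopf_H graded_trunc graded_unit graded_tensor[OF graded_trunc graded_trunc]
  unfolding hopf_algebra_def algebra_obj_def coalgebra_obj_def arrow_def by simp_all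

lemma Fun_Mul: "i < p \<Longrightarrow> j < p \<Longrightarrow> Fun (Mul H) (pure \<A> \<A> (\<x> i) (\<x> j)) = (if i + j < p then \<x> (i + j) else 0)"
  using hopf xpow_mult[of i j] by (simp add: is_trunc_poly_hopf_def Let_def)

lemma Fun_Unit: "Fun (Unit H) c = c \<odot>\<^bsub>\<A>\<^esub> \<x> 0"
proof -
  have "Fun (Unit H) 1 = \<x> 0"
    using hopf by (simp add: is_trunc_poly_hopf_def Let_def monom_eq_1)
  then show ?thesis using lin_smult[OF arrow_lin[OF arrow_Unit], of 1 c] by simp
qed

lemma Fun_Comul_0: "Fun (Comul H) (\<x> 0) = pure \<A> \<A> (\<x> 0) (\<x> 0)"
proof -
  have eq: "Comul H \<circ>\<^sub>a Unit H \<circ>\<^sub>a lunit \<I> = Unit H \<star> Unit H"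
    using hopf_H by (simp add: hopf_algebra_def)
  have u: "Fun (Unit H) 1 = \<x> 0" by (simp add: Fun_Unit)
  have "Fun (Comul H \<circ>\<^sub>a Unit H \<circ>\<^sub>a lunit \<I>) (pure \<I> \<I> 1 1) = Fun (Comul H) (\<x> 0)"
    by (simp add: Fun_comp arrow_dom(1)[OF arrow_lunit[OF graded_unit]] Fun_lunit[OF graded_unit] arrow_dom(1)[OF arrow_Unit] u)
  then show ?thesis unfolding eq using Fun_tensor[OF arrow_Unit arrow_Unit, of 1 1] u by simp
qed

lemma Fun_Comul_1: "Fun (Comul H) (\<x> 1) = pure \<A> \<A> (\<x> 1) (\<x> 0) \<oplus>\<^bsub>\<A> \<boxtimes> \<A>\<^esub> pure \<A> \<A> (\<x> 0) (\<x> 1)"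
  using hopf by (simp add: is_trunc_poly_hopf_def Let_def monom_eq_1)

text \<open>Since \<open>1 \<otimes> x\<close> and \<open>x \<otimes> 1\<close> commute up to \<open>\<xi>\<close> in the braided tensor square, the
  comultiplication of a power of \<open>x\<close> has Gaussian binomials as coefficients.\<close>

lemma Fun_Comul:
  "n < p \<Longrightarrow> Fun (Comul H) (\<x> n) = finsum (\<A> \<boxtimes> \<A>) (\<lambda>k. qbin \<xi> n k \<odot>\<^bsub>\<A> \<boxtimes> \<A>\<^esub> pure \<A> \<A> (\<x> k) (\<x> (n - k))) {..n}"
proof (induction n)
  case 0
  have vAA: "vecsp (\<A> \<boxtimes> \<A>)" by (rule vecsp_tensor[OF vecsp_trunc])
  interpret abelian_monoid "\<A> \<boxtimes> \<A>" by (rule vecsp_monoid[OF vAA])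
  show ?case using vAA by (simp add: Fun_Comul_0)
next
  case (Suc n)
  note vAA = vecsp_tensor[OF vecsp_trunc, of \<A>]
  have n: "n < p" "1 < p" using Suc.prems by auto
  note CC = arrow_tensor[OF arrow_Comul arrow_Comul] and MM = arrow_tensor[OF arrow_Mul arrow_Mul]
  have eq: "Comul H \<circ>\<^sub>a Mul H = (Mul H \<star> Mul H) \<circ>\<^sub>a middle_braid \<A> \<circ>\<^sub>a (Comul H \<star> Comul H)"
    using hopf_H by (simp add: hopf_algebra_def)
  define Q where "Q s t = Fun (Mul H \<star> Mul H) (Fun (middle_braid \<A>) (pure (\<A> \<boxtimes> \<A>) (\<A> \<boxtimes> \<A>) s t))" for s t
  have Q1: "lin (\<A> \<boxtimes> \<A>) (\<A> \<boxtimes> \<A>) (\<lambda>s. Q s t)" and Q2: "lin (\<A> \<boxtimes> \<A>) (\<A> \<boxtimes> \<A>) (Q t)" if "t \<in> carrier (\<A> \<boxtimes> \<A>)" for t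
    unfolding Q_def
    using lin_comp[OF lin_comp[OF pure_lin(1)[OF vAA vAA that] arrow_lin[OF arrow_middle_braid]] arrow_lin[OF MM]]
      lin_comp[OF lin_comp[OF pure_lin(2)[OF vAA vAA that] arrow_lin[OF arrow_middle_braid]] arrow_lin[OF MM]]
    by auto
  have Qx: "Q (pure \<A> \<A> (\<x> a) (\<x> b)) (pure \<A> \<A> (\<x> c) (\<x> d))
      = \<xi> ^ (b * c) \<odot>\<^bsub>\<A> \<boxtimes> \<A>\<^esub> pure \<A> \<A> (\<x> (a + c)) (\<x> (b + d))"
    if "a + c < p" "b + d < p" for a b c d
    using that by (simp add: Q_def Fun_middle_braid lin_smult[OF arrow_lin[OF MM]] Fun_tensor[OF arrow_Mul arrow_Mul] Fun_Mul)
  have xn: "pure \<A> \<A> (\<x> 1) (\<x> n) \<in> carrier (\<A> \<boxtimes> \<A>)" using n by simp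
  \<comment> \<open>The summation rule takes a sequence of vectors; its values beyond \<open>Suc n\<close> have coefficient \<open>0\<close>.\<close>
  define a where "a k = (if k \<le> Suc n then pure \<A> \<A> (\<x> k) (\<x> (Suc n - k)) else \<zero>\<^bsub>\<A> \<boxtimes> \<A>\<^esub>)" for k
  have a: "a k \<in> carrier (\<A> \<boxtimes> \<A>)" for k
    using Suc.prems vAA by (simp add: a_def)
  have cx: "Fun (Comul H) (\<x> i) \<in> carrier (\<A> \<boxtimes> \<A>)" if "i < p" for i
    using arrow_closed[OF arrow_Comul] that by simp
  have "Fun (Comul H) (\<x> (Suc n)) = Fun (Comul H \<circ>\<^sub>a Mul H) (pure \<A> \<A> (\<x> 1) (\<x> n))"
    using n xn Suc.prems by (simp add: Fun_comp arrow_dom(1)[OF arrow_Mul] Fun_Mul)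
  also have "\<dots> = Q (Fun (Comul H) (\<x> 1)) (Fun (Comul H) (\<x> n))"
    unfolding eq using n xn
    by (simp add: Fun_comp arrow_dom(1)[OF CC] Fun_tensor[OF arrow_Comul arrow_Comul] Q_def)
  also have "\<dots> = Q (pure \<A> \<A> (\<x> 1) (\<x> 0)) (Fun (Comul H) (\<x> n)) \<oplus>\<^bsub>\<A> \<boxtimes> \<A>\<^esub> Q (pure \<A> \<A> (\<x> 0) (\<x> 1)) (Fun (Comul H) (\<x> n))"
    unfolding Fun_Comul_1 using n cx by (intro lin_add[OF Q1]) simp_all
  also have "Q (pure \<A> \<A> (\<x> 1) (\<x> 0)) (Fun (Comul H) (\<x> n)) = finsum (\<A> \<boxtimes> \<A>) (\<lambda>k. qbin \<xi> n k \<odot>\<^bsub>\<A> \<boxtimes> \<A>\<^esub> a (Suc k)) {..n}"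
  proof -
    have l: "lin (\<A> \<boxtimes> \<A>) (\<A> \<boxtimes> \<A>) (Q (pure \<A> \<A> (\<x> 1) (\<x> 0)))" using n by (intro Q2) simp
    have "Q (pure \<A> \<A> (\<x> 1) (\<x> 0)) (Fun (Comul H) (\<x> n))
        = finsum (\<A> \<boxtimes> \<A>) (\<lambda>k. Q (pure \<A> \<A> (\<x> 1) (\<x> 0)) (qbin \<xi> n k \<odot>\<^bsub>\<A> \<boxtimes> \<A>\<^esub> pure \<A> \<A> (\<x> k) (\<x> (n - k)))) {..n}"
      unfolding Suc.IH[OF n(1)] using n vAA by (intro lin_finsum[OF l]) auto
    also have "\<dots> = finsum (\<A> \<boxtimes> \<A>) (\<lambda>k. qbin \<xi> n k \<odot>\<^bsub>\<A> \<boxtimes> \<A>\<^esub> a (Suc k)) {..n}"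
      using n a vAA Suc.prems
      by (intro vecsp_finsum_cong[OF vAA]) (auto simp: lin_smult[OF l] Qx a_def plus_1_eq_Suc simp del: One_nat_def)
    finally show ?thesis .
  qed
  also have "Q (pure \<A> \<A> (\<x> 0) (\<x> 1)) (Fun (Comul H) (\<x> n)) = finsum (\<A> \<boxtimes> \<A>) (\<lambda>k. (qbin \<xi> n k * \<xi> ^ k) \<odot>\<^bsub>\<A> \<boxtimes> \<A>\<^esub> a k) {..n}"
  proof -
    have l: "lin (\<A> \<boxtimes> \<A>) (\<A> \<boxtimes> \<A>) (Q (pure \<A> \<A> (\<x> 0) (\<x> 1)))" using n by (intro Q2) simp
    have "Q (pure \<A> \<A> (\<x> 0) (\<x> 1)) (Fun (Comul H) (\<x> n))
        = finsum (\<A> \<boxtimes> \<A>) (\<lambda>k. Q (pure \<A> \<A> (\<x> 0) (\<x> 1)) (qbin \<xi> n k \<odot>\<^bsub>\<A> \<boxtimes> \<A>\<^esub> pure \<A> \<A> (\<x> k) (\<x> (n - k)))) {..n}"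
      unfolding Suc.IH[OF n(1)] using n vAA by (intro lin_finsum[OF l]) auto
    also have "\<dots> = finsum (\<A> \<boxtimes> \<A>) (\<lambda>k. (qbin \<xi> n k * \<xi> ^ k) \<odot>\<^bsub>\<A> \<boxtimes> \<A>\<^esub> a k) {..n}"
      using n a vAA Suc.prems
      by (intro vecsp_finsum_cong[OF vAA]) (auto simp: lin_smult[OF l] Qx a_def vecsp_smult(1) Suc_diff_le plus_1_eq_Suc simp del: One_nat_def)
    finally show ?thesis .
  qed
  also have "finsum (\<A> \<boxtimes> \<A>) (\<lambda>k. qbin \<xi> n k \<odot>\<^bsub>\<A> \<boxtimes> \<A>\<^esub> a (Suc k)) {..n} \<oplus>\<^bsub>\<A> \<boxtimes> \<A>\<^esub>
      finsum (\<A> \<boxtimes> \<A>) (\<lambda>k. (qbin \<xi> n k * \<xi> ^ k) \<odot>\<^bsub>\<A> \<boxtimes> \<A>\<^esub> a k) {..n}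
      = finsum (\<A> \<boxtimes> \<A>) (\<lambda>k. qbin \<xi> (Suc n) k \<odot>\<^bsub>\<A> \<boxtimes> \<A>\<^esub> a k) {..Suc n}"
    by (rule qbin_sum_Suc[OF vAA a])
  also have "\<dots> = finsum (\<A> \<boxtimes> \<A>) (\<lambda>k. qbin \<xi> (Suc n) k \<odot>\<^bsub>\<A> \<boxtimes> \<A>\<^esub> pure \<A> \<A> (\<x> k) (\<x> (Suc n - k))) {..Suc n}"
    using vAA Suc.prems by (intro vecsp_finsum_cong[OF vAA]) (auto simp: a_def simp del: qbin.simps)
  finally show ?case .
qed

lemma Fun_Counit: "n < p \<Longrightarrow> Fun (Counit H) (\<x> n) = (if n = 0 then 1 else 0)"
proof -
  have "Counit H \<circ>\<^sub>a Unit H = id_arr \<I>" using hopf_H by (simp add: hopf_algebra_def)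
  then have "Fun (Counit H \<circ>\<^sub>a Unit H) 1 = 1" by simp
  then have 0: "Fun (Counit H) (\<x> 0) = 1"
    by (simp add: Fun_comp arrow_dom(1)[OF arrow_Unit] Fun_Unit)
  have 1: "Fun (Counit H) (\<x> 1) = 0" using hopf by (simp add: is_trunc_poly_hopf_def Let_def)
  have eq: "Counit H \<circ>\<^sub>a Mul H = lunit \<I> \<circ>\<^sub>a (Counit H \<star> Counit H)"
    using hopf_H by (simp add: hopf_algebra_def)
  have "Fun (Counit H) (\<x> (Suc m)) = 0" if m: "Suc m < p" for m
  proof -
    have mp: "m < p" "1 < p" using m by auto
    have "Fun (Counit H) (\<x> (Suc m)) = Fun (Counit H \<circ>\<^sub>a Mul H) (pure \<A> \<A> (\<x> 1) (\<x> m))"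
      using m mp by (simp add: Fun_comp arrow_dom(1)[OF arrow_Mul] Fun_Mul)
    also have "\<dots> = 0" unfolding eq using m mp 1
      by (simp add: Fun_comp arrow_dom(1)[OF arrow_tensor[OF arrow_Counit arrow_Counit]]
          Fun_tensor[OF arrow_Counit arrow_Counit] Fun_lunit[OF graded_unit])
    finally show ?thesis .
  qed
  then show "n < p \<Longrightarrow> ?thesis" using 0 by (cases n) auto
qed

text \<open>The scalar by which the antipode multiplies \<open>x\<^sup>n\<close>.\<close>

definition sgnq :: "nat \<Rightarrow> 'k" where "sgnq n = (-1) ^ n * \<xi> ^ (n * (n - 1) div 2)"

text \<open>The antipode axiom at \<open>x\<^sup>n\<close> expresses the antipode of \<open>x\<^sup>n\<close> by those of the lower powers, and
  \<open>qbin_alternating\<close> shows that the asserted scalars solve this recursion.\<close>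

lemma Fun_Antipode: "n < p \<Longrightarrow> Fun (Antipode H) (\<x> n) = sgnq n \<odot>\<^bsub>\<A>\<^esub> \<x> n"
proof (induction n rule: less_induct)
  case (less n)
  note vA = vecsp_trunc and vAA = vecsp_tensor[OF vecsp_trunc, of \<A>]
  note SI = arrow_tensor[OF arrow_Antipode arrow_id[OF graded_trunc]]
  have eq: "Mul H \<circ>\<^sub>a (Antipode H \<star> id_arr \<A>) \<circ>\<^sub>a Comul H = Unit H \<circ>\<^sub>a Counit H"
    using hopf_H by (simp add: hopf_algebra_def)
  note l = lin_comp[OF arrow_lin[OF SI] arrow_lin[OF arrow_Mul]]
  define S where "S = Fun (Antipode H) (\<x> n)"
  have S: "S \<in> carrier \<A>" unfolding S_def using arrow_closed[OF arrow_Antipode] less.prems by simp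
  have m1: "Fun (Mul H) (pure \<A> \<A> f (\<x> 0)) = f" if f: "f \<in> carrier \<A>" for f
  proof (rule generates_lin_eq[OF generates_trunc _ lin_id[OF vA] _ f])
    show "lin \<A> \<A> (\<lambda>f. Fun (Mul H) (pure \<A> \<A> f (\<x> 0)))"
      by (rule lin_comp[OF pure_lin(1)[OF vA vA] arrow_lin[OF arrow_Mul]]) simp
  qed (auto simp: Fun_Mul)
  let ?t = "\<lambda>k. Fun (Mul H) (Fun (Antipode H \<star> id_arr \<A>) (pure \<A> \<A> (\<x> k) (\<x> (n - k))))"
  have tl: "?t k = sgnq k \<odot>\<^bsub>\<A>\<^esub> \<x> n" if "k < n" for k
    using that less.IH[OF that] less.prems
    by (simp add: Fun_tensor[OF arrow_Antipode arrow_id[OF graded_trunc]] pure_smult[of _ \<A> _ \<A>, unfolded trunc_simps]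
        lin_smult[OF arrow_lin[OF arrow_Mul]] Fun_Mul)
  have tn: "?t n = S"
    using less.prems S by (simp add: Fun_tensor[OF arrow_Antipode arrow_id[OF graded_trunc]] m1 S_def)
  have tc: "?t k \<in> carrier \<A>" if "k \<le> n" for k
    using tl[of k] tn S less.prems vecsp_closed(3)[OF vA xpow_carrier, of n "sgnq k"] that by (cases "k = n") auto
  have "Fun (Mul H \<circ>\<^sub>a (Antipode H \<star> id_arr \<A>) \<circ>\<^sub>a Comul H) (\<x> n)
      = Fun (Mul H) (Fun (Antipode H \<star> id_arr \<A>) (Fun (Comul H) (\<x> n)))"
    using less.prems arrow_closed[OF arrow_Comul]
    by (simp add: Fun_comp arrow_dom(1)[OF arrow_Comul])
  also have "\<dots> = finsum \<A> (\<lambda>k. Fun (Mul H) (Fun (Antipode H \<star> id_arr \<A>)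
      (qbin \<xi> n k \<odot>\<^bsub>\<A> \<boxtimes> \<A>\<^esub> pure \<A> \<A> (\<x> k) (\<x> (n - k))))) {..n}"
    unfolding Fun_Comul[OF less.prems] using less.prems vAA by (intro lin_finsum[OF l]) auto
  also have "\<dots> = finsum \<A> (\<lambda>k. qbin \<xi> n k \<odot>\<^bsub>\<A>\<^esub> ?t k) {..n}"
    using less.prems vA tc lin_smult[OF l] by (intro vecsp_finsum_cong[OF vA] vecsp_closed(3)[OF vA]) auto
  also have "\<dots> = (\<Sum>k\<le>n. qbin \<xi> n k \<odot>\<^bsub>\<A>\<^esub> ?t k)"
    using tc vA by (intro finsum_trunc vecsp_closed(3)[OF vA]) auto
  also have "\<dots> = qbin \<xi> n n \<odot>\<^bsub>\<A>\<^esub> S + (\<Sum>k<n. qbin \<xi> n k \<odot>\<^bsub>\<A>\<^esub> (sgnq k \<odot>\<^bsub>\<A>\<^esub> \<x> n))"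
    using tl tn by (simp add: lessThan_Suc_atMost[symmetric] add.commute)
  also have "qbin \<xi> n n = 1" by (induction n) (simp_all add: qbin_eq_0)
  finally have e: "Fun (Unit H \<circ>\<^sub>a Counit H) (\<x> n) = S + (\<Sum>k<n. Polynomial.smult (qbin \<xi> n k * sgnq k) (\<x> n))"
    unfolding eq by simp
  have "Fun (Unit H \<circ>\<^sub>a Counit H) (\<x> n) = Polynomial.smult (if n = 0 then 1 else 0) (\<x> 0)"
    using less.prems by (simp add: Fun_comp arrow_dom(1)[OF arrow_Counit] Fun_Counit Fun_Unit)
  then have e': "S = Polynomial.smult (if n = 0 then 1 else 0) (\<x> 0) - Polynomial.smult (\<Sum>k<n. qbin \<xi> n k * sgnq k) (\<x> n)"
    using e by (auto simp: smult_sum eq_neg_iff_add_eq_0)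
  show ?case
  proof (cases n)
    case 0
    then show ?thesis using e' by (simp add: S_def sgnq_def)
  next
    case (Suc m)
    have "(\<Sum>k\<le>n. qbin \<xi> n k * sgnq k) = 0"
      using qbin_alternating[of \<xi> m] by (simp only: Suc sgnq_def mult.assoc)
    moreover have "(\<Sum>k\<le>n. qbin \<xi> n k * sgnq k) = (\<Sum>k<n. qbin \<xi> n k * sgnq k) + sgnq n"
      using \<open>qbin \<xi> n n = 1\<close> by (simp add: lessThan_Suc_atMost[symmetric])
    ultimately have "(\<Sum>k<n. qbin \<xi> n k * sgnq k) = - sgnq n" by (simp add: eq_neg_iff_add_eq_0)
    then show ?thesis using e' Suc by (simp add: S_def)
  qed
qed

section \<open>The dual algebra\<close>

text \<open>The structure constants of the dual algebra in the basis \<open>\<delta>\<close>.\<close>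

definition \<kappa> :: "nat \<Rightarrow> nat \<Rightarrow> 'k" where "\<kappa> i j = qbin \<xi> (i + j) i * inverse \<xi> ^ (i * j)"

text \<open>The Gaussian binomial is the coefficient of \<open>x\<^sup>i \<otimes> x\<^sup>j\<close> in the comultiplication of \<open>x\<^sup>i\<^sup>+\<^sup>j\<close>,
  and the other factor of \<open>\<kappa>\<close> comes from the inverse braiding.\<close>

lemma dual_mul:
  shows arrow_dual_mul: "arrow (dual_mul H) (\<D> \<boxtimes> \<D>) \<D>"
    and Fun_dual_mul: "i < p \<Longrightarrow> j < p \<Longrightarrow> Fun (dual_mul H) (pure \<D> \<D> (\<delta> i) (\<delta> j))
      = (if i + j < p then \<kappa> i j \<odot>\<^bsub>\<D>\<^esub> \<delta> (i + j) else \<zero>\<^bsub>\<D>\<^esub>)"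
proof -
  note DD = graded_tensor[OF graded_dual graded_dual]
  note vAA = vecsp_tensor[OF vecsp_trunc, of \<A>] and vD = vecsp_dual[OF vecsp_trunc]
  note vDD = vecsp_tensor[OF vD, of \<D>]
  note I = arrow_id[OF graded_trunc] and bc = arrow_comp[OF arrow_Comul arrow_braid_inv_trunc]
  note f1 = arrow_tensor[OF bc arrow_id[OF DD]] and f2 = arrow_assoc[OF graded_trunc graded_trunc DD]
    and f3 = arrow_tensor[OF I arrow_ev_id[OF graded_dual]]
  note f23 = arrow_comp[OF f2 f3] note f234 = arrow_comp[OF f23 arrow_ev]
  define g where "g = ev \<A> \<circ>\<^sub>a (id_arr \<A> \<star> ev_id \<A> \<D>) \<circ>\<^sub>a assoc \<A> \<A> (\<D> \<boxtimes> \<D>) \<circ>\<^sub>a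
        ((braid_inv \<A> \<A> \<circ>\<^sub>a Comul H) \<star> id_arr (\<D> \<boxtimes> \<D>))"
  have g: "arrow g (\<A> \<boxtimes> (\<D> \<boxtimes> \<D>)) \<I>"
    unfolding g_def by (intro arrow_comp[OF _ arrow_ev] arrow_comp[OF _ f3] arrow_comp[OF f1 f2])
  have eq: "dual_mul H = of_adjoint_unit \<A> (\<D> \<boxtimes> \<D>) g"
    by (simp add: dual_mul_def Let_def g_def)
  show "arrow (dual_mul H) (\<D> \<boxtimes> \<D>) \<D>" unfolding eq by (rule arrow_of_adjoint_unit[OF g DD])
  assume ij: "i < p" "j < p"
  have dd: "pure \<D> \<D> (\<delta> i) (\<delta> j) \<in> carrier (\<D> \<boxtimes> \<D>)" by simp
  show "Fun (dual_mul H) (pure \<D> \<D> (\<delta> i) (\<delta> j)) = (if i + j < p then \<kappa> i j \<odot>\<^bsub>\<D>\<^esub> \<delta> (i + j) else \<zero>\<^bsub>\<D>\<^esub>)"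
  proof (rule dual_eqI)
    show "Fun (dual_mul H) (pure \<D> \<D> (\<delta> i) (\<delta> j)) \<in> carrier \<D>"
      unfolding eq by (rule arrow_closed[OF arrow_of_adjoint_unit[OF g DD] dd])
    show "(if i + j < p then \<kappa> i j \<odot>\<^bsub>\<D>\<^esub> \<delta> (i + j) else \<zero>\<^bsub>\<D>\<^esub>) \<in> carrier \<D>"
      using vecsp_closed[OF vD] by simp
    fix n assume n: "n < p"
    let ?h = "\<lambda>s. Fun (ev \<A> \<circ>\<^sub>a (id_arr \<A> \<star> ev_id \<A> \<D>) \<circ>\<^sub>a assoc \<A> \<A> (\<D> \<boxtimes> \<D>))
        (pure (\<A> \<boxtimes> \<A>) (\<D> \<boxtimes> \<D>) (Fun (braid_inv \<A> \<A>) s) (pure \<D> \<D> (\<delta> i) (\<delta> j)))"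
    have hl: "lin (\<A> \<boxtimes> \<A>) \<I> ?h"
      by (rule lin_comp[OF lin_comp[OF arrow_lin[OF arrow_braid_inv_trunc] pure_lin(1)[OF vAA vDD dd]] arrow_lin[OF f234]])
    have h: "?h (pure \<A> \<A> (\<x> k) (\<x> l)) = inverse \<xi> ^ (k * l) * ((if i = k then 1 else 0) * (if j = l then 1 else 0))"
      if "k < p" "l < p" for k l
    proof -
      have bl: "Fun (braid_inv \<A> \<A>) (pure \<A> \<A> (\<x> k) (\<x> l)) = inverse \<xi> ^ (k * l) \<odot>\<^bsub>\<A> \<boxtimes> \<A>\<^esub> pure \<A> \<A> (\<x> l) (\<x> k)"
        by (rule Fun_braid_inv_trunc[OF that])
      have "?h (pure \<A> \<A> (\<x> k) (\<x> l)) = inverse \<xi> ^ (k * l) * Fun (ev \<A> \<circ>\<^sub>a (id_arr \<A> \<star> ev_id \<A> \<D>) \<circ>\<^sub>a assoc \<A> \<A> (\<D> \<boxtimes> \<D>))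
        (pure (\<A> \<boxtimes> \<A>) (\<D> \<boxtimes> \<D>) (pure \<A> \<A> (\<x> l) (\<x> k)) (pure \<D> \<D> (\<delta> i) (\<delta> j)))"
        unfolding bl using that by (simp add: pure_smult lin_smult[OF arrow_lin[OF f234]])
      also have "Fun (ev \<A> \<circ>\<^sub>a (id_arr \<A> \<star> ev_id \<A> \<D>) \<circ>\<^sub>a assoc \<A> \<A> (\<D> \<boxtimes> \<D>))
        (pure (\<A> \<boxtimes> \<A>) (\<D> \<boxtimes> \<D>) (pure \<A> \<A> (\<x> l) (\<x> k)) (pure \<D> \<D> (\<delta> i) (\<delta> j)))
        = Fun (ev \<A>) (pure \<A> \<D> (\<x> l) (\<delta> i (\<x> k) \<odot>\<^bsub>\<D>\<^esub> \<delta> j))"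
        using that by (simp add: Fun_comp arrow_dom(1)[OF f2] Fun_assoc[OF graded_trunc graded_trunc DD]
            Fun_tensor[OF I arrow_ev_id[OF graded_dual]] Fun_ev_id[OF graded_dual])
      also have "\<dots> = (if i = k then 1 else 0) * (if j = l then 1 else 0)"
        using that vecsp_closed(3)[OF vD delta_carrier] by (simp add: Fun_ev)
      finally show ?thesis .
    qed
    have "Fun (dual_mul H) (pure \<D> \<D> (\<delta> i) (\<delta> j)) (\<x> n) = Fun g (pure \<A> (\<D> \<boxtimes> \<D>) (\<x> n) (pure \<D> \<D> (\<delta> i) (\<delta> j)))"
      unfolding eq by (rule Fun_of_adjoint_unit[OF g DD dd xpow_carrier[OF n]])
    also have "\<dots> = ?h (Fun (Comul H) (\<x> n))"
      using n dd arrow_closed[OF arrow_Comul xpow_carrier[OF n]]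
      by (simp add: g_def Fun_comp arrow_dom(1)[OF f1] Fun_tensor[OF bc arrow_id[OF DD]] arrow_dom(1)[OF arrow_Comul]
          arrow_dom(1)[OF f2] arrow_closed[OF arrow_braid_inv_trunc])
    also have "\<dots> = finsum \<I> (\<lambda>k. ?h (qbin \<xi> n k \<odot>\<^bsub>\<A> \<boxtimes> \<A>\<^esub> pure \<A> \<A> (\<x> k) (\<x> (n - k)))) {..n}"
      unfolding Fun_Comul[OF n] using n vAA by (intro lin_finsum[OF hl]) auto
    also have "\<dots> = (\<Sum>k\<le>n. qbin \<xi> n k * ?h (pure \<A> \<A> (\<x> k) (\<x> (n - k))))"
      using n by (subst finsum_unit) (auto intro!: sum.cong simp: lin_smult[OF hl])
    also have "\<dots> = (\<Sum>k\<le>n. if k = i then qbin \<xi> n i * inverse \<xi> ^ (i * (n - i)) * (if j = n - i then 1 else 0) else 0)"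
      using n by (intro sum.cong refl) (auto simp: h)
    also have "\<dots> = (if n = i + j then \<kappa> i j else 0)"
      by (auto simp: \<kappa>_def sum.delta)
    finally show "Fun (dual_mul H) (pure \<D> \<D> (\<delta> i) (\<delta> j)) (\<x> n)
        = (if i + j < p then \<kappa> i j \<odot>\<^bsub>\<D>\<^esub> \<delta> (i + j) else \<zero>\<^bsub>\<D>\<^esub>) (\<x> n)"
      using n by auto
  qed
qed

lemma dual_unit:
  shows arrow_dual_unit: "arrow (dual_unit H) \<I> \<D>" and Fun_dual_unit: "Fun (dual_unit H) 1 = \<delta> 0"
proof -
  note g = arrow_comp[OF arrow_runit[OF graded_trunc] arrow_Counit]
  have eq: "dual_unit H = of_adjoint_unit \<A> \<I> (Counit H \<circ>\<^sub>a runit \<A>)"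
    by (simp add: dual_unit_def)
  show ar: "arrow (dual_unit H) \<I> \<D>" unfolding eq by (rule arrow_of_adjoint_unit[OF g graded_unit])
  show "Fun (dual_unit H) 1 = \<delta> 0"
  proof (rule dual_eqI)
    show "Fun (dual_unit H) 1 \<in> carrier \<D>" by (rule arrow_closed[OF ar]) simp
    fix n assume n: "n < p"
    have "Fun (dual_unit H) 1 (\<x> n) = Fun (Counit H \<circ>\<^sub>a runit \<A>) (pure \<A> \<I> (\<x> n) 1)"
      unfolding eq by (rule Fun_of_adjoint_unit[OF g graded_unit _ xpow_carrier[OF n]]) simp
    also have "\<dots> = (if n = 0 then 1 else 0)"
      using n vecsp_trunc by (simp add: Fun_comp arrow_dom(1)[OF arrow_runit[OF graded_trunc]] Fun_runit[OF graded_trunc] Fun_Counit)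
    finally show "Fun (dual_unit H) 1 (\<x> n) = \<delta> 0 (\<x> n)" using n by simp
  qed simp
qed

end

context zp_root
begin

section \<open>Families of vectors as tensors\<close>

declare One_nat_def [simp del]

lemma funpow_one [simp]: "(f ^^ 1) x = f x" for f :: "'a \<Rightarrow> 'a"
  by (simp add: One_nat_def)

definition fam :: "('k, 'b) gspace \<Rightarrow> (nat \<Rightarrow> 'b) \<Rightarrow> ('k, 'k poly \<Rightarrow> 'k, 'b) tensor" where
  "fam M u = finsum (\<D> \<boxtimes> M) (\<lambda>i. pure \<D> M (\<delta> i) (u i)) {..<p}"

text \<open>Multiplication by a power of \<open>x\<close> shifts coordinates, possibly beyond \<open>p - 1\<close>, where they are
  continued by \<open>0\<close>.\<close>

definition ecoord :: "('k, 'b) gspace \<Rightarrow> nat \<Rightarrow> ('k, 'k poly \<Rightarrow> 'k, 'b) tensor \<Rightarrow> 'b" where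
  "ecoord M i t = (if i < p then coord M i t else \<zero>\<^bsub>M\<^esub>)"

lemma coord_of_adjoint:
  assumes g: "arrow g (\<A> \<boxtimes> U) Y" and U: "graded_space U" and "u \<in> carrier U" "j < p"
  shows "coord Y j (Fun (of_adjoint \<A> U Y g) u) = Fun g (pure \<A> U (\<x> j) u)"
  unfolding Fun_of_adjoint[OF g U assms(3)]
  by (rule coord_sum[OF arrow_graded(2)[OF g] _ assms(4)])
    (rule arrow_closed[OF g], simp add: assms(3))

context
  fixes M :: "('k, 'b) gspace"
  assumes M: "graded_space M"
begin

lemma vecsp_T: "vecsp (\<D> \<boxtimes> M)" and graded_T: "graded_space (\<D> \<boxtimes> M)"
  by (simp_all add: vecsp_tensor vecsp_dual vecsp_trunc graded_tensor graded_dual M)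

lemma coord_fam: "(\<And>i. i < p \<Longrightarrow> u i \<in> carrier M) \<Longrightarrow> j < p \<Longrightarrow> coord M j (fam M u) = u j"
  unfolding fam_def by (rule coord_sum[OF M])

lemma coord_closed: "j < p \<Longrightarrow> t \<in> carrier (\<D> \<boxtimes> M) \<Longrightarrow> coord M j t \<in> carrier M"
  by (rule lin_closed[OF coord_lin[OF M]])

lemma ecoord_lin: "lin (\<D> \<boxtimes> M) M (ecoord M j)"
proof (cases "j < p")
  case True
  then show ?thesis using coord_lin[OF M True] by (rule_tac lin_cong) (auto simp: ecoord_def)
next
  case False
  then show ?thesis using lin_zero_map[OF vecsp_T graded_vecsp[OF M]] by (rule_tac lin_cong) (auto simp: ecoord_def)
qed

lemma ecoord_closed: "t \<in> carrier (\<D> \<boxtimes> M) \<Longrightarrow> ecoord M j t \<in> carrier M"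
  by (rule lin_closed[OF ecoord_lin])

lemma coord_eqI:
  assumes "s \<in> carrier (\<D> \<boxtimes> M)" "t \<in> carrier (\<D> \<boxtimes> M)" "\<And>j. j < p \<Longrightarrow> coord M j s = coord M j t"
  shows "s = t"
proof -
  have "s = finsum (\<D> \<boxtimes> M) (\<lambda>i. pure \<D> M (\<delta> i) (coord M i s)) {..<p}" by (simp add: coord_expand[OF M assms(1)])
  also have "\<dots> = finsum (\<D> \<boxtimes> M) (\<lambda>i. pure \<D> M (\<delta> i) (coord M i t)) {..<p}"
    by (rule vecsp_finsum_cong[OF vecsp_T]) (use assms coord_closed in auto)
  also have "\<dots> = t" by (rule coord_expand[OF M assms(2)])
  finally show ?thesis .
qed

lemma fam_lin:
  assumes "\<And>i. i < p \<Longrightarrow> lin V M (\<lambda>t. u t i)" "vecsp V"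
  shows "lin V (\<D> \<boxtimes> M) (\<lambda>t. fam M (u t))"
  unfolding fam_def
proof (intro lin_finsum_map assms(2) vecsp_T)
  fix i assume "i \<in> {..<p}"
  then show "lin V (\<D> \<boxtimes> M) (\<lambda>t. pure \<D> M (\<delta> i) (u t i))"
    using lin_comp[OF assms(1) pure_lin(2)[OF vecsp_dual[OF vecsp_trunc] graded_vecsp[OF M] delta_carrier]] by simp
qed simp

lemma ecoord_pure:
  "m \<in> carrier M \<Longrightarrow> n < p \<Longrightarrow> ecoord M i (pure \<D> M (\<delta> n) m) = (if i = n then m else \<zero>\<^bsub>M\<^esub>)"
  by (auto simp: ecoord_def coord_pure[OF M])

end

end

context zp_hopf
begin

section \<open>The structure map of the anti-Yetter-Drinfeld condition\<close>

context
  fixes M :: "('k, 'b) gspace" and \<rho> :: "('k, ('k, 'k poly, 'b) tensor, 'b) garr"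
  assumes M: "graded_space M" and rho: "arrow \<rho> (\<A> \<boxtimes> M) M"
begin

abbreviation (input) T :: "('k, ('k, 'k poly \<Rightarrow> 'k, 'b) tensor) gspace" where "T \<equiv> \<D> \<boxtimes> M"

text \<open>The adjoint multiplies by \<open>x\<^sup>i\<close> before evaluating, so the coordinates are shifted by \<open>i\<close>.\<close>

lemma r_one:
  shows arrow_r_one: "arrow (r_one H M) (\<A> \<boxtimes> T) T"
    and coord_r_one: "i < p \<Longrightarrow> j < p \<Longrightarrow> t \<in> carrier T \<Longrightarrow>
      coord M j (Fun (r_one H M) (pure \<A> T (\<x> i) t)) = ecoord M (j + i) t"
proof -
  note TT = graded_T[OF M]
  note AT = graded_tensor[OF graded_trunc TT]
  note f1 = arrow_assoc_inv[OF graded_trunc graded_trunc TT] and f2 = arrow_tensor[OF arrow_Mul arrow_id[OF TT]]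
    and f3 = arrow_ev_id[OF M]
  let ?g = "ev_id \<A> M \<circ>\<^sub>a (Mul H \<star> id_arr T) \<circ>\<^sub>a assoc_inv \<A> \<A> T"
  have g: "arrow ?g (\<A> \<boxtimes> (\<A> \<boxtimes> T)) M" by (intro arrow_comp[OF _ f3] arrow_comp[OF f1 f2])
  have eq: "r_one H M = of_adjoint \<A> (\<A> \<boxtimes> T) M ?g" by (simp add: r_one_def Let_def)
  show "arrow (r_one H M) (\<A> \<boxtimes> T) T" unfolding eq by (rule arrow_of_adjoint[OF g AT])
  assume ij: "i < p" "j < p" and t: "t \<in> carrier T"
  have "coord M j (Fun (r_one H M) (pure \<A> T (\<x> i) t)) = Fun ?g (pure \<A> (\<A> \<boxtimes> T) (\<x> j) (pure \<A> T (\<x> i) t))"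
    unfolding eq by (rule coord_of_adjoint[OF g AT _ ij(2)]) (use ij t in simp)
  also have "\<dots> = Fun (ev_id \<A> M) (pure \<A> T (if j + i < p then \<x> (j + i) else 0) t)"
    using ij t by (simp add: Fun_comp arrow_dom(1)[OF f1] Fun_assoc_inv[OF graded_trunc graded_trunc TT]
        Fun_tensor[OF arrow_Mul arrow_id[OF TT]] Fun_Mul)
  also have "\<dots> = ecoord M (j + i) t"
    using pure_zero(1)[OF vecsp_trunc vecsp_T[OF M] t] lin_zero[OF arrow_lin[OF f3]]
    by (simp add: ecoord_def coord_def trunc_simps)
  finally show "coord M j (Fun (r_one H M) (pure \<A> T (\<x> i) t)) = ecoord M (j + i) t" .
qed

text \<open>Each factor of the coefficients has one source: the power of \<open>\<xi>\<close> is the braiding of \<open>x\<^sup>j\<close>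
  with \<open>x\<^sup>i\<close>, the Gaussian binomial belongs to the comultiplication, and \<open>sgnq\<close> is the antipode.\<close>

lemma r_zero:
  shows arrow_r_zero: "arrow (r_zero H M \<rho>) (\<A> \<boxtimes> T) T"
    and coord_r_zero: "i < p \<Longrightarrow> j < p \<Longrightarrow> t \<in> carrier T \<Longrightarrow>
      coord M j (Fun (r_zero H M \<rho>) (pure \<A> T (\<x> i) t))
      = finsum M (\<lambda>k. (\<xi> ^ (i * j) * qbin \<xi> i k * sgnq (i - k)) \<odot>\<^bsub>M\<^esub>
          Fun \<rho> (pure \<A> M (\<x> k) (ecoord M (i - k + j) t))) {..i}"
proof -
  note TT = graded_T[OF M] and vM = graded_vecsp[OF M] and vT = vecsp_T[OF M]
  note AT = graded_tensor[OF graded_trunc TT] and I = arrow_id[OF graded_trunc]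
  note vAT = vecsp_tensor[OF vecsp_trunc, of "T"] and vAA = vecsp_tensor[OF vecsp_trunc, of \<A>]
  note as = arrow_assoc[OF graded_trunc graded_trunc TT] and ai = arrow_assoc_inv[OF graded_trunc graded_trunc TT]
    and br = arrow_tensor[OF arrow_braid_trunc arrow_id[OF TT]]
    and cm = arrow_tensor[OF arrow_Comul arrow_id[OF AT]] and as2 = arrow_assoc[OF graded_trunc graded_trunc AT]
    and sa = arrow_tensor[OF I arrow_tensor[OF arrow_Antipode arrow_id[OF AT]]]
    and MI = arrow_tensor[OF arrow_Mul arrow_id[OF TT]] and e = arrow_tensor[OF I arrow_ev_id[OF M]]
  note mu = arrow_tensor[OF I arrow_comp[OF ai MI]]
  let ?g = "\<rho> \<circ>\<^sub>a (id_arr \<A> \<star> ev_id \<A> M) \<circ>\<^sub>a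
        (id_arr \<A> \<star> ((Mul H \<star> id_arr T) \<circ>\<^sub>a assoc_inv \<A> \<A> T)) \<circ>\<^sub>a
        (id_arr \<A> \<star> (Antipode H \<star> id_arr (\<A> \<boxtimes> T))) \<circ>\<^sub>a
        (assoc \<A> \<A> (\<A> \<boxtimes> T) \<circ>\<^sub>a (Comul H \<star> id_arr (\<A> \<boxtimes> T))) \<circ>\<^sub>a
        (assoc \<A> \<A> T \<circ>\<^sub>a (braid \<A> \<A> \<star> id_arr T) \<circ>\<^sub>a assoc_inv \<A> \<A> T)"
  note in1 = arrow_comp[OF arrow_comp[OF ai br] as] and in2 = arrow_comp[OF cm as2]
  have g: "arrow ?g (\<A> \<boxtimes> (\<A> \<boxtimes> T)) M"
    by (intro arrow_comp[OF _ rho] arrow_comp[OF _ e] arrow_comp[OF _ mu] arrow_comp[OF _ sa] arrow_comp[OF in1 in2])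
  have eq: "r_zero H M \<rho> = of_adjoint \<A> (\<A> \<boxtimes> T) M ?g" by (simp add: r_zero_def Let_def)
  show "arrow (r_zero H M \<rho>) (\<A> \<boxtimes> T) T" unfolding eq by (rule arrow_of_adjoint[OF g AT])
  assume ij: "i < p" "j < p" and t: "t \<in> carrier T"
  note [simp] = ij t
  have xt: "pure \<A> T (\<x> j) t \<in> carrier (\<A> \<boxtimes> T)" by simp
  let ?G = "\<lambda>s. Fun \<rho> (Fun (id_arr \<A> \<star> ev_id \<A> M) (Fun (id_arr \<A> \<star> ((Mul H \<star> id_arr T) \<circ>\<^sub>a assoc_inv \<A> \<A> T))
        (Fun (id_arr \<A> \<star> (Antipode H \<star> id_arr (\<A> \<boxtimes> T))) (Fun (assoc \<A> \<A> (\<A> \<boxtimes> T))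
          (pure (\<A> \<boxtimes> \<A>) (\<A> \<boxtimes> T) s (pure \<A> T (\<x> j) t))))))"
  have Gl: "lin (\<A> \<boxtimes> \<A>) M ?G"
    by (rule lin_comp[OF lin_comp[OF lin_comp[OF lin_comp[OF lin_comp[OF pure_lin(1)[OF vAA vAT xt] arrow_lin[OF as2]]
      arrow_lin[OF sa]] arrow_lin[OF mu]] arrow_lin[OF e]] arrow_lin[OF rho]])
  have G: "?G (pure \<A> \<A> (\<x> k) (\<x> l)) = sgnq l \<odot>\<^bsub>M\<^esub> Fun \<rho> (pure \<A> M (\<x> k) (ecoord M (l + j) t))"
    if [simp]: "k < p" "l < p" for k l
  proof -
    note sc = pure_smult lin_smult[OF arrow_lin[OF mu]] lin_smult[OF arrow_lin[OF e]] lin_smult[OF arrow_lin[OF rho]]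
    have ml: "(if l + j < p then \<x> (l + j) else 0) \<in> carrier \<A>" using vecsp_closed(1)[OF vecsp_trunc] by (simp add: trunc_simps)
    have "Fun (id_arr \<A> \<star> ((Mul H \<star> id_arr T) \<circ>\<^sub>a assoc_inv \<A> \<A> T)) (pure \<A> (\<A> \<boxtimes> (\<A> \<boxtimes> T)) (\<x> k) (pure \<A> (\<A> \<boxtimes> T) (\<x> l) (pure \<A> T (\<x> j) t)))
        = pure \<A> (\<A> \<boxtimes> T) (\<x> k) (pure \<A> T (if l + j < p then \<x> (l + j) else 0) t)"
      by (simp add: Fun_tensor[OF I arrow_comp[OF ai MI]] Fun_comp arrow_dom(1)[OF ai]
          Fun_assoc_inv[OF graded_trunc graded_trunc TT] Fun_tensor[OF arrow_Mul arrow_id[OF TT]] Fun_Mul)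
    moreover have "Fun (id_arr \<A> \<star> ev_id \<A> M) (pure \<A> (\<A> \<boxtimes> T) (\<x> k) (pure \<A> T (if l + j < p then \<x> (l + j) else 0) t))
        = pure \<A> M (\<x> k) (ecoord M (l + j) t)"
      using ml pure_zero(1)[OF vecsp_trunc vT t] lin_zero[OF arrow_lin[OF arrow_ev_id[OF M]]]
      by (simp add: Fun_tensor[OF I arrow_ev_id[OF M]] ecoord_def coord_def trunc_simps)
    moreover have "Fun (id_arr \<A> \<star> (Antipode H \<star> id_arr (\<A> \<boxtimes> T))) (Fun (assoc \<A> \<A> (\<A> \<boxtimes> T))
          (pure (\<A> \<boxtimes> \<A>) (\<A> \<boxtimes> T) (pure \<A> \<A> (\<x> k) (\<x> l)) (pure \<A> T (\<x> j) t)))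
        = sgnq l \<odot>\<^bsub>\<A> \<boxtimes> (\<A> \<boxtimes> (\<A> \<boxtimes> T))\<^esub> pure \<A> (\<A> \<boxtimes> (\<A> \<boxtimes> T)) (\<x> k) (pure \<A> (\<A> \<boxtimes> T) (\<x> l) (pure \<A> T (\<x> j) t))"
      by (simp add: Fun_assoc[OF graded_trunc graded_trunc AT] Fun_tensor[OF I arrow_tensor[OF arrow_Antipode arrow_id[OF AT]]]
          Fun_tensor[OF arrow_Antipode arrow_id[OF AT]] Fun_Antipode pure_smult del: trunc_simps)
    ultimately show ?thesis
      using ecoord_closed[OF M t, of "l + j"] ml by (simp add: sc)
  qed
  have rt: "Fun \<rho> (pure \<A> M (\<x> k) (ecoord M l t)) \<in> carrier M" if "k < p" for k l
    using that ecoord_closed[OF M t] by (intro arrow_closed[OF rho]) simp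
  have "coord M j (Fun (r_zero H M \<rho>) (pure \<A> T (\<x> i) t)) = Fun ?g (pure \<A> (\<A> \<boxtimes> T) (\<x> j) (pure \<A> T (\<x> i) t))"
    unfolding eq by (rule coord_of_adjoint[OF g AT _ ij(2)]) simp
  also have "\<dots> = ?G (\<xi> ^ (j * i) \<odot>\<^bsub>\<A> \<boxtimes> \<A>\<^esub> Fun (Comul H) (\<x> i))"
  proof -
    have "Fun (assoc \<A> \<A> T \<circ>\<^sub>a (braid \<A> \<A> \<star> id_arr T) \<circ>\<^sub>a assoc_inv \<A> \<A> T) (pure \<A> (\<A> \<boxtimes> T) (\<x> j) (pure \<A> T (\<x> i) t))
      = \<xi> ^ (j * i) \<odot>\<^bsub>\<A> \<boxtimes> (\<A> \<boxtimes> T)\<^esub> pure \<A> (\<A> \<boxtimes> T) (\<x> i) (pure \<A> T (\<x> j) t)"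
      by (simp add: Fun_comp arrow_dom(1)[OF ai] Fun_assoc_inv[OF graded_trunc graded_trunc TT]
          Fun_tensor[OF arrow_braid_trunc arrow_id[OF TT]] Fun_braid_trunc pure_smult lin_smult[OF arrow_lin[OF as]]
          Fun_assoc[OF graded_trunc graded_trunc TT])
    moreover have "Fun (assoc \<A> \<A> (\<A> \<boxtimes> T) \<circ>\<^sub>a (Comul H \<star> id_arr (\<A> \<boxtimes> T)))
        (\<xi> ^ (j * i) \<odot>\<^bsub>\<A> \<boxtimes> (\<A> \<boxtimes> T)\<^esub> pure \<A> (\<A> \<boxtimes> T) (\<x> i) (pure \<A> T (\<x> j) t))
      = Fun (assoc \<A> \<A> (\<A> \<boxtimes> T)) (pure (\<A> \<boxtimes> \<A>) (\<A> \<boxtimes> T) (\<xi> ^ (j * i) \<odot>\<^bsub>\<A> \<boxtimes> \<A>\<^esub> Fun (Comul H) (\<x> i)) (pure \<A> T (\<x> j) t))"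
      using arrow_closed[OF arrow_Comul xpow_carrier[OF ij(1)]] vecsp_closed(3)[OF vecsp_tensor[OF vecsp_trunc], of "pure \<A> (\<A> \<boxtimes> T) (\<x> i) (pure \<A> T (\<x> j) t)" "\<A> \<boxtimes> T"]
      by (simp add: Fun_comp arrow_dom(1)[OF cm] lin_smult[OF arrow_lin[OF cm]] Fun_tensor[OF arrow_Comul arrow_id[OF AT]] pure_smult)
    ultimately show ?thesis
      by (simp add: Fun_comp arrow_dom(1)[OF ai] arrow_dom(1)[OF cm] vecsp_closed(3)[OF vecsp_tensor[OF vecsp_trunc]])
  qed
  also have "\<dots> = \<xi> ^ (j * i) \<odot>\<^bsub>M\<^esub> ?G (Fun (Comul H) (\<x> i))"
    by (rule lin_smult[OF Gl]) (rule arrow_closed[OF arrow_Comul], simp)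
  also have "?G (Fun (Comul H) (\<x> i)) = finsum M (\<lambda>k. ?G (qbin \<xi> i k \<odot>\<^bsub>\<A> \<boxtimes> \<A>\<^esub> pure \<A> \<A> (\<x> k) (\<x> (i - k)))) {..i}"
    unfolding Fun_Comul[OF ij(1)]
  proof (rule lin_finsum[OF Gl])
    fix k assume "k \<in> {..i}"
    then have "k < p" "i - k < p" using ij(1) le_less_trans[of k i p] le_less_trans[of "i - k" i p] by auto
    then show "qbin \<xi> i k \<odot>\<^bsub>\<A> \<boxtimes> \<A>\<^esub> pure \<A> \<A> (\<x> k) (\<x> (i - k)) \<in> carrier (\<A> \<boxtimes> \<A>)" using vAA by simp
  qed
  also have "\<dots> = finsum M (\<lambda>k. (qbin \<xi> i k * sgnq (i - k)) \<odot>\<^bsub>M\<^esub> Fun \<rho> (pure \<A> M (\<x> k) (ecoord M (i - k + j) t))) {..i}"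
  proof (rule vecsp_finsum_cong[OF vM])
    fix k assume "k \<in> {..i}"
    then have k: "k < p" "i - k < p" using ij(1) le_less_trans[of k i p] le_less_trans[of "i - k" i p] by auto
    show "(qbin \<xi> i k * sgnq (i - k)) \<odot>\<^bsub>M\<^esub> Fun \<rho> (pure \<A> M (\<x> k) (ecoord M (i - k + j) t)) \<in> carrier M"
      using rt[OF k(1)] vM by simp
    show "?G (qbin \<xi> i k \<odot>\<^bsub>\<A> \<boxtimes> \<A>\<^esub> pure \<A> \<A> (\<x> k) (\<x> (i - k)))
      = (qbin \<xi> i k * sgnq (i - k)) \<odot>\<^bsub>M\<^esub> Fun \<rho> (pure \<A> M (\<x> k) (ecoord M (i - k + j) t))"
      using lin_smult[OF Gl, of "pure \<A> \<A> (\<x> k) (\<x> (i - k))" "qbin \<xi> i k"] k G[OF k] rt[OF k(1)] vM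
      by (simp add: vecsp_smult(1))
  qed
  also have "\<xi> ^ (j * i) \<odot>\<^bsub>M\<^esub> \<dots> = finsum M (\<lambda>k. \<xi> ^ (j * i) \<odot>\<^bsub>M\<^esub> ((qbin \<xi> i k * sgnq (i - k)) \<odot>\<^bsub>M\<^esub>
      Fun \<rho> (pure \<A> M (\<x> k) (ecoord M (i - k + j) t)))) {..i}"
  proof (rule lin_finsum[OF lin_smult_map[OF lin_id[OF vM]]])
    fix k assume "k \<in> {..i}"
    then have "k < p" using ij(1) le_less_trans[of k i p] by auto
    then show "(qbin \<xi> i k * sgnq (i - k)) \<odot>\<^bsub>M\<^esub> Fun \<rho> (pure \<A> M (\<x> k) (ecoord M (i - k + j) t)) \<in> carrier M"
      using rt vM by (intro vecsp_closed(3)) auto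
  qed
  also have "\<dots> = finsum M (\<lambda>k. (\<xi> ^ (i * j) * qbin \<xi> i k * sgnq (i - k)) \<odot>\<^bsub>M\<^esub>
          Fun \<rho> (pure \<A> M (\<x> k) (ecoord M (i - k + j) t))) {..i}"
  proof (rule vecsp_finsum_cong[OF vM])
    fix k assume "k \<in> {..i}"
    then have "k < p" using ij(1) le_less_trans[of k i p] by auto
    note r = rt[OF this, of "i - k + j"]
    show "(\<xi> ^ (i * j) * qbin \<xi> i k * sgnq (i - k)) \<odot>\<^bsub>M\<^esub> Fun \<rho> (pure \<A> M (\<x> k) (ecoord M (i - k + j) t)) \<in> carrier M"
      by (rule vecsp_closed(3)[OF vM r])
    show "\<xi> ^ (j * i) \<odot>\<^bsub>M\<^esub> ((qbin \<xi> i k * sgnq (i - k)) \<odot>\<^bsub>M\<^esub> Fun \<rho> (pure \<A> M (\<x> k) (ecoord M (i - k + j) t)))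
      = (\<xi> ^ (i * j) * qbin \<xi> i k * sgnq (i - k)) \<odot>\<^bsub>M\<^esub> Fun \<rho> (pure \<A> M (\<x> k) (ecoord M (i - k + j) t))"
      by (simp only: vecsp_smult(1)[OF vM r, symmetric] mult.assoc mult.commute[of j i])
  qed
  finally show "coord M j (Fun (r_zero H M \<rho>) (pure \<A> T (\<x> i) t))
      = finsum M (\<lambda>k. (\<xi> ^ (i * j) * qbin \<xi> i k * sgnq (i - k)) \<odot>\<^bsub>M\<^esub>
          Fun \<rho> (pure \<A> M (\<x> k) (ecoord M (i - k + j) t))) {..i}" .
qed

abbreviation (input) opx :: "'b \<Rightarrow> 'b" where "opx m \<equiv> Fun \<rho> (pure \<A> M (\<x> 1) m)"

text \<open>The part of the action of \<open>x\<close> through \<open>act\<close> that belongs to the summand \<open>x \<otimes> 1\<close> of its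
  comultiplication.\<close>

definition shift_twist where
  "shift_twist t = Fun (r_one H M) (Fun (braided_structure \<A> T) (pure \<A> T (\<x> 1) t))"

text \<open>The two summands of the comultiplication of \<open>x\<close> make \<open>r_zero\<close> on \<open>x\<close> a sum of two operators:
  one applies \<open>x\<close> to the coordinates and one shifts them.\<close>

definition adj_one where
  "adj_one t = fam M (\<lambda>j. \<xi> ^ j \<odot>\<^bsub>M\<^esub> Fun \<rho> (pure \<A> M (\<x> 1) (ecoord M j t)))"

definition adj_two where
  "adj_two t = fam M (\<lambda>j. (- (\<xi> ^ j)) \<odot>\<^bsub>M\<^esub> ecoord M (j + 1) t)"

lemma opx_lin: "lin M M (\<lambda>m. opx m)"
  using p_gt_1 by (intro lin_comp[OF pure_lin(2)[OF vecsp_trunc graded_vecsp[OF M]] arrow_lin[OF rho]]) simp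

lemma opx_closed: "m \<in> carrier M \<Longrightarrow> opx m \<in> carrier M"
  by (rule lin_closed[OF opx_lin])

lemma adj_lin: "lin T T adj_one" "lin T T adj_two"
  unfolding adj_one_def[abs_def] adj_two_def[abs_def]
  by (intro fam_lin[OF M] lin_smult_map lin_comp[OF ecoord_lin[OF M] opx_lin] ecoord_lin[OF M] vecsp_T[OF M])+

lemma ecoord_adj:
  assumes "t \<in> carrier T"
  shows "j < p \<Longrightarrow> ecoord M j (adj_one t) = \<xi> ^ j \<odot>\<^bsub>M\<^esub> opx (ecoord M j t)"
    and "ecoord M j (adj_two t) = (- (\<xi> ^ j)) \<odot>\<^bsub>M\<^esub> ecoord M (j + 1) t"
proof -
  note vM = graded_vecsp[OF M] and e = ecoord_closed[OF M assms]
  show "j < p \<Longrightarrow> ecoord M j (adj_one t) = \<xi> ^ j \<odot>\<^bsub>M\<^esub> opx (ecoord M j t)"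
    using vM e opx_closed by (simp add: adj_one_def ecoord_def[of M j "fam M _"] coord_fam[OF M])
  have "ecoord M (j + 1) t = \<zero>\<^bsub>M\<^esub>" if "\<not> j < p" using that by (simp add: ecoord_def)
  then show "ecoord M j (adj_two t) = (- (\<xi> ^ j)) \<odot>\<^bsub>M\<^esub> ecoord M (j + 1) t"
    using vM e by (auto simp: adj_two_def ecoord_def[of M j "fam M _"] coord_fam[OF M])
qed

lemma ecoord_eqI:
  assumes "s \<in> carrier T" "t \<in> carrier T" "\<And>j. j < p \<Longrightarrow> ecoord M j s = ecoord M j t"
  shows "s = t"
  using assms(3) by (intro coord_eqI[OF M assms(1,2)]) (simp add: ecoord_def)

text \<open>The scalar is the one in the \<open>q\<close>-binomial theorem with \<open>q = \<xi>\<close>, because \<open>adj_one\<close> multiplies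
  the coordinate \<open>j\<close> by \<open>\<xi>\<^sup>j\<close> and \<open>adj_two\<close> lowers \<open>j\<close> by one.\<close>

lemma adj_commute: "t \<in> carrier T \<Longrightarrow> adj_two (adj_one t) = \<xi> \<odot>\<^bsub>T\<^esub> adj_one (adj_two t)"
proof (rule ecoord_eqI)
  assume t: "t \<in> carrier T"
  note vM = graded_vecsp[OF M] and vT = vecsp_T[OF M] and e = ecoord_closed[OF M t]
  have c: "adj_one t \<in> carrier T" "adj_two t \<in> carrier T" using lin_closed[OF adj_lin(1) t] lin_closed[OF adj_lin(2) t] .
  have c2: "adj_two (adj_one t) \<in> carrier T" "adj_one (adj_two t) \<in> carrier T"
    using lin_closed[OF adj_lin(2) c(1)] lin_closed[OF adj_lin(1) c(2)] .
  show "adj_two (adj_one t) \<in> carrier T" "\<xi> \<odot>\<^bsub>T\<^esub> adj_one (adj_two t) \<in> carrier T" using c2 vT by simp_all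
  fix j assume j: "j < p"
  have z: "ecoord M (j + 1) (adj_one t) = \<xi> ^ (j + 1) \<odot>\<^bsub>M\<^esub> opx (ecoord M (j + 1) t)"
  proof (cases "j + 1 < p")
    case False
    then show ?thesis using lin_zero[OF opx_lin] vM by (simp add: ecoord_def)
  qed (simp add: ecoord_adj(1)[OF t])
  show "ecoord M j (adj_two (adj_one t)) = ecoord M j (\<xi> \<odot>\<^bsub>T\<^esub> adj_one (adj_two t))"
    using j vM e opx_closed[OF e]
    by (simp add: ecoord_adj(1)[OF c(2)] ecoord_adj(2)[OF c(1)] z lin_smult[OF ecoord_lin[OF M] c2(2)]
        ecoord_adj(2)[OF t] lin_smult[OF opx_lin] vecsp_smult(1)[symmetric] power_add mult_ac)
qed

lemma ecoord_adj_one_pow: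
  "t \<in> carrier T \<Longrightarrow> j < p \<Longrightarrow> ecoord M j ((adj_one ^^ k) t) = \<xi> ^ (k * j) \<odot>\<^bsub>M\<^esub> ((\<lambda>m. opx m) ^^ k) (ecoord M j t)"
proof (induction k)
  case 0
  then show ?case using graded_vecsp[OF M] ecoord_closed[OF M] by simp
next
  case (Suc k)
  note vM = graded_vecsp[OF M]
  have c: "(adj_one ^^ k) t \<in> carrier T" by (rule lin_closed[OF lin_funpow[OF adj_lin(1)] Suc.prems(1)])
  have d: "((\<lambda>m. opx m) ^^ k) (ecoord M j t) \<in> carrier M"
    by (rule lin_closed[OF lin_funpow[OF opx_lin] ecoord_closed[OF M Suc.prems(1)]])
  show ?case
    using Suc vM d opx_closed[OF d]
    by (simp add: ecoord_adj(1)[OF c] lin_smult[OF opx_lin] vecsp_smult(1)[symmetric] power_add)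
qed

lemma ecoord_adj_two_pow:
  "t \<in> carrier T \<Longrightarrow> ecoord M j ((adj_two ^^ l) t) = (\<xi> ^ (l * j) * sgnq l) \<odot>\<^bsub>M\<^esub> ecoord M (l + j) t"
proof (induction l arbitrary: j)
  case 0
  then show ?case using graded_vecsp[OF M] ecoord_closed[OF M] by (simp add: sgnq_def)
next
  case (Suc l)
  note vM = graded_vecsp[OF M]
  have c: "(adj_two ^^ l) t \<in> carrier T" by (rule lin_closed[OF lin_funpow[OF adj_lin(2)] Suc.prems(1)])
  have "Suc l * l div 2 = l + l * (l - 1) div 2" by (cases l) (auto simp: algebra_simps)
  then have "- (\<xi> ^ j) * (\<xi> ^ (l * (j + 1)) * sgnq l) = \<xi> ^ (Suc l * j) * sgnq (Suc l)"
    by (simp add: sgnq_def power_add algebra_simps)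
  moreover have "ecoord M (l + (j + 1)) t = ecoord M (Suc l + j) t" by (simp add: One_nat_def)
  ultimately show ?case
    using Suc.IH[OF Suc.prems, of "j + 1"] vM ecoord_closed[OF M Suc.prems]
    by (simp add: ecoord_adj(2)[OF c] vecsp_smult(1)[symmetric])
qed

lemma qbinomial_adj:
  assumes "t \<in> carrier T"
  shows "((\<lambda>t. adj_one t \<oplus>\<^bsub>T\<^esub> adj_two t) ^^ i) t
    = finsum T (\<lambda>k. qbin \<xi> i k \<odot>\<^bsub>T\<^esub> (adj_one ^^ k) ((adj_two ^^ (i - k)) t)) {..i}"
  by (rule qbinomial[OF adj_lin assms adj_commute])

context
  assumes rho_pow: "\<And>k m. k < p \<Longrightarrow> m \<in> carrier M \<Longrightarrow> Fun \<rho> (pure \<A> M (\<x> k) m) = ((\<lambda>m. opx m) ^^ k) m"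
begin

text \<open>The formula for the coordinates of \<open>r_zero\<close> is the expansion of a power of
  \<open>adj_one + adj_two\<close> by the \<open>q\<close>-binomial theorem.\<close>

lemma r_zero_pow:
  assumes i: "i < p" and t: "t \<in> carrier T"
  shows "Fun (r_zero H M \<rho>) (pure \<A> T (\<x> i) t) = ((\<lambda>t. adj_one t \<oplus>\<^bsub>T\<^esub> adj_two t) ^^ i) t"
proof (rule ecoord_eqI)
  note vM = graded_vecsp[OF M] and vT = vecsp_T[OF M]
  have xt: "pure \<A> T (\<x> i) t \<in> carrier (\<A> \<boxtimes> T)" using i t by simp
  show "Fun (r_zero H M \<rho>) (pure \<A> T (\<x> i) t) \<in> carrier T"
    by (rule arrow_closed[OF arrow_r_zero xt])
  show "((\<lambda>t. adj_one t \<oplus>\<^bsub>T\<^esub> adj_two t) ^^ i) t \<in> carrier T"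
    by (rule lin_closed[OF lin_funpow[OF lin_add_map[OF adj_lin]] t])
  fix j assume j: "j < p"
  have c2: "(adj_two ^^ l) t \<in> carrier T" for l by (rule lin_closed[OF lin_funpow[OF adj_lin(2)] t])
  have c1: "(adj_one ^^ k) ((adj_two ^^ l) t) \<in> carrier T" for k l by (rule lin_closed[OF lin_funpow[OF adj_lin(1)] c2])
  note pl = lin_funpow[OF opx_lin] and e = ecoord_closed[OF M t]
  have "ecoord M j (((\<lambda>t. adj_one t \<oplus>\<^bsub>T\<^esub> adj_two t) ^^ i) t)
      = finsum M (\<lambda>k. ecoord M j (qbin \<xi> i k \<odot>\<^bsub>T\<^esub> (adj_one ^^ k) ((adj_two ^^ (i - k)) t))) {..i}"
    unfolding qbinomial_adj[OF t] by (rule lin_finsum[OF ecoord_lin[OF M]]) (use c1 vT in simp)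
  also have "\<dots> = finsum M (\<lambda>k. (\<xi> ^ (i * j) * qbin \<xi> i k * sgnq (i - k)) \<odot>\<^bsub>M\<^esub>
          Fun \<rho> (pure \<A> M (\<x> k) (ecoord M (i - k + j) t))) {..i}"
  proof (rule vecsp_finsum_cong[OF vM])
    fix k assume "k \<in> {..i}"
    then have k: "k \<le> i" "k < p" using i by auto
    have r: "Fun \<rho> (pure \<A> M (\<x> k) (ecoord M (i - k + j) t)) = ((\<lambda>m. opx m) ^^ k) (ecoord M (i - k + j) t)"
      by (rule rho_pow[OF k(2) e])
    have pc: "((\<lambda>m. opx m) ^^ k) (ecoord M (i - k + j) t) \<in> carrier M" by (rule lin_closed[OF pl e])
    show "(\<xi> ^ (i * j) * qbin \<xi> i k * sgnq (i - k)) \<odot>\<^bsub>M\<^esub> Fun \<rho> (pure \<A> M (\<x> k) (ecoord M (i - k + j) t)) \<in> carrier M"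
      unfolding r using pc vM by simp
    have "i * j = k * j + (i - k) * j" using k(1) by (simp add: add_mult_distrib[symmetric])
    then have "\<xi> ^ (i * j) = \<xi> ^ (k * j) * \<xi> ^ ((i - k) * j)" by (simp add: power_add)
    then show "ecoord M j (qbin \<xi> i k \<odot>\<^bsub>T\<^esub> (adj_one ^^ k) ((adj_two ^^ (i - k)) t))
      = (\<xi> ^ (i * j) * qbin \<xi> i k * sgnq (i - k)) \<odot>\<^bsub>M\<^esub> Fun \<rho> (pure \<A> M (\<x> k) (ecoord M (i - k + j) t))"
      unfolding r using pc vM
      by (simp add: lin_smult[OF ecoord_lin[OF M] c1] ecoord_adj_one_pow[OF c2 j] ecoord_adj_two_pow[OF t]
          lin_smult[OF pl e] vecsp_smult(1)[symmetric] mult_ac)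
  qed
  also have "\<dots> = ecoord M j (Fun (r_zero H M \<rho>) (pure \<A> T (\<x> i) t))"
    using coord_r_zero[OF i j t] j by (simp add: ecoord_def[of M j "Fun _ _"])
  finally show "ecoord M j (Fun (r_zero H M \<rho>) (pure \<A> T (\<x> i) t)) = ecoord M j (((\<lambda>t. adj_one t \<oplus>\<^bsub>T\<^esub> adj_two t) ^^ i) t)"
    by simp
qed

abbreviation (input) adj where "adj t \<equiv> adj_one t \<oplus>\<^bsub>T\<^esub> adj_two t"

lemma adj_lin': "lin T T (\<lambda>t. adj t)" by (rule lin_add_map[OF adj_lin])

lemma adj_r_zero: "t \<in> carrier T \<Longrightarrow> adj t = Fun (r_zero H M \<rho>) (pure \<A> T (\<x> 1) t)"
  using r_zero_pow[of 1 t] p_gt_1 by simp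

lemma adj_homog:
  assumes "d < p" "t \<in> homog T d"
  shows "adj t \<in> homog T ((1 + d) mod p)"
  unfolding adj_r_zero[OF homog_carrier[OF graded_T[OF M] assms]]
  by (rule arrow_homog[OF arrow_r_zero _ homog_pure[OF p_gt_1 assms(1) xpow_homog assms(2)]]) simp

lemma shift_twist_lin: "lin T T shift_twist"
  unfolding shift_twist_def[abs_def]
  by (rule lin_comp[OF lin_comp[OF pure_lin(2)[OF vecsp_trunc vecsp_T[OF M]] arrow_lin[OF arrow_braided_structure]] arrow_lin[OF arrow_r_one]])
    (use p_gt_1 graded_trunc graded_T[OF M] in simp_all)

lemma r_one_twist:
  assumes k: "k < p" and d: "d < p" "t \<in> homog T d"
  shows "Fun (r_one H M) (Fun (braided_structure \<A> T) (pure \<A> T (\<x> k) t))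
    = (\<xi> powi (- (int k ^ 2) - 2 * int k * int d)) \<odot>\<^bsub>T\<^esub> Fun (r_one H M) (pure \<A> T (\<x> k) t)"
  using homog_carrier[OF graded_T[OF M] d] k
  by (simp add: Fun_braided_structure[OF graded_trunc graded_T[OF M] k d(1) xpow_homog d(2)] lin_smult[OF arrow_lin[OF arrow_r_one]])

lemma r_one_homog:
  assumes "k < p" "d < p" "t \<in> homog T d"
  shows "Fun (r_one H M) (pure \<A> T (\<x> k) t) \<in> homog T ((k + d) mod p)"
  by (rule arrow_homog[OF arrow_r_one _ homog_pure[OF assms(1,2) xpow_homog assms(3)]]) simp

lemma powi_deg: "\<xi> powi (a - 2 * int ((k + d) mod p)) = \<xi> powi (a - 2 * (int k + int d))"
proof (rule powi_root_cong)
  show "(a - 2 * int ((k + d) mod p)) mod int p = (a - 2 * (int k + int d)) mod int p"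
    using mod_diff_cong[OF refl[of "a mod int p"] mod_mult_right_eq[of 2 "int k + int d" "int p"]]
    by (simp only: of_nat_mod of_nat_add)
qed

text \<open>In degree \<open>d\<close> the braided structure contributes \<open>\<xi>\<close> to the power \<open>- k\<^sup>2 - 2 k d\<close>.  The operator
  \<open>shift_twist\<close> contributes the exponent \<open>- 1 - 2 d\<close> and raises the degree by one, so that its
  \<open>k\<close>-th power accumulates the same scalar.\<close>

lemma r_one_pow:
  assumes t: "t \<in> carrier T"
  shows "k < p \<Longrightarrow> Fun (r_one H M) (Fun (braided_structure \<A> T) (pure \<A> T (\<x> k) t)) = (shift_twist ^^ k) t"
proof -
  note vT = vecsp_T[OF M] and TT = graded_T[OF M]
  have hom: "(shift_twist ^^ k) t = (\<xi> powi (- (int k ^ 2) - 2 * int k * int d)) \<odot>\<^bsub>T\<^esub> Fun (r_one H M) (pure \<A> T (\<x> k) t)"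
    if d: "d < p" "t \<in> homog T d" and "k < p" for k d t
    using that(3)
  proof (induction k)
    case 0
    have tT: "t \<in> carrier T" by (rule homog_carrier[OF TT d])
    have "Fun (r_one H M) (pure \<A> T (\<x> 0) t) = t"
    proof (rule ecoord_eqI[OF arrow_closed[OF arrow_r_one] tT])
      fix j assume "j < p"
      then show "ecoord M j (Fun (r_one H M) (pure \<A> T (\<x> 0) t)) = ecoord M j t"
        using coord_r_one[OF 0 _ tT, of j] by (simp add: ecoord_def)
    qed (use tT in simp)
    then show ?case using vT tT by simp
  next
    case (Suc k)
    have k: "k < p" using Suc.prems by simp
    have tT: "t \<in> carrier T" by (rule homog_carrier[OF TT d])
    let ?r = "Fun (r_one H M) (pure \<A> T (\<x> k) t)"
    have r: "?r \<in> carrier T" using k tT by (intro arrow_closed[OF arrow_r_one]) simp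
    have rh: "?r \<in> homog T ((k + d) mod p)" by (rule r_one_homog[OF k d])
    have rr: "Fun (r_one H M) (pure \<A> T (\<x> 1) ?r) = Fun (r_one H M) (pure \<A> T (\<x> (Suc k)) t)"
    proof (rule ecoord_eqI)
      show "Fun (r_one H M) (pure \<A> T (\<x> 1) ?r) \<in> carrier T" "Fun (r_one H M) (pure \<A> T (\<x> (Suc k)) t) \<in> carrier T"
        using r tT Suc.prems p_gt_1 by (auto intro!: arrow_closed[OF arrow_r_one])
      fix j assume j: "j < p"
      then show "ecoord M j (Fun (r_one H M) (pure \<A> T (\<x> 1) ?r)) = ecoord M j (Fun (r_one H M) (pure \<A> T (\<x> (Suc k)) t))"
        using coord_r_one[OF p_gt_1 j r] coord_r_one[OF Suc.prems j tT] coord_r_one[OF k _ tT, of "j + 1"]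
        by (auto simp: ecoord_def One_nat_def)
    qed
    have "(shift_twist ^^ Suc k) t = (\<xi> powi (- (int k ^ 2) - 2 * int k * int d)) \<odot>\<^bsub>T\<^esub> shift_twist ?r"
      using Suc.IH[OF k] lin_smult[OF shift_twist_lin r] by simp
    also have "shift_twist ?r = (\<xi> powi (- 1 - 2 * int ((k + d) mod p))) \<odot>\<^bsub>T\<^esub> Fun (r_one H M) (pure \<A> T (\<x> (Suc k)) t)"
      using r_one_twist[OF p_gt_1 _ rh] rr by (simp add: shift_twist_def)
    also have "(\<xi> powi (- (int k ^ 2) - 2 * int k * int d)) \<odot>\<^bsub>T\<^esub> \<dots>
      = (\<xi> powi (- (int k ^ 2) - 2 * int k * int d) * \<xi> powi (- 1 - 2 * int ((k + d) mod p))) \<odot>\<^bsub>T\<^esub> Fun (r_one H M) (pure \<A> T (\<x> (Suc k)) t)"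
      using vT tT Suc.prems arrow_closed[OF arrow_r_one, of "pure \<A> T (\<x> (Suc k)) t"] by (simp add: vecsp_smult(1))
    also have "\<xi> powi (- (int k ^ 2) - 2 * int k * int d) * \<xi> powi (- 1 - 2 * int ((k + d) mod p))
      = \<xi> powi (- (int (Suc k) ^ 2) - 2 * int (Suc k) * int d)"
      unfolding powi_deg by (simp add: power_int_add[symmetric] power2_eq_square algebra_simps)
    finally show ?case .
  qed
  assume k: "k < p"
  show ?thesis
  proof (rule generates_lin_eq[OF generates_homog[OF TT] _ lin_funpow[OF shift_twist_lin] _ t])
    show "lin T T (\<lambda>t. Fun (r_one H M) (Fun (braided_structure \<A> T) (pure \<A> T (\<x> k) t)))"
      by (rule lin_comp[OF lin_comp[OF pure_lin(2)[OF vecsp_trunc vT] arrow_lin[OF arrow_braided_structure]] arrow_lin[OF arrow_r_one]])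
        (use k graded_trunc TT in simp_all)
    fix s assume "s \<in> (\<Union>i<p. homog T i)"
    then obtain d where d: "d < p" "s \<in> homog T d" by blast
    show "Fun (r_one H M) (Fun (braided_structure \<A> T) (pure \<A> T (\<x> k) s)) = (shift_twist ^^ k) s"
      unfolding hom[OF d k] by (rule r_one_twist[OF k d])
  qed
qed

text \<open>Shifting the coordinates and applying \<open>adj\<close> commute up to \<open>\<xi>\<close> inverse; the twist in
  \<open>shift_twist\<close> changes by two more powers of \<open>\<xi>\<close>, since \<open>adj\<close> raises the degree by one.\<close>

lemma adj_shift_commute:
  assumes t: "t \<in> carrier T"
  shows "adj (shift_twist t) = \<xi> \<odot>\<^bsub>T\<^esub> shift_twist (adj t)"
proof (rule generates_lin_eq[OF generates_homog[OF graded_T[OF M]] _ _ _ t])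
  note vT = vecsp_T[OF M] and TT = graded_T[OF M] and vM = graded_vecsp[OF M]
  show "lin T T (\<lambda>t. adj (shift_twist t))" by (rule lin_comp[OF shift_twist_lin adj_lin'])
  show "lin T T (\<lambda>t. \<xi> \<odot>\<^bsub>T\<^esub> shift_twist (adj t))" by (rule lin_smult_map[OF lin_comp[OF adj_lin' shift_twist_lin]])
  fix s assume "s \<in> (\<Union>i<p. homog T i)"
  then obtain d where d: "d < p" "s \<in> homog T d" by blast
  have s: "s \<in> carrier T" by (rule homog_carrier[OF TT d])
  let ?R = "\<lambda>t. Fun (r_one H M) (pure \<A> T (\<x> 1) t)"
  have Rc: "?R t \<in> carrier T" if "t \<in> carrier T" for t
    using that p_gt_1 by (intro arrow_closed[OF arrow_r_one]) simp
  have eR: "ecoord M j (?R t) = ecoord M (j + 1) t" if "t \<in> carrier T" "j < p" for j t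
    using coord_r_one[OF p_gt_1 that(2,1)] that by (simp add: ecoord_def[of M j "Fun _ _"])
  have ac: "adj t \<in> carrier T" if "t \<in> carrier T" for t by (rule lin_closed[OF adj_lin' that])
  have ea: "ecoord M j (adj t) = \<xi> ^ j \<odot>\<^bsub>M\<^esub> (opx (ecoord M j t) \<oplus>\<^bsub>M\<^esub> (-1) \<odot>\<^bsub>M\<^esub> ecoord M (j + 1) t)"
    if "t \<in> carrier T" for j t
  proof -
    note e = ecoord_closed[OF M that]
    have c: "adj_one t \<in> carrier T" "adj_two t \<in> carrier T"
      using lin_closed[OF adj_lin(1) that] lin_closed[OF adj_lin(2) that] .
    have 1: "ecoord M j (adj_one t) = \<xi> ^ j \<odot>\<^bsub>M\<^esub> opx (ecoord M j t)"
    proof (cases "j < p")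
      case False
      then show ?thesis using lin_zero[OF opx_lin] vM by (simp add: ecoord_def)
    qed (rule ecoord_adj(1)[OF that])
    show ?thesis
      using e opx_closed[OF e] vM
      by (simp add: lin_add[OF ecoord_lin[OF M] c] 1 ecoord_adj(2)[OF that] vecsp_smult(3) vecsp_smult(1)[symmetric])
  qed
  have CR: "adj (?R s) = inverse \<xi> \<odot>\<^bsub>T\<^esub> ?R (adj s)"
  proof (rule ecoord_eqI)
    show "adj (?R s) \<in> carrier T" by (rule ac[OF Rc[OF s]])
    show "inverse \<xi> \<odot>\<^bsub>T\<^esub> ?R (adj s) \<in> carrier T" by (rule vecsp_closed(3)[OF vT Rc[OF ac[OF s]]])
    fix j assume j: "j < p"
    have e2: "ecoord M (j + 1) (?R s) = ecoord M (j + 1 + 1) s"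
    proof (cases "j + 1 < p")
      case True
      then show ?thesis using eR[OF s, of "j + 1"] by simp
    qed (simp add: ecoord_def)
    have w: "opx (ecoord M (j + 1) s) \<oplus>\<^bsub>M\<^esub> (-1) \<odot>\<^bsub>M\<^esub> ecoord M (j + 1 + 1) s \<in> carrier M"
      using ecoord_closed[OF M s] opx_closed vM by simp
    have "ecoord M j (adj (?R s)) = \<xi> ^ j \<odot>\<^bsub>M\<^esub> (opx (ecoord M (j + 1) s) \<oplus>\<^bsub>M\<^esub> (-1) \<odot>\<^bsub>M\<^esub> ecoord M (j + 1 + 1) s)"
      unfolding ea[OF Rc[OF s]] eR[OF s j] e2 ..
    also have "\<dots> = (inverse \<xi> * \<xi> ^ (j + 1)) \<odot>\<^bsub>M\<^esub> (opx (ecoord M (j + 1) s) \<oplus>\<^bsub>M\<^esub> (-1) \<odot>\<^bsub>M\<^esub> ecoord M (j + 1 + 1) s)"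
    proof -
      have "inverse \<xi> * \<xi> ^ (j + 1) = \<xi> ^ j" by (simp add: field_simps One_nat_def)
      then show ?thesis by (simp only:)
    qed
    also have "\<dots> = inverse \<xi> \<odot>\<^bsub>M\<^esub> ecoord M (j + 1) (adj s)"
      unfolding ea[OF s] using w vM by (subst vecsp_smult(1)) (simp_all add: add.commute)
    also have "\<dots> = ecoord M j (inverse \<xi> \<odot>\<^bsub>T\<^esub> ?R (adj s))"
      using lin_smult[OF ecoord_lin[OF M] Rc[OF ac[OF s]]] eR[OF ac[OF s] j] by simp
    finally show "ecoord M j (adj (?R s)) = ecoord M j (inverse \<xi> \<odot>\<^bsub>T\<^esub> ?R (adj s))" .
  qed
  have "adj (shift_twist s) = (\<xi> powi (- 1 - 2 * int d)) \<odot>\<^bsub>T\<^esub> adj (?R s)"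
    using r_one_twist[OF p_gt_1 d] lin_smult[OF adj_lin' Rc[OF s]] by (simp add: shift_twist_def)
  also have "\<dots> = (\<xi> powi (- 1 - 2 * int d) * inverse \<xi>) \<odot>\<^bsub>T\<^esub> ?R (adj s)"
    unfolding CR using vT Rc[OF ac[OF s]] by (simp add: vecsp_smult(1))
  also have "\<xi> powi (- 1 - 2 * int d) * inverse \<xi> = \<xi> * \<xi> powi (- 1 - 2 * int ((1 + d) mod p))"
  proof -
    have "inverse \<xi> = \<xi> powi (-1)" by (simp add: power_int_minus)
    moreover have "\<xi> = \<xi> powi 1" by simp
    ultimately have "\<xi> powi (- 1 - 2 * int d) * inverse \<xi> = \<xi> powi (- 1 - 2 * int d + -1)"
      "\<xi> * \<xi> powi (- 1 - 2 * (int 1 + int d)) = \<xi> powi (1 + (- 1 - 2 * (int 1 + int d)))"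
      by (metis power_int_add root_nonzero)+
    then show ?thesis unfolding powi_deg by (simp add: algebra_simps)
  qed
  also have "(\<xi> * \<xi> powi (- 1 - 2 * int ((1 + d) mod p))) \<odot>\<^bsub>T\<^esub> ?R (adj s) = \<xi> \<odot>\<^bsub>T\<^esub> shift_twist (adj s)"
    using r_one_twist[OF p_gt_1 _ adj_homog[OF d]] vT Rc[OF ac[OF s]] by (simp add: shift_twist_def vecsp_smult(1))
  finally show "adj (shift_twist s) = \<xi> \<odot>\<^bsub>T\<^esub> shift_twist (adj s)" .
qed

text \<open>The \<open>q\<close>-binomial theorem a second time, now for the two parts \<open>shift_twist\<close> and \<open>adj\<close> of the action
  of \<open>x\<close>.\<close>

lemma act_arr:
  shows arrow_act: "arrow (act H M \<rho>) (\<A> \<boxtimes> T) T"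
    and Fun_act_pow: "i < p \<Longrightarrow> t \<in> carrier T \<Longrightarrow>
      Fun (act H M \<rho>) (pure \<A> T (\<x> i) t) = ((\<lambda>t. shift_twist t \<oplus>\<^bsub>T\<^esub> adj t) ^^ i) t"
proof -
  note vT = vecsp_T[OF M] and TT = graded_T[OF M] and vAA = vecsp_tensor[OF vecsp_trunc, of \<A>]
  note I = arrow_id[OF graded_trunc]
  note f1 = arrow_tensor[OF arrow_Comul arrow_id[OF TT]] and f2 = arrow_assoc[OF graded_trunc graded_trunc TT]
    and f3 = arrow_tensor[OF I arrow_r_zero] and f4 = arrow_braided_structure[OF graded_trunc TT] and f5 = arrow_r_one
  have eq: "act H M \<rho> = r_one H M \<circ>\<^sub>a braided_structure \<A> T \<circ>\<^sub>a (id_arr \<A> \<star> r_zero H M \<rho>) \<circ>\<^sub>a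
     (assoc \<A> \<A> T \<circ>\<^sub>a (Comul H \<star> id_arr T))"
    by (simp add: act_def Let_def)
  show "arrow (act H M \<rho>) (\<A> \<boxtimes> T) T"
    unfolding eq by (intro arrow_comp[OF _ f5] arrow_comp[OF _ f4] arrow_comp[OF _ f3] arrow_comp[OF f1 f2])
  assume i: "i < p" and t: "t \<in> carrier T"
  let ?G = "\<lambda>s. Fun (r_one H M) (Fun (braided_structure \<A> T) (Fun (id_arr \<A> \<star> r_zero H M \<rho>)
      (Fun (assoc \<A> \<A> T) (pure (\<A> \<boxtimes> \<A>) T s t))))"
  have Gl: "lin (\<A> \<boxtimes> \<A>) T ?G"
    by (rule lin_comp[OF lin_comp[OF lin_comp[OF lin_comp[OF pure_lin(1)[OF vAA vT t] arrow_lin[OF f2]]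
      arrow_lin[OF f3]] arrow_lin[OF f4]] arrow_lin[OF f5]])
  have rz: "Fun (r_zero H M \<rho>) (pure \<A> T (\<x> l) t) \<in> carrier T" if "l < p" for l
    using that t by (intro arrow_closed[OF arrow_r_zero]) simp
  have G: "?G (pure \<A> \<A> (\<x> k) (\<x> l)) = (shift_twist ^^ k) (((\<lambda>t. adj t) ^^ l) t)" if "k < p" "l < p" for k l
    using that t rz[OF that(2)] r_one_pow[OF rz[OF that(2)] that(1)]
    by (simp add: Fun_assoc[OF graded_trunc graded_trunc TT] Fun_tensor[OF I arrow_r_zero] r_zero_pow)
  have cl: "(shift_twist ^^ k) (((\<lambda>t. adj t) ^^ l) t) \<in> carrier T" for k l
    by (rule lin_closed[OF lin_funpow[OF shift_twist_lin] lin_closed[OF lin_funpow[OF adj_lin'] t]])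
  have "Fun (act H M \<rho>) (pure \<A> T (\<x> i) t) = ?G (Fun (Comul H) (\<x> i))"
    unfolding eq using i t arrow_closed[OF arrow_Comul xpow_carrier[OF i]]
    by (simp add: Fun_comp arrow_dom(1)[OF f1] Fun_tensor[OF arrow_Comul arrow_id[OF TT]])
  also have "\<dots> = finsum T (\<lambda>k. ?G (qbin \<xi> i k \<odot>\<^bsub>\<A> \<boxtimes> \<A>\<^esub> pure \<A> \<A> (\<x> k) (\<x> (i - k)))) {..i}"
    unfolding Fun_Comul[OF i] by (rule lin_finsum[OF Gl]) (use vAA i in auto)
  also have "\<dots> = finsum T (\<lambda>k. qbin \<xi> i k \<odot>\<^bsub>T\<^esub> (shift_twist ^^ k) (((\<lambda>t. adj t) ^^ (i - k)) t)) {..i}"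
  proof (rule vecsp_finsum_cong[OF vT])
    fix k assume "k \<in> {..i}"
    then have k: "k < p" "i - k < p" using i by auto
    show "qbin \<xi> i k \<odot>\<^bsub>T\<^esub> (shift_twist ^^ k) (((\<lambda>t. adj t) ^^ (i - k)) t) \<in> carrier T"
      by (rule vecsp_closed(3)[OF vT cl])
    show "?G (qbin \<xi> i k \<odot>\<^bsub>\<A> \<boxtimes> \<A>\<^esub> pure \<A> \<A> (\<x> k) (\<x> (i - k)))
      = qbin \<xi> i k \<odot>\<^bsub>T\<^esub> (shift_twist ^^ k) (((\<lambda>t. adj t) ^^ (i - k)) t)"
      unfolding G[OF k, symmetric] by (rule lin_smult[OF Gl]) (use k in simp)
  qed
  also have "\<dots> = ((\<lambda>t. shift_twist t \<oplus>\<^bsub>T\<^esub> adj t) ^^ i) t"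
    using qbinomial[where P = shift_twist and Q = "\<lambda>t. adj t" and V = T and q = \<xi> and v = t and n = i,
        OF shift_twist_lin adj_lin' t] adj_shift_commute by simp
  finally show "Fun (act H M \<rho>) (pure \<A> T (\<x> i) t) = ((\<lambda>t. shift_twist t \<oplus>\<^bsub>T\<^esub> adj t) ^^ i) t" .
qed

lemma Fun_act_pow':
  assumes "i < p" "t \<in> carrier T"
  shows "Fun (act H M \<rho>) (pure \<A> T (\<x> i) t) = ((\<lambda>t. Fun (act H M \<rho>) (pure \<A> T (\<x> 1) t)) ^^ i) t"
proof -
  have "((\<lambda>t. shift_twist t \<oplus>\<^bsub>T\<^esub> adj t) ^^ i) t = ((\<lambda>t. Fun (act H M \<rho>) (pure \<A> T (\<x> 1) t)) ^^ i) t"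
  proof (induction i)
    case (Suc i)
    have "((\<lambda>t. shift_twist t \<oplus>\<^bsub>T\<^esub> adj t) ^^ i) t \<in> carrier T"
      by (rule lin_closed[OF lin_funpow[OF lin_add_map[OF shift_twist_lin adj_lin']] assms(2)])
    then show ?case using Fun_act_pow[OF p_gt_1] Suc by simp
  qed simp
  then show ?thesis using Fun_act_pow[OF assms] by simp
qed

text \<open>Both \<open>shift_twist\<close> and \<open>adj_two\<close> take \<open>\<delta> n \<otimes> m\<close> to a multiple of \<open>\<delta> (n - 1) \<otimes> m\<close>; the difference
  of scalars in the last summand combines the two.\<close>

lemma Fun_act_pure:
  assumes n: "n < p" and d: "d < p" "m \<in> homog M d"
  shows "Fun (act H M \<rho>) (pure \<A> T (\<x> 1) (pure \<D> M (\<delta> n) m)) = \<xi> ^ n \<odot>\<^bsub>T\<^esub> pure \<D> M (\<delta> n) (opx m) \<oplus>\<^bsub>T\<^esub>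
    (if n = 0 then \<zero>\<^bsub>T\<^esub> else (\<xi> powi (2 * int n - 1 - 2 * int d) - \<xi> ^ (n - 1)) \<odot>\<^bsub>T\<^esub> pure \<D> M (\<delta> (n - 1)) m)"
proof (rule ecoord_eqI)
  note vT = vecsp_T[OF M] and vM = graded_vecsp[OF M]
  have m: "m \<in> carrier M" by (rule homog_carrier[OF M d])
  let ?t = "pure \<D> M (\<delta> n) m"
  have t: "?t \<in> carrier T" using m by simp
  have th: "?t \<in> homog T ((codeg n + d) mod p)" by (rule homog_pure[OF codeg(2) d(1) delta_homog[OF n] d(2)])
  have om: "opx m \<in> carrier M" by (rule opx_closed[OF m])
  show "Fun (act H M \<rho>) (pure \<A> T (\<x> 1) ?t) \<in> carrier T"
    using t p_gt_1 by (intro arrow_closed[OF arrow_act]) simp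
  show "\<xi> ^ n \<odot>\<^bsub>T\<^esub> pure \<D> M (\<delta> n) (opx m) \<oplus>\<^bsub>T\<^esub>
    (if n = 0 then \<zero>\<^bsub>T\<^esub> else (\<xi> powi (2 * int n - 1 - 2 * int d) - \<xi> ^ (n - 1)) \<odot>\<^bsub>T\<^esub> pure \<D> M (\<delta> (n - 1)) m) \<in> carrier T"
    using vT m om by simp
  fix j assume j: "j < p"
  have pw: "\<xi> powi (- 1 - 2 * int ((codeg n + d) mod p)) = \<xi> powi (2 * int n - 1 - 2 * int d)"
  proof -
    have "\<xi> powi (- 1 - 2 * int ((codeg n + d) mod p)) = \<xi> powi (- 1 - 2 * (int (codeg n) + int d))" by (rule powi_deg)
    also have "\<dots> = \<xi> powi (2 * int n - 1 - 2 * int d)"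
    proof (rule powi_root_cong)
      have "int (codeg n) mod int p = (- int n) mod int p"
        by (rule codeg_mod) (use n in simp)
      then have "(- 1 - 2 * (int (codeg n) + int d)) mod int p = (- 1 - 2 * (- int n + int d)) mod int p"
        by (intro mod_diff_cong mod_mult_cong mod_add_cong refl)
      then show "(- 1 - 2 * (int (codeg n) + int d)) mod int p = (2 * int n - 1 - 2 * int d) mod int p"
        by (simp add: algebra_simps)
    qed
    finally show ?thesis .
  qed
  have st: "shift_twist ?t = (\<xi> powi (2 * int n - 1 - 2 * int d)) \<odot>\<^bsub>T\<^esub> Fun (r_one H M) (pure \<A> T (\<x> 1) ?t)"
    using r_one_twist[OF p_gt_1 _ th] pw by (simp add: shift_twist_def)
  have rc: "Fun (r_one H M) (pure \<A> T (\<x> 1) ?t) \<in> carrier T"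
    using t p_gt_1 by (intro arrow_closed[OF arrow_r_one]) simp
  have er: "ecoord M j (Fun (r_one H M) (pure \<A> T (\<x> 1) ?t)) = (if j + 1 = n then m else \<zero>\<^bsub>M\<^esub>)"
    using coord_r_one[OF p_gt_1 j t] j ecoord_pure[OF M m n, of "j + 1"] by (simp add: ecoord_def[of M j "Fun _ _"])
  have c: "adj_one ?t \<in> carrier T" "adj_two ?t \<in> carrier T"
    using lin_closed[OF adj_lin(1) t] lin_closed[OF adj_lin(2) t] .
  have sc: "shift_twist ?t \<in> carrier T" "adj ?t \<in> carrier T"
    using lin_closed[OF shift_twist_lin t] lin_closed[OF adj_lin' t] .
  have "ecoord M j (Fun (act H M \<rho>) (pure \<A> T (\<x> 1) ?t)) = ecoord M j (shift_twist ?t \<oplus>\<^bsub>T\<^esub> adj ?t)"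
    using Fun_act_pow[OF p_gt_1 t] by simp
  also have "\<dots> = (\<xi> powi (2 * int n - 1 - 2 * int d)) \<odot>\<^bsub>M\<^esub> (if j + 1 = n then m else \<zero>\<^bsub>M\<^esub>)
      \<oplus>\<^bsub>M\<^esub> (\<xi> ^ j \<odot>\<^bsub>M\<^esub> opx (if j = n then m else \<zero>\<^bsub>M\<^esub>) \<oplus>\<^bsub>M\<^esub> (- (\<xi> ^ j)) \<odot>\<^bsub>M\<^esub> (if j + 1 = n then m else \<zero>\<^bsub>M\<^esub>))"
    unfolding lin_add[OF ecoord_lin[OF M] sc] lin_add[OF ecoord_lin[OF M] c]
    by (simp only: st lin_smult[OF ecoord_lin[OF M] rc] er ecoord_adj(1)[OF t j] ecoord_adj(2)[OF t] ecoord_pure[OF M m n])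
  also have "\<dots> = ecoord M j (\<xi> ^ n \<odot>\<^bsub>T\<^esub> pure \<D> M (\<delta> n) (opx m) \<oplus>\<^bsub>T\<^esub>
    (if n = 0 then \<zero>\<^bsub>T\<^esub> else (\<xi> powi (2 * int n - 1 - 2 * int d) - \<xi> ^ (n - 1)) \<odot>\<^bsub>T\<^esub> pure \<D> M (\<delta> (n - 1)) m))"
    (is "_ = ecoord M j (?a \<oplus>\<^bsub>T\<^esub> ?b)")
  proof -
    have ab: "?a \<in> carrier T" "?b \<in> carrier T" using vT m om by simp_all
    have 1: "ecoord M j ?a = (if j = n then \<xi> ^ n \<odot>\<^bsub>M\<^esub> opx m else \<zero>\<^bsub>M\<^esub>)"
      using om vM by (simp add: lin_smult[OF ecoord_lin[OF M]] ecoord_pure[OF M om n])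
    have 2: "ecoord M j ?b = (if j + 1 = n then (\<xi> powi (2 * int n - 1 - 2 * int d) - \<xi> ^ j) \<odot>\<^bsub>M\<^esub> m else \<zero>\<^bsub>M\<^esub>)"
    proof (cases "n = 0")
      case True
      then show ?thesis using lin_zero[OF ecoord_lin[OF M]] by simp
    next
      case False
      then have "n - 1 < p" "j = n - 1 \<longleftrightarrow> j + 1 = n" using n by auto
      then show ?thesis using m vM False by (auto simp: lin_smult[OF ecoord_lin[OF M]] ecoord_pure[OF M m])
    qed
    show ?thesis
      unfolding lin_add[OF ecoord_lin[OF M] ab] 1 2
      using m om vM lin_zero[OF opx_lin] vecsp_smult(2)[OF vM m, of "\<xi> powi (2 * int n - 1 - 2 * int d)" "- (\<xi> ^ j)"]
      by auto
  qed
  finally show "ecoord M j (Fun (act H M \<rho>) (pure \<A> T (\<x> 1) ?t)) = ecoord M j (\<xi> ^ n \<odot>\<^bsub>T\<^esub> pure \<D> M (\<delta> n) (opx m) \<oplus>\<^bsub>T\<^esub>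
    (if n = 0 then \<zero>\<^bsub>T\<^esub> else (\<xi> powi (2 * int n - 1 - 2 * int d) - \<xi> ^ (n - 1)) \<odot>\<^bsub>T\<^esub> pure \<D> M (\<delta> (n - 1)) m))" .
qed

end

end

end

context zp_root
begin

section \<open>Modules on generators\<close>

text \<open>The module axioms are equations between arrows on tensor products, hence can be tested on
  generators.\<close>

lemma module_obj_iff:
  assumes m: "arrow m (B \<boxtimes> B) B" and u: "arrow u \<I> B" and S: "generates B S"
    and M: "graded_space M" and rho: "arrow \<rho> (B \<boxtimes> M) M"
  shows "module_obj B m u M \<rho> \<longleftrightarrow> (\<forall>v\<in>carrier M. Fun \<rho> (pure B M (Fun u 1) v) = v) \<and>
    (\<forall>a\<in>S. \<forall>b\<in>S. \<forall>v\<in>carrier M.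
      Fun \<rho> (pure B M (Fun m (pure B B a b)) v) = Fun \<rho> (pure B M a (Fun \<rho> (pure B M b v))))"
proof -
  note B = arrow_graded(2)[OF m] and vM = graded_vecsp[OF M] and I = arrow_id[OF M]
  note mI = arrow_tensor[OF m I] and uI = arrow_tensor[OF u I] and Ir = arrow_tensor[OF arrow_id[OF B] rho]
    and as = arrow_assoc[OF B B M]
  have SB: "S \<subseteq> carrier B" using S by (simp add: generates_def)
  note a1 = arrow_comp[OF mI rho] and a2 = arrow_comp[OF arrow_comp[OF as Ir] rho] and a3 = arrow_comp[OF uI rho]
  have l: "Fun (\<rho> \<circ>\<^sub>a (m \<star> id_arr M)) (pure (B \<boxtimes> B) M (pure B B a b) v) = Fun \<rho> (pure B M (Fun m (pure B B a b)) v)"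
    "Fun (\<rho> \<circ>\<^sub>a (id_arr B \<star> \<rho>) \<circ>\<^sub>a assoc B B M) (pure (B \<boxtimes> B) M (pure B B a b) v) = Fun \<rho> (pure B M a (Fun \<rho> (pure B M b v)))"
    if "a \<in> carrier B" "b \<in> carrier B" "v \<in> carrier M" for a b v
    using that by (simp_all add: Fun_comp arrow_dom(1)[OF mI] arrow_dom(1)[OF as] Fun_tensor[OF m I] Fun_assoc[OF B B M]
        Fun_tensor[OF arrow_id[OF B] rho])
  have r: "Fun (\<rho> \<circ>\<^sub>a (u \<star> id_arr M)) (pure \<I> M 1 v) = Fun \<rho> (pure B M (Fun u 1) v)" "Fun (lunit M) (pure \<I> M 1 v) = v"
    if "v \<in> carrier M" for v
    using that vM by (simp_all add: Fun_comp arrow_dom(1)[OF uI] Fun_tensor[OF u I] Fun_lunit[OF M])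
  have 1: "\<rho> \<circ>\<^sub>a (u \<star> id_arr M) = lunit M \<longleftrightarrow> (\<forall>v\<in>carrier M. Fun \<rho> (pure B M (Fun u 1) v) = v)"
  proof
    assume "\<rho> \<circ>\<^sub>a (u \<star> id_arr M) = lunit M"
    then show "\<forall>v\<in>carrier M. Fun \<rho> (pure B M (Fun u 1) v) = v" using r by simp
  next
    assume "\<forall>v\<in>carrier M. Fun \<rho> (pure B M (Fun u 1) v) = v"
    then show "\<rho> \<circ>\<^sub>a (u \<star> id_arr M) = lunit M"
      using r by (intro arrow_tensor_eqI[OF a3 arrow_lunit[OF M] generates_unit generates_carrier[OF M]]) auto
  qed
  have 2: "\<rho> \<circ>\<^sub>a (m \<star> id_arr M) = \<rho> \<circ>\<^sub>a (id_arr B \<star> \<rho>) \<circ>\<^sub>a assoc B B M \<longleftrightarrow>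
    (\<forall>a\<in>S. \<forall>b\<in>S. \<forall>v\<in>carrier M.
      Fun \<rho> (pure B M (Fun m (pure B B a b)) v) = Fun \<rho> (pure B M a (Fun \<rho> (pure B M b v))))"
  proof
    assume eq: "\<rho> \<circ>\<^sub>a (m \<star> id_arr M) = \<rho> \<circ>\<^sub>a (id_arr B \<star> \<rho>) \<circ>\<^sub>a assoc B B M"
    show "\<forall>a\<in>S. \<forall>b\<in>S. \<forall>v\<in>carrier M.
      Fun \<rho> (pure B M (Fun m (pure B B a b)) v) = Fun \<rho> (pure B M a (Fun \<rho> (pure B M b v)))"
    proof (intro ballI)
      fix a b v assume ab: "a \<in> S" "b \<in> S" and v: "v \<in> carrier M"
      then have "a \<in> carrier B" "b \<in> carrier B" using SB by auto
      then show "Fun \<rho> (pure B M (Fun m (pure B B a b)) v) = Fun \<rho> (pure B M a (Fun \<rho> (pure B M b v)))"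
        using l[OF _ _ v, of a b] unfolding eq by simp
    qed
  next
    assume "\<forall>a\<in>S. \<forall>b\<in>S. \<forall>v\<in>carrier M.
      Fun \<rho> (pure B M (Fun m (pure B B a b)) v) = Fun \<rho> (pure B M a (Fun \<rho> (pure B M b v)))"
    then show "\<rho> \<circ>\<^sub>a (m \<star> id_arr M) = \<rho> \<circ>\<^sub>a (id_arr B \<star> \<rho>) \<circ>\<^sub>a assoc B B M"
    proof (intro arrow_tensor_eqI[OF a1 a2 generates_tensor[OF S S] generates_carrier[OF M]])
      fix t v assume h: "\<forall>a\<in>S. \<forall>b\<in>S. \<forall>v\<in>carrier M.
        Fun \<rho> (pure B M (Fun m (pure B B a b)) v) = Fun \<rho> (pure B M a (Fun \<rho> (pure B M b v)))"
        and t: "t \<in> {pure B B a b | a b. a \<in> S \<and> b \<in> S}" and v: "v \<in> carrier M"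
      from t obtain a b where ab: "t = pure B B a b" "a \<in> S" "b \<in> S" by blast
      then have "a \<in> carrier B" "b \<in> carrier B" using SB by auto
      then show "Fun (\<rho> \<circ>\<^sub>a (m \<star> id_arr M)) (pure (B \<boxtimes> B) M t v) = Fun (\<rho> \<circ>\<^sub>a (id_arr B \<star> \<rho>) \<circ>\<^sub>a assoc B B M) (pure (B \<boxtimes> B) M t v)"
        using h ab v l by simp
    qed
  qed
  show ?thesis
    unfolding module_obj_def 1 2 using M arrow_mor[OF rho] by blast
qed

end

context zp_hopf
begin

section \<open>Stable anti-Yetter-Drinfeld modules as graded spaces with two operators\<close>

lemma module_trunc_iff:
  assumes M: "graded_space M" and rho: "arrow \<rho> (\<A> \<boxtimes> M) M"
  shows "module_obj \<A> (Mul H) (Unit H) M \<rho> \<longleftrightarrow> (\<forall>v\<in>carrier M. Fun \<rho> (pure \<A> M (\<x> 0) v) = v) \<and>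
    (\<forall>i<p. \<forall>j<p. \<forall>v\<in>carrier M. Fun \<rho> (pure \<A> M (\<x> i) (Fun \<rho> (pure \<A> M (\<x> j) v)))
      = (if i + j < p then Fun \<rho> (pure \<A> M (\<x> (i + j)) v) else \<zero>\<^bsub>M\<^esub>))"
proof -
  have u: "Fun (Unit H) 1 = \<x> 0" using vecsp_trunc by (simp add: Fun_Unit trunc_simps)
  have z: "Fun \<rho> (pure \<A> M 0 v) = \<zero>\<^bsub>M\<^esub>" if "v \<in> carrier M" for v
    using pure_zero(1)[OF vecsp_trunc graded_vecsp[OF M] that] lin_zero[OF arrow_lin[OF rho]] by simp
  show ?thesis
    unfolding module_obj_iff[OF arrow_Mul arrow_Unit generates_trunc M rho] u
    by (rule conj_cong[OF refl]) (auto simp: Fun_Mul z)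
qed

lemma module_dual_iff:
  assumes M: "graded_space M" and sg: "arrow \<sigma> (\<D> \<boxtimes> M) M"
  shows "module_obj \<D> (dual_mul H) (dual_unit H) M \<sigma> \<longleftrightarrow> (\<forall>v\<in>carrier M. Fun \<sigma> (pure \<D> M (\<delta> 0) v) = v) \<and>
    (\<forall>i<p. \<forall>j<p. \<forall>v\<in>carrier M. Fun \<sigma> (pure \<D> M (\<delta> i) (Fun \<sigma> (pure \<D> M (\<delta> j) v)))
      = (if i + j < p then \<kappa> i j \<odot>\<^bsub>M\<^esub> Fun \<sigma> (pure \<D> M (\<delta> (i + j)) v) else \<zero>\<^bsub>M\<^esub>))"
proof -
  note vD = vecsp_dual[OF vecsp_trunc] and vM = graded_vecsp[OF M]
  have z: "Fun \<sigma> (pure \<D> M \<zero>\<^bsub>\<D>\<^esub> v) = \<zero>\<^bsub>M\<^esub>" if "v \<in> carrier M" for v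
    using pure_zero(1)[OF vD vM that] lin_zero[OF arrow_lin[OF sg]] by simp
  have s: "Fun \<sigma> (pure \<D> M (c \<odot>\<^bsub>\<D>\<^esub> \<delta> n) v) = c \<odot>\<^bsub>M\<^esub> Fun \<sigma> (pure \<D> M (\<delta> n) v)" if "v \<in> carrier M" for c n v
    using that by (simp add: pure_smult lin_smult[OF arrow_lin[OF sg]])
  show ?thesis
    unfolding module_obj_iff[OF arrow_dual_mul arrow_dual_unit generates_dual M sg] Fun_dual_unit
    by (rule conj_cong[OF refl]) (auto simp: Fun_dual_mul z s)
qed

text \<open>On both sides of the condition \<open>x\<^sup>i\<close> acts as the \<open>i\<close>-th power of \<open>x\<close>, so the two sides agree as
  soon as they agree on \<open>x\<close>, where \<open>Fun_act_pure\<close> computes the right one.\<close>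

lemma ayd_condition_iff:
  assumes M: "graded_space M" and rho: "arrow \<rho> (\<A> \<boxtimes> M) M" and sg: "arrow \<sigma> (\<D> \<boxtimes> M) M"
    and rho_pow: "\<And>k m. k < p \<Longrightarrow> m \<in> carrier M \<Longrightarrow>
      Fun \<rho> (pure \<A> M (\<x> k) m) = ((\<lambda>m. Fun \<rho> (pure \<A> M (\<x> 1) m)) ^^ k) m"
  shows "\<rho> \<circ>\<^sub>a (id_arr \<A> \<star> \<sigma>) = \<sigma> \<circ>\<^sub>a act H M \<rho> \<longleftrightarrow>
    (\<forall>n<p. \<forall>d<p. \<forall>m\<in>homog M d. Fun \<rho> (pure \<A> M (\<x> 1) (Fun \<sigma> (pure \<D> M (\<delta> n) m)))
      = \<xi> ^ n \<odot>\<^bsub>M\<^esub> Fun \<sigma> (pure \<D> M (\<delta> n) (Fun \<rho> (pure \<A> M (\<x> 1) m))) \<oplus>\<^bsub>M\<^esub>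
        (if n = 0 then \<zero>\<^bsub>M\<^esub> else (\<xi> powi (2 * int n - 1 - 2 * int d) - \<xi> ^ (n - 1)) \<odot>\<^bsub>M\<^esub>
          Fun \<sigma> (pure \<D> M (\<delta> (n - 1)) m)))"
    (is "?L = ?R \<longleftrightarrow> ?rhs")
proof -
  note vM = graded_vecsp[OF M] and vT = vecsp_T[OF M] and TT = graded_T[OF M]
  note Is = arrow_tensor[OF arrow_id[OF graded_trunc] sg]
  have ac: "arrow (act H M \<rho>) (\<A> \<boxtimes> (\<D> \<boxtimes> M)) (\<D> \<boxtimes> M)"
    by (rule arrow_act[OF M rho]) (rule rho_pow)
  note aL = arrow_comp[OF Is rho] and aR = arrow_comp[OF ac sg]
  let ?a = "\<lambda>t. Fun (act H M \<rho>) (pure \<A> (\<D> \<boxtimes> M) (\<x> 1) t)"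
  let ?x = "\<lambda>m. Fun \<rho> (pure \<A> M (\<x> 1) m)"
  have vL: "Fun ?L (pure \<A> (\<D> \<boxtimes> M) (\<x> i) t) = Fun \<rho> (pure \<A> M (\<x> i) (Fun \<sigma> t))"
    and vR: "Fun ?R (pure \<A> (\<D> \<boxtimes> M) (\<x> i) t) = Fun \<sigma> (Fun (act H M \<rho>) (pure \<A> (\<D> \<boxtimes> M) (\<x> i) t))"
    if "i < p" "t \<in> carrier (\<D> \<boxtimes> M)" for i t
    using that by (simp_all add: Fun_comp arrow_dom(1)[OF Is] arrow_dom(1)[OF ac] Fun_tensor[OF arrow_id[OF graded_trunc] sg])
  have val: "Fun \<sigma> (?a (pure \<D> M (\<delta> n) m)) = \<xi> ^ n \<odot>\<^bsub>M\<^esub> Fun \<sigma> (pure \<D> M (\<delta> n) (?x m)) \<oplus>\<^bsub>M\<^esub>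
        (if n = 0 then \<zero>\<^bsub>M\<^esub> else (\<xi> powi (2 * int n - 1 - 2 * int d) - \<xi> ^ (n - 1)) \<odot>\<^bsub>M\<^esub>
          Fun \<sigma> (pure \<D> M (\<delta> (n - 1)) m))"
    if n: "n < p" and d: "d < p" "m \<in> homog M d" for n d m
  proof -
    have m: "m \<in> carrier M" by (rule homog_carrier[OF M d])
    have xm: "?x m \<in> carrier M" using m p_gt_1 by (intro arrow_closed[OF rho]) simp
    have c: "pure \<D> M (\<delta> n) (?x m) \<in> carrier (\<D> \<boxtimes> M)" "pure \<D> M (\<delta> (n - 1)) m \<in> carrier (\<D> \<boxtimes> M)"
      using m xm by simp_all
    have a: "?a (pure \<D> M (\<delta> n) m) = \<xi> ^ n \<odot>\<^bsub>\<D> \<boxtimes> M\<^esub> pure \<D> M (\<delta> n) (?x m) \<oplus>\<^bsub>\<D> \<boxtimes> M\<^esub>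
      (if n = 0 then \<zero>\<^bsub>\<D> \<boxtimes> M\<^esub> else (\<xi> powi (2 * int n - 1 - 2 * int d) - \<xi> ^ (n - 1)) \<odot>\<^bsub>\<D> \<boxtimes> M\<^esub> pure \<D> M (\<delta> (n - 1)) m)"
      by (rule Fun_act_pure[OF M rho _ n d]) (rule rho_pow)
    show ?thesis
      unfolding a using c vT by (simp add: lin_add[OF arrow_lin[OF sg]] lin_smult[OF arrow_lin[OF sg]] lin_zero[OF arrow_lin[OF sg]])
  qed
  show ?thesis
  proof
    assume eq: "?L = ?R"
    show ?rhs
    proof (intro allI impI ballI)
      fix n d m assume n: "n < p" and d: "d < p" "m \<in> homog M d"
      have "pure \<D> M (\<delta> n) m \<in> carrier (\<D> \<boxtimes> M)" using homog_carrier[OF M d] by simp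
      then have "?x (Fun \<sigma> (pure \<D> M (\<delta> n) m)) = Fun \<sigma> (?a (pure \<D> M (\<delta> n) m))"
        using vL[OF p_gt_1] vR[OF p_gt_1] eq by simp
      then show "?x (Fun \<sigma> (pure \<D> M (\<delta> n) m)) = \<xi> ^ n \<odot>\<^bsub>M\<^esub> Fun \<sigma> (pure \<D> M (\<delta> n) (?x m)) \<oplus>\<^bsub>M\<^esub>
        (if n = 0 then \<zero>\<^bsub>M\<^esub> else (\<xi> powi (2 * int n - 1 - 2 * int d) - \<xi> ^ (n - 1)) \<odot>\<^bsub>M\<^esub>
          Fun \<sigma> (pure \<D> M (\<delta> (n - 1)) m))"
        using val[OF n d] by simp
    qed
  next
    assume rhs: ?rhs
    have gen: "generates (\<D> \<boxtimes> M) {pure \<D> M \<phi> m | \<phi> m. \<phi> \<in> \<delta> ` {..<p} \<and> m \<in> (\<Union>d<p. homog M d)}"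
      by (rule generates_tensor[OF generates_dual generates_homog[OF M]])
    have al: "lin (\<D> \<boxtimes> M) (\<D> \<boxtimes> M) ?a"
      using p_gt_1 by (intro lin_comp[OF pure_lin(2)[OF vecsp_trunc vT] arrow_lin[OF ac]]) simp
    have xl: "lin M M ?x"
      using p_gt_1 by (intro lin_comp[OF pure_lin(2)[OF vecsp_trunc vM] arrow_lin[OF rho]]) simp
    have step: "?x (Fun \<sigma> t) = Fun \<sigma> (?a t)" if t: "t \<in> carrier (\<D> \<boxtimes> M)" for t
    proof (rule generates_lin_eq[OF gen lin_comp[OF arrow_lin[OF sg] xl] lin_comp[OF al arrow_lin[OF sg]] _ t])
      fix s assume "s \<in> {pure \<D> M \<phi> m | \<phi> m. \<phi> \<in> \<delta> ` {..<p} \<and> m \<in> (\<Union>d<p. homog M d)}"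
      then obtain n d m where s: "s = pure \<D> M (\<delta> n) m" "n < p" "d < p" "m \<in> homog M d" by auto
      then show "?x (Fun \<sigma> s) = Fun \<sigma> (?a s)" using rhs val[OF s(2-4)] by simp
    qed
    have pow: "(?x ^^ i) (Fun \<sigma> t) = Fun \<sigma> ((?a ^^ i) t)" if t: "t \<in> carrier (\<D> \<boxtimes> M)" for i t
    proof (induction i)
      case (Suc i)
      have "(?a ^^ i) t \<in> carrier (\<D> \<boxtimes> M)" by (rule lin_closed[OF lin_funpow[OF al] t])
      then show ?case using Suc step by simp
    qed simp
    show "?L = ?R"
    proof (rule arrow_tensor_eqI[OF aL aR generates_trunc generates_carrier[OF TT]])
      fix f t assume "f \<in> \<x> ` {..<p}" and t: "t \<in> carrier (\<D> \<boxtimes> M)"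
      then obtain i where i: "f = \<x> i" "i < p" by blast
      have st: "Fun \<sigma> t \<in> carrier M" by (rule arrow_closed[OF sg t])
      have "Fun (act H M \<rho>) (pure \<A> (\<D> \<boxtimes> M) (\<x> i) t) = (?a ^^ i) t"
        by (rule Fun_act_pow'[OF M rho _ i(2) t]) (rule rho_pow)
      then show "Fun ?L (pure \<A> (\<D> \<boxtimes> M) f t) = Fun ?R (pure \<A> (\<D> \<boxtimes> M) f t)"
        unfolding i(1) vL[OF i(2) t] vR[OF i(2) t]
        using rho_pow[OF i(2) st] pow[OF t] by simp
    qed
  qed
qed

lemma stab_arr:
  assumes M: "graded_space (Und N)" and rho: "arrow (Act N) (\<A> \<boxtimes> Und N) (Und N)" and sg: "arrow (Dact N) (\<D> \<boxtimes> Und N) (Und N)"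
  shows arrow_stab: "arrow (stab H N) (Und N) (Und N)"
    and Fun_stab: "d < p \<Longrightarrow> m \<in> homog (Und N) d \<Longrightarrow> Fun (stab H N) m = (\<xi> powi (- (int d ^ 2))) \<odot>\<^bsub>Und N\<^esub>
      finsum (Und N) (\<lambda>n. Fun (Dact N) (pure \<D> (Und N) (\<delta> n) (Fun (Act N) (pure \<A> (Und N) (\<x> n) m)))) {..<p}"
proof -
  let ?M = "Und N"
  note vD = vecsp_dual[OF vecsp_trunc] and vM = graded_vecsp[OF M] and ID = arrow_id[OF graded_dual]
  note vDA = vecsp_tensor[OF vD, of \<A>]
  note f1 = arrow_scaling[OF M, of "\<lambda>i. \<xi> powi (- (int i ^ 2))"] and f2 = arrow_lunit_inv[OF M]
    and f3 = arrow_tensor[OF arrow_coev arrow_id[OF M]] and f4 = arrow_assoc[OF graded_dual graded_trunc M]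
    and f5 = arrow_tensor[OF ID rho]
  have eq: "stab H N = Dact N \<circ>\<^sub>a (id_arr \<D> \<star> Act N) \<circ>\<^sub>a assoc \<D> \<A> ?M \<circ>\<^sub>a (coev \<A> \<star> id_arr ?M) \<circ>\<^sub>a
     inv_arr (lunit ?M) \<circ>\<^sub>a scaling (\<lambda>i. \<xi> powi (- (int i ^ 2))) ?M"
    by (simp add: stab_def Let_def antitwist_eq[OF M])
  show "arrow (stab H N) ?M ?M"
    unfolding eq by (intro arrow_comp[OF _ sg] arrow_comp[OF _ f5] arrow_comp[OF _ f4] arrow_comp[OF _ f3] arrow_comp[OF f1 f2])
  assume d: "d < p" "m \<in> homog ?M d"
  have m: "m \<in> carrier ?M" by (rule homog_carrier[OF M d])
  let ?c = "\<xi> powi (- (int d ^ 2))"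
  have cm: "?c \<odot>\<^bsub>?M\<^esub> m \<in> carrier ?M" by (rule vecsp_closed(3)[OF vM m])
  let ?G = "\<lambda>s. Fun (Dact N) (Fun (id_arr \<D> \<star> Act N) (Fun (assoc \<D> \<A> ?M) (pure (\<D> \<boxtimes> \<A>) ?M s (?c \<odot>\<^bsub>?M\<^esub> m))))"
  have Gl: "lin (\<D> \<boxtimes> \<A>) ?M ?G"
    by (rule lin_comp[OF lin_comp[OF lin_comp[OF pure_lin(1)[OF vDA vM cm] arrow_lin[OF f4]] arrow_lin[OF f5]] arrow_lin[OF sg]])
  let ?s = "\<lambda>n. Fun (Dact N) (pure \<D> ?M (\<delta> n) (Fun (Act N) (pure \<A> ?M (\<x> n) m)))"
  have xc: "Fun (Act N) (pure \<A> ?M (\<x> n) m) \<in> carrier ?M" if "n < p" for n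
    using that m by (intro arrow_closed[OF rho]) simp
  have sc: "?s n \<in> carrier ?M" if "n < p" for n
    using xc[OF that] by (intro arrow_closed[OF sg]) simp
  have G: "?G (pure \<D> \<A> (\<delta> n) (\<x> n)) = ?c \<odot>\<^bsub>?M\<^esub> ?s n" if "n < p" for n
    using that m cm xc[OF that]
    by (simp add: Fun_assoc[OF graded_dual graded_trunc M] Fun_tensor[OF ID rho] pure_smult
        lin_smult[OF arrow_lin[OF f4]] lin_smult[OF arrow_lin[OF f5]] lin_smult[OF arrow_lin[OF sg]])
  have "Fun (stab H N) m = ?G (Fun (coev \<A>) 1)"
    unfolding eq using m cm arrow_closed[OF arrow_coev, of 1]
    by (simp add: Fun_comp arrow_dom(1)[OF f1] Fun_scaling[OF M d] Fun_lunit_inv[OF M] Fun_tensor[OF arrow_coev arrow_id[OF M]])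
  also have "\<dots> = finsum ?M (\<lambda>n. ?G (pure \<D> \<A> (\<delta> n) (\<x> n))) {..<p}"
    unfolding Fun_coev by (rule lin_finsum[OF Gl]) simp
  also have "\<dots> = finsum ?M (\<lambda>n. ?c \<odot>\<^bsub>?M\<^esub> ?s n) {..<p}"
    using G sc vM by (intro vecsp_finsum_cong[OF vM]) auto
  also have "\<dots> = ?c \<odot>\<^bsub>?M\<^esub> finsum ?M ?s {..<p}"
    by (rule lin_finsum[OF lin_smult_map[OF lin_id[OF vM]], symmetric]) (use sc in simp)
  finally show "Fun (stab H N) m = ?c \<odot>\<^bsub>?M\<^esub> finsum ?M ?s {..<p}" .
qed

end

text \<open>The data of a stable anti-Yetter-Drinfeld module in terms of the operator \<open>ra\<close> of degree
  \<open>1\<close> by which \<open>x\<close> acts and the operators \<open>dn n\<close> of degree \<open>- n\<close> by which the dual basis acts: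
  the two module structures, then the anti-Yetter-Drinfeld condition, then stability.\<close>

locale stable_ops = zp_hopf p \<xi> H for p :: nat and \<xi> :: "'k::field" and H :: "('k, 'k poly) hopf" +
  fixes M :: "('k, 'u) gspace" and ra :: "'u \<Rightarrow> 'u" and dn :: "nat \<Rightarrow> 'u \<Rightarrow> 'u"
  assumes M: "graded_space M" and ra_lin: "lin M M ra" and dn_lin: "\<And>n. n < p \<Longrightarrow> lin M M (dn n)"
    and ra_homog: "\<And>d m. d < p \<Longrightarrow> m \<in> homog M d \<Longrightarrow> ra m \<in> homog M ((1 + d) mod p)"
    and dn_homog: "\<And>n d m. n < p \<Longrightarrow> d < p \<Longrightarrow> m \<in> homog M d \<Longrightarrow> dn n m \<in> homog M ((codeg n + d) mod p)"
    and ra_nilpotent: "\<And>m. m \<in> carrier M \<Longrightarrow> (ra ^^ p) m = \<zero>\<^bsub>M\<^esub>"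
    and dn_0: "\<And>m. m \<in> carrier M \<Longrightarrow> dn 0 m = m"
    and dn_dn: "\<And>i j m. i < p \<Longrightarrow> j < p \<Longrightarrow> m \<in> carrier M \<Longrightarrow>
       dn i (dn j m) = (if i + j < p then \<kappa> i j \<odot>\<^bsub>M\<^esub> dn (i + j) m else \<zero>\<^bsub>M\<^esub>)"
    and ra_dn: "\<And>n d m. n < p \<Longrightarrow> d < p \<Longrightarrow> m \<in> homog M d \<Longrightarrow> ra (dn n m) = \<xi> ^ n \<odot>\<^bsub>M\<^esub> dn n (ra m) \<oplus>\<^bsub>M\<^esub>
        (if n = 0 then \<zero>\<^bsub>M\<^esub> else (\<xi> powi (2 * int n - 1 - 2 * int d) - \<xi> ^ (n - 1)) \<odot>\<^bsub>M\<^esub> dn (n - 1) m)"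
    and stable: "\<And>d m. d < p \<Longrightarrow> m \<in> homog M d \<Longrightarrow>
       (\<xi> powi (- (int d ^ 2))) \<odot>\<^bsub>M\<^esub> finsum M (\<lambda>n. dn n ((ra ^^ n) m)) {..<p} = m"

context zp_hopf
begin

definition raising :: "('k, 'k poly, 'u) ayd \<Rightarrow> 'u \<Rightarrow> 'u" where
  "raising N m = Fun (Act N) (pure \<A> (Und N) (\<x> 1) m)"

definition lowering :: "('k, 'k poly, 'u) ayd \<Rightarrow> nat \<Rightarrow> 'u \<Rightarrow> 'u" where
  "lowering N n m = Fun (Dact N) (pure \<D> (Und N) (\<delta> n) m)"

lemma ayd_arrows:
  assumes "aYD_obj H N"
  shows "graded_space (Und N)" "arrow (Act N) (\<A> \<boxtimes> Und N) (Und N)" "arrow (Dact N) (\<D> \<boxtimes> Und N) (Und N)"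
proof -
  show g: "graded_space (Und N)" using assms by (simp add: aYD_obj_def module_obj_def)
  show "arrow (Act N) (\<A> \<boxtimes> Und N) (Und N)" "arrow (Dact N) (\<D> \<boxtimes> Und N) (Und N)"
    using assms g graded_tensor[OF graded_trunc g] graded_tensor[OF graded_dual g]
    by (simp_all add: aYD_obj_def module_obj_def arrow_def)
qed

lemma Act_pow:
  assumes N: "aYD_obj H N" and k: "k < p" and m: "m \<in> carrier (Und N)"
  shows "Fun (Act N) (pure \<A> (Und N) (\<x> k) m) = (raising N ^^ k) m"
proof -
  have mo: "(\<forall>v\<in>carrier (Und N). Fun (Act N) (pure \<A> (Und N) (\<x> 0) v) = v) \<and>
    (\<forall>i<p. \<forall>j<p. \<forall>v\<in>carrier (Und N). Fun (Act N) (pure \<A> (Und N) (\<x> i) (Fun (Act N) (pure \<A> (Und N) (\<x> j) v)))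
      = (if i + j < p then Fun (Act N) (pure \<A> (Und N) (\<x> (i + j)) v) else \<zero>\<^bsub>Und N\<^esub>))"
    using N module_trunc_iff[OF ayd_arrows(1,2)[OF N]] by (simp add: aYD_obj_def)
  show ?thesis using k
  proof (induction k)
    case 0
    then show ?case using mo m by simp
  next
    case (Suc k)
    then show ?case using mo[THEN conjunct2, rule_format, OF p_gt_1, of k m] m by (simp add: raising_def plus_1_eq_Suc)
  qed
qed

theorem stable_ops_of_saYD:
  assumes "N \<in> Obj (saYD H)"
  shows "stable_ops p \<xi> H (Und N) (raising N) (lowering N)"
proof -
  have N: "aYD_obj H N" and st: "stab H N = id_arr (Und N)" using assms by (auto simp: saYD_def)
  let ?M = "Und N"
  note ar = ayd_arrows[OF N] and pow = Act_pow[OF N]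
  note vM = graded_vecsp[OF ar(1)]
  have xl: "lin ?M ?M (raising N)"
    unfolding raising_def[abs_def] using p_gt_1 by (intro lin_comp[OF pure_lin(2)[OF vecsp_trunc vM] arrow_lin[OF ar(2)]]) simp
  have dl: "lin ?M ?M (lowering N n)" for n
    unfolding lowering_def[abs_def]
    by (intro lin_comp[OF pure_lin(2)[OF vecsp_dual[OF vecsp_trunc] vM] arrow_lin[OF ar(3)]]) simp
  have xh: "raising N m \<in> homog ?M ((1 + d) mod p)" if "d < p" "m \<in> homog ?M d" for d m
    unfolding raising_def by (rule arrow_homog[OF ar(2) _ homog_pure[OF p_gt_1 that(1) xpow_homog that(2)]]) simp
  have dh: "lowering N n m \<in> homog ?M ((codeg n + d) mod p)" if "n < p" "d < p" "m \<in> homog ?M d" for n d m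
    unfolding lowering_def by (rule arrow_homog[OF ar(3) _ homog_pure[OF codeg(2) that(2) delta_homog[OF that(1)] that(3)]]) simp
  have mo: "(\<forall>v\<in>carrier ?M. Fun (Act N) (pure \<A> ?M (\<x> 0) v) = v) \<and>
    (\<forall>i<p. \<forall>j<p. \<forall>v\<in>carrier ?M. Fun (Act N) (pure \<A> ?M (\<x> i) (Fun (Act N) (pure \<A> ?M (\<x> j) v)))
      = (if i + j < p then Fun (Act N) (pure \<A> ?M (\<x> (i + j)) v) else \<zero>\<^bsub>?M\<^esub>))"
    using N module_trunc_iff[OF ar(1,2)] by (simp add: aYD_obj_def)
  have md: "(\<forall>v\<in>carrier ?M. lowering N 0 v = v) \<and> (\<forall>i<p. \<forall>j<p. \<forall>v\<in>carrier ?M. lowering N i (lowering N j v)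
      = (if i + j < p then \<kappa> i j \<odot>\<^bsub>?M\<^esub> lowering N (i + j) v else \<zero>\<^bsub>?M\<^esub>))"
    using N module_dual_iff[OF ar(1,3)] by (simp add: aYD_obj_def lowering_def)
  have nil: "(raising N ^^ p) m = \<zero>\<^bsub>?M\<^esub>" if m: "m \<in> carrier ?M" for m
  proof -
    have p1: "p - 1 < p" "p = Suc (p - 1)" using p_gt_1 by auto
    have "(raising N ^^ p) m = raising N ((raising N ^^ (p - 1)) m)" using p1(2) by (metis comp_apply funpow.simps(2))
    also have "\<dots> = Fun (Act N) (pure \<A> ?M (\<x> 1) (Fun (Act N) (pure \<A> ?M (\<x> (p - 1)) m)))"
      unfolding pow[OF p1(1) m] raising_def ..
    also have "\<dots> = \<zero>\<^bsub>?M\<^esub>" using mo[THEN conjunct2, rule_format, OF p_gt_1 p1(1) m] p_gt_1 by simp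
    finally show ?thesis .
  qed
  have ay: "\<forall>n<p. \<forall>d<p. \<forall>m\<in>homog ?M d. raising N (lowering N n m) = \<xi> ^ n \<odot>\<^bsub>?M\<^esub> lowering N n (raising N m) \<oplus>\<^bsub>?M\<^esub>
        (if n = 0 then \<zero>\<^bsub>?M\<^esub> else (\<xi> powi (2 * int n - 1 - 2 * int d) - \<xi> ^ (n - 1)) \<odot>\<^bsub>?M\<^esub> lowering N (n - 1) m)"
    using N ayd_condition_iff[OF ar] pow[unfolded raising_def[abs_def]]
    unfolding aYD_obj_def raising_def lowering_def by simp
  have stb: "(\<xi> powi (- (int d ^ 2))) \<odot>\<^bsub>?M\<^esub> finsum ?M (\<lambda>n. lowering N n ((raising N ^^ n) m)) {..<p} = m"
    if d: "d < p" "m \<in> homog ?M d" for d m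
  proof -
    have m: "m \<in> carrier ?M" by (rule homog_carrier[OF ar(1) d])
    have "finsum ?M (\<lambda>n. lowering N n ((raising N ^^ n) m)) {..<p}
      = finsum ?M (\<lambda>n. Fun (Dact N) (pure \<D> ?M (\<delta> n) (Fun (Act N) (pure \<A> ?M (\<x> n) m)))) {..<p}"
      by (rule vecsp_finsum_cong[OF vM])
        (use m in \<open>auto simp: pow lowering_def intro!: arrow_closed[OF ar(3)] pure_carrier lin_closed[OF lin_funpow[OF xl]]\<close>)
    then show ?thesis using Fun_stab[OF ar d] m unfolding st by simp
  qed
  note md' = md[THEN conjunct1, rule_format] md[THEN conjunct2, rule_format]
  show ?thesis
    by (rule stable_ops.intro[OF zp_hopf_axioms stable_ops_axioms.intro])
      (assumption | rule ar(1) xl dl xh dh nil md' ay[rule_format] stb)+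
qed

text \<open>The two actions are the bilinear extensions of the given operators from the bases \<open>\<x>\<close> and \<open>\<delta>\<close>.\<close>

theorem saYD_of_stable_ops:
  assumes "stable_ops p \<xi> H M ra dn"
  shows "\<exists>N\<in>Obj (saYD H). Und N = M"
proof -
  interpret stable_ops p \<xi> H M ra dn by fact
  note xl = ra_lin and dl = dn_lin and xh = ra_homog and dh = dn_homog and nil = ra_nilpotent
    and d0 = dn_0 and dd = dn_dn and stb = stable
  have rel: "\<forall>n<p. \<forall>d<p. \<forall>m\<in>homog M d. ra (dn n m) = \<xi> ^ n \<odot>\<^bsub>M\<^esub> dn n (ra m) \<oplus>\<^bsub>M\<^esub>
        (if n = 0 then \<zero>\<^bsub>M\<^esub> else (\<xi> powi (2 * int n - 1 - 2 * int d) - \<xi> ^ (n - 1)) \<odot>\<^bsub>M\<^esub> dn (n - 1) m)"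
    using ra_dn by blast
  note vM = graded_vecsp[OF M] and xpl = lin_funpow[OF xl]
  define b where "b f m = finsum M (\<lambda>i. coeff f i \<odot>\<^bsub>M\<^esub> (ra ^^ i) m) {..<p}" for f m
  define c where "c \<phi> m = finsum M (\<lambda>n. \<phi> (\<x> n) \<odot>\<^bsub>M\<^esub> dn n m) {..<p}" for \<phi> :: "'k poly \<Rightarrow> 'k" and m
  have bl: "bilin \<A> M M b"
    unfolding bilin_def b_def
  proof (intro conjI ballI lin_finsum_map lin_smult_map vM vecsp_trunc xpl)
    fix m i assume "m \<in> carrier M"
    then have "(ra ^^ i) m \<in> carrier M" by (rule lin_closed[OF xpl])
    then show "lin \<A> M (\<lambda>f. coeff f i \<odot>\<^bsub>M\<^esub> (ra ^^ i) m)"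
      using vM by (intro linI vecsp_trunc) (auto simp: vecsp_smult trunc_simps)
  qed simp_all
  have cl: "bilin \<D> M M c"
    unfolding bilin_def c_def
  proof (intro conjI ballI lin_finsum_map lin_smult_map vM vecsp_dual vecsp_trunc)
    fix m n assume m: "m \<in> carrier M" and "n \<in> {..<p}"
    then have n: "n < p" by simp
    have "dn n m \<in> carrier M" by (rule lin_closed[OF dl[OF n] m])
    then show "lin \<D> M (\<lambda>\<phi>. \<phi> (\<x> n) \<odot>\<^bsub>M\<^esub> dn n m)"
      using vM n by (intro linI vecsp_dual vecsp_trunc) (auto simp: vecsp_smult)
  qed (use dl in simp_all)
  have bx: "b (\<x> i) m = (ra ^^ i) m" if "i < p" "m \<in> carrier M" for i m
  proof -
    have "b (\<x> i) m = finsum M (\<lambda>j. if j = i then (ra ^^ i) m else \<zero>\<^bsub>M\<^esub>) {..<p}"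
      unfolding b_def using vM lin_closed[OF xpl that(2)] by (intro vecsp_finsum_cong[OF vM]) auto
    also have "\<dots> = (ra ^^ i) m" using that lin_closed[OF xpl that(2)] by (subst finsum_single[OF vM]) auto
    finally show ?thesis .
  qed
  have cd: "c (\<delta> i) m = dn i m" if "i < p" "m \<in> carrier M" for i m
  proof -
    have "c (\<delta> i) m = finsum M (\<lambda>j. if j = i then dn i m else \<zero>\<^bsub>M\<^esub>) {..<p}"
      unfolding c_def using vM that lin_closed[OF dl _] by (intro vecsp_finsum_cong[OF vM]) auto
    also have "\<dots> = dn i m" using that lin_closed[OF dl that(2)] by (subst finsum_single[OF vM]) auto
    finally show ?thesis .
  qed
  have xph: "(ra ^^ i) m \<in> homog M ((i + d) mod p)" if "d < p" "m \<in> homog M d" for i d m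
  proof (induction i)
    case (Suc i)
    have "ra ((ra ^^ i) m) \<in> homog M ((1 + (i + d) mod p) mod p)" by (rule xh[OF _ Suc]) simp
    moreover have "(1 + (i + d) mod p) mod p = (Suc i + d) mod p" by (simp add: mod_add_right_eq mod_Suc_eq plus_1_eq_Suc)
    ultimately show ?case by simp
  qed (use that in simp)
  define \<rho> where "\<rho> = bilin_arr \<A> M M b"
  define \<sigma> where "\<sigma> = bilin_arr \<D> M M c"
  have rho: "arrow \<rho> (\<A> \<boxtimes> M) M"
    unfolding \<rho>_def
  proof (rule arrow_bilin[OF graded_trunc M M bl])
    fix i j f m assume h: "i < p" "j < p" "f \<in> homog \<A> i" "m \<in> homog M j"
    then obtain k where f: "f = k \<odot>\<^bsub>\<A>\<^esub> \<x> i" by (auto simp: trunc_simps smult_monom)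
    have m: "m \<in> carrier M" by (rule homog_carrier[OF M h(2,4)])
    have "b f m = k \<odot>\<^bsub>M\<^esub> (ra ^^ i) m"
      unfolding f bilin_simps(4)[OF bl xpow_carrier[OF h(1)] m] bx[OF h(1) m] ..
    then show "b f m \<in> homog M ((i + j) mod p)" using homog_smult[OF M _ xph[OF h(2,4)]] by simp
  qed
  have sg: "arrow \<sigma> (\<D> \<boxtimes> M) M"
    unfolding \<sigma>_def
  proof (rule arrow_bilin[OF graded_dual M M cl])
    fix i j \<phi> m assume h: "i < p" "j < p" "\<phi> \<in> homog \<D> i" "m \<in> homog M j"
    have m: "m \<in> carrier M" by (rule homog_carrier[OF M h(2,4)])
    have z: "\<phi> (\<x> n) = 0" if "n < p" "n \<noteq> codeg i" for n using h(3) that unfolding dual_homog_iff[OF h(1)] by blast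
    show "c \<phi> m \<in> homog M ((i + j) mod p)"
      unfolding c_def
    proof (rule subspace_finsum[OF graded_homog[OF M]])
      fix n assume "n \<in> {..<p}"
      then have n: "n < p" by simp
      show "\<phi> (\<x> n) \<odot>\<^bsub>M\<^esub> dn n m \<in> homog M ((i + j) mod p)"
      proof (cases "n = codeg i")
        case True
        then show ?thesis using homog_smult[OF M _ dh[OF n h(2,4)]] codeg(3)[OF h(1)] by simp
      next
        case False
        then show ?thesis using z[OF n] vM lin_closed[OF dl[OF n] m] homog_zero[OF M] by simp
      qed
    qed simp
  qed
  have rx: "Fun \<rho> (pure \<A> M (\<x> i) m) = (ra ^^ i) m" if "i < p" "m \<in> carrier M" for i m
    unfolding \<rho>_def Fun_bilin[OF M bl xpow_carrier[OF that(1)] that(2)] by (rule bx[OF that])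
  have sd: "Fun \<sigma> (pure \<D> M (\<delta> i) m) = dn i m" if "i < p" "m \<in> carrier M" for i m
    unfolding \<sigma>_def Fun_bilin[OF M cl delta_carrier that(2)] by (rule cd[OF that])
  have upz: "(ra ^^ (i + j)) m = \<zero>\<^bsub>M\<^esub>" if "\<not> i + j < p" "m \<in> carrier M" for i j m
  proof -
    have "i + j = (i + j - p) + p" using that by simp
    then have "(ra ^^ (i + j)) m = (ra ^^ (i + j - p)) ((ra ^^ p) m)" by (metis comp_apply funpow_add)
    then show ?thesis using nil[OF that(2)] lin_zero[OF xpl] by simp
  qed
  have fa: "(ra ^^ i) ((ra ^^ j) m) = (ra ^^ (i + j)) m" for i j m by (simp add: funpow_add)
  have m1: "module_obj \<A> (Mul H) (Unit H) M \<rho>"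
    unfolding module_trunc_iff[OF M rho]
    using rx upz lin_closed[OF xpl] by (auto simp: fa)
  have m2: "module_obj \<D> (dual_mul H) (dual_unit H) M \<sigma>"
    unfolding module_dual_iff[OF M sg]
    using sd d0 dd lin_closed[OF dl] by auto
  have up_eq: "((\<lambda>m. Fun \<rho> (pure \<A> M (\<x> 1) m)) ^^ k) m = (ra ^^ k) m" if "m \<in> carrier M" for k m
  proof (induction k)
    case (Suc k)
    then show ?case using rx[OF p_gt_1 lin_closed[OF xpl that]] by simp
  qed simp
  have ay: "\<rho> \<circ>\<^sub>a (id_arr \<A> \<star> \<sigma>) = \<sigma> \<circ>\<^sub>a act H M \<rho>"
  proof (subst ayd_condition_iff[OF M rho sg])
    show "Fun \<rho> (pure \<A> M (\<x> k) m) = ((\<lambda>m. Fun \<rho> (pure \<A> M (\<x> 1) m)) ^^ k) m" if "k < p" "m \<in> carrier M" for k m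
      using rx[OF that] up_eq[OF that(2)] by simp
    show "\<forall>n<p. \<forall>d<p. \<forall>m\<in>homog M d. Fun \<rho> (pure \<A> M (\<x> 1) (Fun \<sigma> (pure \<D> M (\<delta> n) m)))
      = \<xi> ^ n \<odot>\<^bsub>M\<^esub> Fun \<sigma> (pure \<D> M (\<delta> n) (Fun \<rho> (pure \<A> M (\<x> 1) m))) \<oplus>\<^bsub>M\<^esub>
        (if n = 0 then \<zero>\<^bsub>M\<^esub> else (\<xi> powi (2 * int n - 1 - 2 * int d) - \<xi> ^ (n - 1)) \<odot>\<^bsub>M\<^esub>
          Fun \<sigma> (pure \<D> M (\<delta> (n - 1)) m))"
    proof (intro allI impI ballI)
      fix n d m assume nd: "n < p" "d < p" "m \<in> homog M d"
      have m: "m \<in> carrier M" by (rule homog_carrier[OF M nd(2,3)])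
      have c: "ra m \<in> carrier M" "dn n m \<in> carrier M" using lin_closed[OF xl m] lin_closed[OF dl[OF nd(1)] m] .
      show "Fun \<rho> (pure \<A> M (\<x> 1) (Fun \<sigma> (pure \<D> M (\<delta> n) m)))
      = \<xi> ^ n \<odot>\<^bsub>M\<^esub> Fun \<sigma> (pure \<D> M (\<delta> n) (Fun \<rho> (pure \<A> M (\<x> 1) m))) \<oplus>\<^bsub>M\<^esub>
        (if n = 0 then \<zero>\<^bsub>M\<^esub> else (\<xi> powi (2 * int n - 1 - 2 * int d) - \<xi> ^ (n - 1)) \<odot>\<^bsub>M\<^esub>
          Fun \<sigma> (pure \<D> M (\<delta> (n - 1)) m))"
        using rel nd rx[OF p_gt_1 m] rx[OF p_gt_1 c(2)] sd[OF nd(1) m] sd[OF nd(1) c(1)] sd[of "n - 1" m] m by simp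
    qed
  qed
  define N where "N = \<lparr>Und = M, Act = \<rho>, Dact = \<sigma>\<rparr>"
  have N: "aYD_obj H N" using m1 m2 ay by (simp add: aYD_obj_def N_def)
  have "stab H N = id_arr M"
  proof (rule arrow_eqI[OF _ arrow_id[OF M] generates_homog[OF M]])
    show "arrow (stab H N) M M" using arrow_stab[of N] M rho sg by (simp add: N_def)
    fix m assume "m \<in> (\<Union>d<p. homog M d)"
    then obtain d where d: "d < p" "m \<in> homog M d" by blast
    have m: "m \<in> carrier M" by (rule homog_carrier[OF M d])
    have pm: "(ra ^^ n) m \<in> carrier M" for n by (rule lin_closed[OF xpl m])
    have "Fun (stab H N) m = (\<xi> powi (- (int d ^ 2))) \<odot>\<^bsub>M\<^esub>
      finsum M (\<lambda>n. Fun \<sigma> (pure \<D> M (\<delta> n) (Fun \<rho> (pure \<A> M (\<x> n) m)))) {..<p}"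
      using Fun_stab[of N d m] M rho sg d by (simp add: N_def)
    also have "finsum M (\<lambda>n. Fun \<sigma> (pure \<D> M (\<delta> n) (Fun \<rho> (pure \<A> M (\<x> n) m)))) {..<p}
      = finsum M (\<lambda>n. dn n ((ra ^^ n) m)) {..<p}"
      by (rule vecsp_finsum_cong[OF vM]) (use rx m sd pm lin_closed[OF dl] in auto)
    finally show "Fun (stab H N) m = Fun (id_arr M) m" using stb[OF d] m by simp
  qed
  then have "N \<in> Obj (saYD H)" using N by (simp add: saYD_def N_def)
  then show ?thesis by (intro bexI[of _ N]) (simp_all add: N_def)
qed

text \<open>Compatibility with an action is bilinear, so it is tested on \<open>x\<close> and on the basis \<open>\<delta>\<close>; the powers
  of \<open>x\<close> follow.\<close>

lemma aYD_hom_iff: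
  assumes N: "aYD_obj H N" and N': "aYD_obj H N'"
  shows "f \<in> aYD_hom H N N' \<longleftrightarrow> arrow f (Und N) (Und N') \<and>
    (\<forall>m\<in>carrier (Und N). Fun f (raising N m) = raising N' (Fun f m)) \<and>
    (\<forall>n<p. \<forall>m\<in>carrier (Und N). Fun f (lowering N n m) = lowering N' n (Fun f m))"
proof (cases "arrow f (Und N) (Und N')")
  case False
  then show ?thesis using ayd_arrows(1)[OF N] ayd_arrows(1)[OF N'] by (auto simp: aYD_hom_def arrow_def)
next
  case f: True
  note a = ayd_arrows[OF N] and a' = ayd_arrows[OF N']
  have l1: "Fun (f \<circ>\<^sub>a Act N) (pure \<A> (Und N) (\<x> i) m) = Fun f ((raising N ^^ i) m)"
    "Fun (Act N' \<circ>\<^sub>a (id_arr \<A> \<star> f)) (pure \<A> (Und N) (\<x> i) m) = (raising N' ^^ i) (Fun f m)"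
    if "i < p" "m \<in> carrier (Und N)" for i m
    using that arrow_closed[OF f that(2)]
    by (simp_all add: Fun_comp arrow_dom(1)[OF a(2)] arrow_dom(1)[OF arrow_tensor[OF arrow_id[OF graded_trunc] f]]
        Fun_tensor[OF arrow_id[OF graded_trunc] f] Act_pow[OF N] Act_pow[OF N'])
  have l2: "Fun (f \<circ>\<^sub>a Dact N) (pure \<D> (Und N) (\<delta> i) m) = Fun f (lowering N i m)"
    "Fun (Dact N' \<circ>\<^sub>a (id_arr \<D> \<star> f)) (pure \<D> (Und N) (\<delta> i) m) = lowering N' i (Fun f m)"
    if "i < p" "m \<in> carrier (Und N)" for i m
    using that arrow_closed[OF f that(2)]
    by (simp_all add: Fun_comp arrow_dom(1)[OF a(3)] arrow_dom(1)[OF arrow_tensor[OF arrow_id[OF graded_dual] f]]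
        Fun_tensor[OF arrow_id[OF graded_dual] f] lowering_def)
  have xl: "lin (Und N) (Und N) (raising N)"
    unfolding raising_def[abs_def] using p_gt_1
    by (intro lin_comp[OF pure_lin(2)[OF vecsp_trunc graded_vecsp[OF a(1)]] arrow_lin[OF a(2)]]) simp
  have 1: "f \<circ>\<^sub>a Act N = Act N' \<circ>\<^sub>a (id_arr \<A> \<star> f) \<longleftrightarrow> (\<forall>m\<in>carrier (Und N). Fun f (raising N m) = raising N' (Fun f m))"
  proof
    assume eq: "f \<circ>\<^sub>a Act N = Act N' \<circ>\<^sub>a (id_arr \<A> \<star> f)"
    show "\<forall>m\<in>carrier (Und N). Fun f (raising N m) = raising N' (Fun f m)"
      using l1[OF p_gt_1] unfolding eq by simp
  next
    assume h: "\<forall>m\<in>carrier (Und N). Fun f (raising N m) = raising N' (Fun f m)"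
    have pw: "Fun f ((raising N ^^ i) m) = (raising N' ^^ i) (Fun f m)" if "m \<in> carrier (Und N)" for i m
    proof (induction i)
      case (Suc i)
      then show ?case using h lin_closed[OF lin_funpow[OF xl] that] by simp
    qed simp
    show "f \<circ>\<^sub>a Act N = Act N' \<circ>\<^sub>a (id_arr \<A> \<star> f)"
      by (rule arrow_tensor_eqI[OF arrow_comp[OF a(2) f] arrow_comp[OF arrow_tensor[OF arrow_id[OF graded_trunc] f] a'(2)]
            generates_trunc generates_carrier[OF a(1)]]) (use l1 pw in auto)
  qed
  have 2: "f \<circ>\<^sub>a Dact N = Dact N' \<circ>\<^sub>a (id_arr \<D> \<star> f) \<longleftrightarrow> (\<forall>n<p. \<forall>m\<in>carrier (Und N). Fun f (lowering N n m) = lowering N' n (Fun f m))"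
  proof
    assume eq: "f \<circ>\<^sub>a Dact N = Dact N' \<circ>\<^sub>a (id_arr \<D> \<star> f)"
    show "\<forall>n<p. \<forall>m\<in>carrier (Und N). Fun f (lowering N n m) = lowering N' n (Fun f m)"
      using l2 unfolding eq by simp
  next
    assume h: "\<forall>n<p. \<forall>m\<in>carrier (Und N). Fun f (lowering N n m) = lowering N' n (Fun f m)"
    show "f \<circ>\<^sub>a Dact N = Dact N' \<circ>\<^sub>a (id_arr \<D> \<star> f)"
      by (rule arrow_tensor_eqI[OF arrow_comp[OF a(3) f] arrow_comp[OF arrow_tensor[OF arrow_id[OF graded_dual] f] a'(3)]
            generates_dual generates_carrier[OF a(1)]]) (use l2 h in auto)
  qed
  show ?thesis unfolding aYD_hom_def using 1 2 f arrow_mor[OF f] by simp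
qed

end

section \<open>Linear categories of spaces with structure\<close>

lemma hom_module_simps [simp]:
  "carrier (hom_module S V W) = S"
  "\<zero>\<^bsub>hom_module S V W\<^esub> = \<lparr>Dom = V, Cod = W, Fun = restrict (\<lambda>v. \<zero>\<^bsub>W\<^esub>) (carrier V)\<rparr>"
  "f \<oplus>\<^bsub>hom_module S V W\<^esub> g = \<lparr>Dom = V, Cod = W, Fun = restrict (\<lambda>v. Fun f v \<oplus>\<^bsub>W\<^esub> Fun g v) (carrier V)\<rparr>"
  "c \<odot>\<^bsub>hom_module S V W\<^esub> f = \<lparr>Dom = V, Cod = W, Fun = restrict (\<lambda>v. c \<odot>\<^bsub>W\<^esub> Fun f v) (carrier V)\<rparr>"
  by (simp_all add: hom_module_def)

lemma lin_hom_lin: "f \<in> lin_hom V W \<Longrightarrow> lin V W (Fun f)"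
  by (simp add: lin_hom_def)

lemma lin_hom_ops:
  assumes "vecsp V" "vecsp W"
  shows "\<lparr>Dom = V, Cod = W, Fun = restrict (\<lambda>v. \<zero>\<^bsub>W\<^esub>) (carrier V)\<rparr> \<in> lin_hom V W"
    and "f \<in> lin_hom V W \<Longrightarrow> g \<in> lin_hom V W \<Longrightarrow>
      \<lparr>Dom = V, Cod = W, Fun = restrict (\<lambda>v. Fun f v \<oplus>\<^bsub>W\<^esub> Fun g v) (carrier V)\<rparr> \<in> lin_hom V W"
    and "f \<in> lin_hom V W \<Longrightarrow>
      \<lparr>Dom = V, Cod = W, Fun = restrict (\<lambda>v. c \<odot>\<^bsub>W\<^esub> Fun f v) (carrier V)\<rparr> \<in> lin_hom V W"
  using lin_restrict[OF lin_zero_map[OF assms]] lin_restrict[OF lin_add_map[of V W "Fun f" "Fun g"]]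
    lin_restrict[OF lin_smult_map[of V W "Fun f" c]]
  by (simp_all add: lin_hom_def)

lemma lin_hom_id: "vecsp V \<Longrightarrow> id_arr V \<in> lin_hom V V"
  using lin_restrict[OF lin_id, of V] by (simp add: lin_hom_def id_arr_def)

lemma lin_hom_comp: "f \<in> lin_hom U V \<Longrightarrow> g \<in> lin_hom V W \<Longrightarrow> g \<circ>\<^sub>a f \<in> lin_hom U W"
  using lin_restrict[OF lin_comp[of U V "Fun f" W "Fun g"]]
  by (simp add: lin_hom_def comp_arr_def compose_def)

lemma vecsp_hom_module:
  assumes V: "vecsp V" and W: "vecsp W" and S: "S \<subseteq> lin_hom V W"
    and "\<zero>\<^bsub>hom_module S V W\<^esub> \<in> S" "\<And>f g. f \<in> S \<Longrightarrow> g \<in> S \<Longrightarrow> f \<oplus>\<^bsub>hom_module S V W\<^esub> g \<in> S"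
    "\<And>c f. f \<in> S \<Longrightarrow> c \<odot>\<^bsub>hom_module S V W\<^esub> f \<in> S"
  shows "vecsp (hom_module S V W)"
proof -
  have l: "lin V W (Fun f)" if "f \<in> S" for f using S that lin_hom_lin by blast
  have cl: "Fun f v \<in> carrier W" if "f \<in> S" "v \<in> carrier V" for f v by (rule lin_closed[OF l[OF that(1)] that(2)])
  have eq: "f = g" if "f \<in> S" "g \<in> S" "\<And>v. v \<in> carrier V \<Longrightarrow> Fun f v = Fun g v" for f g
    by (rule arr_ext[of _ V W]) (use S that in auto)
  note c = assms(4-6)[unfolded hom_module_simps]
  show ?thesis
  proof (rule vecspI; unfold hom_module_simps(1))
    fix f g h assume "f \<in> S" "g \<in> S" "h \<in> S"
    then show "f \<oplus>\<^bsub>hom_module S V W\<^esub> g \<oplus>\<^bsub>hom_module S V W\<^esub> h = f \<oplus>\<^bsub>hom_module S V W\<^esub> (g \<oplus>\<^bsub>hom_module S V W\<^esub> h)"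
      using W by (intro eq assms) (simp_all add: cl vecsp_add_ac(1))
  next
    fix f g assume f: "f \<in> S" "g \<in> S"
    then show "f \<oplus>\<^bsub>hom_module S V W\<^esub> g = g \<oplus>\<^bsub>hom_module S V W\<^esub> f"
      using W by (intro eq assms) (simp_all add: cl vecsp_add_ac(2)[OF W _ _ vecsp_closed(1)[OF W]])
    show "a \<odot>\<^bsub>hom_module S V W\<^esub> (f \<oplus>\<^bsub>hom_module S V W\<^esub> g) = a \<odot>\<^bsub>hom_module S V W\<^esub> f \<oplus>\<^bsub>hom_module S V W\<^esub> a \<odot>\<^bsub>hom_module S V W\<^esub> g" for a
      using W f by (intro eq assms) (simp_all add: cl vecsp_smult(3))
  next
    fix f assume f: "f \<in> S"
    show "f \<oplus>\<^bsub>hom_module S V W\<^esub> \<zero>\<^bsub>hom_module S V W\<^esub> = f"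
      using W f by (intro eq assms) (simp_all add: cl)
    show "0 \<odot>\<^bsub>hom_module S V W\<^esub> f = \<zero>\<^bsub>hom_module S V W\<^esub>"
      using W f by (intro eq assms) (simp_all add: cl)
    show "1 \<odot>\<^bsub>hom_module S V W\<^esub> f = f"
      using W f by (intro eq assms) (simp_all add: cl)
    show "(a * b) \<odot>\<^bsub>hom_module S V W\<^esub> f = a \<odot>\<^bsub>hom_module S V W\<^esub> (b \<odot>\<^bsub>hom_module S V W\<^esub> f)" for a b
      using W f by (intro eq assms) (simp_all add: cl vecsp_smult(1))
    show "(a + b) \<odot>\<^bsub>hom_module S V W\<^esub> f = a \<odot>\<^bsub>hom_module S V W\<^esub> f \<oplus>\<^bsub>hom_module S V W\<^esub> b \<odot>\<^bsub>hom_module S V W\<^esub> f" for a b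
      using W f by (intro eq assms) (simp_all add: cl vecsp_smult(2))
  qed (use assms in auto)
qed

text \<open>Composition of linear maps is associative, unital and bilinear; what remains to be known of a
  class of arrows is that it is closed under the operations.\<close>

lemma linear_category_of_arrows:
  fixes U :: "'o \<Rightarrow> ('k::field, 'u, 'm) module_scheme"
  assumes vs: "\<And>a. a \<in> Obs \<Longrightarrow> vecsp (U a)"
    and S: "\<And>a b. a \<in> Obs \<Longrightarrow> b \<in> Obs \<Longrightarrow> S a b \<subseteq> lin_hom (U a) (U b)"
    and ops: "\<And>a b. a \<in> Obs \<Longrightarrow> b \<in> Obs \<Longrightarrow> \<zero>\<^bsub>hom_module (S a b) (U a) (U b)\<^esub> \<in> S a b"
      "\<And>a b f g. a \<in> Obs \<Longrightarrow> b \<in> Obs \<Longrightarrow> f \<in> S a b \<Longrightarrow> g \<in> S a b \<Longrightarrow>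
        f \<oplus>\<^bsub>hom_module (S a b) (U a) (U b)\<^esub> g \<in> S a b"
      "\<And>a b c f. a \<in> Obs \<Longrightarrow> b \<in> Obs \<Longrightarrow> f \<in> S a b \<Longrightarrow> c \<odot>\<^bsub>hom_module (S a b) (U a) (U b)\<^esub> f \<in> S a b"
    and idn: "\<And>a. a \<in> Obs \<Longrightarrow> id_arr (U a) \<in> S a a"
    and cmp: "\<And>a b c f g. a \<in> Obs \<Longrightarrow> b \<in> Obs \<Longrightarrow> c \<in> Obs \<Longrightarrow> f \<in> S a b \<Longrightarrow> g \<in> S b c \<Longrightarrow> g \<circ>\<^sub>a f \<in> S a c"
  shows "linear_category \<lparr>Obj = Obs, Hom = (\<lambda>a b. hom_module (S a b) (U a) (U b)),
     Ident = (\<lambda>a. id_arr (U a)), Comp = (\<circ>\<^sub>a)\<rparr>"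
proof -
  have v: "vecsp (hom_module (S a b) (U a) (U b))" if "a \<in> Obs" "b \<in> Obs" for a b
    by (rule vecsp_hom_module) (use vs S ops that in auto)
  have mem: "f \<in> lin_hom (U a) (U b)" if "a \<in> Obs" "b \<in> Obs" "f \<in> S a b" for a b f
    using S[OF that(1,2)] that(3) by blast
  have dom: "Dom f = U a" "Cod f = U b" if "a \<in> Obs" "b \<in> Obs" "f \<in> S a b" for a b f
    using mem[OF that] by (simp_all add: lin_hom_def)
  have cl: "Fun f x \<in> carrier (U b)" if "a \<in> Obs" "b \<in> Obs" "f \<in> S a b" "x \<in> carrier (U a)" for a b f x
    by (rule lin_closed[OF lin_hom_lin[OF mem[OF that(1-3)]] that(4)])
  have ad: "Fun f (x \<oplus>\<^bsub>U a\<^esub> y) = Fun f x \<oplus>\<^bsub>U b\<^esub> Fun f y" "Fun f (c \<odot>\<^bsub>U a\<^esub> x) = c \<odot>\<^bsub>U b\<^esub> Fun f x"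
    if "a \<in> Obs" "b \<in> Obs" "f \<in> S a b" "x \<in> carrier (U a)" "y \<in> carrier (U a)" for a b f x y c
    using lin_add[OF lin_hom_lin[OF mem[OF that(1-3)]] that(4,5)] lin_smult[OF lin_hom_lin[OF mem[OF that(1-3)]] that(4)]
    by simp_all
  have FC: "Fun (g \<circ>\<^sub>a f) x = Fun g (Fun f x)" if "a \<in> Obs" "b \<in> Obs" "f \<in> S a b" "x \<in> carrier (U a)" for a b f g x
    using dom[OF that(1-3)] that(4) by (simp add: comp_arr_def compose_def)
  have eqI: "f = g" if "a \<in> Obs" "b \<in> Obs" "f \<in> S a b" "g \<in> S a b" "\<And>x. x \<in> carrier (U a) \<Longrightarrow> Fun f x = Fun g x" for a b f g
    by (rule arr_ext[OF mem mem that(5)]) (use that in auto)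
  have L1: "lin (hom_module (S a b) (U a) (U b)) (hom_module (S a c) (U a) (U c)) (\<lambda>f. g \<circ>\<^sub>a f)"
    if abc: "a \<in> Obs" "b \<in> Obs" "c \<in> Obs" and g: "g \<in> S b c" for a b c g
  proof (rule linI[OF v[OF abc(1,2)] v[OF abc(1,3)]]; unfold hom_module_simps(1))
    show "g \<circ>\<^sub>a f \<in> S a c" if "f \<in> S a b" for f by (rule cmp[OF abc that g])
    fix f assume f: "f \<in> S a b"
    show "g \<circ>\<^sub>a (f \<oplus>\<^bsub>hom_module (S a b) (U a) (U b)\<^esub> h) = (g \<circ>\<^sub>a f) \<oplus>\<^bsub>hom_module (S a c) (U a) (U c)\<^esub> (g \<circ>\<^sub>a h)"
      if h: "h \<in> S a b" for h
    proof (rule eqI[OF abc(1,3)])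
      note fh = ops(2)[OF abc(1,2) f h]
      show "g \<circ>\<^sub>a (f \<oplus>\<^bsub>hom_module (S a b) (U a) (U b)\<^esub> h) \<in> S a c" by (rule cmp[OF abc fh g])
      show "(g \<circ>\<^sub>a f) \<oplus>\<^bsub>hom_module (S a c) (U a) (U c)\<^esub> (g \<circ>\<^sub>a h) \<in> S a c"
        by (rule ops(2)[OF abc(1,3) cmp[OF abc f g] cmp[OF abc h g]])
      fix x assume x: "x \<in> carrier (U a)"
      show "Fun (g \<circ>\<^sub>a (f \<oplus>\<^bsub>hom_module (S a b) (U a) (U b)\<^esub> h)) x = Fun ((g \<circ>\<^sub>a f) \<oplus>\<^bsub>hom_module (S a c) (U a) (U c)\<^esub> (g \<circ>\<^sub>a h)) x"
        unfolding FC[OF abc(1,2) fh x]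
        using x by (simp add: FC[OF abc(1,2) f x] FC[OF abc(1,2) h x] ad(1)[OF abc(2,3) g] cl[OF abc(1,2) f x] cl[OF abc(1,2) h x])
    qed
    show "g \<circ>\<^sub>a (k \<odot>\<^bsub>hom_module (S a b) (U a) (U b)\<^esub> f) = k \<odot>\<^bsub>hom_module (S a c) (U a) (U c)\<^esub> (g \<circ>\<^sub>a f)" for k
    proof (rule eqI[OF abc(1,3)])
      note fh = ops(3)[OF abc(1,2) f, of k]
      show "g \<circ>\<^sub>a (k \<odot>\<^bsub>hom_module (S a b) (U a) (U b)\<^esub> f) \<in> S a c" by (rule cmp[OF abc fh g])
      show "k \<odot>\<^bsub>hom_module (S a c) (U a) (U c)\<^esub> (g \<circ>\<^sub>a f) \<in> S a c" by (rule ops(3)[OF abc(1,3) cmp[OF abc f g]])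
      fix x assume x: "x \<in> carrier (U a)"
      show "Fun (g \<circ>\<^sub>a (k \<odot>\<^bsub>hom_module (S a b) (U a) (U b)\<^esub> f)) x = Fun (k \<odot>\<^bsub>hom_module (S a c) (U a) (U c)\<^esub> (g \<circ>\<^sub>a f)) x"
        unfolding FC[OF abc(1,2) fh x]
        using x by (simp add: FC[OF abc(1,2) f x] ad(2)[OF abc(2,3) g cl[OF abc(1,2) f x] cl[OF abc(1,2) f x]])
    qed
  qed
  have L2: "lin (hom_module (S b c) (U b) (U c)) (hom_module (S a c) (U a) (U c)) (\<lambda>g. g \<circ>\<^sub>a f)"
    if abc: "a \<in> Obs" "b \<in> Obs" "c \<in> Obs" and f: "f \<in> S a b" for a b c f
  proof (rule linI[OF v[OF abc(2,3)] v[OF abc(1,3)]]; unfold hom_module_simps(1))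
    show "g \<circ>\<^sub>a f \<in> S a c" if "g \<in> S b c" for g by (rule cmp[OF abc f that])
    fix g assume g: "g \<in> S b c"
    show "(g \<oplus>\<^bsub>hom_module (S b c) (U b) (U c)\<^esub> h) \<circ>\<^sub>a f = (g \<circ>\<^sub>a f) \<oplus>\<^bsub>hom_module (S a c) (U a) (U c)\<^esub> (h \<circ>\<^sub>a f)"
      if h: "h \<in> S b c" for h
    proof (rule eqI[OF abc(1,3)])
      show "(g \<oplus>\<^bsub>hom_module (S b c) (U b) (U c)\<^esub> h) \<circ>\<^sub>a f \<in> S a c" by (rule cmp[OF abc f ops(2)[OF abc(2,3) g h]])
      show "(g \<circ>\<^sub>a f) \<oplus>\<^bsub>hom_module (S a c) (U a) (U c)\<^esub> (h \<circ>\<^sub>a f) \<in> S a c"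
        by (rule ops(2)[OF abc(1,3) cmp[OF abc f g] cmp[OF abc f h]])
      fix x assume x: "x \<in> carrier (U a)"
      show "Fun ((g \<oplus>\<^bsub>hom_module (S b c) (U b) (U c)\<^esub> h) \<circ>\<^sub>a f) x = Fun ((g \<circ>\<^sub>a f) \<oplus>\<^bsub>hom_module (S a c) (U a) (U c)\<^esub> (h \<circ>\<^sub>a f)) x"
        using x by (simp add: FC[OF abc(1,2) f x] cl[OF abc(1,2) f x])
    qed
    show "(k \<odot>\<^bsub>hom_module (S b c) (U b) (U c)\<^esub> g) \<circ>\<^sub>a f = k \<odot>\<^bsub>hom_module (S a c) (U a) (U c)\<^esub> (g \<circ>\<^sub>a f)" for k
    proof (rule eqI[OF abc(1,3)])
      show "(k \<odot>\<^bsub>hom_module (S b c) (U b) (U c)\<^esub> g) \<circ>\<^sub>a f \<in> S a c" by (rule cmp[OF abc f ops(3)[OF abc(2,3) g]])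
      show "k \<odot>\<^bsub>hom_module (S a c) (U a) (U c)\<^esub> (g \<circ>\<^sub>a f) \<in> S a c" by (rule ops(3)[OF abc(1,3) cmp[OF abc f g]])
      fix x assume x: "x \<in> carrier (U a)"
      show "Fun ((k \<odot>\<^bsub>hom_module (S b c) (U b) (U c)\<^esub> g) \<circ>\<^sub>a f) x = Fun (k \<odot>\<^bsub>hom_module (S a c) (U a) (U c)\<^esub> (g \<circ>\<^sub>a f)) x"
        using x by (simp add: FC[OF abc(1,2) f x] cl[OF abc(1,2) f x])
    qed
  qed
  have I: "f \<circ>\<^sub>a id_arr (U a) = f" "id_arr (U b) \<circ>\<^sub>a f = f" if ab: "a \<in> Obs" "b \<in> Obs" and f: "f \<in> S a b" for a b f
  proof -
    show "f \<circ>\<^sub>a id_arr (U a) = f"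
    proof (rule eqI[OF ab cmp[OF ab(1,1,2) idn[OF ab(1)] f] f])
      show "Fun (f \<circ>\<^sub>a id_arr (U a)) x = Fun f x" if "x \<in> carrier (U a)" for x
        using that FC[OF ab(1,1) idn[OF ab(1)] that] by (simp add: id_arr_def)
    qed
    show "id_arr (U b) \<circ>\<^sub>a f = f"
    proof (rule eqI[OF ab cmp[OF ab(1,2,2) f idn[OF ab(2)]] f])
      show "Fun (id_arr (U b) \<circ>\<^sub>a f) x = Fun f x" if "x \<in> carrier (U a)" for x
        unfolding FC[OF ab f that] using cl[OF ab f that] by (simp add: id_arr_def)
    qed
  qed
  have As: "h \<circ>\<^sub>a (g \<circ>\<^sub>a f) = (h \<circ>\<^sub>a g) \<circ>\<^sub>a f"
    if o: "a \<in> Obs" "b \<in> Obs" "c \<in> Obs" "d \<in> Obs" and f: "f \<in> S a b" and g: "g \<in> S b c" and h: "h \<in> S c d"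
    for a b c d f g h
  proof (rule eqI[OF o(1,4) cmp[OF o(1,3,4) cmp[OF o(1,2,3) f g] h] cmp[OF o(1,2,4) f cmp[OF o(2,3,4) g h]]])
    fix x assume x: "x \<in> carrier (U a)"
    show "Fun (h \<circ>\<^sub>a g \<circ>\<^sub>a f) x = Fun ((h \<circ>\<^sub>a g) \<circ>\<^sub>a f) x"
      by (simp add: FC[OF o(1,3) cmp[OF o(1,2,3) f g] x] FC[OF o(1,2) f x] FC[OF o(2,3) g cl[OF o(1,2) f x]])
  qed
  show ?thesis
    unfolding linear_category_def lincat.simps hom_module_simps(1)
  proof (intro conjI ballI)
    fix a b c d f g h assume "a \<in> Obs" "b \<in> Obs" "c \<in> Obs" "d \<in> Obs" "f \<in> S a b" "g \<in> S b c" "h \<in> S c d"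
    then show "h \<circ>\<^sub>a g \<circ>\<^sub>a f = (h \<circ>\<^sub>a g) \<circ>\<^sub>a f" by (rule As)
  qed (simp_all add: v idn L1 L2 I)
qed

context zp_root
begin

section \<open>The structure of stable anti-Yetter-Drinfeld modules\<close>

text \<open>The scalars \<open>c\<^sub>n\<close> for which \<open>ra\<close> takes the \<open>n\<close>-th to \<open>c\<^sub>n\<close> times the \<open>(n - 1)\<close>-st power of \<open>dn 1\<close>,
  applied to a vector of degree \<open>0\<close>.  The commutation relation forces the recursion \<open>cst_Suc\<close>.\<close>

definition cst :: "nat \<Rightarrow> 'k" where "cst n = (\<xi> ^ n - 1) ^ 2 / (\<xi> - 1)"
definition cprod :: "nat \<Rightarrow> 'k" where "cprod n = (\<Prod>i<n. cst (Suc i))"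

lemma root_neq_1: "\<xi> - 1 \<noteq> 0"
  using primitive[of 1] p_gt_1 by simp

lemma pow_neq_1: "0 < n \<Longrightarrow> n < p \<Longrightarrow> \<xi> ^ n - 1 \<noteq> 0"
  using primitive[of n] by simp

lemma cst_Suc: "cst (Suc n) = \<xi> * cst n + (\<xi> ^ (2 * n + 1) - 1)"
proof -
  have "(\<xi> ^ Suc n - 1) ^ 2 = \<xi> * (\<xi> ^ n - 1) ^ 2 + (\<xi> ^ (2 * n + 1) - 1) * (\<xi> - 1)"
    by (simp add: power2_eq_square power_add power_mult algebra_simps One_nat_def)
  then show ?thesis using root_neq_1 by (simp add: cst_def divide_simps)
qed

lemma cst_0: "cst 0 = 0" by (simp add: cst_def)

lemma cst_p: "cst p = 0" by (simp add: cst_def root)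

lemma cst_nonzero: "0 < n \<Longrightarrow> n < p \<Longrightarrow> cst n \<noteq> 0"
  using pow_neq_1 root_neq_1 by (simp add: cst_def)

lemma cprod_nonzero: "n < p \<Longrightarrow> cprod n \<noteq> 0"
  using cst_nonzero by (simp add: cprod_def)

lemma cprod_Suc: "cprod (Suc n) = cprod n * cst (Suc n)"
  by (simp add: cprod_def)

lemma qint: "(\<Sum>i\<le>n. \<xi> ^ i) = (\<xi> ^ Suc n - 1) / (\<xi> - 1)"
proof -
  have "(\<Sum>i\<le>n. \<xi> ^ i) * (\<xi> - 1) = \<xi> ^ Suc n - 1"
    by (induction n) (simp_all add: algebra_simps)
  then show ?thesis using root_neq_1 by (simp add: divide_simps)
qed

lemma qint_nonzero:
  assumes "Suc m < p"
  shows "(\<Sum>i\<le>m. \<xi> ^ i) \<noteq> 0"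
  unfolding qint using pow_neq_1[OF _ assms] root_neq_1 by simp

lemma qfact_nonzero: "n < p \<Longrightarrow> qfact \<xi> n \<noteq> 0"
  using qint_nonzero by (simp add: qfact_def)

lemma codeg_0 [simp]: "codeg 0 = 0" by (simp add: codeg_def)

lemma codeg_add:
  assumes "n < p" "i < p" "n + i \<le> p"
  shows "(codeg n + codeg i) mod p = codeg (n + i)"
proof -
  have "(codeg n + codeg i) mod p = ((p - n) + (p - i)) mod p"
    by (simp add: codeg_def mod_add_eq)
  also have "(p - n) + (p - i) = (p - (n + i)) + p" using assms by simp
  finally show ?thesis by (simp add: codeg_def)
qed

lemma codeg_Suc: "n < p \<Longrightarrow> (codeg 1 + codeg n) mod p = codeg (Suc n)" "n < p \<Longrightarrow> (1 + codeg (Suc n)) mod p = codeg n"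
  "Suc n < p \<Longrightarrow> codeg (Suc n) \<noteq> 0"
proof -
  have c: "codeg k = p - k" if "0 < k" "k \<le> p" "k \<noteq> p" for k using that by (simp add: codeg_def)
  show "(codeg 1 + codeg n) mod p = codeg (Suc n)" if "n < p"
    using codeg_add[OF p_gt_1 that] that by (simp add: plus_1_eq_Suc)
  show "(1 + codeg (Suc n)) mod p = codeg n" if "n < p"
  proof (cases "Suc n = p")
    case True
    then show ?thesis using c[of n] p_gt_1 by (auto simp: codeg_def)
  next
    case False
    then show ?thesis using c[of "Suc n"] that by (simp add: codeg_def Suc_diff_Suc One_nat_def)
  qed
  show "codeg (Suc n) \<noteq> 0" if "Suc n < p" using c[of "Suc n"] that by simp
qed

lemma powi_codeg:
  assumes "n \<le> p"
  shows "\<xi> powi (1 - 2 * int (codeg n)) = \<xi> ^ (2 * n + 1)"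
proof -
  have "int (codeg n) mod int p = (- int n) mod int p"
    by (rule codeg_mod[OF assms])
  then have "(1 - 2 * int (codeg n)) mod int p = (1 - 2 * (- int n)) mod int p"
    by (intro mod_diff_cong mod_mult_cong refl)
  then have "\<xi> powi (1 - 2 * int (codeg n)) = \<xi> powi (int (2 * n + 1))"
    by (intro powi_root_cong) (simp add: algebra_simps)
  then show ?thesis by (simp only: power_int_of_nat)
qed

end

context zp_hopf
begin

lemma \<kappa>_nonzero: "i + j < p \<Longrightarrow> \<kappa> i j \<noteq> 0"
  using qbin_qfact[of \<xi> i j] qfact_nonzero[of "i + j"] by (auto simp: \<kappa>_def)

end

context stable_ops
begin

abbreviation lo :: "'u \<Rightarrow> 'u" where "lo \<equiv> dn 1"

lemma vM: "vecsp M" by (rule graded_vecsp[OF M])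

lemma lo_lin: "lin M M lo" by (rule dn_lin[OF p_gt_1])

lemmas pow_lin = lin_funpow[OF ra_lin] lin_funpow[OF lo_lin]

lemma pow_closed [simp]: "m \<in> carrier M \<Longrightarrow> (ra ^^ n) m \<in> carrier M" "m \<in> carrier M \<Longrightarrow> (lo ^^ n) m \<in> carrier M"
  "m \<in> carrier M \<Longrightarrow> ra m \<in> carrier M" "m \<in> carrier M \<Longrightarrow> lo m \<in> carrier M"
  by (rule lin_closed[OF pow_lin(1)] lin_closed[OF pow_lin(2)] lin_closed[OF ra_lin] lin_closed[OF lo_lin]; assumption)+

lemma homog0 [simp]: "m \<in> homog M 0 \<Longrightarrow> m \<in> carrier M"
  by (rule homog_carrier[OF M p_pos])

lemma ra_lo:
  assumes "d < p" "m \<in> homog M d"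
  shows "ra (lo m) = \<xi> \<odot>\<^bsub>M\<^esub> lo (ra m) \<oplus>\<^bsub>M\<^esub> (\<xi> powi (1 - 2 * int d) - 1) \<odot>\<^bsub>M\<^esub> m"
  using ra_dn[OF p_gt_1 assms] dn_0 homog_carrier[OF M assms] by simp

lemma lo_pow_homog: "v \<in> homog M 0 \<Longrightarrow> n \<le> p \<Longrightarrow> (lo ^^ n) v \<in> homog M (codeg n)"
proof (induction n)
  case (Suc n)
  have "(lo ^^ n) v \<in> homog M (codeg n)" using Suc by simp
  from dn_homog[OF p_gt_1 codeg(2) this] show ?case using codeg_Suc(1)[of n] Suc.prems(2) by simp
qed simp

lemma ra_pow_homog: "n < p \<Longrightarrow> m \<in> homog M (codeg n) \<Longrightarrow> (ra ^^ n) m \<in> homog M 0"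
proof (induction n arbitrary: m)
  case (Suc n)
  then have "ra m \<in> homog M (codeg n)"
    using ra_homog[OF codeg(2), of m "Suc n"] codeg_Suc(2)[of n] by simp
  then show ?case using Suc by (simp add: funpow_swap1)
qed simp

text \<open>On the kernel of \<open>ra\<close> stability reduces to multiplication by \<open>\<xi>\<close> to the power \<open>- d\<^sup>2\<close>, which
  differs from \<open>1\<close> since the prime \<open>p\<close> does not divide \<open>d\<close>.\<close>

lemma ra_kernel:
  assumes d: "d < p" "d \<noteq> 0" and m: "m \<in> homog M d" and 0: "ra m = \<zero>\<^bsub>M\<^esub>"
  shows "m = \<zero>\<^bsub>M\<^esub>"
proof -
  have mM: "m \<in> carrier M" by (rule homog_carrier[OF M d(1) m])
  have z: "(ra ^^ n) m = (if n = 0 then m else \<zero>\<^bsub>M\<^esub>)" for n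
    by (induction n) (simp_all add: 0 lin_zero[OF ra_lin])
  have "finsum M (\<lambda>n. dn n ((ra ^^ n) m)) {..<p} = finsum M (\<lambda>n. if n = 0 then m else \<zero>\<^bsub>M\<^esub>) {..<p}"
    by (rule vecsp_finsum_cong[OF vM]) (use mM vM in \<open>auto simp: z dn_0 lin_zero[OF dn_lin]\<close>)
  also have "\<dots> = m" using mM by (subst finsum_single[OF vM]) auto
  finally have s: "(\<xi> powi (- (int d ^ 2))) \<odot>\<^bsub>M\<^esub> m = m" using stable[OF d(1) m] by simp
  have "\<xi> powi (- (int d ^ 2)) \<noteq> 1"
  proof
    assume "\<xi> powi (- (int d ^ 2)) = 1"
    then have "\<xi> ^ (d ^ 2) = 1" by (simp add: power_int_minus flip: of_nat_power)
    moreover have "\<xi> ^ (d ^ 2) = \<xi> ^ (d ^ 2 mod p)"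
    proof -
      have "\<xi> powi int (d ^ 2) = \<xi> powi int (d ^ 2 mod p)" by (rule powi_root_cong) (simp add: zmod_int)
      then show ?thesis by (simp only: power_int_of_nat)
    qed
    ultimately have "d ^ 2 mod p = 0" using primitive[of "d ^ 2 mod p"] p_pos by fastforce
    then have "p dvd d" using prime_p by (simp add: prime_dvd_power_nat_iff mod_eq_0_iff_dvd)
    then show False using d by (auto dest: dvd_imp_le)
  qed
  then have c: "\<xi> powi (- (int d ^ 2)) - 1 \<noteq> 0" by simp
  let ?c = "\<xi> powi (- (int d ^ 2))"
  have "(?c - 1) \<odot>\<^bsub>M\<^esub> m = ?c \<odot>\<^bsub>M\<^esub> m \<oplus>\<^bsub>M\<^esub> (-1) \<odot>\<^bsub>M\<^esub> m"
    using vecsp_smult(2)[OF vM mM, of ?c "-1"] by simp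
  also have "\<dots> = (1 + -1) \<odot>\<^bsub>M\<^esub> m" unfolding s using vecsp_smult(2)[OF vM mM, of 1 "-1"] vM mM by simp
  also have "\<dots> = \<zero>\<^bsub>M\<^esub>" using vM mM by simp
  finally have "(1 / (?c - 1)) \<odot>\<^bsub>M\<^esub> ((?c - 1) \<odot>\<^bsub>M\<^esub> m) = \<zero>\<^bsub>M\<^esub>" using vM by simp
  then show ?thesis using c vM mM by (simp flip: vecsp_smult(1))
qed

text \<open>The powers of \<open>ra\<close> take \<open>v\<close> through the degrees \<open>1\<close> to \<open>p - 1\<close>, in which \<open>ra\<close> is injective, and
  the last power vanishes; so the first one does.\<close>

lemma ra_homog_0:
  assumes v: "v \<in> homog M 0"
  shows "ra v = \<zero>\<^bsub>M\<^esub>"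
proof -
  have h: "(ra ^^ j) v \<in> homog M (j mod p)" for j
  proof (induction j)
    case (Suc j)
    then show ?case using ra_homog[of "j mod p" "(ra ^^ j) v"] by (simp add: mod_Suc_eq plus_1_eq_Suc)
  qed (use v in simp)
  have "(ra ^^ (p - i)) v = \<zero>\<^bsub>M\<^esub>" if "i < p" for i
    using that
  proof (induction i)
    case 0
    then show ?case using ra_nilpotent v by simp
  next
    case (Suc i)
    have e: "p - i = Suc (p - Suc i)" using Suc.prems by simp
    have "ra ((ra ^^ (p - Suc i)) v) = \<zero>\<^bsub>M\<^esub>" using Suc by (simp add: e)
    then show ?case using ra_kernel[of "p - Suc i" "(ra ^^ (p - Suc i)) v"] h[of "p - Suc i"] Suc.prems by simp
  qed
  from this[of "p - 1"] show ?thesis using p_gt_1 by simp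
qed

lemma ra_lo_pow:
  assumes v: "v \<in> homog M 0"
  shows "n < p \<Longrightarrow> ra ((lo ^^ Suc n) v) = cst (Suc n) \<odot>\<^bsub>M\<^esub> (lo ^^ n) v"
proof (induction n)
  case 0
  have "ra (lo v) = \<xi> \<odot>\<^bsub>M\<^esub> lo (ra v) \<oplus>\<^bsub>M\<^esub> (\<xi> - 1) \<odot>\<^bsub>M\<^esub> v" using ra_lo[OF p_pos v] by simp
  then show ?case using ra_homog_0[OF v] v vM lin_zero[OF lo_lin] cst_Suc[of 0] by (simp add: cst_0)
next
  case (Suc n)
  let ?w = "(lo ^^ Suc n) v"
  have w: "?w \<in> homog M (codeg (Suc n))" using lo_pow_homog[OF v, of "Suc n"] Suc.prems by simp
  have wM: "?w \<in> carrier M" "(lo ^^ n) v \<in> carrier M" using v by simp_all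
  have "ra (lo ?w) = \<xi> \<odot>\<^bsub>M\<^esub> lo (ra ?w) \<oplus>\<^bsub>M\<^esub> (\<xi> ^ (2 * Suc n + 1) - 1) \<odot>\<^bsub>M\<^esub> ?w"
    using ra_lo[OF codeg(2) w] powi_codeg[of "Suc n"] Suc.prems by simp
  also have "lo (ra ?w) = cst (Suc n) \<odot>\<^bsub>M\<^esub> ?w"
    using Suc lin_smult[OF lo_lin wM(2)] by simp
  also have "\<xi> \<odot>\<^bsub>M\<^esub> (cst (Suc n) \<odot>\<^bsub>M\<^esub> ?w) \<oplus>\<^bsub>M\<^esub> (\<xi> ^ (2 * Suc n + 1) - 1) \<odot>\<^bsub>M\<^esub> ?w = cst (Suc (Suc n)) \<odot>\<^bsub>M\<^esub> ?w"
    unfolding cst_Suc[of "Suc n"] using vM wM by (simp only: vecsp_smult(1,2))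
  finally show ?case by simp
qed

lemma ra_pow_lo_pow: "v \<in> homog M 0 \<Longrightarrow> n < p \<Longrightarrow> (ra ^^ n) ((lo ^^ n) v) = cprod n \<odot>\<^bsub>M\<^esub> v"
proof (induction n)
  case 0
  then show ?case using vM by (simp add: cprod_def)
next
  case (Suc n)
  have "(ra ^^ Suc n) ((lo ^^ Suc n) v) = (ra ^^ n) (ra ((lo ^^ Suc n) v))" by (simp add: funpow_swap1)
  also have "\<dots> = cst (Suc n) \<odot>\<^bsub>M\<^esub> (ra ^^ n) ((lo ^^ n) v)"
    using ra_lo_pow[OF Suc.prems(1), of n] Suc.prems lin_smult[OF pow_lin(1)] by simp
  also have "\<dots> = cprod (Suc n) \<odot>\<^bsub>M\<^esub> v"
    using Suc vM by (simp add: cprod_Suc mult.commute flip: vecsp_smult(1))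
  finally show ?case .
qed

lemma ra_pow_inj: "n < p \<Longrightarrow> m \<in> homog M (codeg n) \<Longrightarrow> (ra ^^ n) m = \<zero>\<^bsub>M\<^esub> \<Longrightarrow> m = \<zero>\<^bsub>M\<^esub>"
proof (induction n arbitrary: m)
  case (Suc n)
  have "ra m \<in> homog M (codeg n)"
    using ra_homog[OF codeg(2) Suc.prems(2)] codeg_Suc(2)[of n] Suc.prems(1) by simp
  then have "ra m = \<zero>\<^bsub>M\<^esub>" using Suc by (simp add: funpow_swap1)
  then show ?case using ra_kernel[OF codeg(2) codeg_Suc(3) Suc.prems(2)] Suc.prems(1) by simp
qed simp

text \<open>Hence \<open>ra\<close> to the power \<open>n\<close> identifies degree \<open>- n\<close> with degree \<open>0\<close>, and the inverse is a
  multiple of the power of \<open>lo\<close>.\<close>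

lemma recover:
  assumes n: "n < p" and m: "m \<in> homog M (codeg n)"
  shows "m = (1 / cprod n) \<odot>\<^bsub>M\<^esub> (lo ^^ n) ((ra ^^ n) m)"
proof -
  let ?v = "(ra ^^ n) m" and ?w = "(1 / cprod n) \<odot>\<^bsub>M\<^esub> (lo ^^ n) ((ra ^^ n) m)"
  have v: "?v \<in> homog M 0" by (rule ra_pow_homog[OF n m])
  have mM: "m \<in> carrier M" by (rule homog_carrier[OF M codeg(2) m])
  have wh: "?w \<in> homog M (codeg n)"
    using homog_smult[OF M codeg(2) lo_pow_homog[OF v]] n by simp
  have wM: "?w \<in> carrier M" by (rule homog_carrier[OF M codeg(2) wh])
  have rw: "(ra ^^ n) ?w = ?v"
    using ra_pow_lo_pow[OF v n] lin_smult[OF pow_lin(1)] v mM vM cprod_nonzero[OF n]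
    by (simp flip: vecsp_smult(1))
  have "m \<oplus>\<^bsub>M\<^esub> (-1) \<odot>\<^bsub>M\<^esub> ?w = \<zero>\<^bsub>M\<^esub>"
  proof (rule ra_pow_inj[OF n])
    show "m \<oplus>\<^bsub>M\<^esub> (-1) \<odot>\<^bsub>M\<^esub> ?w \<in> homog M (codeg n)"
      by (intro homog_add[OF M codeg(2) m] homog_smult[OF M codeg(2) wh])
    have "(ra ^^ n) (m \<oplus>\<^bsub>M\<^esub> (-1) \<odot>\<^bsub>M\<^esub> ?w) = ?v \<oplus>\<^bsub>M\<^esub> (-1) \<odot>\<^bsub>M\<^esub> ?v"
      using mM wM vM rw by (simp only: lin_add[OF pow_lin(1)] lin_smult[OF pow_lin(1)] vecsp_closed)
    also have "\<dots> = (1 + -1) \<odot>\<^bsub>M\<^esub> ?v" using vM mM vecsp_smult(2)[OF vM, of ?v 1 "-1"] by simp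
    also have "\<dots> = \<zero>\<^bsub>M\<^esub>" using vM mM by simp
    finally show "(ra ^^ n) (m \<oplus>\<^bsub>M\<^esub> (-1) \<odot>\<^bsub>M\<^esub> ?w) = \<zero>\<^bsub>M\<^esub>" .
  qed
  then show ?thesis by (rule vecsp_diff_zero[OF vM mM wM])
qed

text \<open>The product rule for the operators \<open>dn n\<close> makes them multiples of powers of \<open>dn 1\<close>.\<close>

lemma dn_eq_lo_pow:
  assumes m: "m \<in> carrier M"
  shows "n < p \<Longrightarrow> (lo ^^ n) m = (\<Prod>i<n. \<kappa> 1 i) \<odot>\<^bsub>M\<^esub> dn n m"
proof (induction n)
  case 0
  then show ?case using dn_0 m vM by simp
next
  case (Suc n)
  have c: "dn n m \<in> carrier M" "dn (Suc n) m \<in> carrier M" using lin_closed[OF dn_lin m] Suc.prems by simp_all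
  then show ?case using Suc dn_dn[OF p_gt_1 _ m, of n] vM
    by (simp add: lin_smult[OF lo_lin] plus_1_eq_Suc flip: vecsp_smult(1))
qed

lemma dn_scale_nonzero: "n < p \<Longrightarrow> (\<Prod>i<n. \<kappa> 1 i) \<noteq> 0"
  using \<kappa>_nonzero[of 1] by (simp add: plus_1_eq_Suc)

lemma dn_as_lo_pow:
  assumes "m \<in> carrier M" "n < p"
  shows "dn n m = (1 / (\<Prod>i<n. \<kappa> 1 i)) \<odot>\<^bsub>M\<^esub> (lo ^^ n) m"
  using dn_eq_lo_pow[OF assms] dn_scale_nonzero[OF assms(2)] lin_closed[OF dn_lin assms(1)] assms(2) vM
  by (simp flip: vecsp_smult(1))

lemma lo_nilpotent:
  assumes m: "m \<in> carrier M"
  shows "(lo ^^ p) m = \<zero>\<^bsub>M\<^esub>"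
proof -
  have p1: "p - 1 < p" "p = Suc (p - 1)" using p_gt_1 by auto
  have c: "dn (p - 1) m \<in> carrier M" by (rule lin_closed[OF dn_lin[OF p1(1)] m])
  have "(lo ^^ p) m = lo ((lo ^^ (p - 1)) m)" using p1(2) by (metis comp_apply funpow.simps(2))
  also have "\<dots> = \<zero>\<^bsub>M\<^esub>"
    using dn_eq_lo_pow[OF m p1(1)] dn_dn[OF p_gt_1 p1(1) m] c vM p_gt_1 by (simp add: lin_smult[OF lo_lin])
  finally show ?thesis .
qed

end

section \<open>The functor to vector spaces\<close>

definition deg0 :: "('k::field, 'u) gspace \<Rightarrow> ('k, 'u) space" where
  "deg0 V = \<lparr>carrier = homog V 0, monoid.mult = undefined, one = undefined,
     ring.zero = \<zero>\<^bsub>V\<^esub>, add = (\<oplus>\<^bsub>V\<^esub>), module.smult = (\<odot>\<^bsub>V\<^esub>)\<rparr>"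

definition deg0_arr ::
  "('k::field, 'u) gspace \<Rightarrow> ('k, 'u) gspace \<Rightarrow> ('k, 'u, 'u) garr \<Rightarrow> (('k, 'u) space, ('k, 'u) space, 'u, 'u) arr" where
  "deg0_arr V W f = \<lparr>Dom = deg0 V, Cod = deg0 W, Fun = restrict (Fun f) (homog V 0)\<rparr>"

lemma deg0_simps [simp]:
  "carrier (deg0 V) = homog V 0" "\<zero>\<^bsub>deg0 V\<^esub> = \<zero>\<^bsub>V\<^esub>" "v \<oplus>\<^bsub>deg0 V\<^esub> w = v \<oplus>\<^bsub>V\<^esub> w" "c \<odot>\<^bsub>deg0 V\<^esub> v = c \<odot>\<^bsub>V\<^esub> v"
  by (simp_all add: deg0_def)

lemma deg0_arr_simps [simp]:
  "Dom (deg0_arr V W f) = deg0 V" "Cod (deg0_arr V W f) = deg0 W" "v \<in> homog V 0 \<Longrightarrow> Fun (deg0_arr V W f) v = Fun f v"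
  by (simp_all add: deg0_arr_def)

lemma linear_category_Vec: "linear_category (Vec :: ('k::field, ('k, 'u) space, (('k, 'u) space, ('k, 'u) space, 'u, 'u) arr) lincat)"
  unfolding Vec_def
  by (rule linear_category_of_arrows[where U = "\<lambda>V. V", simplified])
    (auto simp: fd_space_vecsp lin_hom_id intro: lin_hom_ops lin_hom_comp)

context zp_root
begin

lemma vecsp_deg0:
  assumes V: "graded_space V"
  shows "vecsp (deg0 V)"
proof -
  note vV = graded_vecsp[OF V] and c = homog_carrier[OF V p_pos]
  show ?thesis
    by (rule vecspI) (use vV c homog_zero[OF V p_pos] homog_add[OF V p_pos] homog_smult[OF V p_pos] in
        \<open>simp_all add: vecsp_smult vecsp_add_ac(1) vecsp_add_ac(2)[OF vV _ _ vecsp_closed(1)[OF vV]]\<close>)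
qed

lemma fd_deg0:
  assumes V: "graded_space V"
  shows "fd_space (deg0 V)"
proof (rule fd_space_surj[OF graded_fd[OF V]])
  note l = component_lin[OF V p_pos]
  show "lin V (deg0 V) (component V 0)"
    by (rule linI[OF graded_vecsp[OF V] vecsp_deg0[OF V]])
      (simp_all add: component_homog[OF V _ p_pos] lin_add[OF l] lin_smult[OF l])
  show "component V 0 ` carrier V = carrier (deg0 V)"
  proof
    show "component V 0 ` carrier V \<subseteq> carrier (deg0 V)" using component_homog[OF V _ p_pos] by auto
    show "carrier (deg0 V) \<subseteq> component V 0 ` carrier V"
    proof
      fix v assume "v \<in> carrier (deg0 V)"
      then have v: "v \<in> homog V 0" by simp
      then have "component V 0 v = v" by (simp add: component_homog_eq[OF V v p_pos p_pos])
      then show "v \<in> component V 0 ` carrier V" using homog_carrier[OF V p_pos v] by (metis imageI)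
    qed
  qed
qed

lemma deg0_arr_hom:
  assumes f: "arrow f V W"
  shows "deg0_arr V W f \<in> lin_hom (deg0 V) (deg0 W)"
proof -
  note V = arrow_graded(1)[OF f] and W = arrow_graded(2)[OF f] and l = arrow_lin[OF f]
  have "lin (deg0 V) (deg0 W) (Fun f)"
    by (rule linI[OF vecsp_deg0[OF V] vecsp_deg0[OF W]])
      (simp_all add: arrow_homog[OF f p_pos] lin_add[OF l] lin_smult[OF l] homog_carrier[OF V p_pos])
  then show ?thesis using lin_restrict[of "deg0 V" "deg0 W" "Fun f"] by (simp add: lin_hom_def deg0_arr_def)
qed

end

context zp_hopf
begin

lemma saYD_obj: "N \<in> Obj (saYD H) \<Longrightarrow> aYD_obj H N"
  by (simp add: saYD_def)

lemma linear_category_saYD: "linear_category (saYD H :: ('k, ('k, 'k poly, 'u) ayd, ('k, 'u, 'u) garr) lincat)"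
  unfolding saYD_def
proof (rule linear_category_of_arrows)
  let ?O = "{N :: ('k, 'k poly, 'u) ayd. aYD_obj H N \<and> stab H N = id_arr (Und N)}"
  have ob: "aYD_obj H N" "stable_ops p \<xi> H (Und N) (raising N) (lowering N)" if "N \<in> ?O" for N
    using that stable_ops_of_saYD[of N] by (auto simp: saYD_def)
  have gr: "graded_space (Und N)" if "N \<in> ?O" for N by (rule ayd_arrows(1)[OF ob(1)[OF that]])
  show "vecsp (Und N)" if "N \<in> ?O" for N by (rule graded_vecsp[OF gr[OF that]])
  show "aYD_hom H N N' \<subseteq> lin_hom (Und N) (Und N')" for N N' :: "('k, 'k poly, 'u) ayd"
    by (auto simp: aYD_hom_def mor_def)
  fix N N' assume N: "N \<in> ?O" and N': "N' \<in> ?O"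
  note iff = aYD_hom_iff[OF ob(1)[OF N] ob(1)[OF N']]
  note g = gr[OF N] gr[OF N'] and vs = graded_vecsp[OF gr[OF N]] graded_vecsp[OF gr[OF N']]
  have rl: "lin (Und N) (Und N) (raising N)" "lin (Und N') (Und N') (raising N')"
    "\<And>n. n < p \<Longrightarrow> lin (Und N) (Und N) (lowering N n)" "\<And>n. n < p \<Longrightarrow> lin (Und N') (Und N') (lowering N' n)"
    using stable_ops.ra_lin[OF ob(2)[OF N]] stable_ops.ra_lin[OF ob(2)[OF N']]
      stable_ops.dn_lin[OF ob(2)[OF N]] stable_ops.dn_lin[OF ob(2)[OF N']] by simp_all
  note rc = lin_closed[OF rl(1)] lin_closed[OF rl(3)]
  have fl: "lin (Und N) (Und N') (Fun f)" if "arrow f (Und N) (Und N')" for f by (rule arrow_lin[OF that])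
  show "\<zero>\<^bsub>hom_module (aYD_hom H N N') (Und N) (Und N')\<^esub> \<in> aYD_hom H N N'"
  proof -
    have "arrow (mk_arr (Und N) (Und N') (\<lambda>v. \<zero>\<^bsub>Und N'\<^esub>)) (Und N) (Und N')"
      by (rule arrow_mk[OF g lin_zero_map[OF vs] homog_zero[OF g(2)]])
    then show ?thesis
      unfolding iff hom_module_simps using rc by (simp add: mk_arr_def lin_zero[OF rl(2)] lin_zero[OF rl(4)])
  qed
  show "f \<oplus>\<^bsub>hom_module (aYD_hom H N N') (Und N) (Und N')\<^esub> h \<in> aYD_hom H N N'"
    if f: "f \<in> aYD_hom H N N'" and h: "h \<in> aYD_hom H N N'" for f h
  proof -
    note f' = f[unfolded iff] and h' = h[unfolded iff]
    have af: "arrow f (Und N) (Und N')" "arrow h (Und N) (Und N')" using f' h' by blast+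
    have "arrow (mk_arr (Und N) (Und N') (\<lambda>v. Fun f v \<oplus>\<^bsub>Und N'\<^esub> Fun h v)) (Und N) (Und N')"
      by (rule arrow_mk[OF g lin_add_map[OF fl[OF af(1)] fl[OF af(2)]] homog_add[OF g(2) _ arrow_homog[OF af(1)] arrow_homog[OF af(2)]]])
    then show ?thesis
      unfolding iff hom_module_simps using rc f' h' arrow_closed[OF af(1)] arrow_closed[OF af(2)]
      by (simp add: mk_arr_def lin_add[OF rl(2)] lin_add[OF rl(4)])
  qed
  show "c \<odot>\<^bsub>hom_module (aYD_hom H N N') (Und N) (Und N')\<^esub> f \<in> aYD_hom H N N'"
    if f: "f \<in> aYD_hom H N N'" for f c
  proof -
    note f' = f[unfolded iff]
    have af: "arrow f (Und N) (Und N')" using f' by blast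
    have "arrow (mk_arr (Und N) (Und N') (\<lambda>v. c \<odot>\<^bsub>Und N'\<^esub> Fun f v)) (Und N) (Und N')"
      by (rule arrow_mk[OF g lin_smult_map[OF fl[OF af]] homog_smult[OF g(2) _ arrow_homog[OF af]]])
    then show ?thesis
      unfolding iff hom_module_simps using rc f' arrow_closed[OF af]
      by (simp add: mk_arr_def lin_smult[OF rl(2)] lin_smult[OF rl(4)])
  qed
  show "id_arr (Und N) \<in> aYD_hom H N N"
    unfolding aYD_hom_iff[OF ob(1)[OF N] ob(1)[OF N]] using arrow_id[OF g(1)] rc by simp
  fix N'' f h assume N'': "N'' \<in> ?O" and f: "f \<in> aYD_hom H N N'" and h: "h \<in> aYD_hom H N' N''"
  note f' = f[unfolded iff] and h' = h[unfolded aYD_hom_iff[OF ob(1)[OF N'] ob(1)[OF N'']]]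
  have af: "arrow f (Und N) (Und N')" "arrow h (Und N') (Und N'')" using f' h' by blast+
  show "h \<circ>\<^sub>a f \<in> aYD_hom H N N''"
    unfolding aYD_hom_iff[OF ob(1)[OF N] ob(1)[OF N'']]
    using arrow_comp[OF af] rc f' h' arrow_closed[OF af(1)] by (simp add: Fun_comp_arrow[OF af(1)])
qed

lemma hom_lo_pow:
  assumes N: "N \<in> Obj (saYD H)" "N' \<in> Obj (saYD H)" and f: "f \<in> aYD_hom H N N'" and m: "m \<in> carrier (Und N)"
  shows "Fun f ((lowering N 1 ^^ n) m) = (lowering N' 1 ^^ n) (Fun f m)"
proof -
  interpret S: stable_ops p \<xi> H "Und N" "raising N" "lowering N" by (rule stable_ops_of_saYD[OF N(1)])
  note f' = f[unfolded aYD_hom_iff[OF saYD_obj[OF N(1)] saYD_obj[OF N(2)]]]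
  show ?thesis
  proof (induction n)
    case (Suc n)
    then show ?case using f' p_gt_1 S.pow_closed(2)[OF m, of n] by simp
  qed simp
qed

text \<open>By \<open>recover\<close>, every homogeneous vector is a multiple of a power of \<open>lowering N 1\<close> applied to a
  vector of degree \<open>0\<close>.\<close>

lemma hom_determined_by_deg0:
  assumes N: "N \<in> Obj (saYD H)" "N' \<in> Obj (saYD H)" and f: "f \<in> aYD_hom H N N'" and g: "g \<in> aYD_hom H N N'"
    and eq: "\<And>v. v \<in> homog (Und N) 0 \<Longrightarrow> Fun f v = Fun g v"
  shows "f = g"
proof -
  interpret S: stable_ops p \<xi> H "Und N" "raising N" "lowering N" by (rule stable_ops_of_saYD[OF N(1)])
  note iff = aYD_hom_iff[OF saYD_obj[OF N(1)] saYD_obj[OF N(2)]]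
  have af: "arrow f (Und N) (Und N')" "arrow g (Und N) (Und N')" using f g unfolding iff by blast+
  show ?thesis
  proof (rule arrow_eqI[OF af generates_homog[OF S.M]])
    fix m assume "m \<in> (\<Union>d<p. homog (Und N) d)"
    then obtain d where d: "d < p" "m \<in> homog (Und N) d" by blast
    let ?n = "codeg d"
    have m: "m \<in> homog (Und N) (codeg ?n)" using d codeg(3) by simp
    let ?v = "(raising N ^^ ?n) m"
    have v: "?v \<in> homog (Und N) 0" by (rule S.ra_pow_homog[OF codeg(2) m])
    have vM: "?v \<in> carrier (Und N)" "(lowering N 1 ^^ ?n) ?v \<in> carrier (Und N)" using v by simp_all
    have r: "m = (1 / cprod ?n) \<odot>\<^bsub>Und N\<^esub> (lowering N 1 ^^ ?n) ?v" by (rule S.recover[OF codeg(2) m])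
    have "Fun f ((1 / cprod ?n) \<odot>\<^bsub>Und N\<^esub> (lowering N 1 ^^ ?n) ?v) = Fun g ((1 / cprod ?n) \<odot>\<^bsub>Und N\<^esub> (lowering N 1 ^^ ?n) ?v)"
      unfolding lin_smult[OF arrow_lin[OF af(1)] vM(2)] lin_smult[OF arrow_lin[OF af(2)] vM(2)]
        hom_lo_pow[OF N f vM(1)] hom_lo_pow[OF N g vM(1)] eq[OF v] ..
    then show "Fun f m = Fun g m" using r by simp
  qed
qed

text \<open>The extension is forced by \<open>recover\<close>: in degree \<open>- n\<close> the operator \<open>raising\<close> is applied \<open>n\<close>
  times, then \<open>h\<close>, and then the inverse of the corresponding map on the other module.\<close>

lemma hom_extends_from_deg0:
  assumes N: "N \<in> Obj (saYD H)" "N' \<in> Obj (saYD H)" and h: "h \<in> lin_hom (deg0 (Und N)) (deg0 (Und N'))"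
  shows "\<exists>f\<in>aYD_hom H N N'. \<forall>v\<in>homog (Und N) 0. Fun f v = Fun h v"
proof -
  interpret S: stable_ops p \<xi> H "Und N" "raising N" "lowering N" by (rule stable_ops_of_saYD[OF N(1)])
  interpret S': stable_ops p \<xi> H "Und N'" "raising N'" "lowering N'" by (rule stable_ops_of_saYD[OF N(2)])
  let ?M = "Und N" and ?M' = "Und N'"
  note hl = lin_hom_lin[OF h]
  have hc: "Fun h v \<in> homog ?M' 0" if "v \<in> homog ?M 0" for v using lin_closed[OF hl, of v] that by simp
  let ?r = "\<lambda>n m. (raising N ^^ n) (component ?M (codeg n) m)"
  have rl: "lin ?M ?M (?r n)" for n by (rule lin_comp[OF component_lin[OF S.M codeg(2)] S.pow_lin(1)])
  have rh: "?r n m \<in> homog ?M 0" if "n < p" "m \<in> carrier ?M" for n m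
    by (rule S.ra_pow_homog[OF that(1) component_homog[OF S.M that(2) codeg(2)]])
  have hrl: "lin ?M ?M' (\<lambda>m. Fun h (?r n m))" if n: "n < p" for n
  proof (rule linI[OF S.vM S'.vM])
    fix m assume m: "m \<in> carrier ?M"
    show "Fun h (?r n m) \<in> carrier ?M'" using hc[OF rh[OF n m]] by simp
    show "Fun h (?r n (m \<oplus>\<^bsub>?M\<^esub> w)) = Fun h (?r n m) \<oplus>\<^bsub>?M'\<^esub> Fun h (?r n w)" if "w \<in> carrier ?M" for w
      using lin_add[OF rl m that] lin_add[OF hl, of "?r n m" "?r n w"] rh[OF n m] rh[OF n that] by simp
    show "Fun h (?r n (c \<odot>\<^bsub>?M\<^esub> m)) = c \<odot>\<^bsub>?M'\<^esub> Fun h (?r n m)" for c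
      using lin_smult[OF rl m] lin_smult[OF hl, of "?r n m"] rh[OF n m] by simp
  qed
  \<comment> \<open>Every degree occurs once among the \<open>codeg n\<close>.\<close>
  define F where "F m = finsum ?M' (\<lambda>n. (1 / cprod n) \<odot>\<^bsub>?M'\<^esub> (lowering N' 1 ^^ n) (Fun h (?r n m))) {..<p}" for m
  have Fl: "lin ?M ?M' F"
    unfolding F_def[abs_def]
    by (intro lin_finsum_map lin_smult_map lin_comp[OF hrl S'.pow_lin(2)] S.vM S'.vM) auto
  have Fh: "F m = (1 / cprod n) \<odot>\<^bsub>?M'\<^esub> (lowering N' 1 ^^ n) (Fun h ((raising N ^^ n) m))"
    if n: "n < p" and m: "m \<in> homog ?M (codeg n)" for n m
  proof -
    let ?t = "(1 / cprod n) \<odot>\<^bsub>?M'\<^esub> (lowering N' 1 ^^ n) (Fun h ((raising N ^^ n) m))"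
    have tc: "?t \<in> carrier ?M'" using hc[OF S.ra_pow_homog[OF n m]] S'.vM by simp
    have h0: "Fun h \<zero>\<^bsub>?M\<^esub> = \<zero>\<^bsub>?M'\<^esub>" using lin_zero[OF hl] by simp
    have "F m = finsum ?M' (\<lambda>i. if i = n then ?t else \<zero>\<^bsub>?M'\<^esub>) {..<p}"
      unfolding F_def
    proof (rule vecsp_finsum_cong[OF S'.vM])
      fix i assume "i \<in> {..<p}"
      then have i: "i < p" by simp
      have "codeg i = codeg n \<longleftrightarrow> i = n" using codeg(3)[OF i] codeg(3)[OF n] by metis
      then have "component ?M (codeg i) m = (if i = n then m else \<zero>\<^bsub>?M\<^esub>)"
        by (simp add: component_homog_eq[OF S.M m codeg(2) codeg(2)])
      then show "(1 / cprod i) \<odot>\<^bsub>?M'\<^esub> (lowering N' 1 ^^ i) (Fun h (?r i m)) = (if i = n then ?t else \<zero>\<^bsub>?M'\<^esub>)"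
        using S'.vM by (auto simp: lin_zero[OF S.pow_lin(1)] h0 lin_zero[OF S'.pow_lin(2)])
    qed (use tc S'.vM in auto)
    also have "\<dots> = ?t" using n tc by (subst finsum_single[OF S'.vM]) auto
    finally show ?thesis .
  qed
  define f where "f = mk_arr ?M ?M' F"
  have af: "arrow f ?M ?M'"
    unfolding f_def
  proof (rule arrow_mk[OF S.M S'.M Fl])
    fix d m assume d: "d < p" "m \<in> homog ?M d"
    have m: "m \<in> homog ?M (codeg (codeg d))" using d codeg(3) by simp
    show "F m \<in> homog ?M' d"
      unfolding Fh[OF codeg(2) m]
      using S'.lo_pow_homog[OF hc[OF S.ra_pow_homog[OF codeg(2) m]], of "codeg d"] codeg(2)[of d] codeg(3)[OF d(1)]
      by (intro homog_smult[OF S'.M d(1)]) simp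
  qed
  have ff: "Fun f m = F m" if "m \<in> carrier ?M" for m using that by (simp add: f_def)
  have F0: "F v = Fun h v" if "v \<in> homog ?M 0" for v
    using Fh[OF p_pos, of v] that hc[OF that] S'.vM by (simp add: cprod_def)
  have Flo: "F ((lowering N 1 ^^ n) v) = (lowering N' 1 ^^ n) (Fun h v)" if v: "v \<in> homog ?M 0" and n: "n < p" for n v
  proof -
    have l: "(lowering N 1 ^^ n) v \<in> homog ?M (codeg n)" by (rule S.lo_pow_homog[OF v]) (use n in simp)
    have "Fun h (cprod n \<odot>\<^bsub>?M\<^esub> v) = cprod n \<odot>\<^bsub>?M'\<^esub> Fun h v" using lin_smult[OF hl, of v] v by simp
    then show ?thesis
      unfolding Fh[OF n l] S.ra_pow_lo_pow[OF v n]
      using lin_smult[OF S'.pow_lin(2)] hc[OF v] S'.vM cprod_nonzero[OF n] by (simp flip: vecsp_smult(1))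
  qed
  have rec: "\<exists>n v. n < p \<and> v \<in> homog ?M 0 \<and> m = (lowering N 1 ^^ n) v" if "d < p" "m \<in> homog ?M d" for d m
  proof -
    have m: "m \<in> homog ?M (codeg (codeg d))" using that codeg(3) by simp
    let ?v = "(raising N ^^ codeg d) m"
    have v: "?v \<in> homog ?M 0" by (rule S.ra_pow_homog[OF codeg(2) m])
    have "m = (lowering N 1 ^^ codeg d) ((1 / cprod (codeg d)) \<odot>\<^bsub>?M\<^esub> ?v)"
      using S.recover[OF codeg(2) m] lin_smult[OF S.pow_lin(2)] v by simp
    then show ?thesis using codeg(2) homog_smult[OF S.M p_pos v] by blast
  qed
  have c1: "F (raising N m) = raising N' (F m)" if m: "m \<in> carrier ?M" for m
  proof (rule generates_lin_eq[OF generates_homog[OF S.M] lin_comp[OF S.ra_lin Fl] lin_comp[OF Fl S'.ra_lin] _ m])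
    fix s assume "s \<in> (\<Union>d<p. homog ?M d)"
    then obtain n v where v: "n < p" "v \<in> homog ?M 0" "s = (lowering N 1 ^^ n) v" using rec by blast
    show "F (raising N s) = raising N' (F s)"
    proof (cases n)
      case 0
      then show ?thesis
        using v S.ra_homog_0[OF v(2)] S'.ra_homog_0[OF hc[OF v(2)]] by (simp add: lin_zero[OF Fl] F0[OF v(2)])
    next
      case (Suc k)
      then have k: "k < p" "Suc k < p" using v(1) by simp_all
      have "F (raising N s) = cst (Suc k) \<odot>\<^bsub>?M'\<^esub> F ((lowering N 1 ^^ k) v)"
        unfolding v(3) Suc S.ra_lo_pow[OF v(2) k(1)] using v(2) by (intro lin_smult[OF Fl]) simp
      also have "\<dots> = raising N' ((lowering N' 1 ^^ Suc k) (Fun h v))"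
        unfolding Flo[OF v(2) k(1)] S'.ra_lo_pow[OF hc[OF v(2)] k(1)] ..
      finally show ?thesis unfolding v(3) Suc Flo[OF v(2) k(2)] .
    qed
  qed
  have c2: "F (lowering N 1 m) = lowering N' 1 (F m)" if m: "m \<in> carrier ?M" for m
  proof (rule generates_lin_eq[OF generates_homog[OF S.M] lin_comp[OF S.lo_lin Fl] lin_comp[OF Fl S'.lo_lin] _ m])
    fix s assume "s \<in> (\<Union>d<p. homog ?M d)"
    then obtain n v where v: "n < p" "v \<in> homog ?M 0" "s = (lowering N 1 ^^ n) v" using rec by blast
    show "F (lowering N 1 s) = lowering N' 1 (F s)"
    proof (cases "Suc n < p")
      case True
      then show ?thesis using Flo[OF v(2) True] Flo[OF v(2,1)] v(3) by simp
    next
      case False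
      then have n: "p = Suc n" using v(1) by simp
      have "lowering N 1 s = \<zero>\<^bsub>?M\<^esub>" "lowering N' 1 (F s) = \<zero>\<^bsub>?M'\<^esub>"
        using S.lo_nilpotent[of v] S'.lo_nilpotent[of "Fun h v"] v(2) hc[OF v(2)] Flo[OF v(2,1)] v(3) n by simp_all
      then show ?thesis by (simp add: lin_zero[OF Fl])
    qed
  qed
  have c3: "F ((lowering N 1 ^^ n) m) = (lowering N' 1 ^^ n) (F m)" if m: "m \<in> carrier ?M" for n m
  proof (induction n)
    case (Suc n)
    then show ?case using c2[OF S.pow_closed(2)[OF m, of n]] by simp
  qed simp
  have c4: "F (lowering N n m) = lowering N' n (F m)" if n: "n < p" and m: "m \<in> carrier ?M" for n m
    unfolding S.dn_as_lo_pow[OF m n] S'.dn_as_lo_pow[OF lin_closed[OF Fl m] n]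
    using m by (simp add: lin_smult[OF Fl] c3)
  have "f \<in> aYD_hom H N N'"
    unfolding aYD_hom_iff[OF saYD_obj[OF N(1)] saYD_obj[OF N(2)]]
    using af c1 c4 lin_closed[OF S.dn_lin] by (simp add: ff)
  then show ?thesis using F0 by (intro bexI[of _ f]) (simp_all add: ff)
qed

lemma linear_functor_deg0:
  "linear_functor (saYD H :: ('k, ('k, 'k poly, 'u) ayd, ('k, 'u, 'u) garr) lincat) Vec
     (\<lambda>N. deg0 (Und N)) (\<lambda>N N'. deg0_arr (Und N) (Und N'))"
  unfolding linear_functor_def
proof (intro conjI ballI)
  fix N N' :: "('k, 'k poly, 'u) ayd" assume N: "N \<in> Obj (saYD H)" and N': "N' \<in> Obj (saYD H)"
  note g = ayd_arrows(1)[OF saYD_obj[OF N]] ayd_arrows(1)[OF saYD_obj[OF N']]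
  show "deg0 (Und N) \<in> Obj Vec" using fd_deg0[OF g(1)] by (simp add: Vec_def)
  note iff = aYD_hom_iff[OF saYD_obj[OF N] saYD_obj[OF N']]
  have ar: "arrow f (Und N) (Und N')" if "f \<in> aYD_hom H N N'" for f using that unfolding iff by blast
  have v1: "vecsp (Hom (saYD H) N N')" using linear_category_saYD N N' unfolding linear_category_def by blast
  have v2: "vecsp (Hom Vec (deg0 (Und N)) (deg0 (Und N')))"
  proof -
    have "deg0 (Und N) \<in> Obj Vec" "deg0 (Und N') \<in> Obj Vec"
      using fd_deg0[OF g(1)] fd_deg0[OF g(2)] by (simp_all add: Vec_def)
    then show ?thesis using linear_category_Vec unfolding linear_category_def by blast
  qed
  show "lin (Hom (saYD H) N N') (Hom Vec (deg0 (Und N)) (deg0 (Und N'))) (deg0_arr (Und N) (Und N'))"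
  proof (rule linI[OF v1 v2])
    have c: "carrier (Hom (saYD H) N N') = aYD_hom H N N'" by (simp add: saYD_def)
    show "deg0_arr (Und N) (Und N') f \<in> carrier (Hom Vec (deg0 (Und N)) (deg0 (Und N')))"
      if "f \<in> carrier (Hom (saYD H) N N')" for f
      using deg0_arr_hom[OF ar] that by (simp add: Vec_def c)
  qed (auto simp: saYD_def Vec_def deg0_arr_def fun_eq_iff restrict_def homog_carrier[OF g(1) p_pos])
  show "deg0_arr (Und N) (Und N) (Ident (saYD H) N) = Ident Vec (deg0 (Und N))"
    by (auto simp: saYD_def Vec_def deg0_arr_def id_arr_def fun_eq_iff restrict_def homog_carrier[OF g(1) p_pos])
  fix N'' :: "('k, 'k poly, 'u) ayd" and f h assume "N'' \<in> Obj (saYD H)"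
    and f: "f \<in> carrier (Hom (saYD H) N N')" and "h \<in> carrier (Hom (saYD H) N' N'')"
  have af: "arrow f (Und N) (Und N')" using ar f by (simp add: saYD_def)
  show "deg0_arr (Und N) (Und N'') (Comp (saYD H) h f)
      = Comp Vec (deg0_arr (Und N') (Und N'') h) (deg0_arr (Und N) (Und N') f)"
    using arrow_homog[OF af p_pos] homog_carrier[OF g(1) p_pos]
    by (auto simp: saYD_def Vec_def deg0_arr_def comp_arr_def compose_def fun_eq_iff restrict_def arrow_dom[OF af])
qed

lemma fully_faithful_deg0:
  fixes N N' :: "('k, 'k poly, 'u) ayd"
  assumes N: "N \<in> Obj (saYD H)" "N' \<in> Obj (saYD H)"
  shows "bij_betw (deg0_arr (Und N) (Und N')) (carrier (Hom (saYD H) N N'))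
    (carrier (Hom Vec (deg0 (Und N)) (deg0 (Und N'))))"
proof -
  have c: "carrier (Hom (saYD H) N N') = aYD_hom H N N'"
    "carrier (Hom Vec (deg0 (Und N)) (deg0 (Und N'))) = lin_hom (deg0 (Und N)) (deg0 (Und N'))"
    by (simp_all add: saYD_def Vec_def)
  have ar: "arrow f (Und N) (Und N')" if "f \<in> aYD_hom H N N'" for f
    using that unfolding aYD_hom_iff[OF saYD_obj[OF N(1)] saYD_obj[OF N(2)]] by blast
  show ?thesis
    unfolding c bij_betw_def
  proof (intro conjI inj_onI subset_antisym subsetI)
    fix f g assume f: "f \<in> aYD_hom H N N'" "g \<in> aYD_hom H N N'" and eq: "deg0_arr (Und N) (Und N') f = deg0_arr (Und N) (Und N') g"
    show "f = g"
    proof (rule hom_determined_by_deg0[OF N f])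
      fix v assume v: "v \<in> homog (Und N) 0"
      have "Fun (deg0_arr (Und N) (Und N') f) v = Fun (deg0_arr (Und N) (Und N') g) v" using eq by simp
      then show "Fun f v = Fun g v" using v by simp
    qed
  next
    fix h assume "h \<in> deg0_arr (Und N) (Und N') ` aYD_hom H N N'"
    then show "h \<in> lin_hom (deg0 (Und N)) (deg0 (Und N'))" using deg0_arr_hom[OF ar] by blast
  next
    fix h assume h: "h \<in> lin_hom (deg0 (Und N)) (deg0 (Und N'))"
    obtain f where f: "f \<in> aYD_hom H N N'" "\<forall>v\<in>homog (Und N) 0. Fun f v = Fun h v"
      using hom_extends_from_deg0[OF N h] by blast
    have "deg0_arr (Und N) (Und N') f = h"
      by (rule arr_ext[OF deg0_arr_hom[OF ar[OF f(1)]] h]) (use f(2) in simp)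
    then show "h \<in> deg0_arr (Und N) (Und N') ` aYD_hom H N N'" using f(1) by blast
  qed
qed

end

section \<open>Every vector space occurs in degree zero\<close>

text \<open>An infinite set has as many elements as its square.\<close>

lemma power_inj:
  assumes "infinite A \<or> (\<exists>a. A = {a})"
  shows "\<exists>e. inj_on e (PiE {..<n::nat} (\<lambda>_. A)) \<and> e ` PiE {..<n} (\<lambda>_. A) \<subseteq> A"
proof (induction n)
  case 0
  obtain a where "a \<in> A" using assms by (metis finite.emptyI insertI1 ex_in_conv)
  then show ?case by (intro exI[of _ "\<lambda>_. a"]) (simp add: image_subset_iff)
next
  case (Suc n)
  then obtain e where e: "inj_on e (PiE {..<n} (\<lambda>_. A))" "e ` PiE {..<n} (\<lambda>_. A) \<subseteq> A" by blast
  obtain g where g: "inj_on g (A \<times> A)" "g ` (A \<times> A) \<subseteq> A"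
    using assms
  proof
    assume "infinite A"
    then have "(card_of (A \<times> A), card_of A) \<in> ordIso" by (rule card_of_Times_same_infinite)
    then obtain g where "bij_betw g (A \<times> A) A" using card_of_ordIso by blast
    then show ?thesis using that by (auto simp: bij_betw_def)
  next
    assume "\<exists>a. A = {a}"
    then obtain a where "A = {a}" by blast
    then show ?thesis using that[of "\<lambda>_. a"] by simp
  qed
  define h where "h f = g (e (restrict f {..<n}), f n)" for f :: "nat \<Rightarrow> 'a"
  have r: "restrict f {..<n} \<in> PiE {..<n} (\<lambda>_. A)" "f n \<in> A" if "f \<in> PiE {..<Suc n} (\<lambda>_. A)" for f
    using that by (auto simp: PiE_iff)
  have m: "(e (restrict f {..<n}), f n) \<in> A \<times> A" if "f \<in> PiE {..<Suc n} (\<lambda>_. A)" for f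
    using r[OF that] e(2) by blast
  have "inj_on h (PiE {..<Suc n} (\<lambda>_. A))"
  proof (rule inj_onI)
    fix f f' assume f: "f \<in> PiE {..<Suc n} (\<lambda>_. A)" "f' \<in> PiE {..<Suc n} (\<lambda>_. A)" and "h f = h f'"
    then have "(e (restrict f {..<n}), f n) = (e (restrict f' {..<n}), f' n)"
      using inj_onD[OF g(1), of "(e (restrict f {..<n}), f n)" "(e (restrict f' {..<n}), f' n)"] m by (simp add: h_def)
    then have eq: "restrict f {..<n} = restrict f' {..<n}" "f n = f' n"
      using inj_onD[OF e(1)] r f by auto
    show "f = f'"
    proof (rule PiE_ext[OF f])
      fix i assume "i \<in> {..<Suc n}"
      moreover have "restrict f {..<n} i = restrict f' {..<n} i" by (simp only: eq(1))
      ultimately show "f i = f' i" using eq(2) by (cases "i = n") simp_all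
    qed
  qed
  moreover have "h f \<in> A" if "f \<in> PiE {..<Suc n} (\<lambda>_. A)" for f
    unfolding h_def using m[OF that] g(2) by blast
  ultimately show ?case by (intro exI[of _ h]) (auto simp: image_subset_iff)
qed

lemma space_infinite_or_zero:
  fixes V :: "('k::field_char_0, 'u, 'm) module_scheme"
  assumes V: "vecsp V"
  shows "infinite (carrier V) \<or> (\<exists>a. carrier V = {a})"
proof (cases "carrier V = {\<zero>\<^bsub>V\<^esub>}")
  case False
  then obtain v where v: "v \<in> carrier V" "v \<noteq> \<zero>\<^bsub>V\<^esub>" using vecsp_closed(1)[OF V] by blast
  have "inj (\<lambda>c::'k. c \<odot>\<^bsub>V\<^esub> v)"
  proof (rule injI, rule ccontr)
    fix a b :: 'k assume eq: "a \<odot>\<^bsub>V\<^esub> v = b \<odot>\<^bsub>V\<^esub> v" and ne: "a \<noteq> b"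
    have "(a - b) \<odot>\<^bsub>V\<^esub> v = a \<odot>\<^bsub>V\<^esub> v \<oplus>\<^bsub>V\<^esub> (- b) \<odot>\<^bsub>V\<^esub> v"
      using vecsp_smult(2)[OF V v(1), of a "- b"] by simp
    also have "\<dots> = (b + - b) \<odot>\<^bsub>V\<^esub> v" unfolding eq by (rule vecsp_smult(2)[OF V v(1), symmetric])
    also have "\<dots> = \<zero>\<^bsub>V\<^esub>" using V v by simp
    finally have "(1 / (a - b)) \<odot>\<^bsub>V\<^esub> ((a - b) \<odot>\<^bsub>V\<^esub> v) = \<zero>\<^bsub>V\<^esub>" using V by simp
    then show False using ne v V by (simp flip: vecsp_smult(1))
  qed
  then have "infinite (range (\<lambda>c::'k. c \<odot>\<^bsub>V\<^esub> v))"
    using infinite_UNIV_char_0 by (simp add: finite_image_iff)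
  moreover have "range (\<lambda>c::'k. c \<odot>\<^bsub>V\<^esub> v) \<subseteq> carrier V" using V v(1) by auto
  ultimately show ?thesis using finite_subset by blast
qed blast

text \<open>The tuples of elements of \<open>V\<close> are coded by elements of the type that contains \<open>V\<close>, which is
  possible since a finite power of \<open>V\<close> embeds into \<open>V\<close>.\<close>

lemma tuples_in_universe:
  fixes V :: "('k::field_char_0, 'u, 'm) module_scheme"
  assumes V: "vecsp V"
  shows "\<exists>(E :: 'u set) mk \<pi>. (\<forall>u\<in>E. \<forall>j<n::nat. \<pi> j u \<in> carrier V) \<and>
    (\<forall>f. (\<forall>j<n. f j \<in> carrier V) \<longrightarrow> mk f \<in> E \<and> (\<forall>j<n. \<pi> j (mk f) = f j)) \<and>
    (\<forall>u\<in>E. \<forall>w\<in>E. (\<forall>j<n. \<pi> j u = \<pi> j w) \<longrightarrow> u = w)"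
proof -
  let ?P = "PiE {..<n} (\<lambda>_. carrier V)"
  obtain e where "inj_on e ?P \<and> e ` ?P \<subseteq> carrier V"
    using power_inj[OF space_infinite_or_zero[OF V], of n] by (rule exE)
  then have e: "inj_on e ?P" by (rule conjunct1)
  define \<pi> where "\<pi> j u = inv_into ?P e u j" for j u
  have i: "inv_into ?P e u \<in> ?P" if "u \<in> e ` ?P" for u using that by (rule inv_into_into)
  show ?thesis
  proof (rule exI[of _ "e ` ?P"], rule exI[of _ "\<lambda>f. e (restrict f {..<n})"], rule exI[of _ \<pi>], intro conjI ballI allI impI)
    show "\<pi> j u \<in> carrier V" if "u \<in> e ` ?P" "j < n" for u j unfolding \<pi>_def by (rule PiE_mem[OF i[OF that(1)]]) (use that(2) in simp)
    fix f :: "nat \<Rightarrow> 'u" assume "\<forall>j<n. f j \<in> carrier V"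
    then have f: "restrict f {..<n} \<in> ?P" by auto
    then show "e (restrict f {..<n}) \<in> e ` ?P" by blast
    show "\<pi> j (e (restrict f {..<n})) = f j" if "j < n" for j
      using inv_into_f_f[OF e f] that by (simp add: \<pi>_def)
  next
    fix u w assume u: "u \<in> e ` ?P" and w: "w \<in> e ` ?P" and eq: "\<forall>j<n. \<pi> j u = \<pi> j w"
    have "inv_into ?P e u = inv_into ?P e w"
    proof (rule PiE_ext[OF i[OF u] i[OF w]])
      fix j assume "j \<in> {..<n}"
      then show "inv_into ?P e u j = inv_into ?P e w j" using eq unfolding \<pi>_def by blast
    qed
    then show "u = w" using f_inv_into_f[OF u] f_inv_into_f[OF w] by metis
  qed
qed

text \<open>The interpolation formula of Newton for \<open>x\<^sup>j\<close> at the points \<open>1, q, q\<^sup>2, \<dots>\<close>.\<close>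

lemma qbin_newton: "(\<Sum>n\<le>j. qbin q j n * (\<Prod>l<n. x - q ^ l)) = x ^ j"
proof (induction j)
  case (Suc j)
  have "(\<Sum>n\<le>Suc j. qbin q (Suc j) n * (\<Prod>l<n. x - q ^ l)) = (\<Sum>n\<le>j. x * (qbin q j n * (\<Prod>l<n. x - q ^ l)))"
    unfolding qbin_sum_Suc_field by (simp add: algebra_simps)
  then show ?case by (simp add: Suc flip: sum_distrib_left)
qed simp

lemma finsum_smult_const:
  fixes V :: "('k::field, 'u, 'm) module_scheme"
  assumes V: "vecsp V" and v: "v \<in> carrier V" and I: "finite I"
  shows "finsum V (\<lambda>i. a i \<odot>\<^bsub>V\<^esub> v) I = (\<Sum>i\<in>I. a i) \<odot>\<^bsub>V\<^esub> v"
proof -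
  have "lin (\<I> :: ('k::field, 'k) gspace) V (\<lambda>c. c \<odot>\<^bsub>V\<^esub> v)"
    by (rule linI[OF vecsp_unit V]) (use V v in \<open>simp_all add: vecsp_smult\<close>)
  from lin_finsum[OF this, of I a] show ?thesis by (simp add: finsum_unit I)
qed

context zp_hopf
begin

text \<open>The scalars that turn powers of an operator into a family composing with the constants
  \<open>\<kappa>\<close>.\<close>

definition dpow :: "nat \<Rightarrow> 'k" where "dpow n = (\<Prod>l<n. (\<Sum>i\<le>l. \<xi> ^ i) * inverse \<xi> ^ l)"

lemma dpow_simps: "dpow 0 = 1" "dpow (Suc n) = dpow n * ((\<Sum>i\<le>n. \<xi> ^ i) * inverse \<xi> ^ n)"
  by (simp_all add: dpow_def)

lemma dpow_nonzero: "n < p \<Longrightarrow> dpow n \<noteq> 0"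
  using qint_nonzero by (simp add: dpow_def)

lemma dpow_add: "\<kappa> i j * dpow i * dpow j = dpow (i + j)"
proof -
  have q: "dpow n = qfact \<xi> n * inverse \<xi> ^ (\<Sum>l<n. l)" for n
    by (induction n) (simp_all add: dpow_simps qfact_Suc power_add, simp add: dpow_simps qfact_def)
  have t: "(\<Sum>l<i + j. l) = (\<Sum>l<i. l) + (\<Sum>l<j. l) + i * j"
    by (induction j) simp_all
  have "\<kappa> i j * dpow i * dpow j = (qbin \<xi> (i + j) i * qfact \<xi> i * qfact \<xi> j) * inverse \<xi> ^ (\<Sum>l<i + j. l)"
    unfolding q t by (simp add: \<kappa>_def power_add mult_ac)
  then show ?thesis unfolding qbin_qfact q .
qed

lemma cst_add: "cst (n + i) = \<xi> ^ n * cst i + (\<xi> ^ n - 1) / (\<xi> - 1) * (\<xi> ^ (n + 2 * i) - 1)"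
proof -
  have "(a * b - 1) ^ 2 = a * (b - 1) ^ 2 + (a - 1) * (a * (b * b) - 1)" for a b :: 'k
    by (simp add: power2_eq_square algebra_simps)
  then have "(\<xi> ^ (n + i) - 1) ^ 2 = \<xi> ^ n * (\<xi> ^ i - 1) ^ 2 + (\<xi> ^ n - 1) * (\<xi> ^ (n + 2 * i) - 1)"
    by (simp only: power_add mult_2)
  then show ?thesis using root_neq_1 by (simp add: cst_def add_divide_distrib)
qed

text \<open>The left side is the scalar by which the \<open>n\<close>-th summand of stability acts in degree \<open>- j\<close>; the
  right side is a summand of \<open>qbin_newton\<close>.\<close>

lemma cst_dpow:
  assumes "j < p" "n \<le> j"
  shows "inverse (dpow n) * (\<Prod>l<n. cst (j - l)) = qbin \<xi> j n * (\<Prod>l<n. \<xi> ^ j - \<xi> ^ l)"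
  using assms(2)
proof (induction n)
  case 0
  then show ?case by (simp add: dpow_simps)
next
  case (Suc n)
  obtain k where k: "j = Suc n + k" using Suc.prems le_Suc_ex by blast
  have nz: "qfact \<xi> n \<noteq> 0" "qfact \<xi> k \<noteq> 0" using assms(1) k by (simp_all add: qfact_nonzero)
  have "qbin \<xi> j (Suc n) * qfact \<xi> (Suc n) * qfact \<xi> k = qbin \<xi> j n * qfact \<xi> n * qfact \<xi> (Suc k)"
    using qbin_qfact[of \<xi> "Suc n" k] qbin_qfact[of \<xi> n "Suc k"] k by (simp del: qbin.simps)
  then have "(qbin \<xi> j (Suc n) * (\<Sum>i\<le>n. \<xi> ^ i)) * (qfact \<xi> n * qfact \<xi> k) = (qbin \<xi> j n * (\<Sum>i\<le>k. \<xi> ^ i)) * (qfact \<xi> n * qfact \<xi> k)"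
    by (simp add: qfact_Suc mult_ac)
  then have r: "qbin \<xi> j (Suc n) * (\<Sum>i\<le>n. \<xi> ^ i) = qbin \<xi> j n * (\<Sum>i\<le>k. \<xi> ^ i)" using nz by simp
  have nn: "(\<Sum>i\<le>n. \<xi> ^ i) \<noteq> 0" using qint_nonzero assms(1) k by simp
  have c: "cst (j - n) = (\<Sum>i\<le>k. \<xi> ^ i) * (\<xi> ^ Suc k - 1)"
    unfolding qint cst_def using k by (simp add: power2_eq_square)
  have x: "\<xi> ^ j - \<xi> ^ n = \<xi> ^ n * (\<xi> ^ Suc k - 1)" unfolding k by (simp add: power_add algebra_simps)
  have "inverse (dpow (Suc n)) * (\<Prod>l<Suc n. cst (j - l)) = (inverse (dpow n) * (\<Prod>l<n. cst (j - l))) * \<xi> ^ n * cst (j - n) / (\<Sum>i\<le>n. \<xi> ^ i)"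
    by (simp add: dpow_simps field_simps)
  also have "\<dots> = (qbin \<xi> j n * (\<Sum>i\<le>k. \<xi> ^ i)) * (\<Prod>l<n. \<xi> ^ j - \<xi> ^ l) * (\<xi> ^ j - \<xi> ^ n) / (\<Sum>i\<le>n. \<xi> ^ i)"
    using Suc by (simp add: c x mult_ac)
  also have "\<dots> = qbin \<xi> j (Suc n) * (\<Prod>l<Suc n. \<xi> ^ j - \<xi> ^ l)"
    unfolding r[symmetric] using nn by simp
  finally show ?case .
qed

end

text \<open>The power of \<open>V\<close> with exponent \<open>p\<close>, coded as in \<open>tuples_in_universe\<close>.\<close>

locale coded_power = zp_hopf p \<xi> H for p :: nat and \<xi> :: "'k::field" and H :: "('k, 'k poly) hopf" +
  fixes V :: "('k, 'u) space" and E :: "'u set" and mk :: "(nat \<Rightarrow> 'u) \<Rightarrow> 'u" and \<pi> :: "nat \<Rightarrow> 'u \<Rightarrow> 'u"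
  assumes V: "fd_space V"
    and \<pi>_closed: "\<And>u j. u \<in> E \<Longrightarrow> j < p \<Longrightarrow> \<pi> j u \<in> carrier V"
    and mk_closed: "\<And>f. (\<And>j. j < p \<Longrightarrow> f j \<in> carrier V) \<Longrightarrow> mk f \<in> E"
    and \<pi>_mk: "\<And>f i. (\<And>j. j < p \<Longrightarrow> f j \<in> carrier V) \<Longrightarrow> i < p \<Longrightarrow> \<pi> i (mk f) = f i"
    and \<pi>_ext: "\<And>u w. u \<in> E \<Longrightarrow> w \<in> E \<Longrightarrow> (\<And>j. j < p \<Longrightarrow> \<pi> j u = \<pi> j w) \<Longrightarrow> u = w"
begin

lemma vV: "vecsp V" by (rule fd_space_vecsp[OF V])

text \<open>Coordinate \<open>j\<close> is placed in degree \<open>- j\<close>.\<close>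

definition pw :: "('k, 'u) gspace" where
  "pw = \<lparr>carrier = E, monoid.mult = undefined, one = undefined, ring.zero = mk (\<lambda>j. \<zero>\<^bsub>V\<^esub>),
     add = (\<lambda>u w. mk (\<lambda>j. \<pi> j u \<oplus>\<^bsub>V\<^esub> \<pi> j w)), module.smult = (\<lambda>c u. mk (\<lambda>j. c \<odot>\<^bsub>V\<^esub> \<pi> j u)),
     homog = (\<lambda>d. {u \<in> E. \<forall>j<p. j \<noteq> codeg d \<longrightarrow> \<pi> j u = \<zero>\<^bsub>V\<^esub>})\<rparr>"

definition put :: "nat \<Rightarrow> 'u \<Rightarrow> 'u" where
  "put i v = mk (\<lambda>j. if j = i then v else \<zero>\<^bsub>V\<^esub>)"

text \<open>Coordinate \<open>j\<close> stands for the \<open>j\<close>-th power of \<open>dn 1\<close> applied to a vector of degree \<open>0\<close>, so that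
  both operators are dictated by \<open>ra_lo_pow\<close> and \<open>dn_as_lo_pow\<close>.\<close>

definition ra :: "'u \<Rightarrow> 'u" where
  "ra u = mk (\<lambda>j. if Suc j < p then cst (Suc j) \<odot>\<^bsub>V\<^esub> \<pi> (Suc j) u else \<zero>\<^bsub>V\<^esub>)"

definition dn :: "nat \<Rightarrow> 'u \<Rightarrow> 'u" where
  "dn n u = mk (\<lambda>j. if n \<le> j then inverse (dpow n) \<odot>\<^bsub>V\<^esub> \<pi> (j - n) u else \<zero>\<^bsub>V\<^esub>)"

lemma pw_carrier [simp]: "carrier pw = E"
  by (simp add: pw_def)

lemma pw_homog: "u \<in> homog pw d \<longleftrightarrow> u \<in> E \<and> (\<forall>j<p. j \<noteq> codeg d \<longrightarrow> \<pi> j u = \<zero>\<^bsub>V\<^esub>)"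
  by (simp add: pw_def)

lemma pw_closed:
  "\<zero>\<^bsub>pw\<^esub> \<in> E" "u \<in> E \<Longrightarrow> w \<in> E \<Longrightarrow> u \<oplus>\<^bsub>pw\<^esub> w \<in> E" "u \<in> E \<Longrightarrow> c \<odot>\<^bsub>pw\<^esub> u \<in> E"
  "v \<in> carrier V \<Longrightarrow> put i v \<in> E" "u \<in> E \<Longrightarrow> ra u \<in> E" "u \<in> E \<Longrightarrow> dn n u \<in> E"
  using vV \<pi>_closed by (auto simp: pw_def put_def ra_def dn_def intro!: mk_closed)

lemma \<pi>_simps:
  assumes "j < p"
  shows "\<pi> j \<zero>\<^bsub>pw\<^esub> = \<zero>\<^bsub>V\<^esub>"
    "u \<in> E \<Longrightarrow> w \<in> E \<Longrightarrow> \<pi> j (u \<oplus>\<^bsub>pw\<^esub> w) = \<pi> j u \<oplus>\<^bsub>V\<^esub> \<pi> j w"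
    "u \<in> E \<Longrightarrow> \<pi> j (c \<odot>\<^bsub>pw\<^esub> u) = c \<odot>\<^bsub>V\<^esub> \<pi> j u"
    "v \<in> carrier V \<Longrightarrow> \<pi> j (put i v) = (if j = i then v else \<zero>\<^bsub>V\<^esub>)"
    "u \<in> E \<Longrightarrow> \<pi> j (ra u) = (if Suc j < p then cst (Suc j) \<odot>\<^bsub>V\<^esub> \<pi> (Suc j) u else \<zero>\<^bsub>V\<^esub>)"
    "u \<in> E \<Longrightarrow> \<pi> j (dn n u) = (if n \<le> j then inverse (dpow n) \<odot>\<^bsub>V\<^esub> \<pi> (j - n) u else \<zero>\<^bsub>V\<^esub>)"
  using assms vV \<pi>_closed by (auto simp: pw_def put_def ra_def dn_def intro!: \<pi>_mk trans[OF \<pi>_mk])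

lemma vecsp_pw: "vecsp pw"
proof (rule vecspI; unfold pw_carrier)
  fix u v w assume E: "u \<in> E" "v \<in> E" "w \<in> E"
  show "(u \<oplus>\<^bsub>pw\<^esub> v) \<oplus>\<^bsub>pw\<^esub> w = u \<oplus>\<^bsub>pw\<^esub> (v \<oplus>\<^bsub>pw\<^esub> w)"
    by (rule \<pi>_ext) (use E vV in \<open>simp_all add: pw_closed \<pi>_simps \<pi>_closed vecsp_add_ac(1)\<close>)
next
  fix v w assume E: "v \<in> E" "w \<in> E"
  show "v \<oplus>\<^bsub>pw\<^esub> w = w \<oplus>\<^bsub>pw\<^esub> v"
    by (rule \<pi>_ext) (use E vV in \<open>simp_all add: pw_closed \<pi>_simps \<pi>_closed vecsp_add_ac(2)[OF _ _ _ vecsp_closed(1)[OF vV]]\<close>)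
  show "a \<odot>\<^bsub>pw\<^esub> (v \<oplus>\<^bsub>pw\<^esub> w) = a \<odot>\<^bsub>pw\<^esub> v \<oplus>\<^bsub>pw\<^esub> a \<odot>\<^bsub>pw\<^esub> w" for a
    by (rule \<pi>_ext) (use E vV in \<open>simp_all add: pw_closed \<pi>_simps \<pi>_closed vecsp_smult\<close>)
next
  fix v assume E: "v \<in> E"
  show "v \<oplus>\<^bsub>pw\<^esub> \<zero>\<^bsub>pw\<^esub> = v" "0 \<odot>\<^bsub>pw\<^esub> v = \<zero>\<^bsub>pw\<^esub>" "1 \<odot>\<^bsub>pw\<^esub> v = v"
    by (rule \<pi>_ext; use E vV in \<open>simp add: pw_closed \<pi>_simps \<pi>_closed\<close>)+
  show "(a * b) \<odot>\<^bsub>pw\<^esub> v = a \<odot>\<^bsub>pw\<^esub> (b \<odot>\<^bsub>pw\<^esub> v)" "(a + b) \<odot>\<^bsub>pw\<^esub> v = a \<odot>\<^bsub>pw\<^esub> v \<oplus>\<^bsub>pw\<^esub> b \<odot>\<^bsub>pw\<^esub> v" for a b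
    by (rule \<pi>_ext; use E vV in \<open>simp add: pw_closed \<pi>_simps \<pi>_closed vecsp_smult\<close>)+
qed (simp_all add: pw_closed)

lemma lin_\<pi>: "j < p \<Longrightarrow> lin pw V (\<pi> j)"
  by (rule linI[OF vecsp_pw vV]) (simp_all add: \<pi>_simps \<pi>_closed)

lemma lin_put: "lin V pw (put i)"
  by (rule linI[OF vV vecsp_pw]; (rule \<pi>_ext)?) (use vV in \<open>simp_all add: \<pi>_simps pw_closed\<close>)

lemma lin_ra: "lin pw pw ra"
  by (rule linI[OF vecsp_pw vecsp_pw]; (rule \<pi>_ext)?)
    (use vV in \<open>simp_all add: \<pi>_simps pw_closed \<pi>_closed vecsp_smult(3) mult.commute flip: vecsp_smult(1)\<close>)

lemma lin_dn: "lin pw pw (dn n)"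
  by (rule linI[OF vecsp_pw vecsp_pw]; (rule \<pi>_ext)?)
    (use vV in \<open>simp_all add: \<pi>_simps pw_closed \<pi>_closed vecsp_smult(3) mult.commute flip: vecsp_smult(1)\<close>)

lemma sum_put:
  assumes "u \<in> E"
  shows "finsum pw (\<lambda>j. put j (\<pi> j u)) {..<p} = u"
proof (rule \<pi>_ext)
  show "finsum pw (\<lambda>j. put j (\<pi> j u)) {..<p} \<in> E"
    using vecsp_finsum_closed[OF vecsp_pw, of "{..<p}" "\<lambda>j. put j (\<pi> j u)"] assms by (simp add: pw_closed \<pi>_closed)
  fix i assume i: "i < p"
  have "\<pi> i (finsum pw (\<lambda>j. put j (\<pi> j u)) {..<p}) = finsum V (\<lambda>j. \<pi> i (put j (\<pi> j u))) {..<p}"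
    by (rule lin_finsum[OF lin_\<pi>[OF i]]) (use assms in \<open>simp add: pw_closed \<pi>_closed\<close>)
  also have "\<dots> = finsum V (\<lambda>j. if j = i then \<pi> i u else \<zero>\<^bsub>V\<^esub>) {..<p}"
    by (rule vecsp_finsum_cong[OF vV]) (use assms i vV in \<open>auto simp: \<pi>_simps \<pi>_closed\<close>)
  also have "\<dots> = \<pi> i u" using i assms by (subst finsum_single[OF vV]) (auto simp: \<pi>_closed)
  finally show "\<pi> i (finsum pw (\<lambda>j. put j (\<pi> j u)) {..<p}) = \<pi> i u" .
qed (rule assms)

lemma fd_pw: "fd_space pw"
proof -
  obtain S where S: "finite S" "generates V S" using V unfolding fd_space_iff_generates by blast
  have "generates pw (\<Union>j<p. put j ` S)"
    unfolding generates_def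
  proof (intro conjI allI impI vecsp_pw)
    show "(\<Union>j<p. put j ` S) \<subseteq> carrier pw" using S(2) by (auto simp: generates_def pw_closed)
    fix U assume U: "VectorSpace.subspace scalars U pw" "(\<Union>j<p. put j ` S) \<subseteq> U"
    show "carrier pw \<subseteq> U"
    proof
      fix u assume "u \<in> carrier pw"
      then have u: "u \<in> E" by simp
      have "finsum pw (\<lambda>j. put j (\<pi> j u)) {..<p} \<in> U"
      proof (rule subspace_finsum[OF U(1)])
        fix j assume j: "j \<in> {..<p}"
        show "put j (\<pi> j u) \<in> U"
          by (rule generates_lin_image[OF S(2) lin_put U(1)]) (use U(2) j u in \<open>auto simp: \<pi>_closed\<close>)
      qed
      then show "u \<in> U" by (simp add: sum_put[OF u])
    qed
  qed
  then show ?thesis unfolding fd_space_iff_generates using S(1) by (intro exI[of _ "\<Union>j<p. put j ` S"]) simp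
qed

lemma graded_pw: "graded_space pw"
proof (rule graded_spaceI[where pr = "\<lambda>d u. put (codeg d) (\<pi> (codeg d) u)"])
  show "fd_space pw" by (rule fd_pw)
  fix d assume d: "d < p"
  show "VectorSpace.subspace scalars (homog pw d) pw"
    by (rule submoduleI[OF vecsp_pw]) (use vV in \<open>auto simp: pw_homog pw_closed \<pi>_simps\<close>)
  show "lin pw pw (\<lambda>u. put (codeg d) (\<pi> (codeg d) u))" by (rule lin_comp[OF lin_\<pi>[OF codeg(2)] lin_put])
  show "put (codeg d) (\<pi> (codeg d) u) \<in> homog pw d" if "u \<in> carrier pw" for u
    using that codeg(2)[of d] by (simp add: pw_homog pw_closed \<pi>_closed \<pi>_simps)
  show "put (codeg d) (\<pi> (codeg d) u) = (if d = e then u else \<zero>\<^bsub>pw\<^esub>)" if e: "e < p" and u: "u \<in> homog pw e" for e u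
  proof (rule \<pi>_ext)
    have uE: "u \<in> E" using u by (simp add: pw_homog)
    show "put (codeg d) (\<pi> (codeg d) u) \<in> E" "(if d = e then u else \<zero>\<^bsub>pw\<^esub>) \<in> E"
      using uE codeg(2)[of d] by (simp_all add: pw_closed \<pi>_closed)
    fix j assume j: "j < p"
    have "codeg d = codeg e \<longleftrightarrow> d = e" using codeg(3)[OF d] codeg(3)[OF e] by metis
    then show "\<pi> j (put (codeg d) (\<pi> (codeg d) u)) = \<pi> j (if d = e then u else \<zero>\<^bsub>pw\<^esub>)"
      using u j uE codeg(2)[of d] by (auto simp: \<pi>_simps \<pi>_closed pw_homog)
  qed
next
  fix u assume "u \<in> carrier pw"
  then have u: "u \<in> E" by simp
  interpret abelian_monoid pw by (rule vecsp_monoid[OF vecsp_pw])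
  note im = codeg_bij(2)
  have "inj_on codeg {..<p}" by (rule codeg_bij(1))
  then have "finsum pw (\<lambda>j. put j (\<pi> j u)) (codeg ` {..<p}) = finsum pw (\<lambda>d. put (codeg d) (\<pi> (codeg d) u)) {..<p}"
    by (intro finsum_reindex) (use u codeg(2) in \<open>auto simp: pw_closed \<pi>_closed\<close>)
  then show "finsum pw (\<lambda>d. put (codeg d) (\<pi> (codeg d) u)) {..<p} = u" by (simp add: im sum_put[OF u])
qed

lemma ra_pow: "u \<in> E \<Longrightarrow> (ra ^^ n) u \<in> E"
  by (induction n) (simp_all add: pw_closed)

lemma \<pi>_ra_pow:
  "u \<in> E \<Longrightarrow> j < p \<Longrightarrow> \<pi> j ((ra ^^ n) u) = (if j + n < p then (\<Prod>l<n. cst (j + n - l)) \<odot>\<^bsub>V\<^esub> \<pi> (j + n) u else \<zero>\<^bsub>V\<^esub>)"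
proof (induction n arbitrary: j)
  case 0
  then show ?case using vV by (simp add: \<pi>_closed)
next
  case (Suc n)
  then show ?case using vV
    by (auto simp: \<pi>_simps ra_pow \<pi>_closed mult.commute simp flip: vecsp_smult(1))
qed

lemma ra_homog:
  assumes u: "u \<in> homog pw d" and d: "d < p"
  shows "ra u \<in> homog pw ((1 + d) mod p)"
  unfolding pw_homog
proof (intro conjI allI impI)
  have uE: "u \<in> E" using u by (simp add: pw_homog)
  then show "ra u \<in> E" by (simp add: pw_closed)
  fix j assume j: "j < p" "j \<noteq> codeg ((1 + d) mod p)"
  have "Suc j \<noteq> codeg d" if "Suc j < p"
  proof
    assume "Suc j = codeg d"
    then have "d = codeg (Suc j)" using codeg(3)[OF d] by simp
    then have "(1 + d) mod p = codeg j" using codeg_Suc(2)[OF j(1)] by simp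
    then show False using j codeg(3)[OF j(1)] by simp
  qed
  then show "\<pi> j (ra u) = \<zero>\<^bsub>V\<^esub>" using u j uE vV by (simp add: \<pi>_simps pw_homog)
qed

lemma dn_homog:
  assumes u: "u \<in> homog pw d" and d: "d < p" and n: "n < p"
  shows "dn n u \<in> homog pw ((codeg n + d) mod p)"
  unfolding pw_homog
proof (intro conjI allI impI)
  have uE: "u \<in> E" using u by (simp add: pw_homog)
  then show "dn n u \<in> E" by (simp add: pw_closed)
  fix j assume j: "j < p" "j \<noteq> codeg ((codeg n + d) mod p)"
  have "j - n \<noteq> codeg d" if "n \<le> j"
  proof
    assume "j - n = codeg d"
    then have "d = codeg (j - n)" using codeg(3)[OF d] by simp
    then have "(codeg n + d) mod p = codeg j" using codeg_add[of n "j - n"] that j(1) n by simp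
    then show False using j codeg(3)[OF j(1)] by simp
  qed
  then show "\<pi> j (dn n u) = \<zero>\<^bsub>V\<^esub>" using u j uE vV by (simp add: \<pi>_simps pw_homog)
qed

lemma dn_dn:
  assumes ij: "i < p" "j < p" and u: "u \<in> E"
  shows "dn i (dn j u) = (if i + j < p then \<kappa> i j \<odot>\<^bsub>pw\<^esub> dn (i + j) u else \<zero>\<^bsub>pw\<^esub>)"
proof (rule \<pi>_ext)
  show "dn i (dn j u) \<in> E" "(if i + j < p then \<kappa> i j \<odot>\<^bsub>pw\<^esub> dn (i + j) u else \<zero>\<^bsub>pw\<^esub>) \<in> E"
    using u by (simp_all add: pw_closed)
  fix k assume k: "k < p"
  have l: "\<pi> k (dn i (dn j u)) = (if i + j \<le> k then (inverse (dpow i) * inverse (dpow j)) \<odot>\<^bsub>V\<^esub> \<pi> (k - (i + j)) u else \<zero>\<^bsub>V\<^esub>)"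
    using u k vV by (auto simp: \<pi>_simps pw_closed \<pi>_closed vecsp_smult(1))
  show "\<pi> k (dn i (dn j u)) = \<pi> k (if i + j < p then \<kappa> i j \<odot>\<^bsub>pw\<^esub> dn (i + j) u else \<zero>\<^bsub>pw\<^esub>)"
  proof (cases "i + j < p")
    case True
    have "\<kappa> i j * inverse (dpow (i + j)) = inverse (dpow i) * inverse (dpow j)"
      using dpow_add[of i j] dpow_nonzero[OF True] dpow_nonzero[OF ij(1)] dpow_nonzero[OF ij(2)]
      by (simp add: divide_simps mult_ac)
    then show ?thesis
      unfolding l using True u k vV by (auto simp: \<pi>_simps pw_closed \<pi>_closed simp flip: vecsp_smult(1))
  next
    case False
    then show ?thesis unfolding l using k by (simp add: \<pi>_simps)
  qed
qed

lemma ra_dn: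
  assumes n: "n < p" and d: "d < p" and u: "u \<in> homog pw d"
  shows "ra (dn n u) = \<xi> ^ n \<odot>\<^bsub>pw\<^esub> dn n (ra u) \<oplus>\<^bsub>pw\<^esub>
    (if n = 0 then \<zero>\<^bsub>pw\<^esub> else (\<xi> powi (2 * int n - 1 - 2 * int d) - \<xi> ^ (n - 1)) \<odot>\<^bsub>pw\<^esub> dn (n - 1) u)"
    (is "_ = ?a \<oplus>\<^bsub>pw\<^esub> ?b")
proof (rule \<pi>_ext)
  have uE: "u \<in> E" using u by (simp add: pw_homog)
  have ab: "?a \<in> E" "?b \<in> E" using uE by (simp_all add: pw_closed)
  then show "?a \<oplus>\<^bsub>pw\<^esub> ?b \<in> E" by (simp add: pw_closed)
  show "ra (dn n u) \<in> E" using uE by (simp add: pw_closed)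
  define i where "i = codeg d"
  have i: "i < p" "d = codeg i" using codeg(2) codeg(3)[OF d] by (simp_all add: i_def)
  have z: "\<pi> k u = \<zero>\<^bsub>V\<^esub>" if "k < p" "k \<noteq> i" for k using u that by (simp add: pw_homog i_def)
  fix j assume j: "j < p"
  let ?e = "(\<xi> powi (2 * int n - 1 - 2 * int d) - \<xi> ^ (n - 1))"
  have L: "\<pi> j (ra (dn n u)) = (if Suc j < p \<and> n \<le> Suc j then (cst (Suc j) * inverse (dpow n)) \<odot>\<^bsub>V\<^esub> \<pi> (Suc j - n) u else \<zero>\<^bsub>V\<^esub>)"
    using uE j vV by (auto simp: \<pi>_simps pw_closed \<pi>_closed vecsp_smult(1))
  have Ra: "\<pi> j ?a = (if n \<le> j \<and> Suc (j - n) < p then (\<xi> ^ n * inverse (dpow n) * cst (Suc (j - n))) \<odot>\<^bsub>V\<^esub> \<pi> (Suc (j - n)) u else \<zero>\<^bsub>V\<^esub>)"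
    using uE j vV by (auto simp: \<pi>_simps pw_closed \<pi>_closed vecsp_smult(1))
  have Rb: "\<pi> j ?b = (if n = 0 then \<zero>\<^bsub>V\<^esub> else if n \<le> Suc j then (?e * inverse (dpow (n - 1))) \<odot>\<^bsub>V\<^esub> \<pi> (Suc j - n) u else \<zero>\<^bsub>V\<^esub>)"
    using uE j vV by (cases n) (auto simp: \<pi>_simps pw_closed \<pi>_closed vecsp_smult(1))
  have R: "\<pi> j (?a \<oplus>\<^bsub>pw\<^esub> ?b) = \<pi> j ?a \<oplus>\<^bsub>V\<^esub> \<pi> j ?b" using ab j by (simp add: \<pi>_simps)
  show "\<pi> j (ra (dn n u)) = \<pi> j (?a \<oplus>\<^bsub>pw\<^esub> ?b)"
  proof (cases "n \<le> Suc j \<and> Suc j - n = i")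
    case False
    have 1: "\<pi> (Suc j - n) u = \<zero>\<^bsub>V\<^esub>" if "n \<le> Suc j" "Suc j - n < p" using False z[of "Suc j - n"] that by simp
    have 2: "\<pi> (Suc (j - n)) u = \<zero>\<^bsub>V\<^esub>" if "n \<le> j" "Suc (j - n) < p"
      using 1 that by (simp add: Suc_diff_le)
    have 3: "Suc j - n < p" if "n \<noteq> 0" using that j by simp
    have "\<pi> j (ra (dn n u)) = \<zero>\<^bsub>V\<^esub>" unfolding L using 1 vV by auto
    moreover have "\<pi> j ?a = \<zero>\<^bsub>V\<^esub>" unfolding Ra using 2 vV by simp
    moreover have "\<pi> j ?b = \<zero>\<^bsub>V\<^esub>" unfolding Rb using 1 3 vV by simp
    ultimately show ?thesis unfolding R using vV by simp
  next
    case True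
    then have ji: "Suc j = n + i" by linarith
    have w: "\<pi> i u \<in> carrier V" by (rule \<pi>_closed[OF uE i(1)])
    \<comment> \<open>The boundary cases are covered by \<open>cst p = 0\<close> and \<open>cst 0 = 0\<close>.\<close>
    have L': "\<pi> j (ra (dn n u)) = (cst (n + i) * inverse (dpow n)) \<odot>\<^bsub>V\<^esub> \<pi> i u"
    proof (cases "Suc j < p")
      case False
      then have "n + i = p" using j ji by simp
      then show ?thesis unfolding L using w vV ji by (simp add: cst_p)
    next
      case True
      then show ?thesis unfolding L ji by simp
    qed
    have Ra': "\<pi> j ?a = (\<xi> ^ n * inverse (dpow n) * cst i) \<odot>\<^bsub>V\<^esub> \<pi> i u"
    proof (cases "n \<le> j")
      case True
      then have "Suc (j - n) = i" using ji by simp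
      then show ?thesis unfolding Ra using True i by simp
    next
      case False
      then have "i = 0" using ji by simp
      then show ?thesis unfolding Ra using False w vV by (simp add: cst_0)
    qed
    have c: "cst (n + i) * inverse (dpow n) = \<xi> ^ n * inverse (dpow n) * cst i + (if n = 0 then 0 else ?e * inverse (dpow (n - 1)))"
    proof (cases n)
      case (Suc m)
      have m: "m < p" using n Suc by simp
      have "2 * int n - 1 - 2 * int d = int (2 * m) + (1 - 2 * int d)" using Suc by simp
      then have "\<xi> powi (2 * int n - 1 - 2 * int d) = \<xi> ^ (2 * m) * \<xi> powi (1 - 2 * int d)"
        by (simp only: power_int_add[OF disjI1[OF root_nonzero]] power_int_of_nat)
      also have "\<dots> = \<xi> ^ m * \<xi> ^ (n + 2 * i)"
      proof -
        have "2 * m + (2 * i + 1) = m + (n + 2 * i)" using Suc by simp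
        then show ?thesis using powi_codeg[of i] i by (simp only: power_add[symmetric] less_imp_le)
      qed
      finally have e: "?e = \<xi> ^ m * (\<xi> ^ (n + 2 * i) - 1)" using Suc by (simp add: algebra_simps)
      have q: "(\<Sum>i\<le>m. \<xi> ^ i) = (\<xi> ^ n - 1) / (\<xi> - 1)" unfolding qint Suc ..
      have nz: "dpow m \<noteq> 0" "(\<xi> ^ n - 1) / (\<xi> - 1) \<noteq> 0" using dpow_nonzero[OF m] qint_nonzero[of m] n Suc q by simp_all
      have dn: "inverse (dpow m) = inverse (dpow n) * ((\<xi> ^ n - 1) / (\<xi> - 1) * inverse \<xi> ^ m)"
      proof -
        have "dpow n = dpow m * ((\<xi> ^ n - 1) / (\<xi> - 1) * inverse \<xi> ^ m)"
          using dpow_simps(2)[of m] unfolding q Suc .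
        moreover have "inverse a = inverse (a * b) * b" if "b \<noteq> 0" for a b :: 'k using that by simp
        moreover have "(\<xi> ^ n - 1) / (\<xi> - 1) * inverse \<xi> ^ m \<noteq> 0" using nz(2) by simp
        ultimately show ?thesis by metis
      qed
      have "?e * inverse (dpow m) = inverse (dpow n) * ((\<xi> ^ n - 1) / (\<xi> - 1) * (\<xi> ^ (n + 2 * i) - 1)) * (\<xi> ^ m * inverse \<xi> ^ m)"
        unfolding e dn by (simp only: mult_ac)
      also have "\<xi> ^ m * inverse \<xi> ^ m = 1" by (simp flip: power_mult_distrib)
      finally have "?e * inverse (dpow m) = inverse (dpow n) * ((\<xi> ^ n - 1) / (\<xi> - 1) * (\<xi> ^ (n + 2 * i) - 1))" by simp
      moreover have "n - 1 = m" "n \<noteq> 0" using Suc by simp_all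
      ultimately show ?thesis unfolding cst_add[of n i] by (simp only: if_False) (simp add: algebra_simps)
    qed simp
    have Rb': "\<pi> j ?b = (if n = 0 then 0 else ?e * inverse (dpow (n - 1))) \<odot>\<^bsub>V\<^esub> \<pi> i u"
      unfolding Rb using True w vV by simp
    show ?thesis unfolding R L' Ra' Rb' c by (rule vecsp_smult(2)[OF vV w])
  qed
qed

text \<open>The sum of the scalars of \<open>cst_dpow\<close> is \<open>\<xi>\<close> to the power \<open>j\<^sup>2\<close>, which cancels the antitwist as
  \<open>j\<close> is congruent to \<open>- d\<close>.\<close>

lemma stable:
  assumes d: "d < p" and u: "u \<in> homog pw d"
  shows "(\<xi> powi (- (int d ^ 2))) \<odot>\<^bsub>pw\<^esub> finsum pw (\<lambda>n. dn n ((ra ^^ n) u)) {..<p} = u"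
proof (rule \<pi>_ext)
  have uE: "u \<in> E" using u by (simp add: pw_homog)
  have t: "dn n ((ra ^^ n) u) \<in> E" for n using uE by (simp add: pw_closed ra_pow)
  have s: "finsum pw (\<lambda>n. dn n ((ra ^^ n) u)) {..<p} \<in> E"
    using vecsp_finsum_closed[OF vecsp_pw, of "{..<p}" "\<lambda>n. dn n ((ra ^^ n) u)"] t by simp
  then show "(\<xi> powi (- (int d ^ 2))) \<odot>\<^bsub>pw\<^esub> finsum pw (\<lambda>n. dn n ((ra ^^ n) u)) {..<p} \<in> E"
    by (simp add: pw_closed)
  fix j assume j: "j < p"
  have w: "\<pi> j u \<in> carrier V" by (rule \<pi>_closed[OF uE j])
  let ?t = "\<lambda>n. if n \<le> j then qbin \<xi> j n * (\<Prod>l<n. \<xi> ^ j - \<xi> ^ l) else 0"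
  have "\<pi> j (finsum pw (\<lambda>n. dn n ((ra ^^ n) u)) {..<p}) = finsum V (\<lambda>n. \<pi> j (dn n ((ra ^^ n) u))) {..<p}"
    by (rule lin_finsum[OF lin_\<pi>[OF j]]) (simp add: t)
  also have "\<dots> = finsum V (\<lambda>n. ?t n \<odot>\<^bsub>V\<^esub> \<pi> j u) {..<p}"
  proof (rule vecsp_finsum_cong[OF vV])
    fix n assume "n \<in> {..<p}"
    show "\<pi> j (dn n ((ra ^^ n) u)) = ?t n \<odot>\<^bsub>V\<^esub> \<pi> j u"
    proof (cases "n \<le> j")
      case True
      then have "j - n + n = j" "j - n < p" using j by simp_all
      then have "\<pi> (j - n) ((ra ^^ n) u) = (\<Prod>l<n. cst (j - l)) \<odot>\<^bsub>V\<^esub> \<pi> j u"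
        using \<pi>_ra_pow[OF uE, of "j - n" n] j by simp
      then have "\<pi> j (dn n ((ra ^^ n) u)) = (inverse (dpow n) * (\<Prod>l<n. cst (j - l))) \<odot>\<^bsub>V\<^esub> \<pi> j u"
        using True j uE w vV by (simp add: \<pi>_simps ra_pow vecsp_smult(1))
      then show ?thesis unfolding cst_dpow[OF j True] using True by simp
    next
      case False
      then show ?thesis using j uE w vV by (simp add: \<pi>_simps ra_pow)
    qed
  qed (use w vV in simp)
  also have "\<dots> = (\<Sum>n<p. ?t n) \<odot>\<^bsub>V\<^esub> \<pi> j u" by (rule finsum_smult_const[OF vV w]) simp
  also have "(\<Sum>n<p. ?t n) = (\<Sum>n\<le>j. qbin \<xi> j n * (\<Prod>l<n. \<xi> ^ j - \<xi> ^ l))"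
    by (rule sum.mono_neutral_cong_right) (use j in auto)
  also have "\<dots> = \<xi> powi (int (j ^ 2))" unfolding qbin_newton power_int_of_nat by (simp add: power2_eq_square power_mult)
  finally have "\<pi> j ((\<xi> powi (- (int d ^ 2))) \<odot>\<^bsub>pw\<^esub> finsum pw (\<lambda>n. dn n ((ra ^^ n) u)) {..<p})
      = (\<xi> powi (- (int d ^ 2) + int (j ^ 2))) \<odot>\<^bsub>V\<^esub> \<pi> j u"
    using j s by (simp only: \<pi>_simps(3) power_int_add[OF disjI1[OF root_nonzero]] vecsp_smult(1)[OF vV w])
  also have "\<dots> = \<pi> j u"
  proof (cases "j = codeg d")
    case True
    have "int j mod int p = (- int d) mod int p" unfolding True by (rule codeg_mod) (use d in simp)
    then have "(- (int d ^ 2) + int j ^ 2) mod int p = (- (int d ^ 2) + (- int d) ^ 2) mod int p"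
      by (metis mod_add_right_eq power_mod)
    then have "\<xi> powi (- (int d ^ 2) + int (j ^ 2)) = \<xi> powi 0"
      by (intro powi_root_cong) simp
    then show ?thesis using w vV by simp
  next
    case False
    then show ?thesis using u j vV by (simp add: pw_homog)
  qed
  finally show "\<pi> j ((\<xi> powi (- (int d ^ 2))) \<odot>\<^bsub>pw\<^esub> finsum pw (\<lambda>n. dn n ((ra ^^ n) u)) {..<p}) = \<pi> j u" .
qed (use u in \<open>simp add: pw_homog\<close>)

lemma stable_ops_pw: "stable_ops p \<xi> H pw ra dn"
proof (intro stable_ops.intro stable_ops_axioms.intro zp_hopf_axioms)
  fix m assume "m \<in> carrier pw"
  then have m: "m \<in> E" by simp
  show "(ra ^^ p) m = \<zero>\<^bsub>pw\<^esub>" by (rule \<pi>_ext) (use m in \<open>simp_all add: ra_pow pw_closed \<pi>_ra_pow \<pi>_simps\<close>)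
  show "dn 0 m = m" by (rule \<pi>_ext) (use m vV in \<open>simp_all add: pw_closed \<pi>_simps \<pi>_closed dpow_simps\<close>)
qed (use graded_pw lin_ra lin_dn ra_homog dn_homog dn_dn ra_dn stable in simp_all)

lemma deg0_pw_iso:
  "\<exists>u\<in>lin_hom (deg0 pw) V. \<exists>w\<in>lin_hom V (deg0 pw). w \<circ>\<^sub>a u = id_arr (deg0 pw) \<and> u \<circ>\<^sub>a w = id_arr V"
proof -
  have h: "v \<in> homog pw 0 \<longleftrightarrow> v \<in> E \<and> (\<forall>j<p. j \<noteq> 0 \<longrightarrow> \<pi> j v = \<zero>\<^bsub>V\<^esub>)" for v by (simp add: pw_homog)
  have E: "v \<in> E" if "v \<in> homog pw 0" for v using that by (simp add: h)
  have p0: "put 0 v \<in> homog pw 0" if "v \<in> carrier V" for v using that by (simp add: h pw_closed \<pi>_simps)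
  have e: "put 0 (\<pi> 0 v) = v" if v: "v \<in> homog pw 0" for v
    by (rule \<pi>_ext) (use v[unfolded h] in \<open>simp_all add: pw_closed \<pi>_closed \<pi>_simps\<close>)
  have l: "lin (deg0 pw) V (\<pi> 0)" "lin V (deg0 pw) (put 0)"
    by (rule linI[OF vecsp_deg0[OF graded_pw] vV] linI[OF vV vecsp_deg0[OF graded_pw]];
        simp add: E p0 \<pi>_simps \<pi>_closed lin_add[OF lin_put] lin_smult[OF lin_put])+
  let ?u = "\<lparr>Dom = deg0 pw, Cod = V, Fun = restrict (\<pi> 0) (carrier (deg0 pw))\<rparr>"
  let ?w = "\<lparr>Dom = V, Cod = deg0 pw, Fun = restrict (put 0) (carrier V)\<rparr>"
  have uw: "?u \<in> lin_hom (deg0 pw) V" "?w \<in> lin_hom V (deg0 pw)"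
    using lin_restrict[OF l(1)] lin_restrict[OF l(2)] by (simp_all add: lin_hom_def)
  have "?w \<circ>\<^sub>a ?u = id_arr (deg0 pw)" "?u \<circ>\<^sub>a ?w = id_arr V"
    using p0 E e by (auto simp: comp_arr_def id_arr_def compose_def fun_eq_iff restrict_def \<pi>_simps \<pi>_closed)
  then show ?thesis using uw by blast
qed

end

theorem essentially_surjective_deg0:
  fixes \<xi> :: "'k::field_char_0" and V :: "('k, 'u) space"
  assumes "zp_hopf p \<xi> H" and V: "fd_space V"
  shows "\<exists>N\<in>Obj (zp_graded.saYD p \<xi> H :: ('k, ('k, 'k poly, 'u) ayd, ('k, 'u, 'u) garr) lincat).
    \<exists>u\<in>lin_hom (deg0 (Und N)) V. \<exists>w\<in>lin_hom V (deg0 (Und N)).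
      w \<circ>\<^sub>a u = id_arr (deg0 (Und N)) \<and> u \<circ>\<^sub>a w = id_arr V"
proof -
  interpret zp_hopf p \<xi> H by fact
  obtain E :: "'u set" and mk \<pi> where "(\<forall>u\<in>E. \<forall>j<p. \<pi> j u \<in> carrier V) \<and>
    (\<forall>f. (\<forall>j<p. f j \<in> carrier V) \<longrightarrow> mk f \<in> E \<and> (\<forall>j<p. \<pi> j (mk f) = f j)) \<and>
    (\<forall>u\<in>E. \<forall>w\<in>E. (\<forall>j<p. \<pi> j u = \<pi> j w) \<longrightarrow> u = w)"
    using tuples_in_universe[OF fd_space_vecsp[OF V], of p] by (elim exE)
  then interpret coded_power p \<xi> H V E mk \<pi>
    using V by unfold_locales simp_all
  obtain N where "N \<in> Obj (saYD H)" "Und N = pw" using saYD_of_stable_ops[OF stable_ops_pw] by (elim bexE)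
  then show ?thesis using deg0_pw_iso by (intro bexI[of _ N]) simp_all
qed

theorem theorem5p11:
  fixes p :: nat and \<xi> :: "'k::{alg_closed_field, field_char_0}" and H :: "('k, 'k poly) hopf"
  assumes "prime p"
    and "\<xi> ^ p = 1" and "\<And>m. 0 < m \<Longrightarrow> m < p \<Longrightarrow> \<xi> ^ m \<noteq> 1"
    and "is_trunc_poly_hopf p \<xi> H"
  shows "lin_equivalent
    (zp_graded.saYD p \<xi> H :: ('k, ('k, 'k poly, 'u) ayd, ('k, 'u, 'u) garr) lincat)
    (Vec :: ('k, ('k, 'u) space, (('k, 'u) space, ('k, 'u) space, 'u, 'u) arr) lincat)"
proof -
  interpret zp_hopf p \<xi> H using assms by unfold_locales
  show ?thesis
  proof (rule lin_equivalentI[OF linear_category_saYD linear_category_Vec linear_functor_deg0 fully_faithful_deg0])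
    fix V :: "('k, 'u) space" assume "V \<in> Obj Vec"
    then show "\<exists>N\<in>Obj (saYD H). \<exists>u\<in>carrier (Hom Vec (deg0 (Und N)) V). \<exists>w\<in>carrier (Hom Vec V (deg0 (Und N))).
      Comp Vec w u = Ident Vec (deg0 (Und N)) \<and> Comp Vec u w = Ident Vec V"
      using essentially_surjective_deg0[OF zp_hopf_axioms, of V] by (simp add: Vec_def zp_hopf_def)
  qed
qed

end
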